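(* Let $N\ge 2$ be an integer. Then for every $u\in W_{\mu_N}(\mathbb{R}^N)$, $$\ln\left(\int_{\mathbb{R}^N}e^u\,d\mu_N\right)\le\frac{1}{\widetilde{\omega_N}}\int_{\mathbb{R}^N}H_N(u,\mu_N)\,dx+\int_{\mathbb{R}^N}u\,d\mu_N.$$
   Context: $\omega_{N-1}$ is the $(N-1)$-dimensional measure of the unit sphere of $\mathbb{R}^N$ and $V_N$ is the volume of the unit ball of $\mathbb{R}^N$. Define $$\widetilde{\omega_N}:=N^N\left(\frac{N}{N-1}\right)^{N-1}\omega_{N-1},\qquad \mu_N(x):=\frac{1}{V_N\left(1+|x|^{\frac{N}{N-1}}\right)^N},\qquad d\mu_N:=\mu_N(x)\,dx,\qquad v_N:=\ln\mu_N,$$ $$H_N(u,\mu_N):=|\nabla v_N+\nabla u|^N-|\nabla v_N|^N-N|\nabla v_N|^{N-2}\nabla v_N\cdot\nabla u.$$ When $N=2$, $|\nabla v_N|^{N-2}$ is understood as $1$. With $\nabla u$ denoting the weak (distributional) gradient, $$W_{\mu_N}(\mathbb{R}^N):=\{u\in L^1(\mathbb{R}^N,d\mu_N):\ |\nabla u|\in L^N(\mathbb{R}^N,dx),\ |\nabla u|^2|\nabla v_N|^{N-2}\in L^1(\mathbb{R}^N,dx)\}$$ (real-valued functions). *)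

theory Defs
  imports "HOL-Analysis.Analysis"
begin

text \<open>The \<open>s\<close>-dimensional Hausdorff measure, normalised so that it agrees with the usual
  \<open>s\<close>-dimensional volume on \<open>s\<close>-dimensional surfaces. Empty covering sets are given weight
  \<open>0\<close> separately because \<open>0 ^ 0 = 1\<close>; boundedness is required because
  \<^const>\<open>diameter\<close> is only meaningful for bounded sets.\<close>

definition hausdorff_measure :: "nat \<Rightarrow> 'a::metric_space set \<Rightarrow> ennreal" where
  "hausdorff_measure s A =
     (SUP \<delta>\<in>{0<..}. INF U\<in>{U :: nat \<Rightarrow> 'a set. A \<subseteq> (\<Union>i. U i) \<and> (\<forall>i. bounded (U i) \<and> diameter (U i) \<le> \<delta>)}.
        \<Sum>i. if U i = {} then 0 else ennreal (unit_ball_vol (real s) * (diameter (U i) / 2) ^ s))"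

definition sphere_area :: "'n::finite itself \<Rightarrow> real" where
  "sphere_area _ = enn2real (hausdorff_measure (CARD('n) - 1) (sphere (0::real^'n) 1))"

definition omega_tilde :: "'n::finite itself \<Rightarrow> real" where
  "omega_tilde _ =
     real CARD('n) ^ CARD('n) * (real CARD('n) / (real CARD('n) - 1)) ^ (CARD('n) - 1)
       * sphere_area TYPE('n)"

definition mu :: "real^'n \<Rightarrow> real" where
  "mu x = 1 / (measure lebesgue (ball (0::real^'n) 1)
                * (1 + norm x powr (real CARD('n) / (real CARD('n) - 1))) ^ CARD('n))"

definition mu_measure :: "(real^'n) measure" where
  "mu_measure = density lebesgue (\<lambda>x. ennreal (mu x))"

definition v :: "real^'n \<Rightarrow> real" where
  "v x = ln (mu x)"

definition grad :: "(real^'n \<Rightarrow> real) \<Rightarrow> real^'n \<Rightarrow> real^'n" where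
  "grad f x = (THE D. GDERIV f x :> D)"

primrec continuously_diff :: "nat \<Rightarrow> ('a::real_normed_vector \<Rightarrow> real) \<Rightarrow> bool" where
  "continuously_diff 0 f \<longleftrightarrow> continuous_on UNIV f"
| "continuously_diff (Suc k) f \<longleftrightarrow>
     (\<forall>x. f differentiable (at x)) \<and> (\<forall>h. continuously_diff k (\<lambda>x. frechet_derivative f (at x) h))"

definition test_function :: "('a::real_normed_vector \<Rightarrow> real) \<Rightarrow> bool" where
  "test_function \<phi> \<longleftrightarrow> (\<forall>k. continuously_diff k \<phi>) \<and> compact (closure {x. \<phi> x \<noteq> 0})"

definition has_weak_gradient :: "(real^'n \<Rightarrow> real) \<Rightarrow> (real^'n \<Rightarrow> real^'n) \<Rightarrow> bool" where
  "has_weak_gradient u g \<longleftrightarrow>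
     (\<forall>K. compact K \<longrightarrow> u absolutely_integrable_on K \<and> g absolutely_integrable_on K) \<and>
     (\<forall>\<phi>. test_function \<phi> \<longrightarrow>
        (\<integral>x. u x *\<^sub>R grad \<phi> x \<partial>lebesgue) = - (\<integral>x. \<phi> x *\<^sub>R g x \<partial>lebesgue))"

text \<open>A weak gradient is unique up to a null set, so the choice of representative does not
  affect integrals.\<close>

definition weak_grad :: "(real^'n \<Rightarrow> real) \<Rightarrow> real^'n \<Rightarrow> real^'n" where
  "weak_grad u = (SOME g. has_weak_gradient u g)"

text \<open>In the next two definitions \<open>N - 2\<close> is a natural-number exponent; for \<open>N = 2\<close> the factor
  \<open>norm (grad v x) ^ (N - 2)\<close> is \<open>1\<close>, also at the origin, where \<open>grad v\<close> vanishes.\<close>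

definition H :: "(real^'n \<Rightarrow> real) \<Rightarrow> real^'n \<Rightarrow> real" where
  "H u x = norm (grad v x + weak_grad u x) ^ CARD('n) - norm (grad v x) ^ CARD('n)
     - real CARD('n) * norm (grad v x) ^ (CARD('n) - 2) * (grad v x \<bullet> weak_grad u x)"

definition W_mu :: "(real^'n \<Rightarrow> real) set" where
  "W_mu = {u. integrable mu_measure u \<and> (\<exists>g. has_weak_gradient u g)
     \<and> integrable lebesgue (\<lambda>x. norm (weak_grad u x) ^ CARD('n))
     \<and> integrable lebesgue (\<lambda>x. (norm (weak_grad u x))\<^sup>2 * norm (grad v x) ^ (CARD('n) - 2))}"

end

theory Submission
  imports Defs
begin

text \<open>The inequality is a limit of optimal-transport inequalities. For a compactly supported \<open>C\<^sup>1\<close>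
  perturbation \<open>U\<close> of \<open>v\<close> one transports the normalised restriction of \<open>e\<^bsup>v + U\<^esup>\<close> to a ball of radius \<open>R\<close>
  onto the normalised restriction of \<open>\<mu>\<close> to a ball of radius \<open>R'\<close> by a Knothe map, whose partial
  derivatives are nonnegative and multiply to the density quotient. The arithmetic-geometric mean
  inequality, integration by parts and Young's inequality, with weights for which \<open>U = 0\<close> is an
  equality case, give an estimate in which the quantities diverging as \<open>R \<rightarrow> \<infinity>\<close> cancel up to a
  logarithm; for \<open>R' = R Z\<^bsup>1/q\<^esup>\<close>, where \<open>Z\<close> is the integral of \<open>e\<^bsup>v + U\<^esup>\<close> and \<open>q = N / (N - 1)\<close>, this
  logarithm tends to \<open>ln Z\<close>. Since \<open>div (|\<nabla>v|\<^bsup>N - 2\<^esup> \<nabla>v)\<close> is a multiple of \<open>\<mu>\<close>, the term of \<open>H\<close> that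
  is linear in the gradient turns into the mean of \<open>U\<close>.

  A general \<open>u\<close> is reached by mollification, a logarithmic cut-off (whose \<open>N\<close>-energy tends to \<open>0\<close>)
  and a smooth truncation of the values. Passing to the limit only needs \<open>0 \<le> H\<close> and
  \<open>H \<le> C (|\<nabla>u|\<^bsup>N\<^esup> + |\<nabla>v|\<^bsup>N - 2\<^esup> |\<nabla>u|\<^sup>2)\<close>.

  As \<open>H \<ge> 0\<close>, the constant may be stated with the Hausdorff measure of the sphere once that measure is
  known to be positive and at most \<open>N V\<^sub>N\<close>.\<close>

section \<open>Monotone transport on the line\<close>

text \<open>Knothe's map enters only through its diagonal partial derivatives, and each of these
  comes from a transport between densities on the line; this is why semicontinuous densities
  suffice. Balls are forced: the integral of |grad v|^N diverges logarithmically, so on the whole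
  space both sides of the transport estimate are infinite. On a ball, however, the weight e^((1 -
  1/N)(v + U)) does not vanish at the boundary and integration by parts would leave a boundary term;
  hence its boundary value is subtracted. The price is the integral over the ball of the N-th root
  of the Jacobian, which concavity of the root bounds by the volumes of the two balls. Young's
  inequality and this tangent are both tuned to the identity map, the extremal case for U = 0; the
  ratio of the radii is the one remaining parameter, and its optimal value produces the logarithm.
  In the approximation of a general u the values are truncated under the cut-off, so that the
  gradient falling on the cut-off carries a bounded factor.\<close>

definition cum :: "(real \<Rightarrow> real) \<Rightarrow> real \<Rightarrow> real" where
  "cum k x = enn2real (\<integral>\<^sup>+t. ennreal (k t) * indicator {..x} t \<partial>lborel)"

text \<open>This is the monotone rearrangement, the generalised inverse of \<open>cum g\<close>
  composed with \<open>cum f\<close>. Restricting the infimum to \<open>{-M..M}\<close> keeps it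
  finite where \<open>cum f x = 0\<close>.\<close>

definition mono_transport :: "real \<Rightarrow> (real \<Rightarrow> real) \<Rightarrow> (real \<Rightarrow> real) \<Rightarrow> real \<Rightarrow> real" where
  "mono_transport M f g x = Inf {s\<in>{-M..M}. cum f x \<le> cum g s}"

locale density_1d =
  fixes M C :: real and k :: "real \<Rightarrow> real"
  assumes k_meas[measurable]: "k \<in> borel_measurable borel"
    and k_nonneg: "\<And>t. 0 \<le> k t" and k_le: "\<And>t. k t \<le> C"
    and k_supp: "\<And>t. \<bar>t\<bar> > M \<Longrightarrow> k t = 0"
    and k_int: "(\<integral>\<^sup>+t. ennreal (k t) \<partial>lborel) = 1"
begin

lemma C_nonneg: "0 \<le> C" using k_nonneg[of 0] k_le[of 0] by simp

lemma cum_ennreal: "(\<integral>\<^sup>+t. ennreal (k t) * indicator {..x} t \<partial>lborel) = ennreal (cum k x)"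
proof -
  have "(\<integral>\<^sup>+t. ennreal (k t) * indicator {..x} t \<partial>lborel) \<le> (\<integral>\<^sup>+t. ennreal (k t) \<partial>lborel)"
    by (intro nn_integral_mono) (auto simp: indicator_def)
  then have "(\<integral>\<^sup>+t. ennreal (k t) * indicator {..x} t \<partial>lborel) < top"
    using k_int by (simp add: order_le_less_trans)
  then show ?thesis by (simp add: cum_def)
qed

lemma cum_nonneg: "0 \<le> cum k x" by (simp add: cum_def)

lemma cum_le_1: "cum k x \<le> 1"
proof -
  have "ennreal (cum k x) \<le> (\<integral>\<^sup>+t. ennreal (k t) \<partial>lborel)"
    unfolding cum_ennreal[symmetric] by (intro nn_integral_mono) (auto simp: indicator_def)
  then show ?thesis using k_int by simp
qed

lemma cum_add:
  assumes "x \<le> y"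
  shows "ennreal (cum k y) = ennreal (cum k x) + (\<integral>\<^sup>+t. ennreal (k t) * indicator {x<..y} t \<partial>lborel)"
  unfolding cum_ennreal[symmetric] using assms
  by (subst nn_integral_add[symmetric]) (auto intro!: nn_integral_cong simp: indicator_def)

lemma cum_tail: "(\<integral>\<^sup>+t. ennreal (k t) * indicator {x<..} t \<partial>lborel) = ennreal (1 - cum k x)"
proof -
  have "ennreal (cum k x) + (\<integral>\<^sup>+t. ennreal (k t) * indicator {x<..} t \<partial>lborel) = 1"
    unfolding cum_ennreal[symmetric] k_int[symmetric]
    by (subst nn_integral_add[symmetric]) (auto intro!: nn_integral_cong simp: indicator_def)
  then have "(\<integral>\<^sup>+t. ennreal (k t) * indicator {x<..} t \<partial>lborel) = 1 - ennreal (cum k x)"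
    by (metis ennreal_add_diff_cancel_left ennreal_neq_top)
  then show ?thesis
    by (simp add: cum_nonneg ennreal_1[symmetric] ennreal_minus del: ennreal_1)
qed

lemma cum_mono: "x \<le> y \<Longrightarrow> cum k x \<le> cum k y"
proof -
  assume "x \<le> y"
  then have "ennreal (cum k x) \<le> ennreal (cum k y)" by (simp add: cum_add)
  then show ?thesis using cum_nonneg by (simp add: ennreal_le_iff)
qed

lemma cum_diff_le:
  assumes "x \<le> y" "\<And>t. x < t \<Longrightarrow> t \<le> y \<Longrightarrow> k t \<le> B" "0 \<le> B"
  shows "cum k y - cum k x \<le> B * (y - x)"
proof -
  have "(\<integral>\<^sup>+t. ennreal (k t) * indicator {x<..y} t \<partial>lborel)
      \<le> (\<integral>\<^sup>+t. ennreal B * indicator {x<..y} t \<partial>lborel)"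
    using assms by (intro nn_integral_mono) (auto simp: indicator_def intro!: ennreal_leI)
  also have "\<dots> = ennreal (B * (y - x))"
    using assms by (simp add: nn_integral_cmult_indicator ennreal_mult)
  finally have "ennreal (cum k y) \<le> ennreal (cum k x + B * (y - x))"
    using cum_add[OF assms(1)] assms by (simp add: cum_nonneg)
  then show ?thesis using assms cum_nonneg[of x] by (subst (asm) ennreal_le_iff) auto
qed

lemma cum_diff_ge:
  assumes "x \<le> y" "\<And>t. x < t \<Longrightarrow> t \<le> y \<Longrightarrow> B \<le> k t" "0 \<le> B"
  shows "B * (y - x) \<le> cum k y - cum k x"
proof -
  have "ennreal (B * (y - x)) = (\<integral>\<^sup>+t. ennreal B * indicator {x<..y} t \<partial>lborel)"
    using assms by (simp add: nn_integral_cmult_indicator ennreal_mult)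
  also have "\<dots> \<le> (\<integral>\<^sup>+t. ennreal (k t) * indicator {x<..y} t \<partial>lborel)"
    using assms by (intro nn_integral_mono) (auto simp: indicator_def intro!: ennreal_leI)
  finally have "ennreal (cum k x + B * (y - x)) \<le> ennreal (cum k y)"
    using cum_add[OF assms(1)] assms by (simp add: cum_nonneg)
  then show ?thesis using cum_nonneg[of y] by (subst (asm) ennreal_le_iff) auto
qed

lemma continuous_cum: "continuous_on A (cum k)"
proof -
  have "C-lipschitz_on UNIV (cum k)"
  proof (rule lipschitz_onI)
    fix x y
    show "dist (cum k x) (cum k y) \<le> C * dist x y"
    proof (cases "x \<le> y")
      case True
      then show ?thesis using cum_diff_le[OF True, of C] k_le C_nonneg cum_mono[OF True]
        by (simp add: dist_real_def)
    next
      case False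
      then show ?thesis using cum_diff_le[of y x C] k_le C_nonneg cum_mono[of y x]
        by (simp add: dist_real_def)
    qed
  qed (rule C_nonneg)
  then show ?thesis by (meson continuous_on_subset lipschitz_on_continuous_on subset_UNIV)
qed

lemma cum_right: "M \<le> x \<Longrightarrow> cum k x = 1"
proof -
  assume "M \<le> x"
  then have "(\<integral>\<^sup>+t. ennreal (k t) * indicator {..x} t \<partial>lborel) = (\<integral>\<^sup>+t. ennreal (k t) \<partial>lborel)"
    using k_supp by (intro nn_integral_cong) (auto simp: indicator_def not_le)
  then show ?thesis by (simp add: cum_def k_int)
qed

lemma cum_left: "x \<le> -M \<Longrightarrow> cum k x = 0"
proof -
  assume x: "x \<le> -M"
  have "AE t in lborel. t \<noteq> x" by (rule AE_lborel_singleton)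
  then have "AE t in lborel. ennreal (k t) * indicator {..x} t = 0"
  proof eventually_elim
    case (elim t)
    then show ?case using k_supp[of t] x by (auto simp: indicator_def)
  qed
  then have "(\<integral>\<^sup>+t. ennreal (k t) * indicator {..x} t \<partial>lborel) = 0"
    by (subst nn_integral_0_iff_AE) auto
  then show ?thesis by (simp add: cum_def)
qed

lemma M_pos: "0 < M"
proof (rule ccontr)
  assume "\<not> 0 < M"
  then have "cum k 0 = 0" "cum k 0 = 1" using cum_left[of 0] cum_right[of 0] by auto
  then show False by simp
qed

end

locale transport_1d = f: density_1d M C f + g: density_1d M C g
  for M C :: real and f g :: "real \<Rightarrow> real"
begin

abbreviation T where "T \<equiv> mono_transport M f g"

lemma T_closed: "closed {s\<in>{-M..M}. cum f x \<le> cum g s}"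
proof -
  have "continuous_on UNIV (cum g)" by (rule g.continuous_cum)
  then have "closed {s. cum f x \<le> cum g s}"
    by (intro closed_Collect_le continuous_intros) auto
  then have "closed ({-M..M} \<inter> {s. cum f x \<le> cum g s})" by (intro closed_Int) auto
  then show ?thesis by (simp add: Int_def)
qed

lemma T_mem: "T x \<in> {s\<in>{-M..M}. cum f x \<le> cum g s}"
  unfolding mono_transport_def
proof (rule closed_contains_Inf[OF _ _ T_closed])
  show "{s\<in>{-M..M}. cum f x \<le> cum g s} \<noteq> {}"
    using f.cum_le_1[of x] g.cum_right[of M] g.M_pos by (auto intro!: exI[of _ M])
  show "bdd_below {s\<in>{-M..M}. cum f x \<le> cum g s}" by (rule bdd_belowI[of _ "-M"]) auto
qed

lemma T_bounds: "-M \<le> T x" "T x \<le> M" using T_mem[of x] by auto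

text \<open>The Galois connection of a generalised inverse. It turns statements about
  \<open>T\<close> into comparisons of the continuous functions \<open>cum f\<close> and
  \<open>cum g\<close>; in the Knothe construction it also yields measurability jointly in the
  parameters.\<close>

lemma T_le_iff: "s \<in> {-M..M} \<Longrightarrow> T x \<le> s \<longleftrightarrow> cum f x \<le> cum g s"
proof
  assume s: "s \<in> {-M..M}" and "T x \<le> s"
  then show "cum f x \<le> cum g s" using T_mem[of x] g.cum_mono[of "T x" s] by auto
next
  assume "s \<in> {-M..M}" "cum f x \<le> cum g s"
  then show "T x \<le> s" unfolding mono_transport_def
    by (intro cInf_lower) (auto intro!: bdd_belowI[of _ "-M"])
qed

text \<open>\<open>cum g\<close> is continuous and vanishes at \<open>-M\<close>, so an excess at
  \<open>T x\<close> would give an earlier point where it equals \<open>cum f x\<close>, against the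
  minimality of \<open>T x\<close>.\<close>

lemma cum_T: "cum g (T x) = cum f x"
proof (rule antisym)
  show "cum f x \<le> cum g (T x)" using T_mem[of x] by auto
  show "cum g (T x) \<le> cum f x"
  proof (rule ccontr)
    assume *: "\<not> cum g (T x) \<le> cum f x"
    have "cum g (-M) \<le> cum f x" using g.cum_left[of "-M"] f.cum_nonneg[of x] by simp
    then obtain s where s: "-M \<le> s" "s \<le> T x" "cum g s = cum f x"
      using IVT'[of "cum g" "-M" "cum f x" "T x"] * T_bounds[of x] g.continuous_cum by fastforce
    then have "T x \<le> s" using T_le_iff[of s x] T_bounds[of x] by auto
    then show False using s * by auto
  qed
qed

lemma T_mono: "x \<le> y \<Longrightarrow> T x \<le> T y"
  using T_le_iff[of "T y" x] T_bounds[of y] f.cum_mono[of x y] cum_T[of y] by auto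

lemma T_measurable[measurable]: "T \<in> borel_measurable borel"
  by (rule borel_measurable_mono) (simp add: T_mono monoI)

text \<open>By the Galois connection the event \<open>s < T x\<close> is
  \<open>cum g s < cum f x\<close>. This is a half-line that starts at the last point where
  \<open>cum f\<close> takes the value \<open>cum g s\<close>, so its mass is
  \<open>1 - cum g s\<close>.\<close>

lemma T_push_tail:
  "(\<integral>\<^sup>+x. ennreal (f x) * indicator {x. s < T x} x \<partial>lborel) = ennreal (1 - cum g s)"
proof -
  consider "s < -M" | "s \<ge> M" | "-M \<le> s" "s < M" by linarith
  then show ?thesis
  proof cases
    case 1
    then have "indicator {x. s < T x} = (\<lambda>x. 1 :: ennreal)"
      using T_bounds by (auto simp: indicator_def fun_eq_iff intro: less_le_trans)
    then show ?thesis using f.k_int g.cum_left[of s] 1 by simp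
  next
    case 2
    then have "indicator {x. s < T x} = (\<lambda>x. 0 :: ennreal)"
      using T_bounds by (auto simp: indicator_def fun_eq_iff not_less intro: order_trans)
    then show ?thesis using g.cum_right[of s] 2 by simp
  next
    case 3
    then have eq: "{x. s < T x} = {x. cum g s < cum f x}"
      using T_le_iff[of s] by (auto simp: not_le[symmetric])
    show ?thesis
    proof (cases "cum g s = 1")
      case True
      then have "{x. cum g s < cum f x} = {}" using f.cum_le_1 by (auto simp: not_less)
      then show ?thesis unfolding eq by (simp add: True)
    next
      case False
      then have lt: "cum g s < 1" using g.cum_le_1[of s] by simp
      define A where "A = {x\<in>{-M..M}. cum f x \<le> cum g s}"
      have "continuous_on UNIV (cum f)" by (rule f.continuous_cum)
      then have "closed {x. cum f x \<le> cum g s}"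
        by (intro closed_Collect_le continuous_intros) auto
      then have "closed ({-M..M} \<inter> {x. cum f x \<le> cum g s})" by (intro closed_Int) auto
      then have clA: "closed A" by (simp add: Int_def A_def)
      have A_ne: "-M \<in> A" using f.M_pos f.cum_left[of "-M"] g.cum_nonneg by (simp add: A_def)
      have bdd: "bdd_above A" by (rule bdd_aboveI[of _ M]) (simp add: A_def)
      define b where "b = Sup A"
      have bA: "b \<in> A" unfolding b_def using clA A_ne bdd by (intro closed_contains_Sup) auto
      have max: "x \<le> b" if "x \<in> A" for x unfolding b_def using that bdd by (rule cSup_upper)
      obtain b' where b': "-M \<le> b'" "b' \<le> M" "cum f b' = cum g s"
        using IVT'[of "cum f" "-M" "cum g s" M] f.M_pos f.cum_left[of "-M"] f.cum_right[of M]
          g.cum_nonneg[of s] lt f.continuous_cum by fastforce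
      then have "b' \<le> b" by (intro max) (simp add: A_def)
      then have cb: "cum f b = cum g s" using bA f.cum_mono[of b' b] b' by (auto simp: A_def)
      have "{x. cum g s < cum f x} = {b<..}"
      proof (intro set_eqI iffI; clarsimp)
        fix x assume "cum g s < cum f x"
        then show "b < x" using cb f.cum_mono[of x b] by linarith
      next
        fix x assume x: "b < x"
        show "cum g s < cum f x"
        proof (rule ccontr)
          assume n: "\<not> cum g s < cum f x"
          then have "x < M" using f.cum_right[of x] lt by force
          then have "x \<in> A" using n x bA by (auto simp: A_def)
          then show False using max x by force
        qed
      qed
      then show ?thesis unfolding eq using f.cum_tail[of b] cb by simp
    qed
  qed
qed

lemma T_push_measure: "distr (density lborel f) borel T = density lborel g"
proof (rule measure_eqI_lessThan)
  fix s
  have "emeasure (distr (density lborel f) borel T) {s<..}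
      = (\<integral>\<^sup>+x. ennreal (f x) * indicator {x. s < T x} x \<partial>lborel)"
    by (subst emeasure_distr) (auto simp: emeasure_density vimage_def)
  also have "\<dots> = ennreal (1 - cum g s)" by (rule T_push_tail)
  also have "\<dots> = emeasure (density lborel g) {s<..}"
    using g.cum_tail[of s] by (simp add: emeasure_density)
  finally show "emeasure (distr (density lborel f) borel T) {s<..} = emeasure (density lborel g) {s<..}" .
  show "emeasure (distr (density lborel f) borel T) {s<..} < \<infinity>"
    using \<open>emeasure (distr (density lborel f) borel T) {s<..} = (\<integral>\<^sup>+x. ennreal (f x) * indicator {x. s < T x} x \<partial>lborel)\<close>
    by (simp add: T_push_tail)
qed auto

lemma T_push:
  assumes [measurable]: "h \<in> borel_measurable borel"
  shows "(\<integral>\<^sup>+x. ennreal (f x) * h (T x) \<partial>lborel) = (\<integral>\<^sup>+y. ennreal (g y) * h y \<partial>lborel)"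
proof -
  have "(\<integral>\<^sup>+x. ennreal (f x) * h (T x) \<partial>lborel) = (\<integral>\<^sup>+x. h (T x) \<partial>density lborel f)"
    by (subst nn_integral_density) auto
  also have "\<dots> = (\<integral>\<^sup>+y. h y \<partial>distr (density lborel f) borel T)"
    by (subst nn_integral_distr) auto
  also have "\<dots> = (\<integral>\<^sup>+y. ennreal (g y) * h y \<partial>lborel)"
    unfolding T_push_measure by (subst nn_integral_density) auto
  finally show ?thesis .
qed

text \<open>Mass balance on a short interval: by \<open>cum_T\<close> the mass of \<open>f\<close>
  between \<open>x\<close> and \<open>x + h\<close> equals the mass of \<open>g\<close> between
  \<open>T x\<close> and \<open>T (x + h)\<close>. Lower semicontinuity makes the former almost
  \<open>f x * h\<close> at least, upper semicontinuity makes the latter almost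
  \<open>g (T x)\<close> times the increment of \<open>T\<close> at most.\<close>

lemma T_derivative_ge:
  assumes lsc: "\<And>c. c < f x \<Longrightarrow> eventually (\<lambda>t. c < f t) (at x)"
    and usc: "\<And>s c. g s < c \<Longrightarrow> eventually (\<lambda>t. g t < c) (at s)"
    and c: "c < f x / g (T x)"
  shows "eventually (\<lambda>h. c * h \<le> T (x + h) - T x) (at_right 0)"
proof (cases "c \<le> 0")
  case True
  show ?thesis
    using eventually_at_right_less[of 0]
  proof eventually_elim
    case (elim h)
    then have "c * h \<le> 0" using True by (simp add: mult_nonpos_nonneg)
    then show ?case using T_mono[of x "x + h"] elim by simp
  qed
next
  case False
  then have "g (T x) \<noteq> 0" using c by auto
  then have gp: "0 < g (T x)" using g.k_nonneg[of "T x"] by linarith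
  have cg: "c * g (T x) < f x" using c gp by (simp add: field_simps)
  \<comment> \<open>The gap between \<open>c\<close> and the quotient is split: \<open>f0\<close>
    lies slightly below \<open>f x\<close>, and \<open>g0 = f0 / c\<close> still lies above
    \<open>g (T x)\<close>.\<close>
  define f0 where "f0 = (c * g (T x) + f x) / 2"
  have f0: "c * g (T x) < f0" "f0 < f x" using cg by (auto simp: f0_def)
  define g0 where "g0 = f0 / c"
  have g0: "g (T x) < g0" "c * g0 = f0" using f0 False by (auto simp: g0_def field_simps)
  have f0p: "0 < f0" using f0 gp False by (meson less_trans mult_pos_pos not_le)
  have g0p: "0 < g0" using g0 gp by simp
  obtain d where d: "d > 0" "\<And>t. t \<noteq> x \<Longrightarrow> dist t x < d \<Longrightarrow> f0 < f t"
    using lsc[OF f0(2)] unfolding eventually_at by auto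
  obtain e where e: "e > 0" "\<And>t. t \<noteq> T x \<Longrightarrow> dist t (T x) < e \<Longrightarrow> g t < g0"
    using usc[OF g0(1)] unfolding eventually_at by auto
  \<comment> \<open>For \<open>h < e / c\<close> an increment of \<open>T\<close> of size at least
    \<open>e\<close> is already large enough, so the upper bound on \<open>g\<close> is used only
    within distance \<open>e\<close> of \<open>T x\<close>.\<close>
  have "eventually (\<lambda>h. h < min d (e / c)) (at_right 0)"
    using d e False by (intro order_tendstoD[of _ 0]) (auto intro!: tendsto_intros)
  then show ?thesis using eventually_at_right_less[of 0]
  proof eventually_elim
    case (elim h)
    then have h: "0 < h" "h < d" "h < e / c" by auto
    show ?case
    proof (cases "T (x + h) - T x < e")
      case False
      then show ?thesis using h \<open>\<not> c \<le> 0\<close> by (simp add: field_simps)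
    next
      case True
      have m: "T x \<le> T (x + h)" using T_mono h by simp
      have "f0 * ((x + h) - x) \<le> cum f (x + h) - cum f x"
        using h d f0p by (intro f.cum_diff_ge) (auto simp: dist_real_def intro!: less_imp_le)
      also have "\<dots> = cum g (T (x + h)) - cum g (T x)" by (simp add: cum_T)
      also have "\<dots> \<le> g0 * (T (x + h) - T x)"
        using m e True g0p by (intro g.cum_diff_le) (auto simp: dist_real_def intro!: less_imp_le)
      finally have "f0 * h \<le> g0 * (T (x + h) - T x)" by simp
      moreover have "f0 * h = g0 * (c * h)" by (simp add: g0(2)[symmetric] mult_ac)
      ultimately have "g0 * (c * h) \<le> g0 * (T (x + h) - T x)" by simp
      then show ?thesis using g0p by simp
    qed
  qed
qed

end

section \<open>The Knothe map\<close>

abbreviation lborel_Pi :: "'i set \<Rightarrow> ('i \<Rightarrow> real) measure" where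
  "lborel_Pi I \<equiv> Pi\<^sub>M I (\<lambda>_. lborel)"

lemma space_lborel_Pi: "space (lborel_Pi I) = Pi\<^sub>E I (\<lambda>_. UNIV)"
  by (simp add: space_PiM)

definition box_function :: "real \<Rightarrow> real \<Rightarrow> 'i set \<Rightarrow> (('i \<Rightarrow> real) \<Rightarrow> real) \<Rightarrow> bool" where
  "box_function M C I k \<longleftrightarrow> k \<in> borel_measurable (lborel_Pi I) \<and>
     (\<forall>x\<in>space (lborel_Pi I). 0 \<le> k x \<and> k x \<le> C \<and> ((\<exists>i\<in>I. \<bar>x i\<bar> > M) \<longrightarrow> k x = 0))"

text \<open>Semicontinuity along coordinate lines survives taking marginals and sections, hence the induction on
  the number of coordinates, and it suffices for one-sided lower bounds on the difference quotients.\<close>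

definition separately_lsc :: "'i set \<Rightarrow> (('i \<Rightarrow> real) \<Rightarrow> real) \<Rightarrow> bool" where
  "separately_lsc I k \<longleftrightarrow> (\<forall>x\<in>space (lborel_Pi I). \<forall>i\<in>I. \<forall>c<k x.
     eventually (\<lambda>t. c < k (x(i := t))) (at (x i)))"

definition marginal :: "'i \<Rightarrow> (('i \<Rightarrow> real) \<Rightarrow> real) \<Rightarrow> ('i \<Rightarrow> real) \<Rightarrow> real" where
  "marginal n k y = (LINT t|lborel. k (y(n := t)))"

lemma fun_upd_space:
  assumes "y \<in> space (lborel_Pi J)"
  shows "y(n := t) \<in> space (lborel_Pi (insert n J))"
  using assms by (auto simp: space_lborel_Pi PiE_def extensional_def)

lemma restrict_fun_upd_eq:
  assumes "x \<in> space (lborel_Pi (insert n J))"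
  shows "(restrict x J)(n := x n) = x"
  using assms by (auto simp: space_lborel_Pi PiE_def extensional_def fun_eq_iff)

lemma restrict_space: "restrict x J \<in> space (lborel_Pi J)"
  by (auto simp: space_lborel_Pi)

section \<open>Marginals and sections of a density on a box\<close>

locale box_section =
  fixes M C :: real and J :: "'i set" and n :: 'i and k :: "('i \<Rightarrow> real) \<Rightarrow> real"
  assumes J: "finite J" "n \<notin> J" and box: "box_function M C (insert n J) k" and M: "0 \<le> M"
begin

lemma k_measurable[measurable]: "k \<in> borel_measurable (lborel_Pi (insert n J))"
  using box by (simp add: box_function_def)

lemma upd_measurable[measurable]:
  "(\<lambda>(y, t). y(n := t)) \<in> lborel_Pi J \<Otimes>\<^sub>M lborel \<rightarrow>\<^sub>M lborel_Pi (insert n J)"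
  by (rule measurable_add_dim)

lemma section_pair_measurable[measurable]:
  "(\<lambda>(y, t). k (y(n := t))) \<in> borel_measurable (lborel_Pi J \<Otimes>\<^sub>M lborel)"
  using measurable_compose[OF upd_measurable k_measurable] by (simp add: split_beta')

lemma section_measurable:
  assumes "y \<in> space (lborel_Pi J)"
  shows "(\<lambda>t. k (y(n := t))) \<in> borel_measurable borel"
  using measurable_Pair2[OF section_pair_measurable assms] by simp

lemma section_bounds:
  assumes "y \<in> space (lborel_Pi J)"
  shows "0 \<le> k (y(n := t))" "k (y(n := t)) \<le> C" "\<bar>t\<bar> > M \<Longrightarrow> k (y(n := t)) = 0"
  using box fun_upd_space[OF assms, of n t] unfolding box_function_def
  by (auto dest!: bspec[where x = "y(n := t)"])

lemma C_nonneg: "0 \<le> C"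
  using section_bounds(1,2)[OF restrict_space[of undefined]] by (meson order_trans)

lemma section_integrable:
  assumes "y \<in> space (lborel_Pi J)"
  shows "integrable lborel (\<lambda>t. k (y(n := t)))"
proof (rule Bochner_Integration.integrable_bound)
  show "integrable lborel (\<lambda>t. C * indicator {-M..M} t :: real)"
    by (intro integrable_mult_right integrable_real_indicator) (auto simp: emeasure_lborel_Icc_eq)
  show "(\<lambda>t. k (y(n := t))) \<in> borel_measurable lborel" using section_measurable[OF assms] by simp
  show "AE t in lborel. norm (k (y(n := t))) \<le> norm (C * indicator {- M..M} t :: real)"
  proof (rule AE_I2)
    fix t
    show "norm (k (y(n := t))) \<le> norm (C * indicator {- M..M} t :: real)"
    proof (cases "\<bar>t\<bar> > M")
      case True
      then show ?thesis using section_bounds(3)[OF assms True] by simp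
    next
      case False
      then have "t \<in> {-M..M}" by auto
      then show ?thesis using section_bounds(1,2)[OF assms, of t] C_nonneg by simp
    qed
  qed
qed

lemma marginal_nonneg: "y \<in> space (lborel_Pi J) \<Longrightarrow> 0 \<le> marginal n k y"
  unfolding marginal_def by (intro integral_nonneg_AE) (auto simp: section_bounds)

lemma nn_marginal:
  assumes "y \<in> space (lborel_Pi J)"
  shows "(\<integral>\<^sup>+t. ennreal (k (y(n := t))) \<partial>lborel) = ennreal (marginal n k y)"
  unfolding marginal_def using section_integrable[OF assms] section_bounds[OF assms]
  by (intro nn_integral_eq_integral) auto

lemma marginal_le:
  assumes "y \<in> space (lborel_Pi J)"
  shows "marginal n k y \<le> 2 * M * C"
proof -
  have "marginal n k y \<le> (LINT t|lborel. C * indicator {-M..M} t)"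
    unfolding marginal_def using section_bounds[OF assms] C_nonneg
    by (intro integral_mono section_integrable assms integrable_mult_right integrable_real_indicator)
      (auto simp: indicator_def not_le abs_if emeasure_lborel_Icc_eq)
  then show ?thesis using M by (simp add: mult_ac)
qed

lemma marginal_measurable[measurable]: "marginal n k \<in> borel_measurable (lborel_Pi J)"
  unfolding marginal_def
  by (rule sigma_finite_measure.borel_measurable_lebesgue_integral[OF sigma_finite_lborel]) simp

lemma box_marginal: "box_function M (2 * M * C) J (marginal n k)"
  unfolding box_function_def
proof (intro conjI ballI impI)
  fix y assume y: "y \<in> space (lborel_Pi J)"
  show "0 \<le> marginal n k y" "marginal n k y \<le> 2 * M * C"
    using marginal_nonneg[OF y] marginal_le[OF y] by auto
  assume "\<exists>i\<in>J. \<bar>y i\<bar> > M"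
  then obtain i where i: "i \<in> J" "\<bar>y i\<bar> > M" by auto
  have "k (y(n := t)) = 0" for t
    using box fun_upd_space[OF y, of n t] i J unfolding box_function_def
    by (auto dest!: bspec[where x = "y(n := t)"] bspec[where x = i])
  then show "marginal n k y = 0" by (simp add: marginal_def)
qed (rule marginal_measurable)

lemma nn_integral_marginal:
  "(\<integral>\<^sup>+y. ennreal (marginal n k y) \<partial>lborel_Pi J) = (\<integral>\<^sup>+x. ennreal (k x) \<partial>lborel_Pi (insert n J))"
proof -
  interpret product_sigma_finite "\<lambda>_. lborel :: real measure" by standard
  show ?thesis using J
    by (subst product_nn_integral_insert) (auto intro!: nn_integral_cong simp: nn_marginal)
qed

lemma section_AE_0:
  assumes "y \<in> space (lborel_Pi J)" "marginal n k y = 0"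
  shows "AE t in lborel. k (y(n := t)) = 0"
proof -
  have "(\<integral>\<^sup>+t. ennreal (k (y(n := t))) \<partial>lborel) = 0" using nn_marginal[OF assms(1)] assms(2) by simp
  then have "AE t in lborel. ennreal (k (y(n := t))) = 0"
    using section_measurable[OF assms(1)] by (subst (asm) nn_integral_0_iff_AE) auto
  then show ?thesis
    by (rule AE_mp) (auto intro!: AE_I2 antisym simp: section_bounds(1)[OF assms(1)])
qed

text \<open>Over a zero of the marginal there is no conditional density. Almost everywhere
  \<open>k\<close> itself vanishes over such points, so the product formula for the Knothe map does
  not see them.\<close>

lemma marginal_0_AE:
  "AE x in lborel_Pi (insert n J). marginal n k (restrict x J) = 0 \<longrightarrow> k x = 0"
proof -
  interpret product_sigma_finite "\<lambda>_. lborel :: real measure" by standard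
  have [measurable]: "(\<lambda>x. restrict x J) \<in> lborel_Pi (insert n J) \<rightarrow>\<^sub>M lborel_Pi J"
    by (rule measurable_restrict_subset) auto
  have r: "restrict (y(n := t)) J = y" if "y \<in> space (lborel_Pi J)" for y t
    using that J by (auto simp: space_lborel_Pi PiE_def extensional_def fun_eq_iff restrict_def)
  have "(\<integral>\<^sup>+x. ennreal (k x) * indicator {y\<in>space (lborel_Pi J). marginal n k y = 0} (restrict x J) \<partial>lborel_Pi (insert n J))
      = (\<integral>\<^sup>+y. \<integral>\<^sup>+t. ennreal (k (y(n := t))) * indicator {y\<in>space (lborel_Pi J). marginal n k y = 0}
          (restrict (y(n := t)) J) \<partial>lborel \<partial>lborel_Pi J)"
    using J by (subst product_nn_integral_insert) auto
  also have "\<dots> = (\<integral>\<^sup>+y. ennreal (marginal n k y) * indicator {y\<in>space (lborel_Pi J). marginal n k y = 0} y \<partial>lborel_Pi J)"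
  proof (rule nn_integral_cong)
    fix y assume y: "y \<in> space (lborel_Pi J)"
    note [measurable] = section_measurable[OF y]
    show "(\<integral>\<^sup>+t. ennreal (k (y(n := t))) * indicator {y\<in>space (lborel_Pi J). marginal n k y = 0}
          (restrict (y(n := t)) J) \<partial>lborel)
      = ennreal (marginal n k y) * indicator {y\<in>space (lborel_Pi J). marginal n k y = 0} y"
      by (simp add: r[OF y] nn_integral_multc nn_marginal[OF y])
  qed
  also have "\<dots> = (\<integral>\<^sup>+y. 0 \<partial>lborel_Pi J)"
    by (intro nn_integral_cong) (auto simp: indicator_def)
  also have "\<dots> = 0" by simp
  finally have "AE x in lborel_Pi (insert n J). ennreal (k x) *
      indicator {y\<in>space (lborel_Pi J). marginal n k y = 0} (restrict x J) = 0"
    by (subst (asm) nn_integral_0_iff_AE) auto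
  then show ?thesis
  proof (rule AE_mp, intro AE_I2 impI)
    fix x assume x: "x \<in> space (lborel_Pi (insert n J))" and m: "marginal n k (restrict x J) = 0"
      and "ennreal (k x) * indicator {y\<in>space (lborel_Pi J). marginal n k y = 0} (restrict x J) = 0"
    then have "k x \<le> 0" using restrict_space[of x J] by (simp add: indicator_def ennreal_eq_0_iff)
    moreover have "0 \<le> k x" using box x by (auto simp: box_function_def)
    ultimately show "k x = 0" by simp
  qed
qed

text \<open>This is the conditional density on a section. Its bound degenerates with the marginal,
  hence a constant \<open>C'\<close> that may depend on \<open>y\<close>.\<close>

lemma density_section:
  assumes "y \<in> space (lborel_Pi J)" "0 < marginal n k y" "C / marginal n k y \<le> C'"
  shows "density_1d M C' (\<lambda>t. k (y(n := t)) / marginal n k y)"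
proof
  note [measurable] = section_measurable[OF assms(1)]
  show "(\<lambda>t. k (y(n := t)) / marginal n k y) \<in> borel_measurable borel" by measurable
  show "0 \<le> k (y(n := t)) / marginal n k y" for t using section_bounds(1)[OF assms(1)] assms by simp
  show "k (y(n := t)) / marginal n k y \<le> C'" for t
    using section_bounds(2)[OF assms(1)] assms
    by (meson divide_right_mono less_imp_le order_trans)
  show "k (y(n := t)) / marginal n k y = 0" if "M < \<bar>t\<bar>" for t
    using section_bounds(3)[OF assms(1) that] by simp
  have "(\<integral>\<^sup>+ t. ennreal (k (y(n := t)) / marginal n k y) \<partial>lborel)
      = (\<integral>\<^sup>+ t. ennreal (k (y(n := t))) \<partial>lborel) / ennreal (marginal n k y)"
    using assms section_bounds(1)[OF assms(1)]
    by (subst nn_integral_divide[symmetric]) (auto simp: divide_ennreal)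
  then show "(\<integral>\<^sup>+ t. ennreal (k (y(n := t)) / marginal n k y) \<partial>lborel) = 1"
    using nn_marginal[OF assms(1)] assms by (simp add: divide_ennreal)
qed

lemma fun_upd_fun_upd: "i \<in> J \<Longrightarrow> y(i := s, n := t) = (y(n := t))(i := s)"
  using J by (auto simp: fun_upd_twist)

text \<open>Fatou's lemma along sequences: a lower limit in one of the remaining coordinates passes
  under the integral over the coordinate \<open>n\<close>. Negative levels are trivial, which allows
  the argument to run in \<open>ennreal\<close>.\<close>

lemma marginal_lsc:
  assumes lsc: "separately_lsc (insert n J) k"
  shows "separately_lsc J (marginal n k)"
  unfolding separately_lsc_def
proof (intro ballI allI impI)
  fix y i c assume y: "y \<in> space (lborel_Pi J)" and i: "i \<in> J" and c: "c < marginal n k y"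
  have ins: "y(i := s) \<in> space (lborel_Pi J)" for s
    using fun_upd_space[OF y, of i s] i by (simp add: insert_absorb)
  show "\<forall>\<^sub>F s in at (y i). c < marginal n k (y(i := s))"
  proof (cases "c < 0")
    case True
    then show ?thesis using marginal_nonneg[OF ins] by (intro always_eventually allI) (meson less_le_trans)
  next
    case False
    show ?thesis
    proof (rule sequentially_imp_eventually_at, intro allI impI)
      fix S :: "nat \<Rightarrow> real" assume S: "(\<forall>m. S m \<noteq> y i) \<and> S \<longlonglongrightarrow> y i"
      then have fl: "filterlim S (at (y i)) sequentially" by (auto simp: filterlim_at)
      have "ennreal c < ennreal (marginal n k y)" using c False by (simp add: ennreal_less_iff)
      also have "\<dots> = (\<integral>\<^sup>+t. ennreal (k (y(n := t))) \<partial>lborel)" using nn_marginal[OF y] by simp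
      also have "\<dots> \<le> (\<integral>\<^sup>+t. liminf (\<lambda>m. ennreal (k (y(i := S m, n := t)))) \<partial>lborel)"
      proof (rule nn_integral_mono)
        fix t
        show "ennreal (k (y(n := t))) \<le> liminf (\<lambda>m. ennreal (k (y(i := S m, n := t))))"
          unfolding le_Liminf_iff
        proof (intro allI impI)
          fix d assume d: "d < ennreal (k (y(n := t)))"
          then obtain d' where d': "d = ennreal d'" "0 \<le> d'" by (cases d) auto
          then have "d' < k (y(n := t))" using d by (simp add: ennreal_less_iff)
          then have "\<forall>\<^sub>F s in at ((y(n := t)) i). d' < k ((y(n := t))(i := s))"
            using lsc fun_upd_space[OF y, of n t] i unfolding separately_lsc_def by blast
          moreover have "(y(n := t)) i = y i" using i J by auto
          ultimately have "\<forall>\<^sub>F s in at (y i). d' < k (y(i := s, n := t))"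
            unfolding fun_upd_fun_upd[OF i] by (simp only:)
          then have "\<forall>\<^sub>F m in sequentially. d' < k (y(i := S m, n := t))"
            using fl by (rule eventually_compose_filterlim)
          then show "\<forall>\<^sub>F m in sequentially. d < ennreal (k (y(i := S m, n := t)))"
            by eventually_elim (simp add: d' ennreal_less_iff)
        qed
      qed
      also have "\<dots> \<le> liminf (\<lambda>m. \<integral>\<^sup>+t. ennreal (k (y(i := S m, n := t))) \<partial>lborel)"
        using section_measurable[OF ins] by (intro nn_integral_liminf) auto
      also have "\<dots> = liminf (\<lambda>m. ennreal (marginal n k (y(i := S m))))"
        using nn_marginal[OF ins] by simp
      finally have "\<forall>\<^sub>F m in sequentially. ennreal c < ennreal (marginal n k (y(i := S m)))"
        by (rule less_LiminfD)
      then show "\<forall>\<^sub>F m in sequentially. c < marginal n k (y(i := S m))"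
        by eventually_elim (use False in \<open>simp add: ennreal_less_iff\<close>)
    qed
  qed
qed

end

lemma (in box_section) marginal_usc:
  assumes usc: "separately_lsc (insert n J) (\<lambda>x. - k x)"
  shows "separately_lsc J (\<lambda>y. - marginal n k y)"
proof -
  \<comment> \<open>Reduce to lower semicontinuity of the complement; the cut-off to \<open>\<bar>x n\<bar> \<le> M\<close> acts only in the
    integrated variable.\<close>
  have usc_marginal: "\<forall>\<^sub>F s in at (y i). c < - marginal n k (y(i := s))"
    if y: "y \<in> space (lborel_Pi J)" and i: "i \<in> J" and c: "c < - marginal n k y" for y i c
  proof -
    have ins: "y(i := s) \<in> space (lborel_Pi J)" for s
      using fun_upd_space[OF y, of i s] i by (simp add: insert_absorb)
    define cc where "cc y t = (C - k (y(n := t))) * indicator {-M..M} t" for y t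
    have cc_nn: "(\<integral>\<^sup>+t. ennreal (cc y t) \<partial>lborel) = ennreal (2 * M * C - marginal n k y)"
      if y: "y \<in> space (lborel_Pi J)" for y
    proof -
      have k0: "k (y(n := t)) * indicator {-M..M} t = k (y(n := t))" for t
        using section_bounds(3)[OF y, of t] by (cases "\<bar>t\<bar> > M") (auto simp: indicator_def)
      have cc_eq: "cc y = (\<lambda>t. C * indicator {-M..M} t - k (y(n := t)))"
        unfolding cc_def by (simp add: left_diff_distrib k0)
      have int: "integrable lborel (\<lambda>t. C * indicator {-M..M} t :: real)"
        by (intro integrable_mult_right integrable_real_indicator) (auto simp: emeasure_lborel_Icc_eq)
      have "(\<integral>\<^sup>+t. ennreal (cc y t) \<partial>lborel) = ennreal (LINT t|lborel. cc y t)"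
      proof (rule nn_integral_eq_integral)
        show "integrable lborel (cc y)"
          unfolding cc_eq by (intro Bochner_Integration.integrable_diff int section_integrable y)
        show "AE t in lborel. 0 \<le> cc y t"
          using section_bounds[OF y] by (auto simp: cc_def)
      qed
      also have "(LINT t|lborel. cc y t) = 2 * M * C - marginal n k y"
        unfolding cc_eq marginal_def using int section_integrable[OF y] M by simp
      finally show ?thesis .
    qed
    have cc_ge: "0 \<le> 2 * M * C - marginal n k y" if "y \<in> space (lborel_Pi J)" for y
      using marginal_le[OF that] by simp
    show ?thesis
    proof (rule sequentially_imp_eventually_at, intro allI impI)
      fix S :: "nat \<Rightarrow> real" assume S: "(\<forall>m. S m \<noteq> y i) \<and> S \<longlonglongrightarrow> y i"
      then have fl: "filterlim S (at (y i)) sequentially" by (auto simp: filterlim_at)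
      show "\<forall>\<^sub>F m in sequentially. c < - marginal n k (y(i := S m))"
      proof (cases "2 * M * C + c < 0")
        case True
        then show ?thesis using marginal_le[OF ins] by (intro always_eventually allI) (smt (verit))
      next
        case False
        have "ennreal (2 * M * C + c) < ennreal (2 * M * C - marginal n k y)"
          using c False by (simp add: ennreal_less_iff)
        also have "\<dots> = (\<integral>\<^sup>+t. ennreal (cc y t) \<partial>lborel)" using cc_nn[OF y] by simp
        also have "\<dots> \<le> (\<integral>\<^sup>+t. liminf (\<lambda>m. ennreal (cc (y(i := S m)) t)) \<partial>lborel)"
        proof (rule nn_integral_mono)
          fix t
          show "ennreal (cc y t) \<le> liminf (\<lambda>m. ennreal (cc (y(i := S m)) t))"
            unfolding le_Liminf_iff
          proof (intro allI impI)
            fix d assume d: "d < ennreal (cc y t)"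
            then obtain d' where d': "d = ennreal d'" "0 \<le> d'" by (cases d) auto
            have tM: "t \<in> {-M..M}"
            proof (rule ccontr)
              assume "t \<notin> {-M..M}"
              then have "cc y t = 0" by (simp add: cc_def)
              then show False using d by simp
            qed
            then have "d' - C < - k (y(n := t))" using d d' by (simp add: ennreal_less_iff cc_def)
            then have "\<forall>\<^sub>F s in at ((y(n := t)) i). d' - C < - k ((y(n := t))(i := s))"
              using usc fun_upd_space[OF y, of n t] i unfolding separately_lsc_def by blast
            moreover have "(y(n := t)) i = y i" using i J by auto
            ultimately have "\<forall>\<^sub>F s in at (y i). d' - C < - k (y(i := s, n := t))"
              unfolding fun_upd_fun_upd[OF i] by (simp only:)
            then have "\<forall>\<^sub>F m in sequentially. d' - C < - k (y(i := S m, n := t))"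
              using fl by (rule eventually_compose_filterlim)
            then show "\<forall>\<^sub>F m in sequentially. d < ennreal (cc (y(i := S m)) t)"
              by eventually_elim (use tM d' in \<open>simp add: ennreal_less_iff cc_def\<close>)
          qed
        qed
        also have "\<dots> \<le> liminf (\<lambda>m. \<integral>\<^sup>+t. ennreal (cc (y(i := S m)) t) \<partial>lborel)"
          unfolding cc_def using section_measurable[OF ins]
          by (intro nn_integral_liminf) auto
        also have "\<dots> = liminf (\<lambda>m. ennreal (2 * M * C - marginal n k (y(i := S m))))"
          using cc_nn[OF ins] by simp
        finally have "\<forall>\<^sub>F m in sequentially.
            ennreal (2 * M * C + c) < ennreal (2 * M * C - marginal n k (y(i := S m)))"
          by (rule less_LiminfD)
        then show ?thesis
          by eventually_elim (use False in \<open>simp add: ennreal_less_iff\<close>)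
      qed
    qed
  qed
  then show ?thesis by (auto simp: separately_lsc_def)
qed

text \<open>The cylinder over a null set is null although the line has infinite measure: in
  \<open>ennreal\<close> the product of \<open>top\<close> and \<open>0\<close> is
  \<open>0\<close>.\<close>

lemma AE_lborel_Pi_insert:
  assumes J: "finite J" "n \<notin> J" and AE: "AE y in lborel_Pi J. Q y"
  shows "AE x in lborel_Pi (insert n J). Q (restrict x J)"
proof -
  interpret product_sigma_finite "\<lambda>_. lborel :: real measure" by standard
  obtain N where N: "{y \<in> space (lborel_Pi J). \<not> Q y} \<subseteq> N" "emeasure (lborel_Pi J) N = 0" "N \<in> sets (lborel_Pi J)"
    using AE by (auto elim!: AE_E)
  have [measurable]: "(\<lambda>x. restrict x J) \<in> lborel_Pi (insert n J) \<rightarrow>\<^sub>M lborel_Pi J"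
    by (rule measurable_restrict_subset) auto
  note [measurable] = N(3)
  have "(\<integral>\<^sup>+x. indicator N (restrict x J) \<partial>lborel_Pi (insert n J))
      = (\<integral>\<^sup>+y. \<integral>\<^sup>+t. indicator N (restrict (y(n := t)) J) \<partial>lborel \<partial>lborel_Pi J)"
    using J by (subst product_nn_integral_insert) auto
  also have "\<dots> = (\<integral>\<^sup>+y. top * indicator N y \<partial>lborel_Pi J)"
  proof (rule nn_integral_cong)
    fix y assume y: "y \<in> space (lborel_Pi J)"
    have "restrict (y(n := t)) J = y" for t
      using y J by (auto simp: space_lborel_Pi PiE_def extensional_def fun_eq_iff restrict_def)
    then show "(\<integral>\<^sup>+t. indicator N (restrict (y(n := t)) J) \<partial>lborel) = top * indicator N y"
      by (simp add: mult.commute)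
  qed
  also have "\<dots> = 0" using N by (subst nn_integral_cmult_indicator) auto
  finally have "AE x in lborel_Pi (insert n J). indicator N (restrict x J) = (0::ennreal)"
    by (subst (asm) nn_integral_0_iff_AE) auto
  then show ?thesis
  proof (rule AE_mp, intro AE_I2 impI)
    fix x assume "x \<in> space (lborel_Pi (insert n J))" "indicator N (restrict x J) = (0::ennreal)"
    then show "Q (restrict x J)" using N(1) restrict_space[of x J] by (auto simp: indicator_def split: if_splits)
  qed
qed

text \<open>\<open>\<kappa> i\<close> is only a lower bound for the lower right derivative of the \<open>i\<close>-th component in direction \<open>i\<close>;
  together with the product formula this replaces differentiability of \<open>T\<close>.\<close>

definition knothe_map :: "'i set \<Rightarrow> real \<Rightarrow> (('i \<Rightarrow> real) \<Rightarrow> real) \<Rightarrow> (('i \<Rightarrow> real) \<Rightarrow> real) \<Rightarrow>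
    (('i \<Rightarrow> real) \<Rightarrow> 'i \<Rightarrow> real) \<Rightarrow> ('i \<Rightarrow> ('i \<Rightarrow> real) \<Rightarrow> real) \<Rightarrow> bool" where
  "knothe_map I M f g T \<kappa> \<longleftrightarrow>
     (\<forall>x\<in>space (lborel_Pi I). T x \<in> space (lborel_Pi I) \<and> (\<forall>i\<in>I. \<bar>T x i\<bar> \<le> M)) \<and>
     (\<forall>i\<in>I. (\<lambda>x. T x i) \<in> borel_measurable (lborel_Pi I)) \<and>
     (\<forall>i\<in>I. \<kappa> i \<in> borel_measurable (lborel_Pi I)) \<and>
     (\<forall>i\<in>I. \<forall>x\<in>space (lborel_Pi I). 0 \<le> \<kappa> i x) \<and>
     (\<forall>i\<in>I. \<forall>x\<in>space (lborel_Pi I). \<forall>h>0. T x i \<le> T (x(i := x i + h)) i) \<and>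
     (\<forall>i\<in>I. \<forall>x\<in>space (lborel_Pi I). \<forall>c<\<kappa> i x.
        eventually (\<lambda>h. c * h \<le> T (x(i := x i + h)) i - T x i) (at_right 0)) \<and>
     (\<forall>k\<in>borel_measurable (lborel_Pi I). (\<integral>\<^sup>+x. ennreal (f x) * k (T x) \<partial>lborel_Pi I)
        = (\<integral>\<^sup>+y. ennreal (g y) * k y \<partial>lborel_Pi I)) \<and>
     (AE x in lborel_Pi I. f x = g (T x) * (\<Prod>i\<in>I. \<kappa> i x))"

text \<open>Coordinates are added one at a time. The map \<open>T'\<close> between the marginals is
  kept, and the new component transports the conditional density of \<open>f\<close> over
  \<open>y\<close> to that of \<open>g\<close> over \<open>T' y\<close>. Earlier components do not
  depend on later variables, so the Jacobian matrix is triangular, and the product of the diagonal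
  entries telescopes: quotient of conditional densities times quotient of marginals.\<close>

proposition knothe_map_exists:
  fixes I :: "'i set"
  assumes "finite I" "0 \<le> M"
    and "box_function M C I f" "box_function M C I g"
    and "separately_lsc I f" "separately_lsc I (\<lambda>x. - g x)"
    and "(\<integral>\<^sup>+x. ennreal (f x) \<partial>lborel_Pi I) = 1" "(\<integral>\<^sup>+x. ennreal (g x) \<partial>lborel_Pi I) = 1"
  shows "\<exists>T \<kappa>. knothe_map I M f g T \<kappa>"
  using assms
proof (induction I arbitrary: C f g rule: finite_induct)
  case empty
  \<comment> \<open>Over the empty index set the product measure is a point mass, so both densities
    are 1 there and the identity is the map.\<close>
  have sp: "space (lborel_Pi {}) = {\<lambda>_. undefined}" by (simp add: space_PiM)
  have int: "(\<integral>\<^sup>+x. h x \<partial>lborel_Pi {}) = h (\<lambda>_. undefined)" for h :: "('i \<Rightarrow> real) \<Rightarrow> ennreal"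
    by (simp add: PiM_empty nn_integral_count_space_finite)
  have "f (\<lambda>_. undefined) = 1" "g (\<lambda>_. undefined) = 1"
    using empty.prems unfolding int by simp_all
  then show ?case
    unfolding knothe_map_def by (intro exI[of _ "\<lambda>x. x"] exI[of _ "\<lambda>_ _. 1"]) (auto simp: sp int intro!: AE_I2)
next
  case (insert n J)
  let ?I = "insert n J"
  interpret product_sigma_finite "\<lambda>_. lborel :: real measure" by standard
  interpret F: box_section M C J n f by unfold_locales (use insert in auto)
  interpret G: box_section M C J n g by unfold_locales (use insert in auto)
  define f' where "f' = marginal n f"
  define g' where "g' = marginal n g"
  have f'm[measurable]: "f' \<in> borel_measurable (lborel_Pi J)" by (simp add: f'_def)
  have g'm[measurable]: "g' \<in> borel_measurable (lborel_Pi J)" by (simp add: g'_def)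
  obtain T' L where
    T'_sp: "\<And>x. x \<in> space (lborel_Pi J) \<Longrightarrow> T' x \<in> space (lborel_Pi J)" and
    T'_le: "\<And>x i. x \<in> space (lborel_Pi J) \<Longrightarrow> i \<in> J \<Longrightarrow> \<bar>T' x i\<bar> \<le> M" and
    T'_meas: "\<And>i. i \<in> J \<Longrightarrow> (\<lambda>x. T' x i) \<in> borel_measurable (lborel_Pi J)" and
    L_meas: "\<And>i. i \<in> J \<Longrightarrow> L i \<in> borel_measurable (lborel_Pi J)" and
    L_nn: "\<And>i x. i \<in> J \<Longrightarrow> x \<in> space (lborel_Pi J) \<Longrightarrow> 0 \<le> L i x" and
    T'_mono: "\<And>i x h. i \<in> J \<Longrightarrow> x \<in> space (lborel_Pi J) \<Longrightarrow> 0 < h \<Longrightarrow> T' x i \<le> T' (x(i := x i + h)) i" and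
    T'_diff: "\<And>i x c. i \<in> J \<Longrightarrow> x \<in> space (lborel_Pi J) \<Longrightarrow> c < L i x \<Longrightarrow>
        eventually (\<lambda>h. c * h \<le> T' (x(i := x i + h)) i - T' x i) (at_right 0)" and
    T'_push: "\<And>k. k \<in> borel_measurable (lborel_Pi J) \<Longrightarrow> (\<integral>\<^sup>+x. ennreal (f' x) * k (T' x) \<partial>lborel_Pi J)
        = (\<integral>\<^sup>+y. ennreal (g' y) * k y \<partial>lborel_Pi J)" and
    T'_det: "AE x in lborel_Pi J. f' x = g' (T' x) * (\<Prod>i\<in>J. L i x)"
  proof -
    \<comment> \<open>Integrating one coordinate over an interval of length \<open>2 * M\<close>
      multiplies the bound by this length; therefore the bound is generalised in the
      induction.\<close>
    have "\<exists>T \<kappa>. knothe_map J M f' g' T \<kappa>"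
      unfolding f'_def g'_def using insert.prems
      by (intro insert.IH[where C = "2 * M * C"] F.box_marginal G.box_marginal F.marginal_lsc G.marginal_usc)
        (auto simp: F.nn_integral_marginal G.nn_integral_marginal)
    then obtain T \<kappa> where "knothe_map J M f' g' T \<kappa>" by blast
    then show thesis unfolding knothe_map_def by (intro that[of T \<kappa>]) auto
  qed
  note [measurable] = T'_meas L_meas
  have T'_measurable[measurable]: "T' \<in> lborel_Pi J \<rightarrow>\<^sub>M lborel_Pi J"
  proof (rule measurable_PiM_single')
    show "T' \<in> space (lborel_Pi J) \<rightarrow> (\<Pi>\<^sub>E i\<in>J. space lborel)"
      using T'_sp by (auto simp: space_PiM)
  qed (use T'_meas in simp)
  \<comment> \<open>Conditional densities exist only where both marginals are positive. Elsewhere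
    the new component and its derivative get the default value 0; by \<open>null\<close> and
    \<open>marginal_0_AE\<close> this concerns no mass of \<open>f\<close>.\<close>
  define ok where "ok y \<longleftrightarrow> 0 < f' y \<and> 0 < g' (T' y)" for y
  define fs where "fs y t = f (y(n := t)) / f' y" for y t
  define gs where "gs z t = g (z(n := t)) / g' z" for z t
  define \<tau> where "\<tau> y t = (if ok y then mono_transport M (fs y) (gs (T' y)) t else 0)" for y t
  define T where "T x = (T' (restrict x J))(n := \<tau> (restrict x J) (x n))" for x
  define \<Lambda> where "\<Lambda> i x = (if i = n then if ok (restrict x J)
       then fs (restrict x J) (x n) / gs (T' (restrict x J)) (T x n) else 0 else L i (restrict x J))" for i x
  have tr: "transport_1d M (max (C / f' y) (C / g' (T' y))) (fs y) (gs (T' y))"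
    if "y \<in> space (lborel_Pi J)" "ok y" for y
    using that T'_sp[OF that(1)] unfolding transport_1d_def fs_def gs_def f'_def g'_def ok_def
    by (intro conjI F.density_section G.density_section) auto
  have \<tau>_bounds: "\<bar>\<tau> y t\<bar> \<le> M" if "y \<in> space (lborel_Pi J)" for y t
    using transport_1d.T_bounds[OF tr[OF that]] \<open>0 \<le> M\<close> by (auto simp: \<tau>_def abs_le_iff minus_le_iff)
  have ok_meas[measurable]: "Measurable.pred (lborel_Pi J) ok" unfolding ok_def by measurable
  have fs_meas[measurable]: "(\<lambda>p. fs (fst p) (snd p)) \<in> borel_measurable (lborel_Pi J \<Otimes>\<^sub>M (lborel :: real measure))"
    using F.section_pair_measurable unfolding fs_def by (simp add: split_beta')
  have gs_meas[measurable]: "(\<lambda>p. gs (fst p) (snd p)) \<in> borel_measurable (lborel_Pi J \<Otimes>\<^sub>M (lborel :: real measure))"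
    using G.section_pair_measurable unfolding gs_def by (simp add: split_beta')
  have cum_meas: "(\<lambda>p. cum (k (fst p)) (snd p)) \<in> borel_measurable (lborel_Pi J \<Otimes>\<^sub>M (lborel :: real measure))"
    if k: "(\<lambda>p. k (fst p) (snd p)) \<in> borel_measurable (lborel_Pi J \<Otimes>\<^sub>M (lborel :: real measure))" for k :: "('i \<Rightarrow> real) \<Rightarrow> real \<Rightarrow> real"
  proof -
    have [measurable]: "(\<lambda>q. k (fst (fst q)) (snd q)) \<in> borel_measurable ((lborel_Pi J \<Otimes>\<^sub>M (lborel :: real measure)) \<Otimes>\<^sub>M lborel)"
      using measurable_compose[OF _ k, of "\<lambda>q. (fst (fst q), snd q)" "(lborel_Pi J \<Otimes>\<^sub>M (lborel :: real measure)) \<Otimes>\<^sub>M lborel"]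
      by simp
    have "(\<lambda>p. \<integral>\<^sup>+t. (if t \<le> snd p then ennreal (k (fst p) t) else 0) \<partial>lborel)
        \<in> borel_measurable (lborel_Pi J \<Otimes>\<^sub>M (lborel :: real measure))"
      by (rule lborel.borel_measurable_nn_integral) (simp add: split_beta')
    moreover have "(\<lambda>p. cum (k (fst p)) (snd p))
        = (\<lambda>p. enn2real (\<integral>\<^sup>+t. (if t \<le> snd p then ennreal (k (fst p) t) else 0) \<partial>lborel))"
      unfolding cum_def by (intro ext arg_cong[where f = enn2real] nn_integral_cong) (auto simp: indicator_def)
    ultimately show ?thesis by simp
  qed
  note [measurable] = cum_meas[OF fs_meas] cum_meas[OF gs_meas]
  \<comment> \<open>Sublevel sets of \<tau> are sets defined by \<open>cum\<close> through the
    Galois connection. It holds for levels in \<open>{-M..M}\<close>; below and above this interval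
    the sublevel set is empty or full.\<close>
  have \<tau>_meas: "(\<lambda>p. \<tau> (fst p) (snd p)) \<in> borel_measurable (lborel_Pi J \<Otimes>\<^sub>M (lborel :: real measure))"
  proof (rule borel_measurableI_le)
    fix s
    have "{p \<in> space (lborel_Pi J \<Otimes>\<^sub>M (lborel :: real measure)). \<tau> (fst p) (snd p) \<le> s} =
      {p \<in> space (lborel_Pi J \<Otimes>\<^sub>M (lborel :: real measure)). if ok (fst p)
         then -M \<le> s \<and> (M < s \<or> cum (fs (fst p)) (snd p) \<le> cum (gs (T' (fst p))) s) else 0 \<le> s}"
    proof (intro Collect_cong conj_cong refl)
      fix p assume "p \<in> space (lborel_Pi J \<Otimes>\<^sub>M (lborel :: real measure))"
      then have y: "fst p \<in> space (lborel_Pi J)" by (auto simp: space_pair_measure)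
      show "\<tau> (fst p) (snd p) \<le> s \<longleftrightarrow> (if ok (fst p)
         then -M \<le> s \<and> (M < s \<or> cum (fs (fst p)) (snd p) \<le> cum (gs (T' (fst p))) s) else 0 \<le> s)"
      proof (cases "ok (fst p)")
        case True
        interpret S: transport_1d M "max (C / f' (fst p)) (C / g' (T' (fst p)))" "fs (fst p)" "gs (T' (fst p))"
          by (rule tr[OF y True])
        show ?thesis using True S.T_bounds[of "snd p"] S.T_le_iff[of s "snd p"]
          by (cases "s \<le> M"; cases "-M \<le> s") (auto simp: \<tau>_def)
      qed (simp add: \<tau>_def)
    qed
    also have "\<dots> \<in> sets (lborel_Pi J \<Otimes>\<^sub>M (lborel :: real measure))"
    proof -
      have [measurable]: "(\<lambda>p. cum (gs (T' (fst p))) s) \<in> borel_measurable (lborel_Pi J \<Otimes>\<^sub>M (lborel :: real measure))"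
        using measurable_compose[OF _ cum_meas[OF gs_meas], of "\<lambda>p. (T' (fst p), s)" "lborel_Pi J \<Otimes>\<^sub>M (lborel :: real measure)"]
        by simp
      show ?thesis by measurable
    qed
    finally show "{p \<in> space (lborel_Pi J \<Otimes>\<^sub>M (lborel :: real measure)). \<tau> (fst p) (snd p) \<le> s} \<in> sets (lborel_Pi J \<Otimes>\<^sub>M (lborel :: real measure))" .
  qed
  have restr[measurable]: "(\<lambda>x. restrict x J) \<in> lborel_Pi ?I \<rightarrow>\<^sub>M lborel_Pi J"
    by (rule measurable_restrict_subset) auto
  have proj[measurable]: "(\<lambda>x. x n) \<in> lborel_Pi ?I \<rightarrow>\<^sub>M lborel"
    by (rule measurable_component_singleton) simp
  have \<tau>x[measurable]: "(\<lambda>x. \<tau> (restrict x J) (x n)) \<in> borel_measurable (lborel_Pi ?I)"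
    using measurable_compose[OF measurable_Pair[OF restr proj] \<tau>_meas] by simp
  have T_sp: "T x \<in> space (lborel_Pi ?I)" if "x \<in> space (lborel_Pi ?I)" for x
    unfolding T_def by (intro fun_upd_space T'_sp restrict_space)
  have T_i: "T x i = T' (restrict x J) i" if "i \<in> J" for x i
    using that insert.hyps by (auto simp: T_def)
  have T_n: "T x n = \<tau> (restrict x J) (x n)" for x by (simp add: T_def)
  have T_comp[measurable]: "(\<lambda>x. T x i) \<in> borel_measurable (lborel_Pi ?I)" if "i \<in> ?I" for i
  proof (cases "i = n")
    case False
    then have "i \<in> J" using that by simp
    then show ?thesis unfolding T_i[OF \<open>i \<in> J\<close>] by measurable
  qed (simp add: T_n)
  have T_meas[measurable]: "T \<in> lborel_Pi ?I \<rightarrow>\<^sub>M lborel_Pi ?I"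
  proof (rule measurable_PiM_single')
    show "T \<in> space (lborel_Pi ?I) \<rightarrow> (\<Pi>\<^sub>E i\<in>?I. space lborel)"
      using T_sp by (auto simp: space_PiM)
  qed (use T_comp in simp)
  have \<Lambda>_meas: "\<Lambda> i \<in> borel_measurable (lborel_Pi ?I)" if "i \<in> ?I" for i
  proof (cases "i = n")
    case True
    have [measurable]: "(\<lambda>x. fs (restrict x J) (x n)) \<in> borel_measurable (lborel_Pi ?I)"
      using measurable_compose[OF measurable_Pair[OF restr proj] fs_meas] by simp
    have [measurable]: "(\<lambda>x. gs (T' (restrict x J)) (\<tau> (restrict x J) (x n))) \<in> borel_measurable (lborel_Pi ?I)"
      using measurable_compose[OF measurable_Pair gs_meas, of "\<lambda>x. T' (restrict x J)" "lborel_Pi ?I" "\<lambda>x. \<tau> (restrict x J) (x n)"]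
      by simp
    have "\<Lambda> n = (\<lambda>x. if ok (restrict x J)
       then fs (restrict x J) (x n) / gs (T' (restrict x J)) (\<tau> (restrict x J) (x n)) else 0)"
      by (auto simp: \<Lambda>_def T_n fun_eq_iff)
    then show ?thesis using True by simp
  next
    case False
    then have "i \<in> J" using that by simp
    moreover have "\<Lambda> i = (\<lambda>x. L i (restrict x J))" using False by (simp add: \<Lambda>_def fun_eq_iff)
    ultimately show ?thesis using measurable_compose[OF restr L_meas] by simp
  qed
  have restr_upd_n: "restrict (x(n := s)) J = restrict x J" for x s
    using insert.hyps by (auto simp: fun_eq_iff restrict_def)
  have restr_upd: "restrict (x(i := s)) J = (restrict x J)(i := s)" if "i \<in> J" for x i s
    using that by (auto simp: fun_eq_iff restrict_def)
  have gs_eq: "(T' y)(n := T x n) = T x" if "y = restrict x J" for x y using that by (simp add: T_def)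
  have \<Lambda>_nn: "0 \<le> \<Lambda> i x" if "i \<in> ?I" "x \<in> space (lborel_Pi ?I)" for i x
  proof (cases "i = n")
    case True
    have "0 \<le> fs (restrict x J) (x n) / gs (T' (restrict x J)) (T x n)" if "ok (restrict x J)"
    proof -
      interpret S: transport_1d M "max (C / f' (restrict x J)) (C / g' (T' (restrict x J)))"
        "fs (restrict x J)" "gs (T' (restrict x J))"
        by (rule tr[OF restrict_space that])
      show ?thesis using S.f.k_nonneg S.g.k_nonneg by simp
    qed
    then show ?thesis using True by (simp add: \<Lambda>_def)
  next
    case False
    then show ?thesis using that L_nn[OF _ restrict_space] by (auto simp: \<Lambda>_def)
  qed
  have T_mono: "T x i \<le> T (x(i := x i + h)) i"
    if "i \<in> ?I" "x \<in> space (lborel_Pi ?I)" "0 < h" for i x h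
  proof (cases "i = n")
    case True
    have "\<tau> (restrict x J) (x n) \<le> \<tau> (restrict x J) (x n + h)"
      using transport_1d.T_mono[OF tr[OF restrict_space]] that by (auto simp: \<tau>_def)
    then show ?thesis using True by (simp add: T_n restr_upd_n)
  next
    case False
    then have "i \<in> J" using that by simp
    then show ?thesis using T'_mono[OF _ restrict_space, of i h x] that
      by (simp add: T_i restr_upd)
  qed
  have T_diff: "eventually (\<lambda>h. c * h \<le> T (x(i := x i + h)) i - T x i) (at_right 0)"
    if i: "i \<in> ?I" and x: "x \<in> space (lborel_Pi ?I)" and c: "c < \<Lambda> i x" for i x c
  proof (cases "i = n")
    case False
    then have "i \<in> J" using that by simp
    then show ?thesis using T'_diff[OF _ restrict_space, of i c x] c False
      by (simp add: T_i restr_upd \<Lambda>_def)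
  next
    case True
    define y where "y = restrict x J"
    have y: "y \<in> space (lborel_Pi J)" unfolding y_def by (rule restrict_space)
    show ?thesis
    proof (cases "ok y")
      case ok: True
      interpret S: transport_1d M "max (C / f' y) (C / g' (T' y))" "fs y" "gs (T' y)"
        by (rule tr[OF y ok])
      have pos: "0 < f' y" "0 < g' (T' y)" using ok by (auto simp: ok_def)
      have xe: "y(n := x n) = x" unfolding y_def by (rule restrict_fun_upd_eq[OF x])
      have "eventually (\<lambda>h. c * h \<le> mono_transport M (fs y) (gs (T' y)) (x n + h)
          - mono_transport M (fs y) (gs (T' y)) (x n)) (at_right 0)"
      proof (rule S.T_derivative_ge)
        fix d assume "d < fs y (x n)"
        then have "d * f' y < f x" using pos by (simp add: fs_def xe field_simps)
        then have "\<forall>\<^sub>F t in at (x n). d * f' y < f (x(n := t))"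
          using insert.prems(4) x unfolding separately_lsc_def by blast
        moreover have "x(n := t) = y(n := t)" for t using xe by (metis fun_upd_upd)
        ultimately show "\<forall>\<^sub>F t in at (x n). d < fs y t"
          using pos by (simp add: fs_def field_simps)
      next
        fix s d assume "gs (T' y) s < d"
        then have "- (d * g' (T' y)) < - g ((T' y)(n := s))" using pos by (simp add: gs_def field_simps)
        then have "\<forall>\<^sub>F t in at (((T' y)(n := s)) n). - (d * g' (T' y)) < - g (((T' y)(n := s))(n := t))"
          using insert.prems(5) fun_upd_space[OF T'_sp[OF y], of n s] unfolding separately_lsc_def by blast
        then show "\<forall>\<^sub>F t in at s. gs (T' y) t < d"
          using pos by (simp add: gs_def field_simps)
      next
        show "c < fs y (x n) / gs (T' y) (mono_transport M (fs y) (gs (T' y)) (x n))"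
          using c True ok by (simp add: \<Lambda>_def y_def[symmetric] T_n \<tau>_def)
      qed
      then show ?thesis using True ok by (simp add: T_n restr_upd_n y_def[symmetric] \<tau>_def)
    next
      case False
      \<comment> \<open>At such a point \<Lambda> has its default value 0, so \<open>c\<close> is
        negative and monotonicity of the new component is enough.\<close>
      then have "c < 0" using c True by (simp add: \<Lambda>_def y_def)
      show ?thesis using eventually_at_right_less[of 0]
      proof eventually_elim
        case (elim h)
        then have "c * h \<le> 0" using \<open>c < 0\<close> by (simp add: mult_nonpos_nonneg)
        then show ?case using T_mono[OF i x elim] by simp
      qed
    qed
  qed
  \<comment> \<open>The mass of \<open>f'\<close> that \<open>T'\<close> sends to the zero set of
    \<open>g'\<close> equals the mass of \<open>g'\<close> on that set, which is 0. The same
    argument gives \<open>g_pos\<close> for the full map.\<close>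
  have null: "AE y in lborel_Pi J. 0 < f' y \<longrightarrow> 0 < g' (T' y)"
  proof -
    have "(\<integral>\<^sup>+y. ennreal (f' y) * indicator {z\<in>space (lborel_Pi J). g' z = 0} (T' y) \<partial>lborel_Pi J)
        = (\<integral>\<^sup>+z. ennreal (g' z) * indicator {z\<in>space (lborel_Pi J). g' z = 0} z \<partial>lborel_Pi J)"
      by (rule T'_push) measurable
    also have "\<dots> = (\<integral>\<^sup>+z. 0 \<partial>lborel_Pi J)"
      by (intro nn_integral_cong) (auto simp: indicator_def)
    also have "\<dots> = 0" by simp
    finally have "AE y in lborel_Pi J. ennreal (f' y) * indicator {z\<in>space (lborel_Pi J). g' z = 0} (T' y) = 0"
      by (subst (asm) nn_integral_0_iff_AE) auto
    then show ?thesis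
    proof (rule AE_mp, intro AE_I2 impI)
      fix y assume y: "y \<in> space (lborel_Pi J)" and "0 < f' y"
        and "ennreal (f' y) * indicator {z\<in>space (lborel_Pi J). g' z = 0} (T' y) = 0"
      then have "g' (T' y) \<noteq> 0" using T'_sp[OF y] by (auto simp: indicator_def split: if_splits)
      then show "0 < g' (T' y)"
        using G.marginal_nonneg[OF T'_sp[OF y]] unfolding g'_def by linarith
    qed
  qed
  have push: "(\<integral>\<^sup>+x. ennreal (f x) * k (T x) \<partial>lborel_Pi ?I) = (\<integral>\<^sup>+y. ennreal (g y) * k y \<partial>lborel_Pi ?I)"
    if k[measurable]: "k \<in> borel_measurable (lborel_Pi ?I)" for k
  proof -
    \<comment> \<open>\<open>K z\<close> is the conditional expectation of \<open>k\<close> over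
      \<open>z\<close> under \<open>g\<close>. The inner integral is transported for fixed
      \<open>y\<close> by the map on the line, which produces \<open>K (T' y)\<close>; then the
      push-forward property of \<open>T'\<close> applies to \<open>K\<close>.\<close>
    define K where "K z = (\<integral>\<^sup>+s. ennreal (gs z s) * k (z(n := s)) \<partial>lborel)" for z
    have kp[measurable]: "(\<lambda>p. k ((fst p)(n := snd p))) \<in> borel_measurable (lborel_Pi J \<Otimes>\<^sub>M (lborel :: real measure))"
      using measurable_compose[OF F.upd_measurable k] by (simp add: split_beta')
    have K_meas[measurable]: "K \<in> borel_measurable (lborel_Pi J)"
      unfolding K_def by (rule lborel.borel_measurable_nn_integral) (simp add: split_beta')
    have T_upd: "T (y(n := t)) = (T' y)(n := \<tau> y t)" if y: "y \<in> space (lborel_Pi J)" for y t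
    proof -
      have "restrict (y(n := t)) J = y"
        using y insert.hyps by (auto simp: space_lborel_Pi PiE_def extensional_def fun_eq_iff restrict_def)
      then show ?thesis by (simp add: T_def)
    qed
    have "(\<integral>\<^sup>+x. ennreal (f x) * k (T x) \<partial>lborel_Pi ?I)
        = (\<integral>\<^sup>+y. (\<integral>\<^sup>+t. ennreal (f (y(n := t))) * k (T (y(n := t))) \<partial>lborel) \<partial>lborel_Pi J)"
      using insert.hyps by (subst product_nn_integral_insert) auto
    also have "\<dots> = (\<integral>\<^sup>+y. ennreal (f' y) * K (T' y) \<partial>lborel_Pi J)"
    proof (rule nn_integral_cong_AE)
      show "AE y in lborel_Pi J. (\<integral>\<^sup>+t. ennreal (f (y(n := t))) * k (T (y(n := t))) \<partial>lborel)
          = ennreal (f' y) * K (T' y)"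
        using null
      proof (rule AE_mp, intro AE_I2 impI)
        fix y assume y: "y \<in> space (lborel_Pi J)" and n: "0 < f' y \<longrightarrow> 0 < g' (T' y)"
        show "(\<integral>\<^sup>+t. ennreal (f (y(n := t))) * k (T (y(n := t))) \<partial>lborel) = ennreal (f' y) * K (T' y)"
        proof (cases "0 < f' y")
          case True
          then have ok: "ok y" using n by (simp add: ok_def)
          interpret S: transport_1d M "max (C / f' y) (C / g' (T' y))" "fs y" "gs (T' y)"
            by (rule tr[OF y ok])
          have [measurable]: "(\<lambda>s. k ((T' y)(n := s))) \<in> borel_measurable borel"
            using measurable_Pair2[OF kp T'_sp[OF y]] by simp
          have feq: "ennreal (f (y(n := t))) = ennreal (f' y) * ennreal (fs y t)" for t
            using True S.f.k_nonneg[of t] by (simp add: fs_def ennreal_mult[symmetric])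
          have "(\<integral>\<^sup>+t. ennreal (f (y(n := t))) * k (T (y(n := t))) \<partial>lborel)
              = (\<integral>\<^sup>+t. ennreal (f' y) * (ennreal (fs y t) * k ((T' y)(n := mono_transport M (fs y) (gs (T' y)) t))) \<partial>lborel)"
            using ok by (intro nn_integral_cong) (simp add: T_upd[OF y] feq \<tau>_def mult.assoc)
          also have "\<dots> = ennreal (f' y) * (\<integral>\<^sup>+t. ennreal (fs y t) * k ((T' y)(n := mono_transport M (fs y) (gs (T' y)) t)) \<partial>lborel)"
            by (rule nn_integral_cmult) measurable
          also have "(\<integral>\<^sup>+t. ennreal (fs y t) * k ((T' y)(n := mono_transport M (fs y) (gs (T' y)) t)) \<partial>lborel) = K (T' y)"
            unfolding K_def by (rule S.T_push) measurable
          finally show ?thesis .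
        next
          case False
          then have z: "f' y = 0" using F.marginal_nonneg[OF y] by (simp add: f'_def)
          then have "AE t in lborel. f (y(n := t)) = 0"
            using F.section_AE_0[OF y] by (simp add: f'_def)
          then have "(\<integral>\<^sup>+t. ennreal (f (y(n := t))) * k (T (y(n := t))) \<partial>lborel) = (\<integral>\<^sup>+t. 0 \<partial>(lborel :: real measure))"
            by (intro nn_integral_cong_AE) auto
          then show ?thesis using z by simp
        qed
      qed
    qed
    also have "\<dots> = (\<integral>\<^sup>+z. ennreal (g' z) * K z \<partial>lborel_Pi J)" by (rule T'_push) measurable
    also have "\<dots> = (\<integral>\<^sup>+z. (\<integral>\<^sup>+s. ennreal (g (z(n := s))) * k (z(n := s)) \<partial>lborel) \<partial>lborel_Pi J)"
    proof (rule nn_integral_cong)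
      fix z assume z: "z \<in> space (lborel_Pi J)"
      have [measurable]: "(\<lambda>s. k (z(n := s))) \<in> borel_measurable borel"
        using measurable_Pair2[OF kp z] by simp
      have [measurable]: "(\<lambda>s. gs z s) \<in> borel_measurable borel"
        using measurable_Pair2[OF gs_meas z] by simp
      show "ennreal (g' z) * K z = (\<integral>\<^sup>+s. ennreal (g (z(n := s))) * k (z(n := s)) \<partial>lborel)"
      proof (cases "g' z = 0")
        case True
        then have "AE t in lborel. g (z(n := t)) = 0"
          using G.section_AE_0[OF z] by (simp add: g'_def)
        then have "(\<integral>\<^sup>+t. ennreal (g (z(n := t))) * k (z(n := t)) \<partial>lborel) = (\<integral>\<^sup>+t. 0 \<partial>(lborel :: real measure))"
          by (intro nn_integral_cong_AE) auto
        then show ?thesis using True by simp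
      next
        case False
        then have gp: "0 < g' z" using G.marginal_nonneg[OF z] by (simp add: g'_def)
        have "ennreal (g' z) * K z = (\<integral>\<^sup>+s. ennreal (g' z) * (ennreal (gs z s) * k (z(n := s))) \<partial>lborel)"
          unfolding K_def by (subst nn_integral_cmult) auto
        also have "\<dots> = (\<integral>\<^sup>+s. ennreal (g (z(n := s))) * k (z(n := s)) \<partial>lborel)"
          using gp G.section_bounds(1)[OF z]
          by (intro nn_integral_cong) (simp add: gs_def mult.assoc[symmetric] ennreal_mult[symmetric])
        finally show ?thesis .
      qed
    qed
    also have "\<dots> = (\<integral>\<^sup>+x. ennreal (g x) * k x \<partial>lborel_Pi ?I)"
      using insert.hyps by (subst product_nn_integral_insert) auto
    finally show ?thesis .
  qed
  have g_pos: "AE x in lborel_Pi ?I. 0 < f x \<longrightarrow> 0 < g (T x)"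
  proof -
    have "(\<integral>\<^sup>+y. ennreal (f y) * indicator {z\<in>space (lborel_Pi ?I). g z = 0} (T y) \<partial>lborel_Pi ?I)
        = (\<integral>\<^sup>+z. ennreal (g z) * indicator {z\<in>space (lborel_Pi ?I). g z = 0} z \<partial>lborel_Pi ?I)"
      by (rule push) measurable
    also have "\<dots> = (\<integral>\<^sup>+z. 0 \<partial>lborel_Pi ?I)"
      by (intro nn_integral_cong) (auto simp: indicator_def)
    also have "\<dots> = 0" by simp
    finally have "AE y in lborel_Pi ?I. ennreal (f y) * indicator {z\<in>space (lborel_Pi ?I). g z = 0} (T y) = 0"
      by (subst (asm) nn_integral_0_iff_AE) auto
    then show ?thesis
    proof (rule AE_mp, intro AE_I2 impI)
      fix y assume y: "y \<in> space (lborel_Pi ?I)" and "0 < f y"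
        and "ennreal (f y) * indicator {z\<in>space (lborel_Pi ?I). g z = 0} (T y) = 0"
      then have "g (T y) \<noteq> 0" using T_sp[OF y] by (auto simp: indicator_def split: if_splits)
      moreover have "0 \<le> g (T y)" using insert.prems(3) T_sp[OF y] by (auto simp: box_function_def)
      ultimately show "0 < g (T y)" by linarith
    qed
  qed
  \<comment> \<open>If \<open>f x = 0\<close>, the last factor vanishes. Otherwise
    \<open>marginal_0_AE\<close> excludes \<open>f' y = 0\<close>, and the factors
    \<open>f x / f' y\<close>, \<open>g (T x) / g' (T' y)\<close> and the product formula for
    \<open>T'\<close> combine.\<close>
  have det: "AE x in lborel_Pi ?I. f x = g (T x) * (\<Prod>i\<in>?I. \<Lambda> i x)"
    using AE_lborel_Pi_insert[OF insert.hyps T'_det] AE_lborel_Pi_insert[OF insert.hyps null] g_pos AE_space F.marginal_0_AE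
  proof eventually_elim
    case (elim x)
    define y where "y = restrict x J"
    have y: "y \<in> space (lborel_Pi J)" unfolding y_def by (rule restrict_space)
    have xe: "y(n := x n) = x" unfolding y_def by (rule restrict_fun_upd_eq[OF elim(4)])
    have Te: "(T' y)(n := T x n) = T x" by (simp add: y_def T_def)
    have pr: "(\<Prod>i\<in>?I. \<Lambda> i x) = \<Lambda> n x * (\<Prod>i\<in>J. L i y)"
    proof -
      have "(\<Prod>i\<in>J. \<Lambda> i x) = (\<Prod>i\<in>J. L i y)"
        using insert.hyps by (intro prod.cong) (auto simp: \<Lambda>_def y_def)
      then show ?thesis using insert.hyps by simp
    qed
    have fx: "0 \<le> f x" using insert.prems(2) elim(4) by (auto simp: box_function_def)
    show ?case
    proof (cases "f x = 0")
      case True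
      then have "\<Lambda> n x = 0" by (simp add: \<Lambda>_def fs_def y_def[symmetric] xe)
      then show ?thesis using True pr by simp
    next
      case False
      then have gT: "0 < g (T x)" using elim fx by simp
      show ?thesis
      proof (cases "0 < f' y")
        case True
        then have ok: "ok y" using elim(2) by (simp add: ok_def y_def)
        have pos: "0 < g' (T' y)" using ok by (simp add: ok_def)
        have "\<Lambda> n x = (f x / f' y) / (g (T x) / g' (T' y))"
          using ok by (simp add: \<Lambda>_def y_def[symmetric] fs_def gs_def xe Te)
        moreover have "f' y = g' (T' y) * (\<Prod>i\<in>J. L i y)" using elim(1) by (simp add: y_def)
        moreover from this have "(\<Prod>i\<in>J. L i y) \<noteq> 0" using True by auto
        ultimately have "g (T x) * (\<Lambda> n x * (\<Prod>i\<in>J. L i y)) = f x"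
          using True gT pos by (simp add: field_simps)
        then show ?thesis using pr by simp
      next
        case False
        then have z: "f' y = 0" using F.marginal_nonneg[OF y] by (simp add: f'_def)
        then show ?thesis using False elim(5) \<open>f x \<noteq> 0\<close> by (simp add: f'_def y_def)
      qed
    qed
  qed
  show ?case
    unfolding knothe_map_def
  proof (intro exI[of _ T] exI[of _ \<Lambda>] conjI ballI allI impI)
    show "\<bar>T x i\<bar> \<le> M" if "x \<in> space (lborel_Pi ?I)" "i \<in> ?I" for x i
      using that \<tau>_bounds[OF restrict_space] T'_le[OF restrict_space] T_i T_n by (cases "i = n") auto
  qed (use T_sp T_comp \<Lambda>_meas \<Lambda>_nn T_mono T_diff push det in auto)
qed

section \<open>Transfer from coordinate functions to a Euclidean space\<close>

definition coords :: "('a::euclidean_space \<Rightarrow> real) \<Rightarrow> 'a" where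
  "coords x = (\<Sum>b\<in>Basis. x b *\<^sub>R b)"

definition components :: "'a::euclidean_space \<Rightarrow> 'a \<Rightarrow> real" where
  "components z = (\<lambda>b\<in>Basis. z \<bullet> b)"

lemma coords_inner: "b \<in> Basis \<Longrightarrow> coords x \<bullet> b = x b"
  by (simp add: coords_def inner_sum_left inner_Basis if_distrib cong: if_cong)

lemma components_coords: "x \<in> space (lborel_Pi Basis) \<Longrightarrow> components (coords x) = x"
  by (auto simp: components_def coords_inner space_lborel_Pi PiE_def extensional_def fun_eq_iff)

lemma components_space: "components z \<in> space (lborel_Pi Basis)"
  by (auto simp: components_def space_lborel_Pi)

lemma coords_measurable[measurable]: "coords \<in> borel_measurable (lborel_Pi Basis)"
  unfolding coords_def by measurable

lemma components_measurable[measurable]: "components \<in> borel \<rightarrow>\<^sub>M lborel_Pi Basis"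
  unfolding components_def by measurable

lemma lborel_eq_coords: "lborel = distr (lborel_Pi Basis) borel coords"
  using lborel_eq unfolding coords_def[abs_def] .

lemma nn_integral_coords:
  "h \<in> borel_measurable borel \<Longrightarrow> (\<integral>\<^sup>+z. h z \<partial>lborel) = (\<integral>\<^sup>+x. h (coords x) \<partial>lborel_Pi Basis)"
  by (subst lborel_eq_coords, subst nn_integral_distr) auto

lemma coords_fun_upd:
  assumes "b \<in> Basis"
  shows "coords (x(b := t)) = coords x + (t - x b) *\<^sub>R b"
  by (rule euclidean_eqI) (use assms in \<open>auto simp: coords_inner inner_add_left inner_Basis\<close>)

lemma components_add:
  assumes "b \<in> Basis"
  shows "components (z + h *\<^sub>R b) = (components z)(b := components z b + h)"
  using assms by (auto simp: components_def fun_eq_iff inner_add_left inner_Basis)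

proposition knothe_map_euclidean:
  fixes f g :: "'a::euclidean_space \<Rightarrow> real"
  assumes [measurable]: "f \<in> borel_measurable borel" "g \<in> borel_measurable borel"
    and f: "\<And>x. 0 \<le> f x" "\<And>x. f x \<le> C" "\<And>x. norm x > M \<Longrightarrow> f x = 0"
    and g: "\<And>x. 0 \<le> g x" "\<And>x. g x \<le> C" "\<And>x. norm x > M \<Longrightarrow> g x = 0"
    and lsc: "\<And>x c. c < f x \<Longrightarrow> eventually (\<lambda>y. c < f y) (at x)"
    and usc: "\<And>x c. g x < c \<Longrightarrow> eventually (\<lambda>y. g y < c) (at x)"
    and int: "(\<integral>\<^sup>+x. ennreal (f x) \<partial>lborel) = 1" "(\<integral>\<^sup>+x. ennreal (g x) \<partial>lborel) = 1" and M: "0 \<le> M"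
  obtains T :: "'a \<Rightarrow> 'a" and \<kappa> :: "'a \<Rightarrow> 'a \<Rightarrow> real" where
    "T \<in> borel_measurable borel" "\<And>b. b \<in> Basis \<Longrightarrow> \<kappa> b \<in> borel_measurable borel"
    "\<And>x b. b \<in> Basis \<Longrightarrow> \<bar>T x \<bullet> b\<bar> \<le> M"
    "\<And>x b. b \<in> Basis \<Longrightarrow> 0 \<le> \<kappa> b x"
    "\<And>x b h. b \<in> Basis \<Longrightarrow> 0 < h \<Longrightarrow> T x \<bullet> b \<le> T (x + h *\<^sub>R b) \<bullet> b"
    "\<And>x b c. b \<in> Basis \<Longrightarrow> c < \<kappa> b x \<Longrightarrow>
       eventually (\<lambda>h. c * h \<le> (T (x + h *\<^sub>R b) - T x) \<bullet> b) (at_right 0)"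
    "\<And>k. k \<in> borel_measurable borel \<Longrightarrow>
       (\<integral>\<^sup>+x. ennreal (f x) * k (T x) \<partial>lborel) = (\<integral>\<^sup>+y. ennreal (g y) * k y \<partial>lborel)"
    "AE x in lborel. f x = g (T x) * (\<Prod>b\<in>Basis. \<kappa> b x)"
proof -
  define F where "F x = f (coords x)" for x
  define G where "G x = g (coords x)" for x
  have cn: "M < norm (coords x)" if "b \<in> Basis" "M < \<bar>x b\<bar>" for x :: "'a \<Rightarrow> real" and b
    using Basis_le_norm[OF that(1), of "coords x"] coords_inner[OF that(1), of x] that by simp
  \<comment> \<open>A change of one coordinate tends to the point without reaching it, so the
    punctured neighbourhoods in the two notions of semicontinuity correspond.\<close>
  have fl: "filterlim (\<lambda>t. coords (x(b := t))) (at (coords x)) (at (x b))"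
    if b: "b \<in> Basis" for x :: "'a \<Rightarrow> real" and b
  proof -
    have "((\<lambda>t. coords x + (t - x b) *\<^sub>R b) \<longlongrightarrow> coords x + (x b - x b) *\<^sub>R b) (at (x b))"
      by (intro tendsto_intros)
    moreover have "\<forall>\<^sub>F t in at (x b). coords x + (t - x b) *\<^sub>R b \<noteq> coords x"
      unfolding eventually_at_filter using b by (auto intro!: always_eventually)
    ultimately show ?thesis using b by (simp add: coords_fun_upd filterlim_at)
  qed
  have "\<exists>T \<kappa>. knothe_map Basis M F G T \<kappa>"
  proof (rule knothe_map_exists[where C = C])
    show "box_function M C Basis F" "box_function M C Basis G"
      using f g cn unfolding box_function_def F_def G_def by (auto, measurable)
    show "separately_lsc Basis F"
      unfolding separately_lsc_def F_def
      by (auto intro!: eventually_compose_filterlim[OF lsc fl])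
    show "separately_lsc Basis (\<lambda>x. - G x)"
      unfolding separately_lsc_def G_def
    proof (intro ballI allI impI)
      fix x :: "'a \<Rightarrow> real" and b :: 'a and c assume b: "b \<in> Basis" and "c < - g (coords x)"
      then have "g (coords x) < - c" by simp
      from eventually_compose_filterlim[OF usc[OF this] fl[OF b, of x]]
      show "\<forall>\<^sub>F t in at (x b). c < - g (coords (x(b := t)))"
        by eventually_elim simp
    qed
    show "(\<integral>\<^sup>+x. ennreal (F x) \<partial>lborel_Pi Basis) = 1" "(\<integral>\<^sup>+x. ennreal (G x) \<partial>lborel_Pi Basis) = 1"
      using int unfolding F_def G_def by (simp_all add: nn_integral_coords)
  qed (use M in auto)
  then obtain S L where K: "knothe_map Basis M F G S L" by blast
  note K = K[unfolded knothe_map_def]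
  have S_sp: "S x \<in> space (lborel_Pi Basis)" if "x \<in> space (lborel_Pi Basis)" for x using K that by blast
  have S_le: "\<bar>S x b\<bar> \<le> M" if "x \<in> space (lborel_Pi Basis)" "b \<in> Basis" for x b using K that by blast
  have S_comp[measurable]: "(\<lambda>x. S x b) \<in> borel_measurable (lborel_Pi Basis)" if "b \<in> Basis" for b
    using K that by blast
  have [measurable]: "L b \<in> borel_measurable (lborel_Pi Basis)" if "b \<in> Basis" for b using K that by blast
  have S_meas[measurable]: "S \<in> lborel_Pi Basis \<rightarrow>\<^sub>M lborel_Pi Basis"
  proof (rule measurable_PiM_single')
    show "S \<in> space (lborel_Pi Basis) \<rightarrow> (\<Pi>\<^sub>E i\<in>Basis. space lborel)"
      using S_sp by (auto simp: space_PiM)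
  qed (use S_comp in simp)
  define T where "T z = coords (S (components z))" for z
  define \<kappa> where "\<kappa> b z = L b (components z)" for b z
  have T_b: "T z \<bullet> b = S (components z) b" if "b \<in> Basis" for z b
    using that by (simp add: T_def coords_inner)
  have [measurable]: "T \<in> borel_measurable borel" unfolding T_def by measurable
  have [measurable]: "\<kappa> b \<in> borel_measurable borel" if "b \<in> Basis" for b
    unfolding \<kappa>_def using that by measurable
  show thesis
  proof (rule that)
    show "T \<in> borel_measurable borel" by fact
    show "\<kappa> b \<in> borel_measurable borel" if "b \<in> Basis" for b using that by measurable
    show "\<bar>T x \<bullet> b\<bar> \<le> M" if "b \<in> Basis" for x b
      using S_le[OF components_space that] that by (simp add: T_b)
    show "0 \<le> \<kappa> b x" if "b \<in> Basis" for x b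
      using K that components_space unfolding \<kappa>_def by blast
    show "T x \<bullet> b \<le> T (x + h *\<^sub>R b) \<bullet> b" if "b \<in> Basis" "0 < h" for x b h
    proof -
      have "S (components x) b \<le> S ((components x)(b := components x b + h)) b"
        using K that components_space by blast
      then show ?thesis using that by (simp only: T_b components_add)
    qed
    show "eventually (\<lambda>h. c * h \<le> (T (x + h *\<^sub>R b) - T x) \<bullet> b) (at_right 0)"
      if "b \<in> Basis" "c < \<kappa> b x" for x b c
    proof -
      have "c < L b (components x)" using that by (simp add: \<kappa>_def)
      then have "eventually (\<lambda>h. c * h \<le> S ((components x)(b := components x b + h)) b - S (components x) b) (at_right 0)"
        using K that(1) components_space by blast
      then show ?thesis using that by (simp only: T_b components_add inner_diff_left)
    qed
    show "(\<integral>\<^sup>+x. ennreal (f x) * k (T x) \<partial>lborel) = (\<integral>\<^sup>+y. ennreal (g y) * k y \<partial>lborel)"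
      if [measurable]: "k \<in> borel_measurable borel" for k
    proof -
      have "(\<integral>\<^sup>+x. ennreal (f x) * k (T x) \<partial>lborel)
          = (\<integral>\<^sup>+x. ennreal (F x) * k (coords (S x)) \<partial>lborel_Pi Basis)"
        by (subst nn_integral_coords) (auto intro!: nn_integral_cong simp: F_def T_def components_coords)
      also have "\<dots> = (\<integral>\<^sup>+x. ennreal (G x) * k (coords x) \<partial>lborel_Pi Basis)"
      proof -
        have "(\<lambda>x. k (coords x)) \<in> borel_measurable (lborel_Pi Basis)" by measurable
        note m = this
        have p: "\<forall>k\<in>borel_measurable (lborel_Pi Basis). (\<integral>\<^sup>+x. ennreal (F x) * k (S x) \<partial>lborel_Pi Basis)
            = (\<integral>\<^sup>+y. ennreal (G y) * k y \<partial>lborel_Pi Basis)" using K by blast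
        show ?thesis by (rule bspec[OF p m])
      qed
      also have "\<dots> = (\<integral>\<^sup>+y. ennreal (g y) * k y \<partial>lborel)"
        by (subst nn_integral_coords) (auto simp: G_def)
      finally show ?thesis .
    qed
    have "AE x in distr (lborel_Pi Basis) borel coords. f x = g (T x) * (\<Prod>b\<in>Basis. \<kappa> b x)"
    proof (subst AE_distr_iff)
      have "AE x in lborel_Pi Basis. F x = G (S x) * (\<Prod>i\<in>Basis. L i x)" using K by blast
      then show "AE x in lborel_Pi Basis. f (coords x) = g (T (coords x)) * (\<Prod>b\<in>Basis. \<kappa> b (coords x))"
        by (rule AE_mp) (auto intro!: AE_I2 simp: F_def G_def T_def \<kappa>_def components_coords)
      show "{x \<in> space borel. f x = g (T x) * (\<Prod>b\<in>Basis. \<kappa> b x)} \<in> sets borel" by measurable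
    qed simp
    then show "AE x in lborel. f x = g (T x) * (\<Prod>b\<in>Basis. \<kappa> b x)"
      by (simp only: lborel_eq_coords[symmetric])
  qed
qed

section \<open>The transport inequality\<close>

text \<open>Discrete integration by parts: translation invariance moves the difference quotient from
  \<tau>, which is merely bounded and measurable, to the Lipschitz weight \<psi>, where dominated
  convergence applies.\<close>

lemma difference_quotient_integral_tendsto:
  fixes \<psi> \<tau> :: "'a::euclidean_space \<Rightarrow> real" and G :: "'a \<Rightarrow> 'a"
  assumes [measurable]: "\<psi> \<in> borel_measurable borel" "G \<in> borel_measurable borel" "\<tau> \<in> borel_measurable borel"
    and supp: "\<And>x. norm x > \<rho> \<Longrightarrow> \<psi> x = 0"
    and lip: "\<And>x y. \<bar>\<psi> x - \<psi> y\<bar> \<le> B * norm (x - y)"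
    and deriv: "AE x in lborel. GDERIV \<psi> x :> G x"
    and \<tau>: "\<And>x. \<bar>\<tau> x\<bar> \<le> M"
    and b: "b \<in> Basis"
  shows "(\<lambda>m. LINT x|lborel. \<psi> x * ((\<tau> (x + (1 / real (Suc m)) *\<^sub>R b) - \<tau> x) * real (Suc m)))
     \<longlonglongrightarrow> - (LINT x|lborel. (G x \<bullet> b) * \<tau> x)"
    and "integrable lborel (\<lambda>x. (G x \<bullet> b) * \<tau> x)"
    and "\<And>h s. integrable lborel (\<lambda>x. \<psi> x * ((\<tau> (x + h *\<^sub>R b) - \<tau> x) * s))"
proof -
  have B: "0 \<le> B"
  proof -
    have "\<bar>\<psi> b - \<psi> 0\<bar> \<le> B * norm (b - 0)" by (rule lip)
    then show ?thesis using b by simp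
  qed
  have M: "0 \<le> M" using \<tau>[of 0] by linarith
  define \<sigma> where "\<sigma> = max \<rho> 0"
  have \<psi>0: "\<psi> x = 0" if "norm x > \<sigma>" for x using supp that by (simp add: \<sigma>_def)
  have \<psi>_le: "\<bar>\<psi> x\<bar> \<le> B * (2 * \<sigma> + 2) * indicator (cball 0 (\<sigma> + 1)) x" for x
  proof (cases "norm x > \<sigma>")
    case False
    \<comment> \<open>A point just outside the support; the Lipschitz condition between it and
      \<open>x\<close> bounds \<psi>.\<close>
    define y where "y = (\<sigma> + 1) *\<^sub>R b"
    have "norm y = \<sigma> + 1" using b by (simp add: y_def \<sigma>_def)
    then have "\<psi> y = 0" by (intro \<psi>0) simp
    then have "\<bar>\<psi> x\<bar> \<le> B * norm (x - y)" using lip[of x y] by simp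
    also have "\<dots> \<le> B * (2 * \<sigma> + 2)"
      using B False norm_triangle_ineq4[of x y] \<open>norm y = \<sigma> + 1\<close> by (intro mult_left_mono) auto
    finally show ?thesis using False by simp
  next
    case True
    then show ?thesis using \<psi>0[OF True] B by (simp add: \<sigma>_def)
  qed
  have ind_int: "integrable lborel (\<lambda>x. c * indicator (cball 0 r) (x::'a) :: real)" for c r
    by (intro integrable_mult_right integrable_real_indicator) (auto simp: emeasure_bounded_finite[OF bounded_cball, simplified])
  have int1: "integrable lborel (\<lambda>x. \<psi> x * \<theta> x)"
    if [measurable]: "\<theta> \<in> borel_measurable borel" and \<theta>: "\<And>x. \<bar>\<theta> x\<bar> \<le> c" for \<theta> c
  proof (rule Bochner_Integration.integrable_bound[OF ind_int[of "B * (2 * \<sigma> + 2) * c" "\<sigma> + 1"]])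
    show "AE x in lborel. norm (\<psi> x * \<theta> x) \<le> norm (B * (2 * \<sigma> + 2) * c * indicator (cball 0 (\<sigma> + 1)) x)"
    proof (rule AE_I2)
      fix x
      have "norm (\<psi> x * \<theta> x) \<le> (B * (2 * \<sigma> + 2) * indicator (cball 0 (\<sigma> + 1)) x) * c"
        unfolding real_norm_def abs_mult using \<psi>_le[of x] \<theta>[of x]
        by (intro mult_mono) (auto intro: order_trans[OF abs_ge_zero])
      then show "norm (\<psi> x * \<theta> x) \<le> norm (B * (2 * \<sigma> + 2) * c * indicator (cball 0 (\<sigma> + 1)) x)"
        by (simp add: mult_ac)
    qed
  qed simp
  show int2: "integrable lborel (\<lambda>x. \<psi> x * ((\<tau> (x + h *\<^sub>R b) - \<tau> x) * s))" for h s
  proof (rule int1)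
    show "\<bar>(\<tau> (x + h *\<^sub>R b) - \<tau> x) * s\<bar> \<le> 2 * M * \<bar>s\<bar>" for x
      unfolding abs_mult using \<tau>[of x] \<tau>[of "x + h *\<^sub>R b"] by (intro mult_right_mono) linarith+
  qed measurable
  \<comment> \<open>The quotient after the change of variables: the shift has reversed its sign,
    which is the source of the minus sign in the limit.\<close>
  define D where "D m x = (\<psi> (x - (1 / real (Suc m)) *\<^sub>R b) - \<psi> x) * real (Suc m) * \<tau> x" for m x
  have eq: "(LINT x|lborel. \<psi> x * ((\<tau> (x + (1 / real (Suc m)) *\<^sub>R b) - \<tau> x) * real (Suc m))) = (LINT x|lborel. D m x)" for m
  proof -
    define h where "h = 1 / real (Suc m)"
    have tr: "(LINT x|lborel. k (x + h *\<^sub>R b)) = (LINT x|lborel. k x)" if [measurable]: "k \<in> borel_measurable borel" for k :: "'a \<Rightarrow> real"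
      by (subst (2) lborel_distr_plus[symmetric, of "h *\<^sub>R b"], subst integral_distr) (auto simp: add.commute)
    have i1: "integrable lborel (\<lambda>x. \<psi> x * \<tau> (x + h *\<^sub>R b))" using \<tau> by (intro int1[where c = M]) auto
    have i2: "integrable lborel (\<lambda>x. \<psi> x * \<tau> x)" using \<tau> by (intro int1[where c = M]) auto
    have i3: "integrable lborel (\<lambda>x. \<psi> (x - h *\<^sub>R b) * \<tau> x)"
    proof -
      have "integrable (distr lborel borel ((+) (h *\<^sub>R b))) (\<lambda>x. \<psi> (x - h *\<^sub>R b) * \<tau> x)"
        using i1 by (subst integrable_distr_eq) (auto simp: add.commute)
      then show ?thesis by (simp add: lborel_distr_plus)
    qed
    have "(LINT x|lborel. \<psi> x * \<tau> (x + h *\<^sub>R b)) = (LINT x|lborel. \<psi> (x - h *\<^sub>R b) * \<tau> x)"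
      using tr[of "\<lambda>x. \<psi> (x - h *\<^sub>R b) * \<tau> x"] by simp
    then have "(LINT x|lborel. \<psi> x * \<tau> (x + h *\<^sub>R b) - \<psi> x * \<tau> x)
        = (LINT x|lborel. \<psi> (x - h *\<^sub>R b) * \<tau> x - \<psi> x * \<tau> x)"
      using i1 i2 i3 by simp
    then have "(LINT x|lborel. (\<psi> x * \<tau> (x + h *\<^sub>R b) - \<psi> x * \<tau> x) * real (Suc m))
        = (LINT x|lborel. (\<psi> (x - h *\<^sub>R b) * \<tau> x - \<psi> x * \<tau> x) * real (Suc m))"
      by simp
    then show ?thesis unfolding D_def h_def[symmetric] by (simp add: algebra_simps)
  qed
  have Dlim: "AE x in lborel. (\<lambda>m. D m x) \<longlonglongrightarrow> - ((G x \<bullet> b) * \<tau> x)"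
    using deriv
  proof eventually_elim
    case (elim x)
    then have elim: "(\<psi> has_derivative (\<lambda>h. G x \<bullet> h)) (at x)"
      by (simp add: gderiv_def inner_commute)
    have "((\<lambda>s. (\<psi> (x + s *\<^sub>R b) - \<psi> x) /\<^sub>R s) \<longlongrightarrow> G x \<bullet> b) (at 0)"
    proof -
      have "((\<lambda>s. \<psi> (x + s *\<^sub>R b)) has_derivative (\<lambda>s. G x \<bullet> (s *\<^sub>R b))) (at 0)"
      proof -
        have d1: "((\<lambda>s. x + s *\<^sub>R b) has_derivative (\<lambda>s. s *\<^sub>R b)) (at 0)"
          by (auto intro!: derivative_eq_intros)
        have d2: "(\<psi> has_derivative (\<lambda>h. G x \<bullet> h)) (at ((\<lambda>s. x + s *\<^sub>R b) 0))" using elim by simp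
        from has_derivative_compose[OF d1 d2] show ?thesis .
      qed
      then have "((\<lambda>s. \<psi> (x + s *\<^sub>R b)) has_real_derivative (G x \<bullet> b)) (at 0)"
        by (simp add: has_field_derivative_def mult_commute_abs)
      then show ?thesis by (simp add: has_field_derivative_iff DERIV_def divide_inverse mult.commute)
    qed
    moreover have "filterlim (\<lambda>m. - (1 / real (Suc m))) (at 0) sequentially"
      unfolding filterlim_at using tendsto_minus[OF LIMSEQ_Suc[OF lim_1_over_n]]
      by (auto simp del: of_nat_Suc)
    ultimately have "(\<lambda>m. (\<psi> (x + (- (1 / real (Suc m))) *\<^sub>R b) - \<psi> x) /\<^sub>R (- (1 / real (Suc m)))) \<longlonglongrightarrow> G x \<bullet> b"
      by (rule filterlim_compose)
    then have "(\<lambda>m. - ((\<psi> (x + (- (1 / real (Suc m))) *\<^sub>R b) - \<psi> x) /\<^sub>R (- (1 / real (Suc m)))) * \<tau> x) \<longlonglongrightarrow> - (G x \<bullet> b) * \<tau> x"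
      by (intro tendsto_intros)
    moreover have "- ((\<psi> (x + (- (1 / real (Suc m))) *\<^sub>R b) - \<psi> x) /\<^sub>R (- (1 / real (Suc m)))) * \<tau> x = D m x" for m
      unfolding D_def by (simp add: inverse_eq_divide del: of_nat_Suc)
    ultimately show ?case by simp
  qed
  have Dbound: "\<bar>D m x\<bar> \<le> B * M * indicator (cball 0 (\<sigma> + 1)) x" for m x
  proof (cases "norm x > \<sigma> + 1")
    case True
    have "norm (x - (1 / real (Suc m)) *\<^sub>R b) \<ge> norm x - 1"
    proof -
      have "norm ((1 / real (Suc m)) *\<^sub>R b) \<le> 1" using b by simp
      then show ?thesis using norm_triangle_ineq2[of x "(1 / real (Suc m)) *\<^sub>R b"] by linarith
    qed
    then have "\<psi> (x - (1 / real (Suc m)) *\<^sub>R b) = 0" "\<psi> x = 0" using True by (auto intro!: \<psi>0)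
    then show ?thesis using True by (simp add: D_def)
  next
    case False
    have "\<bar>\<psi> (x - (1 / real (Suc m)) *\<^sub>R b) - \<psi> x\<bar> \<le> B * (1 / real (Suc m))"
      using lip[of "x - (1 / real (Suc m)) *\<^sub>R b" x] b by simp
    then have "\<bar>\<psi> (x - (1 / real (Suc m)) *\<^sub>R b) - \<psi> x\<bar> * real (Suc m) \<le> B"
      by (simp add: field_simps)
    then have "\<bar>D m x\<bar> \<le> B * M"
      unfolding D_def abs_mult using \<tau>[of x] B by (intro mult_mono) auto
    then show ?thesis using False by simp
  qed
  have lim_meas: "(\<lambda>x. - ((G x \<bullet> b) * \<tau> x)) \<in> borel_measurable lborel" by simp
  have D_meas: "D m \<in> borel_measurable lborel" for m unfolding D_def by simp
  note DC = ind_int[of "B * M" "\<sigma> + 1"] Dlim AE_I2[OF Dbound[folded real_norm_def]]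
  have "(\<lambda>m. LINT x|lborel. D m x) \<longlonglongrightarrow> (LINT x|lborel. - ((G x \<bullet> b) * \<tau> x))"
    by (rule integral_dominated_convergence[OF lim_meas D_meas DC])
  then show "(\<lambda>m. LINT x|lborel. \<psi> x * ((\<tau> (x + (1 / real (Suc m)) *\<^sub>R b) - \<tau> x) * real (Suc m)))
     \<longlonglongrightarrow> - (LINT x|lborel. (G x \<bullet> b) * \<tau> x)"
    unfolding eq by simp
  have "integrable lborel (\<lambda>x. - ((G x \<bullet> b) * \<tau> x))"
    by (rule integrable_dominated_convergence[OF lim_meas D_meas DC])
  then show "integrable lborel (\<lambda>x. (G x \<bullet> b) * \<tau> x)" by simp
qed

text \<open>Differentiability is asked for almost everywhere because the weight to be used is the
  positive part of a continuously differentiable function and has a kink along a sphere.\<close>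

definition admissible_weight :: "('a::euclidean_space \<Rightarrow> real) \<Rightarrow> ('a \<Rightarrow> 'a) \<Rightarrow> bool" where
  "admissible_weight \<psi> G \<longleftrightarrow> \<psi> \<in> borel_measurable borel \<and> G \<in> borel_measurable borel \<and> (\<forall>x. 0 \<le> \<psi> x) \<and>
     (\<exists>\<rho>. \<forall>x. norm x > \<rho> \<longrightarrow> \<psi> x = 0) \<and> (\<exists>B. \<forall>x y. \<bar>\<psi> x - \<psi> y\<bar> \<le> B * norm (x - y)) \<and>
     (AE x in lborel. GDERIV \<psi> x :> G x)"

text \<open>This is the inequality \<open>DIM * det^(1/DIM) \<le> div T\<close> between the
  geometric and the arithmetic mean of the diagonal derivatives, integrated against \<psi>. The
  distributional derivative of a component in its own direction is a nonnegative measure, and the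
  pointwise bounds \<kappa> see only a part of it; Fatou's lemma loses the rest in the favourable
  direction.\<close>

proposition transport_inequality:
  fixes f g :: "'a::euclidean_space \<Rightarrow> real"
  assumes [measurable]: "f \<in> borel_measurable borel" "g \<in> borel_measurable borel"
    and f: "\<And>x. 0 \<le> f x" "\<And>x. f x \<le> C" "\<And>x. norm x > M \<Longrightarrow> f x = 0"
    and g: "\<And>x. 0 \<le> g x" "\<And>x. g x \<le> C" "\<And>x. norm x > M \<Longrightarrow> g x = 0"
    and lsc: "\<And>x c. c < f x \<Longrightarrow> eventually (\<lambda>y. c < f y) (at x)"
    and usc: "\<And>x c. g x < c \<Longrightarrow> eventually (\<lambda>y. g y < c) (at x)"
    and int: "(\<integral>\<^sup>+x. ennreal (f x) \<partial>lborel) = 1" "(\<integral>\<^sup>+x. ennreal (g x) \<partial>lborel) = 1" and M: "0 \<le> M"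
  obtains T :: "'a \<Rightarrow> 'a" where
    "T \<in> borel_measurable borel"
    "\<And>k. k \<in> borel_measurable borel \<Longrightarrow>
       (\<integral>\<^sup>+x. ennreal (f x) * k (T x) \<partial>lborel) = (\<integral>\<^sup>+y. ennreal (g y) * k y \<partial>lborel)"
    "AE x in lborel. 0 < f x \<longrightarrow> 0 < g (T x)"
    "\<And>\<psi> G. admissible_weight \<psi> G \<Longrightarrow>
       integrable lborel (\<lambda>x. G x \<bullet> T x) \<and>
       (\<integral>\<^sup>+x. ennreal (\<psi> x * (DIM('a) * (f x / g (T x)) powr (1 / DIM('a)))) \<partial>lborel)
         \<le> ennreal (- (LINT x|lborel. G x \<bullet> T x))"
proof -
  obtain T :: "'a \<Rightarrow> 'a" and \<kappa> :: "'a \<Rightarrow> 'a \<Rightarrow> real" where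
    T[measurable]: "T \<in> borel_measurable borel" and \<kappa>[measurable]: "\<And>b. b \<in> Basis \<Longrightarrow> \<kappa> b \<in> borel_measurable borel" and
    T_le: "\<And>x b. b \<in> Basis \<Longrightarrow> \<bar>T x \<bullet> b\<bar> \<le> M" and
    \<kappa>_nn: "\<And>x b. b \<in> Basis \<Longrightarrow> 0 \<le> \<kappa> b x" and
    T_mono: "\<And>x b h. b \<in> Basis \<Longrightarrow> 0 < h \<Longrightarrow> T x \<bullet> b \<le> T (x + h *\<^sub>R b) \<bullet> b" and
    T_diff: "\<And>x b c. b \<in> Basis \<Longrightarrow> c < \<kappa> b x \<Longrightarrow>
       eventually (\<lambda>h. c * h \<le> (T (x + h *\<^sub>R b) - T x) \<bullet> b) (at_right 0)" and
    push: "\<And>k. k \<in> borel_measurable borel \<Longrightarrow>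
       (\<integral>\<^sup>+x. ennreal (f x) * k (T x) \<partial>lborel) = (\<integral>\<^sup>+y. ennreal (g y) * k y \<partial>lborel)" and
    det: "AE x in lborel. f x = g (T x) * (\<Prod>b\<in>Basis. \<kappa> b x)"
    using knothe_map_euclidean[OF assms] by blast
  have pos: "AE x in lborel. 0 < f x \<longrightarrow> 0 < g (T x)"
    using det
  proof eventually_elim
    case (elim x)
    show ?case
    proof
      assume "0 < f x"
      then have "g (T x) \<noteq> 0" using elim by auto
      then show "0 < g (T x)" using g(1)[of "T x"] by linarith
    qed
  qed
  show thesis
  proof (rule that[OF T push pos])
    fix \<psi> :: "'a \<Rightarrow> real" and G
    assume "admissible_weight \<psi> G"
    then obtain \<rho> B where [measurable]: "\<psi> \<in> borel_measurable borel" "G \<in> borel_measurable borel"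
      and \<psi>: "\<And>x. 0 \<le> \<psi> x" and supp: "\<And>x. norm x > \<rho> \<Longrightarrow> \<psi> x = 0"
      and lip: "\<And>x y. \<bar>\<psi> x - \<psi> y\<bar> \<le> B * norm (x - y)"
      and der: "AE x in lborel. GDERIV \<psi> x :> G x"
      unfolding admissible_weight_def by blast
    \<comment> \<open>\<open>S b\<close> is the distributional derivative of
      \<open>T x \<bullet> b\<close> in direction \<open>b\<close>, tested with \<psi>;
      \<open>q b m\<close> are its difference quotients.\<close>
    define S where "S b = - (LINT x|lborel. (G x \<bullet> b) * (T x \<bullet> b))" for b
    define q where "q b m x = \<psi> x * ((T (x + (1 / real (Suc m)) *\<^sub>R b) \<bullet> b - T x \<bullet> b) * real (Suc m))" for b m x
    have lim: "(\<lambda>m. LINT x|lborel. q b m x) \<longlonglongrightarrow> S b"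
      and Gint: "integrable lborel (\<lambda>x. (G x \<bullet> b) * (T x \<bullet> b))"
      and qint: "integrable lborel (q b m)" if b: "b \<in> Basis" for b m
      using difference_quotient_integral_tendsto[of \<psi> G "\<lambda>x. T x \<bullet> b" \<rho> B M b] supp lip der T_le b
      unfolding q_def S_def by auto
    have q_nn: "0 \<le> q b m x" if "b \<in> Basis" for b m x
      unfolding q_def using \<psi>[of x] T_mono[OF that, of "1 / real (Suc m)" x] by simp
    have S_nn: "0 \<le> S b" if b: "b \<in> Basis" for b
      using lim[OF b] q_nn[OF b] by (intro LIMSEQ_le_const) (auto intro!: exI[of _ 0] integral_nonneg_AE)
    \<comment> \<open>A number below \<open>\<psi> x * \<kappa> b x\<close> is eventually exceeded
      by the difference quotients, by the lower bound on the increments of \<open>T\<close>;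
      monotonicity makes the quotients nonnegative, as Fatou's lemma demands.\<close>
    have fatou: "(\<integral>\<^sup>+x. ennreal (\<psi> x * \<kappa> b x) \<partial>lborel) \<le> ennreal (S b)" if b: "b \<in> Basis" for b
    proof -
      have "(\<integral>\<^sup>+x. ennreal (\<psi> x * \<kappa> b x) \<partial>lborel) \<le> (\<integral>\<^sup>+x. liminf (\<lambda>m. ennreal (q b m x)) \<partial>lborel)"
      proof (rule nn_integral_mono)
        fix x
        show "ennreal (\<psi> x * \<kappa> b x) \<le> liminf (\<lambda>m. ennreal (q b m x))"
          unfolding le_Liminf_iff
        proof (intro allI impI)
          fix d assume d: "d < ennreal (\<psi> x * \<kappa> b x)"
          then obtain d' where d': "d = ennreal d'" "0 \<le> d'" by (cases d) auto
          have dl: "d' < \<psi> x * \<kappa> b x" using d d' by (simp add: ennreal_less_iff)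
          then have pp: "0 < \<psi> x" using \<psi>[of x] d' by (cases "\<psi> x = 0") auto
          have "d' / \<psi> x < \<kappa> b x" using dl pp by (simp add: field_simps)
          then obtain c where c: "d' / \<psi> x < c" "c < \<kappa> b x" using dense by blast
          have "filterlim (\<lambda>m. 1 / real (Suc m)) (at_right 0) sequentially"
            unfolding filterlim_at by (auto intro!: LIMSEQ_Suc[OF lim_1_over_n] simp del: of_nat_Suc)
          from eventually_compose_filterlim[OF T_diff[OF b c(2)] this]
          have "\<forall>\<^sub>F m in sequentially. d' < q b m x"
          proof eventually_elim
            case (elim m)
            have "c \<le> (T (x + (1 / real (Suc m)) *\<^sub>R b) \<bullet> b - T x \<bullet> b) * real (Suc m)"
              using elim by (simp add: inner_diff_left field_simps)
            then have "\<psi> x * c \<le> q b m x" unfolding q_def using pp by (intro mult_left_mono) auto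
            moreover have "d' < \<psi> x * c" using c pp by (simp add: field_simps)
            ultimately show ?case by simp
          qed
          then show "\<forall>\<^sub>F m in sequentially. d < ennreal (q b m x)"
            by eventually_elim (simp add: d' ennreal_less_iff)
        qed
      qed
      also have "\<dots> \<le> liminf (\<lambda>m. \<integral>\<^sup>+x. ennreal (q b m x) \<partial>lborel)"
        unfolding q_def by (intro nn_integral_liminf) simp
      also have "\<dots> = liminf (\<lambda>m. ennreal (LINT x|lborel. q b m x))"
        using qint[OF b] q_nn[OF b] by (subst nn_integral_eq_integral) auto
      also have "\<dots> = ennreal (S b)"
        using lim[OF b] by (intro lim_imp_Liminf) (auto intro!: tendsto_ennrealI)
      finally show ?thesis .
    qed
    have inner_eq: "G x \<bullet> T x = (\<Sum>b\<in>Basis. (G x \<bullet> b) * (T x \<bullet> b))" for x by (rule euclidean_inner)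
    have "integrable lborel (\<lambda>x. G x \<bullet> T x)"
      unfolding inner_eq using Gint by (intro Bochner_Integration.integrable_sum)
    moreover have "(\<integral>\<^sup>+x. ennreal (\<psi> x * (DIM('a) * (f x / g (T x)) powr (1 / DIM('a)))) \<partial>lborel)
         \<le> ennreal (- (LINT x|lborel. G x \<bullet> T x))"
    proof -
      have "(\<integral>\<^sup>+x. ennreal (\<psi> x * (DIM('a) * (f x / g (T x)) powr (1 / DIM('a)))) \<partial>lborel)
          \<le> (\<integral>\<^sup>+x. (\<Sum>b\<in>Basis. ennreal (\<psi> x * \<kappa> b x)) \<partial>lborel)"
      proof (rule nn_integral_mono_AE)
        show "AE x in lborel. ennreal (\<psi> x * (DIM('a) * (f x / g (T x)) powr (1 / DIM('a))))
            \<le> (\<Sum>b\<in>Basis. ennreal (\<psi> x * \<kappa> b x))"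
          using det pos
        proof eventually_elim
          case (elim x)
          have "DIM('a) * (f x / g (T x)) powr (1 / DIM('a)) \<le> (\<Sum>b\<in>Basis. \<kappa> b x)"
          proof (cases "f x = 0")
            case True
            then show ?thesis by (simp add: sum_nonneg \<kappa>_nn)
          next
            case False
            then have "0 < g (T x)" using elim f(1)[of x] by linarith
            then have "f x / g (T x) = (\<Prod>b\<in>Basis. \<kappa> b x)" using elim(1) by simp
            then have "(f x / g (T x)) powr (1 / DIM('a)) \<le> (\<Sum>b\<in>Basis. \<kappa> b x / DIM('a))"
              using arith_geom_mean[of "Basis :: 'a set" "\<lambda>b. \<kappa> b x"] \<kappa>_nn by simp
            then show ?thesis by (simp add: sum_divide_distrib[symmetric] field_simps)
          qed
          then have "\<psi> x * (DIM('a) * (f x / g (T x)) powr (1 / DIM('a))) \<le> (\<Sum>b\<in>Basis. \<psi> x * \<kappa> b x)"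
            unfolding sum_distrib_left[symmetric] by (rule mult_left_mono) (rule \<psi>)
          then show ?case
            by (subst sum_ennreal) (auto intro!: ennreal_leI mult_nonneg_nonneg \<psi> \<kappa>_nn)
        qed
      qed
      also have "\<dots> = (\<Sum>b\<in>Basis. \<integral>\<^sup>+x. ennreal (\<psi> x * \<kappa> b x) \<partial>lborel)"
        by (intro nn_integral_sum) measurable
      also have "\<dots> \<le> (\<Sum>b\<in>Basis. ennreal (S b))" by (intro sum_mono fatou)
      also have "\<dots> = ennreal (\<Sum>b\<in>Basis. S b)" by (intro sum_ennreal S_nn)
      also have "(\<Sum>b\<in>Basis. S b) = - (LINT x|lborel. G x \<bullet> T x)"
        unfolding inner_eq S_def using Gint by (subst Bochner_Integration.integral_sum) (auto simp: sum_negf)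
      finally show ?thesis .
    qed
    ultimately show "integrable lborel (\<lambda>x. G x \<bullet> T x) \<and>
       (\<integral>\<^sup>+x. ennreal (\<psi> x * (DIM('a) * (f x / g (T x)) powr (1 / DIM('a)))) \<partial>lborel)
         \<le> ennreal (- (LINT x|lborel. G x \<bullet> T x))" ..
  qed
qed

section \<open>Radial integration and the extremal density\<close>

lemma balls_in_borel[measurable]:
  "cball (x :: 'a::metric_space) r \<in> sets borel" "ball x r \<in> sets borel"
  by auto

lemma measure_ball_pow:
  assumes "0 \<le> r"
  shows "emeasure lborel (ball (0::'a::euclidean_space) r) = ennreal (unit_ball_vol (DIM('a)) * r ^ DIM('a))"
  using emeasure_ball[of r "0::'a"] assms by simp

lemma measure_cball_pow:
  assumes "0 \<le> r"
  shows "emeasure lborel (cball (0::'a::euclidean_space) r) = ennreal (unit_ball_vol (DIM('a)) * r ^ DIM('a))"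
  using emeasure_cball[of r "0::'a"] assms by simp

lemma nn_integral_power_Icc:
  fixes c :: real
  assumes "0 \<le> a" "a \<le> b" "0 < n" and that: "0 \<le> c"
  shows "(\<integral>\<^sup>+r. ennreal (c * (real n * r ^ (n - 1))) * indicator {a..b} r \<partial>lborel) = ennreal (c * (b ^ n - a ^ n))"
proof -
  have "(\<integral>\<^sup>+r. ennreal (c * (real n * r ^ (n - 1))) * indicator {a..b} r \<partial>lborel) = ennreal (c * b ^ n - c * a ^ n)"
    using assms that
    by (intro nn_integral_FTC_Icc) (auto intro!: derivative_eq_intros mult_nonneg_nonneg)
  then show ?thesis by (simp add: right_diff_distrib)
qed

text \<open>The distribution of the norm under Lebesgue measure is determined on the intervals \<open>{0..<r}\<close>;
  the truncation at \<open>K\<close> makes all measures finite.\<close>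

lemma nn_integral_radial_aux:
  fixes h :: "real \<Rightarrow> ennreal"
  assumes [measurable]: "h \<in> borel_measurable borel" and K: "0 < K"
  defines "n \<equiv> DIM('a::euclidean_space)" and "V \<equiv> unit_ball_vol (real DIM('a))"
  shows "(\<integral>\<^sup>+x. h (norm x) * indicator (cball 0 K) (x :: 'a) \<partial>lborel)
    = (\<integral>\<^sup>+r. h r * (ennreal (V * (real n * r ^ (n - 1))) * indicator {0..K} r) \<partial>lborel)"
proof -
  define A where "A = distr (density lborel (indicator (cball (0::'a) K))) borel (norm :: 'a \<Rightarrow> real)"
  define D where "D = density lborel (\<lambda>r. ennreal (V * (real n * r ^ (n - 1))) * indicator {0..K} r)"
  have n: "0 < n" by (simp add: n_def)
  have V: "0 \<le> V" by (simp add: V_def)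
  have A_tail: "emeasure A {x<..} = ennreal (V * (K ^ n - (max 0 (min x K)) ^ n))" for x
  proof -
    have "emeasure A {x<..} = (\<integral>\<^sup>+z. indicator (cball 0 K) z * indicator {z. x < norm z} z \<partial>(lborel :: 'a measure))"
      unfolding A_def by (subst emeasure_distr, simp, simp, subst emeasure_density) (auto simp: vimage_def intro!: borel_measurable_indicator)
    also have "\<dots> = emeasure lborel (cball (0::'a) K \<inter> {z. x < norm z})"
    proof -
      have "(\<integral>\<^sup>+z. indicator (cball 0 K) z * indicator {z. x < norm z} z \<partial>(lborel :: 'a measure))
          = (\<integral>\<^sup>+z. indicator (cball 0 K \<inter> {z. x < norm z}) z \<partial>(lborel :: 'a measure))"
        by (intro nn_integral_cong) (auto simp: indicator_def)
      then show ?thesis by simp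
    qed
    also have "\<dots> = ennreal (V * (K ^ n - (max 0 (min x K)) ^ n))"
    proof -
      consider "x < 0" | "0 \<le> x" "x \<le> K" | "x > K" by linarith
      then show ?thesis
      proof cases
        case 1
        then have "cball (0::'a) K \<inter> {z. x < norm z} = cball 0 K"
          by (auto intro: less_le_trans[OF _ norm_ge_zero])
        then show ?thesis using 1 K n by (simp add: measure_cball_pow n_def V_def)
      next
        case 2
        have "cball (0::'a) K \<inter> {z. x < norm z} = cball 0 K - cball 0 x" using 2 by auto
        moreover have "emeasure lborel (cball (0::'a) K - cball 0 x)
            = emeasure lborel (cball (0::'a) K) - emeasure lborel (cball (0::'a) x)"
          using 2 by (intro emeasure_Diff) (auto simp: measure_cball_pow)
        moreover have "unit_ball_vol (real n) = V" by (simp add: V_def n_def)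
        ultimately show ?thesis using 2 K V
          by (simp add: measure_cball_pow n_def[symmetric] ennreal_minus right_diff_distrib)
      next
        case 3
        then have "cball (0::'a) K \<inter> {z. x < norm z} = {}" by auto
        then show ?thesis using 3 K by (simp add: min_def max_def)
      qed
    qed
    finally show ?thesis .
  qed
  have D_tail: "emeasure D {x<..} = ennreal (V * (K ^ n - (max 0 (min x K)) ^ n))" for x
  proof -
    have "emeasure D {x<..} = (\<integral>\<^sup>+r. ennreal (V * (real n * r ^ (n - 1))) * indicator {max 0 (min x K)..K} r \<partial>lborel)"
      unfolding D_def
    proof (subst emeasure_density, simp, simp, rule nn_integral_cong_AE)
      have "AE r in lborel. r \<noteq> x" "AE r in lborel. r \<noteq> K" by (rule AE_lborel_singleton)+
      then show "AE r in lborel. ennreal (V * (real n * r ^ (n - 1))) * indicator {0..K} r * indicator {x<..} r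
          = ennreal (V * (real n * r ^ (n - 1))) * indicator {max 0 (min x K)..K} r"
        by eventually_elim (auto simp: indicator_def min_def max_def)
    qed
    also have "\<dots> = ennreal (V * (K ^ n - (max 0 (min x K)) ^ n))"
      using K n V by (intro nn_integral_power_Icc) auto
    finally show ?thesis .
  qed
  have "A = D"
    by (rule measure_eqI_lessThan) (auto simp: A_tail D_tail, auto simp: A_def D_def)
  have "(\<integral>\<^sup>+x. h (norm x) * indicator (cball 0 K) (x :: 'a) \<partial>lborel) = (\<integral>\<^sup>+r. h r \<partial>A)"
    unfolding A_def by (subst nn_integral_distr, simp, simp, subst nn_integral_density) (auto simp: mult.commute intro!: borel_measurable_indicator)
  also have "\<dots> = (\<integral>\<^sup>+r. h r * (ennreal (V * (real n * r ^ (n - 1))) * indicator {0..K} r) \<partial>lborel)"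
    unfolding \<open>A = D\<close> D_def by (subst nn_integral_density) (auto simp: mult.commute)
  finally show ?thesis .
qed

lemma nn_integral_radial:
  fixes h :: "real \<Rightarrow> ennreal"
  assumes [measurable]: "h \<in> borel_measurable borel" and a: "0 \<le> a"
  shows "(\<integral>\<^sup>+x. h (norm x) * indicator {x. a \<le> norm x \<and> norm x \<le> b} (x :: 'a::euclidean_space) \<partial>lborel)
    = (\<integral>\<^sup>+r. h r * ennreal (unit_ball_vol (real DIM('a)) * (real DIM('a) * r ^ (DIM('a) - 1))) * indicator {a..b} r \<partial>lborel)"
proof -
  have "(\<integral>\<^sup>+x. h (norm x) * indicator {x. a \<le> norm x \<and> norm x \<le> b} (x :: 'a) \<partial>lborel)
      = (\<integral>\<^sup>+x. (\<lambda>r. h r * indicator {a..b} r) (norm x) * indicator (cball 0 (max b 1)) (x :: 'a) \<partial>lborel)"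
    by (intro nn_integral_cong) (auto simp: indicator_def)
  also have "\<dots> = (\<integral>\<^sup>+r. (h r * indicator {a..b} r) * (ennreal (unit_ball_vol (real DIM('a)) * (real DIM('a) * r ^ (DIM('a) - 1))) * indicator {0..max b 1} r) \<partial>lborel)"
    by (subst nn_integral_radial_aux) auto
  also have "\<dots> = (\<integral>\<^sup>+r. h r * ennreal (unit_ball_vol (real DIM('a)) * (real DIM('a) * r ^ (DIM('a) - 1))) * indicator {a..b} r \<partial>lborel)"
    using a by (intro nn_integral_cong) (auto simp: indicator_def)
  finally show ?thesis .
qed

text \<open>The absolute value continues the power to negative arguments, so that two-sided
  derivatives exist on all of a closed interval starting at 0. This is the form in which the
  fundamental theorem of calculus is applied to radial primitives.\<close>

lemma abs_powr_has_real_derivative: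
  assumes "1 < q"
  shows "((\<lambda>r. \<bar>r\<bar> powr q) has_real_derivative q * \<bar>r\<bar> powr (q - 2) * r) (at (r::real))"
proof -
  consider "r > 0" | "r < 0" | "r = 0" by linarith
  then show ?thesis
  proof cases
    case 1
    have "((\<lambda>r. r powr q) has_real_derivative q * r powr (q - 1)) (at r)"
      using 1 by (rule has_real_derivative_powr)
    moreover have "q * r powr (q - 1) = q * \<bar>r\<bar> powr (q - 2) * r"
      using 1 powr_add[of r "q - 2" 1] by simp
    moreover have "\<forall>\<^sub>F s in nhds r. s powr q = \<bar>s\<bar> powr q"
      using eventually_nhds_in_open[of "{0<..}" r] 1 by (auto elim: eventually_mono)
    ultimately show ?thesis by (simp add: DERIV_cong_ev)
  next
    case 2
    have "((\<lambda>r. (- r) powr q) has_real_derivative q * (- r) powr (q - 1) * (-1)) (at r)"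
      using 2 by (auto intro!: derivative_eq_intros)
    moreover have "q * (- r) powr (q - 1) * (-1) = q * \<bar>r\<bar> powr (q - 2) * r"
      using 2 powr_add[of "- r" "q - 2" 1] by simp
    moreover have "\<forall>\<^sub>F s in nhds r. (- s) powr q = \<bar>s\<bar> powr q"
      using eventually_nhds_in_open[of "{..<0}" r] 2 by (auto elim: eventually_mono)
    ultimately show ?thesis by (simp add: DERIV_cong_ev)
  next
    case 3
    have "((\<lambda>h. \<bar>h\<bar> powr (q - 1)) \<longlongrightarrow> 0) (at (0::real))"
      using assms by (auto intro!: tendsto_eq_intros)
    moreover have "norm (\<bar>h\<bar> powr q / h) = \<bar>h\<bar> powr (q - 1)" if "h \<noteq> 0" for h :: real
      using that by (simp add: powr_diff)
    ultimately have "((\<lambda>h. norm (\<bar>h\<bar> powr q / h)) \<longlongrightarrow> 0) (at (0::real))"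
      by (subst tendsto_cong[OF eventually_at_filter[THEN iffD2]]) auto
    then have "((\<lambda>h. \<bar>h\<bar> powr q / h) \<longlongrightarrow> 0) (at (0::real))" by (rule tendsto_norm_zero_cancel)
    then show ?thesis using 3 assms by (simp add: DERIV_def)
  qed
qed

text \<open>For \<open>q < 2\<close> the scalar factor is singular at the origin, but there
  \<open>0 powr (q - 2) = 0\<close> multiplies the zero vector. The formula thus gives the gradient
  0, which is correct because \<open>q > 1\<close>.\<close>

lemma norm_powr_GDERIV:
  assumes q: "1 < q"
  shows "GDERIV (\<lambda>x. norm x powr q) x :> (q * norm x powr (q - 2)) *\<^sub>R (x :: 'a::real_inner)"
proof (cases "x = 0")
  case False
  have "GDERIV (\<lambda>x. norm x powr q) x :> (q * norm x powr (q - 1)) *\<^sub>R sgn x"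
    by (rule GDERIV_DERIV_compose[OF GDERIV_norm[OF False]]) (use False in \<open>auto intro!: has_real_derivative_powr\<close>)
  moreover have "(q * norm x powr (q - 1)) *\<^sub>R sgn x = (q * norm x powr (q - 2)) *\<^sub>R x"
    using False powr_add[of "norm x" "q - 2" 1] by (simp add: sgn_div_norm)
  ultimately show ?thesis by simp
next
  case True
  have "((\<lambda>h. norm h powr (q - 1)) \<longlongrightarrow> 0) (at (0::'a))"
    using q by (auto intro!: tendsto_eq_intros)
  moreover have "norm (norm h powr q) / norm h = norm h powr (q - 1)" if "h \<noteq> 0" for h :: 'a
    using that by (simp add: powr_diff)
  ultimately have "((\<lambda>h. norm (norm h powr q) / norm h) \<longlongrightarrow> 0) (at (0::'a))"
    by (subst tendsto_cong[OF eventually_at_filter[THEN iffD2]]) auto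
  then show ?thesis using True q by (simp add: gderiv_def has_derivative_at)
qed

text \<open>The density and an explicit formula for the gradient of its logarithm are fixed
  abstractly, independently of \<open>grad\<close>. \<open>q\<close> is the conjugate exponent of
  \<open>N\<close>, and \<open>N\<close> is the real copy of \<open>n\<close>, since natural and
  real powers occur side by side.\<close>

locale onofri =
  fixes n :: nat and N q V :: real and dens :: "'a::euclidean_space \<Rightarrow> real" and gv :: "'a \<Rightarrow> 'a"
  assumes dim: "2 \<le> n" and n_def: "n = DIM('a)" and N_def: "N = real n" and q_def: "q = N / (N - 1)"
    and V_def: "V = unit_ball_vol N"
    and dens_def: "\<And>x. dens x = 1 / (V * (1 + norm x powr q) ^ n)"
    and gv_def: "\<And>x. gv x = - ((N * q * norm x powr (q - 2) / (1 + norm x powr q)) *\<^sub>R x)"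
begin

text \<open>The constant of the theorem with \<open>N * V\<close>, the classical area of the unit
  sphere, in place of its Hausdorff measure.\<close>

definition om :: real where "om = N ^ n * q ^ (n - 1) * (N * V)"

lemma N: "2 \<le> N" "0 < N" "0 \<le> N" "N \<noteq> 0" "0 < N - 1" using dim by (auto simp: N_def)
lemma n1: "real (n - 1) = N - 1" using dim by (simp add: N_def)
lemma n2: "real (n - 2) = N - 2" using dim by (simp add: N_def)
lemma q: "1 < q" "0 < q" "q \<noteq> 0" "(N - 1) * q = N" "(q - 1) * (N - 1) = 1" "(q - 1) * N = q"
  using N by (auto simp: q_def field_simps)
lemma V: "0 < V" "0 \<le> V" "V \<noteq> 0" proof -
  show "0 < V" unfolding V_def using N by (intro unit_ball_vol_pos) auto
  then show "0 \<le> V" "V \<noteq> 0" by auto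
qed
lemma om_pos: "0 < om" using N q V by (simp add: om_def)
lemma one_powr: "0 < 1 + norm x powr q" by (simp add: add_pos_nonneg)
lemma dens_pos: "0 < dens x" using V one_powr[of x] by (simp add: dens_def)

lemma powr_q_pow: "0 \<le> r \<Longrightarrow> (r powr q) ^ (n - 1) = r ^ n"
proof -
  assume r: "0 \<le> r"
  have "(r powr q) ^ (n - 1) = (r powr q) powr real (n - 1)"
    using dim by (intro powr_realpow'[symmetric]) auto
  also have "\<dots> = r powr ((N - 1) * q)" unfolding powr_powr n1 by (simp add: mult.commute)
  also have "\<dots> = r powr real n" unfolding q(4) by (simp only: N_def)
  also have "\<dots> = r ^ n" using r dim by (intro powr_realpow') auto
  finally show ?thesis .
qed

lemma norm_gv: "norm (gv x) = N * q * norm x powr (q - 1) / (1 + norm x powr q)"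
proof (cases "x = 0")
  case False
  have "norm x powr (q - 2) * norm x = norm x powr (q - 1)"
    using False powr_add[of "norm x" "q - 2" 1] by simp
  then show ?thesis using N q one_powr[of x] by (simp add: gv_def abs_mult mult.assoc)
qed (simp add: gv_def)

lemma powr_q1_pow: "0 \<le> r \<Longrightarrow> (r powr (q - 1)) ^ n = r powr q"
proof -
  assume r: "0 \<le> r"
  have "(r powr (q - 1)) ^ n = r powr ((q - 1) * real n)"
    using r dim by (simp add: powr_realpow' powr_powr[symmetric])
  then show ?thesis using q(6) by (simp add: N_def)
qed

lemma norm_gv_pow: "norm (gv x) ^ n = (N * q) ^ n * norm x powr q / (1 + norm x powr q) ^ n"
  unfolding norm_gv power_divide power_mult_distrib by (simp add: powr_q1_pow)

text \<open>Since \<open>(q - 1) * (N - 2) + (q - 2) = 0\<close>, the powers of the norm cancel. The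
  field of the N-Laplacian is therefore a regular radial factor times \<open>x\<close>, although
  \<open>gv\<close> itself contains a negative power when \<open>q < 2\<close>.\<close>

lemma gv_field: "norm (gv x) ^ (n - 2) *\<^sub>R gv x = - (((N * q) ^ (n - 1) / (1 + norm x powr q) ^ (n - 1)) *\<^sub>R x)"
proof (cases "x = 0")
  case False
  have Sn: "n - 1 = Suc (n - 2)" using dim by simp
  have "(norm x powr (q - 1)) ^ (n - 2) = norm x powr ((q - 1) * (N - 2))"
    using False by (simp add: powr_realpow[symmetric] powr_powr n2)
  moreover have "(q - 1) * (N - 2) + (q - 2) = 0" using q(5) by (simp add: algebra_simps)
  ultimately have "(norm x powr (q - 1)) ^ (n - 2) * norm x powr (q - 2) = 1"
    using False by (simp add: powr_add[symmetric])
  then have "norm (gv x) ^ (n - 2) * (N * q * norm x powr (q - 2) / (1 + norm x powr q))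
      = (N * q) ^ (n - 1) / (1 + norm x powr q) ^ (n - 1)"
    unfolding norm_gv power_divide power_mult_distrib Sn by (simp add: field_simps)
  then show ?thesis by (simp add: gv_def)
qed (simp add: gv_def)

text \<open>Up to the factor \<open>(N - 1) / om\<close>, the divergent energy density of
  \<open>v\<close> is the integrand of the q-th moment of \<open>dens\<close>. The latter appears on
  the transport side, so the two divergences are measured by one function, \<open>A\<close>.\<close>

lemma gv_pow_dens: "(N - 1) / om * norm (gv x) ^ n = dens x * norm x powr q"
proof -
  have e: "n = Suc (n - 1)" using dim by simp
  have c: "(N - 1) / om * (N * q) ^ n = 1 / V"
  proof -
    have "(N * q) ^ n = N ^ n * (q ^ (n - 1) * q)" unfolding power_mult_distrib
      by (subst (2) e) (simp del: Suc_pred' add: mult.commute)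
    then have "(N - 1) / om * (N * q) ^ n = ((N - 1) * q) / (N * V)"
      using N(4) q(3) V(3) by (simp add: om_def)
    then show ?thesis unfolding q(4) using N(4) by simp
  qed
  have "(N - 1) / om * norm (gv x) ^ n = ((N - 1) / om * (N * q) ^ n) * (norm x powr q / (1 + norm x powr q) ^ n)"
    unfolding norm_gv_pow by simp
  then show ?thesis unfolding c by (simp add: dens_def)
qed

lemma ln_dens_GDERIV: "GDERIV (\<lambda>x. ln (dens x)) x :> gv x"
proof -
  have eq: "ln (dens x) = - ln V - N * ln (1 + norm x powr q)" for x
    using V one_powr[of x] by (simp add: dens_def ln_div ln_mult ln_realpow N_def)
  have D: "((\<lambda>s. - ln V - N * ln (1 + s)) has_real_derivative - (N / (1 + norm x powr q))) (at (norm x powr q))"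
    using one_powr[of x] by (auto intro!: derivative_eq_intros)
  have "GDERIV (\<lambda>x. - ln V - N * ln (1 + norm x powr q)) x :> (- (N / (1 + norm x powr q))) *\<^sub>R ((q * norm x powr (q - 2)) *\<^sub>R x)"
    by (rule GDERIV_DERIV_compose[OF norm_powr_GDERIV[OF q(1)] D])
  then show ?thesis unfolding eq by (simp add: gv_def mult_ac)
qed

lemma continuous_norm_powr: "continuous_on A (\<lambda>x::'a. norm x powr q)"
proof -
  have "isCont (\<lambda>x. norm x powr q) x" for x :: 'a
    using norm_powr_GDERIV[OF q(1), of x] unfolding gderiv_def by (rule has_derivative_continuous)
  then show ?thesis by (simp add: continuous_at_imp_continuous_on)
qed

lemma continuous_dens: "continuous_on A dens"
proof -
  have "dens = (\<lambda>x. 1 / (V * (1 + norm x powr q) ^ n))" by (simp add: dens_def fun_eq_iff)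
  moreover have "V * (1 + norm x powr q) ^ n \<noteq> 0" for x :: 'a using V one_powr[of x] by simp
  ultimately show ?thesis by (simp only:) (intro continuous_intros continuous_norm_powr; simp)
qed

text \<open>Near the origin the norm stays bounded because \<open>q > 1\<close>, and far away it
  decays like the inverse of the norm of \<open>x\<close>. This is the decay of the gradient of the
  logarithmic cut-off too, so in \<open>log_cutoff_energy\<close> both scale alike.\<close>

lemma gv_le: "norm (gv x) \<le> 2 * N * q / (1 + norm x)"
proof -
  have "norm x powr (q - 1) / (1 + norm x powr q) \<le> 2 / (1 + norm x)"
  proof (cases "norm x \<le> 1")
    case True
    have a: "norm x powr (q - 1) \<le> 1"
      using True q by (simp add: powr_le1)
    have "norm x powr (q - 1) / (1 + norm x powr q) \<le> 1 / 1" using a by (intro frac_le) auto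
    also have "\<dots> \<le> 2 / (1 + norm x)" using True by (simp add: field_simps add_pos_nonneg)
    finally show ?thesis .
  next
    case False
    then have e: "norm x powr q = norm x powr (q - 1) * norm x" using powr_add[of "norm x" "q - 1" 1] by simp
    have p: "0 < norm x powr (q - 1)" using False by auto
    have "norm x powr (q - 1) / (1 + norm x powr q) \<le> norm x powr (q - 1) / (norm x powr (q - 1) * norm x)"
      unfolding e using False p by (intro divide_left_mono) (auto intro!: mult_pos_pos add_pos_pos)
    also have "\<dots> = 1 / norm x" using p by simp
    also have "\<dots> \<le> 2 / (1 + norm x)"
    proof -
      have "1 * (1 + norm x) \<le> 2 * norm x" using False by simp
      moreover have "0 < norm x" "0 < 1 + norm x" using False by (auto simp: add_pos_nonneg simp del: zero_less_norm_iff)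
      ultimately show ?thesis by (simp add: divide_simps)
    qed
    finally show ?thesis .
  qed
  then have "N * q * (norm x powr (q - 1) / (1 + norm x powr q)) \<le> N * q * (2 / (1 + norm x))"
    using N q by (intro mult_left_mono) auto
  then show ?thesis by (simp add: norm_gv mult_ac)
qed

lemma continuous_gv: "continuous_on A gv"
proof -
  have "isCont gv x" for x
  proof (cases "x = 0")
    case False
    then show ?thesis unfolding gv_def using one_powr[of x]
      by (intro continuous_intros) auto
  next
    case True
    have "((\<lambda>x::'a. N * q * norm x powr (q - 1) / (1 + norm x powr q)) \<longlongrightarrow> 0) (at 0)"
      using q by (auto intro!: tendsto_eq_intros)
    then have "((\<lambda>x. norm (gv x)) \<longlongrightarrow> 0) (at 0)" by (simp only: norm_gv)
    then have "(gv \<longlongrightarrow> 0) (at 0)" by (rule tendsto_norm_zero_cancel)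
    moreover have "gv 0 = 0" by (simp add: gv_def)
    ultimately show ?thesis using True by (simp add: isCont_def)
  qed
  then show ?thesis by (simp add: continuous_at_imp_continuous_on)
qed

lemma dens_le: "dens x \<le> 1 / V"
proof -
  have "1 \<le> (1 + norm x powr q) ^ n" by (simp add: one_le_power)
  then show ?thesis using V one_powr[of x] unfolding dens_def
    by (intro divide_left_mono mult_pos_pos zero_less_power) auto
qed

lemma dens_measurable[measurable]: "dens \<in> borel_measurable borel"
  using continuous_dens by (rule borel_measurable_continuous_onI)

lemma gv_measurable[measurable]: "gv \<in> borel_measurable borel"
  using continuous_gv by (rule borel_measurable_continuous_onI)

text \<open>The radial density has an elementary primitive. The value tends to 1 as the radius
  grows, which shows that \<open>dens\<close> is a probability density.\<close>

lemma dens_ball: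
  assumes r: "0 \<le> r"
  shows "(\<integral>\<^sup>+x. ennreal (dens x) * indicator (cball 0 r) x \<partial>lborel)
    = ennreal ((r powr q / (1 + r powr q)) ^ (n - 1))"
proof -
  \<comment> \<open>In polar coordinates the constant \<open>V\<close> cancels, and \<open>P\<close>
    is a primitive of what remains.\<close>
  define P where "P s = s ^ n / (1 + \<bar>s\<bar> powr q) ^ (n - 1)" for s :: real
  have Sn: "n - 1 + 1 = n" using dim by simp
  have pos: "0 < 1 + \<bar>s\<bar> powr q" for s :: real by (simp add: add_pos_nonneg)
  have DP: "(P has_real_derivative N * s ^ (n - 1) / (1 + \<bar>s\<bar> powr q) ^ n) (at s)" for s
  proof -
    let ?D = "1 + \<bar>s\<bar> powr q"
    have d1: "((\<lambda>s. s ^ n) has_real_derivative N * s ^ (n - 1)) (at s)"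
      unfolding N_def by (auto intro!: derivative_eq_intros)
    have d2: "((\<lambda>s. (1 + \<bar>s\<bar> powr q) ^ (n - 1)) has_real_derivative
        (N - 1) * ?D ^ (n - 2) * (q * \<bar>s\<bar> powr (q - 2) * s)) (at s)"
    proof -
      have "((\<lambda>s. (1 + \<bar>s\<bar> powr q) ^ (n - 1)) has_real_derivative
          of_nat (n - 1) * ((0 + q * \<bar>s\<bar> powr (q - 2) * s) * ?D ^ (n - 1 - Suc 0))) (at s)"
        by (intro DERIV_power DERIV_add DERIV_const abs_powr_has_real_derivative q)
      then show ?thesis
        by (rule DERIV_cong) (simp add: n1[simplified] mult_ac numeral_2_eq_2)
    qed
    have ss: "s ^ n * (\<bar>s\<bar> powr (q - 2) * s) = s ^ (n - 1) * \<bar>s\<bar> powr q"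
    proof (cases "s = 0")
      case False
      have "\<bar>s\<bar> powr q = \<bar>s\<bar> powr (q - 2) * \<bar>s\<bar> powr 2"
        using powr_add[of "\<bar>s\<bar>" "q - 2" 2] by simp
      then have e1: "\<bar>s\<bar> powr q = \<bar>s\<bar> powr (q - 2) * (s * s)" using False by (simp add: powr_numeral power2_eq_square)
      have e2: "s ^ n = s ^ (n - 1) * s" using power_add[of s "n - 1" 1] unfolding Sn by simp
      have "s ^ n * (\<bar>s\<bar> powr (q - 2) * s) = s ^ (n - 1) * s * (\<bar>s\<bar> powr (q - 2) * s)"
        by (simp only: e2)
      also have "\<dots> = s ^ (n - 1) * (\<bar>s\<bar> powr (q - 2) * (s * s))" by (simp only: mult_ac)
      also have "\<dots> = s ^ (n - 1) * \<bar>s\<bar> powr q" by (simp only: e1)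
      finally show ?thesis .
    qed (use dim in auto)
    have D2: "?D ^ (n - 1) = ?D ^ (n - 2) * ?D" "?D ^ n = ?D ^ (n - 2) * ?D * ?D"
    proof -
      obtain k where "n = 2 + k" using le_Suc_ex[OF dim] by blast
      then have "n = Suc (Suc k)" by simp
      then show "?D ^ (n - 1) = ?D ^ (n - 2) * ?D" "?D ^ n = ?D ^ (n - 2) * ?D * ?D" by simp_all
    qed
    have "(P has_real_derivative (N * s ^ (n - 1) * ?D ^ (n - 1) - s ^ n * ((N - 1) * ?D ^ (n - 2) * (q * \<bar>s\<bar> powr (q - 2) * s)))
        / (?D ^ (n - 1) * ?D ^ (n - 1))) (at s)"
      unfolding P_def using pos[of s] by (intro DERIV_divide d1 d2) auto
    \<comment> \<open>Because \<open>(N - 1) * q = N\<close>, the terms of the quotient rule that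
      contain the power \<open>q\<close> cancel.\<close>
    moreover have "(N * s ^ (n - 1) * ?D ^ (n - 1) - s ^ n * ((N - 1) * ?D ^ (n - 2) * (q * \<bar>s\<bar> powr (q - 2) * s)))
        = N * s ^ (n - 1) * ?D ^ (n - 2)"
    proof -
      have "s ^ n * ((N - 1) * ?D ^ (n - 2) * (q * \<bar>s\<bar> powr (q - 2) * s))
          = ((N - 1) * q) * ?D ^ (n - 2) * (s ^ n * (\<bar>s\<bar> powr (q - 2) * s))" by simp
      also have "\<dots> = N * ?D ^ (n - 2) * (s ^ (n - 1) * \<bar>s\<bar> powr q)" unfolding ss q(4) ..
      finally show ?thesis unfolding D2 by (simp add: algebra_simps)
    qed
    moreover have "N * s ^ (n - 1) * ?D ^ (n - 2) / (?D ^ (n - 1) * ?D ^ (n - 1)) = N * s ^ (n - 1) / ?D ^ n"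
    proof -
      have "a * e / ((e * d) * (e * d)) = a / (e * d * d)" if "e \<noteq> 0" "d \<noteq> 0" for a e d :: real
        using that by (simp add: field_simps)
      then show ?thesis unfolding D2 using pos[of s] by (metis less_irrefl power_not_zero)
    qed
    ultimately show ?thesis by simp
  qed
  have "(\<integral>\<^sup>+x. ennreal (dens x) * indicator (cball 0 r) x \<partial>lborel)
      = (\<integral>\<^sup>+x. (\<lambda>s. ennreal (1 / (V * (1 + s powr q) ^ n))) (norm x) * indicator {x. 0 \<le> norm x \<and> norm x \<le> r} (x::'a) \<partial>lborel)"
    by (intro nn_integral_cong) (auto simp: dens_def indicator_def)
  also have "\<dots> = (\<integral>\<^sup>+s. ennreal (1 / (V * (1 + s powr q) ^ n)) * ennreal (V * (N * s ^ (n - 1))) * indicator {0..r} s \<partial>lborel)"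
    by (subst nn_integral_radial) (auto simp: V_def N_def n_def)
  also have "\<dots> = (\<integral>\<^sup>+s. ennreal (N * s ^ (n - 1) / (1 + \<bar>s\<bar> powr q) ^ n) * indicator {0..r} s \<partial>lborel)"
    using V N by (intro nn_integral_cong) (auto simp: indicator_def ennreal_mult[symmetric] add_nonneg_nonneg)
  also have "\<dots> = ennreal (P r - P 0)"
    using r N by (intro nn_integral_FTC_Icc DP) (auto intro!: divide_nonneg_nonneg mult_nonneg_nonneg add_nonneg_nonneg)
  also have "P r - P 0 = (r powr q / (1 + r powr q)) ^ (n - 1)"
    unfolding P_def power_divide powr_q_pow[OF r] using r dim by simp
  finally show ?thesis .
qed

text \<open>The q-th moment on a ball. By \<open>gv_pow_dens\<close> it is a multiple of the energy
  of \<open>v\<close> there, and it grows like \<open>N * ln r\<close>.\<close>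

definition A :: "real \<Rightarrow> real" where
  "A r = (LINT x|lborel. dens x * norm x powr q * indicator (cball 0 r) x)"

lemma A_integrable: "integrable lborel (\<lambda>x. dens x * norm x powr q * indicator (cball 0 r) (x::'a))"
proof (rule Bochner_Integration.integrable_bound)
  show "integrable lborel (\<lambda>x. (1 / V * \<bar>r\<bar> powr q) * indicator (cball 0 r) (x::'a) :: real)"
    by (intro integrable_mult_right integrable_real_indicator)
      (auto simp: emeasure_bounded_finite[OF bounded_cball, simplified])
  show "AE x in lborel. norm (dens x * norm x powr q * indicator (cball 0 r) x)
      \<le> norm (1 / V * \<bar>r\<bar> powr q * indicator (cball 0 r) (x::'a))"
  proof (rule AE_I2)
    fix x :: 'a
    have "dens x * norm x powr q \<le> 1 / V * \<bar>r\<bar> powr q" if "norm x \<le> r"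
      using that q V dens_pos[of x] dens_le[of x] by (intro mult_mono powr_mono2) auto
    then show "norm (dens x * norm x powr q * indicator (cball 0 r) x)
      \<le> norm (1 / V * \<bar>r\<bar> powr q * indicator (cball 0 r) x)"
      using dens_pos[of x] V by (auto simp: indicator_def abs_mult)
  qed
qed measurable

text \<open>In polar coordinates the integrand is \<open>N / r\<close> times a factor that increases
  to 1, by \<open>(r powr q) ^ (n - 1) = r ^ n\<close>. The growth of \<open>A\<close> is thus
  logarithmic with the exact slope \<open>N\<close>: the bound from above uses that the factor is at
  most 1, the bound from below its value at the left end.\<close>

lemma A_diff:
  assumes "0 < a" "a \<le> b"
  shows "ennreal (A b - A a) = (\<integral>\<^sup>+r. ennreal (N / r * (r powr q / (1 + r powr q)) ^ n) * indicator {a..b} r \<partial>lborel)"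
proof -
  have "A b - A a = (LINT x|lborel. dens x * norm x powr q * indicator (cball 0 b) x - dens x * norm x powr q * indicator (cball 0 a) x)"
    unfolding A_def using A_integrable by simp
  also have "ennreal \<dots> = (\<integral>\<^sup>+x. ennreal (dens x * norm x powr q * indicator (cball 0 b) x - dens x * norm x powr q * indicator (cball 0 a) x) \<partial>lborel)"
    using A_integrable assms dens_pos
    by (intro nn_integral_eq_integral[symmetric]) (auto simp: indicator_def less_imp_le intro!: AE_I2)
  also have "\<dots> = (\<integral>\<^sup>+x. (\<lambda>s. ennreal (1 / (V * (1 + s powr q) ^ n) * s powr q)) (norm x) * indicator {x. a \<le> norm x \<and> norm x \<le> b} (x::'a) \<partial>lborel)"
  proof (rule nn_integral_cong_AE)
    have "AE x in lborel. x \<notin> sphere (0::'a) a"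
      using AE_not_in[of "sphere (0::'a) a" lborel] negligible_sphere[of "0::'a" a]
      by (simp add: negligible_iff_null_sets null_sets_completion_iff)
    then show "AE x in lborel. ennreal (dens x * norm x powr q * indicator (cball 0 b) x - dens x * norm x powr q * indicator (cball 0 a) x)
        = (\<lambda>s. ennreal (1 / (V * (1 + s powr q) ^ n) * s powr q)) (norm x) * indicator {x. a \<le> norm x \<and> norm x \<le> b} (x::'a)"
      by eventually_elim (use assms in \<open>auto simp: indicator_def dens_def\<close>)
  qed
  also have "\<dots> = (\<integral>\<^sup>+s. ennreal (1 / (V * (1 + s powr q) ^ n) * s powr q) * ennreal (V * (N * s ^ (n - 1))) * indicator {a..b} s \<partial>lborel)"
    using assms by (subst nn_integral_radial) (auto simp: V_def N_def n_def)
  also have "\<dots> = (\<integral>\<^sup>+r. ennreal (N / r * (r powr q / (1 + r powr q)) ^ n) * indicator {a..b} r \<partial>lborel)"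
  proof (intro nn_integral_cong)
    fix s
    show "ennreal (1 / (V * (1 + s powr q) ^ n) * s powr q) * ennreal (V * (N * s ^ (n - 1))) * indicator {a..b} s
        = ennreal (N / s * (s powr q / (1 + s powr q)) ^ n) * indicator {a..b} s"
    proof (cases "s \<in> {a..b}")
      case True
      then have s: "0 < s" using assms by simp
      have "(s powr q) ^ n = (s powr q) ^ (n - 1) * s powr q"
        using dim by (metis power_minus_mult[of n "s powr q"] less_le_trans zero_less_numeral)
      also have "\<dots> = s ^ n * s powr q" using powr_q_pow[of s] s by simp
      also have "\<dots> = s * s ^ (n - 1) * s powr q"
        using dim by (metis power_minus_mult[of n s] less_le_trans zero_less_numeral mult.commute)
      finally have e: "(s powr q) ^ n / s = s ^ (n - 1) * s powr q" using s by simp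
      have "N / s * (s powr q / (1 + s powr q)) ^ n = N * ((s powr q) ^ n / s) / (1 + s powr q) ^ n"
        unfolding power_divide by simp
      also have "\<dots> = N * (s ^ (n - 1) * s powr q) / (1 + s powr q) ^ n" unfolding e ..
      also have "\<dots> = (1 / (V * (1 + s powr q) ^ n) * s powr q) * (V * (N * s ^ (n - 1)))"
        using V by simp
      finally show ?thesis using V N s by (simp add: ennreal_mult[symmetric] add_nonneg_nonneg)
    qed simp
  qed
  finally show ?thesis .
qed

lemma nn_integral_inverse_Icc:
  assumes "0 < a" "a \<le> b" "0 \<le> c"
  shows "(\<integral>\<^sup>+r. ennreal (c / r) * indicator {a..b} r \<partial>lborel) = ennreal (c * ln (b / a))"
proof -
  have "(\<integral>\<^sup>+r. ennreal (c / r) * indicator {a..b} r \<partial>lborel) = ennreal (c * ln b - c * ln a)"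
    using assms by (intro nn_integral_FTC_Icc) (auto intro!: derivative_eq_intros)
  then show ?thesis using assms by (simp add: ln_div right_diff_distrib)
qed

lemma A_mono: "0 < a \<Longrightarrow> a \<le> b \<Longrightarrow> A a \<le> A b"
  unfolding A_def using dens_pos
  by (intro integral_mono A_integrable) (auto simp: indicator_def less_imp_le)

lemma A_diff_le:
  assumes "0 < a" "a \<le> b"
  shows "A b - A a \<le> N * ln (b / a)"
proof -
  have "ennreal (A b - A a) \<le> (\<integral>\<^sup>+r. ennreal (N / r) * indicator {a..b} r \<partial>lborel)"
    unfolding A_diff[OF assms]
  proof (intro nn_integral_mono)
    fix r
    have "(r powr q / (1 + r powr q)) ^ n \<le> 1"
      by (intro power_le_one) (auto simp: add_pos_nonneg divide_le_eq_1 add_nonneg_nonneg)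
    then have "N / r * (r powr q / (1 + r powr q)) ^ n \<le> N / r" if "a \<le> r"
      using assms N that by (intro mult_left_le) auto
    then show "ennreal (N / r * (r powr q / (1 + r powr q)) ^ n) * indicator {a..b} r \<le> ennreal (N / r) * indicator {a..b} r"
      unfolding indicator_def by (auto intro!: ennreal_leI simp del: times_divide_eq_left)
  qed
  also have "\<dots> = ennreal (N * ln (b / a))" using assms N by (intro nn_integral_inverse_Icc) auto
  finally show ?thesis using assms N by (subst (asm) ennreal_le_iff) (auto intro!: mult_nonneg_nonneg)
qed

lemma A_diff_ge:
  assumes "0 < a" "a \<le> b"
  shows "(a powr q / (1 + a powr q)) ^ n * (N * ln (b / a)) \<le> A b - A a"
proof -
  define c where "c = (a powr q / (1 + a powr q)) ^ n"
  have c: "0 \<le> c" unfolding c_def by (simp add: add_nonneg_nonneg)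
  have "ennreal (c * N * ln (b / a)) = (\<integral>\<^sup>+r. ennreal (c * N / r) * indicator {a..b} r \<partial>lborel)"
    using assms N c by (intro nn_integral_inverse_Icc[symmetric]) auto
  also have "\<dots> \<le> ennreal (A b - A a)"
    unfolding A_diff[OF assms]
  proof (intro nn_integral_mono)
    fix r
    have "c \<le> (r powr q / (1 + r powr q)) ^ n" if "a \<le> r"
    proof -
      have "a powr q \<le> r powr q" using that assms q by (intro powr_mono2) auto
      then have "a powr q / (1 + a powr q) \<le> r powr q / (1 + r powr q)"
        by (simp add: field_simps add_pos_nonneg)
      then show ?thesis unfolding c_def by (intro power_mono) (auto simp: add_nonneg_nonneg)
    qed
    then have "N / r * c \<le> N / r * (r powr q / (1 + r powr q)) ^ n" if "a \<le> r"
      using assms N that by (intro mult_left_mono) auto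
    moreover have "c * N / r = N / r * c" by simp
    ultimately show "ennreal (c * N / r) * indicator {a..b} r \<le> ennreal (N / r * (r powr q / (1 + r powr q)) ^ n) * indicator {a..b} r"
      unfolding indicator_def by (auto intro!: ennreal_leI simp del: times_divide_eq_left)
  qed
  finally show ?thesis using A_mono[OF assms] by (subst (asm) ennreal_le_iff) (auto simp: c_def mult_ac)
qed

end

section \<open>The inequality for compactly supported smooth perturbations\<close>

lemma continuous_cball_bounded:
  fixes k :: "'a::euclidean_space \<Rightarrow> 'b::real_normed_vector"
  assumes "continuous_on UNIV k" "\<And>x. r < norm x \<Longrightarrow> k x = 0"
  obtains B where "0 \<le> B" "\<And>x. norm (k x) \<le> B"
proof -
  have "compact (k ` cball 0 r)"
    using assms(1) by (intro compact_continuous_image continuous_on_subset[OF assms(1)]) auto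
  then obtain B where B: "\<And>y. y \<in> k ` cball 0 r \<Longrightarrow> norm y \<le> B"
    using compact_imp_bounded bounded_iff by metis
  have "norm (k x) \<le> max B 0" for x
  proof (cases "norm x \<le> r")
    case True
    then have "norm (k x) \<le> B" by (intro B imageI) simp
    then show ?thesis by simp
  qed (use assms in auto)
  then show thesis by (intro that[of "max B 0"]) auto
qed

lemma bounded_cball_integrable:
  fixes k :: "'a::euclidean_space \<Rightarrow> real"
  assumes [measurable]: "k \<in> borel_measurable borel"
    and "\<And>x. r < norm x \<Longrightarrow> k x = 0" "\<And>x. norm x \<le> r \<Longrightarrow> \<bar>k x\<bar> \<le> B"
  shows "integrable lborel k"
proof (rule Bochner_Integration.integrable_bound)
  show "integrable lborel (\<lambda>x. \<bar>B\<bar> * indicator (cball 0 r) (x::'a) :: real)"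
    by (intro integrable_mult_right integrable_real_indicator)
      (auto simp: emeasure_bounded_finite[OF bounded_cball, simplified])
  show "AE x in lborel. norm (k x) \<le> norm (\<bar>B\<bar> * indicator (cball 0 r) x :: real)"
  proof (rule AE_I2)
    fix x show "norm (k x) \<le> norm (\<bar>B\<bar> * indicator (cball 0 r) x :: real)"
      using assms(2)[of x] assms(3)[of x] by (cases "norm x \<le> r") (auto simp: indicator_def)
  qed
qed simp

lemma continuous_cball_integrable:
  fixes k :: "'a::euclidean_space \<Rightarrow> real"
  assumes "continuous_on UNIV k" "\<And>x. r < norm x \<Longrightarrow> k x = 0"
  shows "integrable lborel k"
proof -
  obtain B where "\<And>x. norm (k x) \<le> B" using continuous_cball_bounded[OF assms] by metis
  then show ?thesis using assms
    by (intro bounded_cball_integrable[where r = r and B = B] borel_measurable_continuous_onI) auto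
qed

lemma GDERIV_bounded_imp_lipschitz:
  fixes k :: "'a::euclidean_space \<Rightarrow> real"
  assumes "\<And>x. GDERIV k x :> G x" "\<And>x. norm (G x) \<le> B"
  shows "\<bar>k x - k y\<bar> \<le> B * norm (x - y)"
proof -
  have "norm (k x - k y) \<le> B * norm (x - y)"
  proof (rule differentiable_bound[of UNIV k "\<lambda>x h. h \<bullet> G x"])
    show "(k has_derivative (\<lambda>h. h \<bullet> G x)) (at x within UNIV)" for x
      using assms(1)[of x] by (simp add: gderiv_def)
    show "onorm (\<lambda>h. h \<bullet> G x) \<le> B" for x
    proof (rule onorm_le)
      fix h
      have "norm (h \<bullet> G x) \<le> norm h * norm (G x)" by (simp add: Cauchy_Schwarz_ineq2)
      also have "\<dots> \<le> norm h * B" by (intro mult_left_mono assms) auto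
      finally show "norm (h \<bullet> G x) \<le> B * norm h" by (simp add: mult.commute)
    qed
  qed auto
  then show ?thesis by simp
qed

lemma AE_norm_neq: "AE x in lborel. norm (x :: 'a::euclidean_space) \<noteq> r"
proof -
  have "sphere (0::'a) r \<in> null_sets lborel"
    using negligible_sphere[of "0::'a" r]
    by (simp add: negligible_iff_null_sets null_sets_completion_iff)
  from AE_not_in[OF this] show ?thesis by eventually_elim auto
qed

context onofri
begin

text \<open>Young's inequality for \<open>a / l\<close> and \<open>l * b\<close> with
  \<open>l = P powr (1 / q)\<close>. Equality holds for \<open>a = P * b powr (q - 1)\<close>, and
  \<open>P\<close> is later chosen accordingly.\<close>

lemma young_weighted:
  assumes "0 \<le> a" "0 \<le> b" "0 < P"
  shows "a * b \<le> a ^ n / (N * P ^ (n - 1)) + P * b powr q / q"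
proof -
  define l where "l = P powr (1 / q)"
  have l: "0 < l" using assms by (simp add: l_def)
  have "1 / N + 1 / q = 1" using N q by (simp add: q_def field_simps)
  then have "(a / l) * (l * b) \<le> (a / l) powr N / N + (l * b) powr q / q"
    using N q l assms by (intro Youngs_inequality) auto
  moreover have "(a / l) powr N = a ^ n / P ^ (n - 1)"
  proof -
    have "l powr N = P powr (N / q)" by (simp add: l_def powr_powr)
    also have "N / q = real (n - 1)" unfolding n1 using N by (simp add: q_def)
    also have "P powr real (n - 1) = P ^ (n - 1)" using assms by (simp add: powr_realpow)
    finally have "l powr N = P ^ (n - 1)" .
    moreover have "a powr N = a ^ n" using assms dim by (simp add: N_def powr_realpow')
    ultimately show ?thesis using assms l by (simp add: powr_divide)
  qed
  moreover have "(l * b) powr q = P * b powr q"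
    using assms l q by (simp add: powr_mult l_def powr_powr)
  ultimately show ?thesis using l by (simp add: mult.commute)
qed

text \<open>The concave N-th root lies below its tangent at \<open>s ^ n\<close>; this is Young's
  inequality with \<open>b = 1\<close>.\<close>

lemma root_tangent:
  assumes "0 \<le> t" "0 < s"
  shows "t powr (1 / N) \<le> s * (N - 1) / N + t / s ^ (n - 1) / N"
proof -
  have qq: "(s powr (1/q)) powr q = s" using assms q by (simp add: powr_powr)
  have e: "(t powr (1 / N)) ^ n = t"
    using assms N dim by (simp add: powr_realpow'[symmetric] N_def powr_powr)
  have "t powr (1 / N) * 1 \<le> (t powr (1 / N)) ^ n / (N * s ^ (n - 1)) + s * 1 powr q / q"
    using assms by (intro young_weighted) auto
  then show ?thesis using N unfolding e by (simp add: q_def mult.commute)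
qed

end

section \<open>The transport estimate on balls for a compactly supported perturbation\<close>

locale onofri_perturbed = onofri n N q V dens gv
  for n :: nat and N q V :: real and dens :: "'a::euclidean_space \<Rightarrow> real" and gv :: "'a \<Rightarrow> 'a" +
  fixes U :: "'a \<Rightarrow> real" and DU :: "'a \<Rightarrow> 'a" and R0 :: real
  assumes U_deriv: "\<And>x. GDERIV U x :> DU x" and DU_cont: "continuous_on UNIV DU"
    and U_supp: "\<And>x. R0 \<le> norm x \<Longrightarrow> U x = 0" and R0: "0 < R0"
begin

definition EW :: "'a \<Rightarrow> real" where "EW x = exp (U x) * dens x"

lemma EW_pos: "0 < EW x" using dens_pos by (simp add: EW_def)

lemma U_cont: "continuous_on X U"
  using U_deriv unfolding gderiv_def
  by (meson continuous_at_imp_continuous_on has_derivative_continuous)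

lemma EW_cont: "continuous_on X EW"
  unfolding EW_def by (intro continuous_intros U_cont continuous_dens)

lemma DU_measurable[measurable]: "DU \<in> borel_measurable borel"
  using DU_cont by (rule borel_measurable_continuous_onI)

lemma EW_measurable[measurable]: "EW \<in> borel_measurable borel"
  using EW_cont by (rule borel_measurable_continuous_onI)

lemma DU_supp: "R0 < norm x \<Longrightarrow> DU x = 0"
proof -
  assume x: "R0 < norm x"
  have op: "open {y. R0 < norm (y::'a)}" by (intro open_Collect_less continuous_intros)
  have "(U has_derivative (\<lambda>h. 0)) (at x)"
  proof (rule has_derivative_transform_within_open[OF has_derivative_const op])
    show "x \<in> {y. R0 < norm y}" using x by simp
    show "0 = U y" if "y \<in> {y. R0 < norm y}" for y using that U_supp[of y] by simp
  qed
  then have "(\<lambda>h. h \<bullet> DU x) = (\<lambda>h. 0)"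
    using U_deriv[of x] unfolding gderiv_def by (rule has_derivative_unique[rotated])
  then have "DU x \<bullet> DU x = 0" by (rule fun_cong)
  then show ?thesis by simp
qed

lemma DU_bounded: obtains B where "0 \<le> B" "\<And>x. norm (DU x) \<le> B"
  using continuous_cball_bounded[OF DU_cont, of R0] DU_supp by metis

lemma EW_bounded: obtains B where "0 < B" "\<And>x. EW x \<le> B"
proof -
  obtain B where B: "0 \<le> B" "\<And>x. norm (U x) \<le> B"
    using continuous_cball_bounded[OF U_cont, of R0] U_supp less_imp_le by metis
  have "EW x \<le> exp B * (1 / V)" for x
    unfolding EW_def using B(2)[of x] dens_le[of x] dens_pos[of x] by (intro mult_mono) auto
  then show thesis using V by (intro that[of "exp B * (1 / V)"]) auto
qed

lemma EW_powr_GDERIV: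
  "GDERIV (\<lambda>x. EW x powr t) x :> (t * EW x powr t) *\<^sub>R (gv x + DU x)"
proof -
  have eq: "EW x powr t = exp (t * (ln (dens x) + U x))" for x
    using dens_pos[of x] by (simp add: EW_def powr_def ln_mult add.commute)
  have "GDERIV (\<lambda>x. exp (t * (ln (dens x) + U x))) x :> (exp (t * (ln (dens x) + U x)) * t) *\<^sub>R (gv x + DU x)"
    by (rule GDERIV_DERIV_compose[OF GDERIV_add[OF ln_dens_GDERIV U_deriv]])
      (auto intro!: derivative_eq_intros)
  then show ?thesis unfolding eq by (simp add: mult.commute)
qed

lemma DW_integrable: "integrable lborel (\<lambda>x. norm (gv x + DU x) ^ n * indicator (ball 0 R) x)"
proof -
  obtain B where B: "0 \<le> B" "\<And>x. norm (DU x) \<le> B" using DU_bounded by metis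
  have "norm (gv x + DU x) ^ n \<le> (2 * N * q + B) ^ n" for x
  proof (rule power_mono)
    have "2 * N * q / (1 + norm x) \<le> 2 * N * q / 1" using N q by (intro divide_left_mono) (auto intro!: mult_nonneg_nonneg add_pos_nonneg)
    then show "norm (gv x + DU x) \<le> 2 * N * q + B"
      using norm_triangle_ineq[of "gv x" "DU x"] gv_le[of x] B(2)[of x] by simp
  qed simp
  moreover have "0 \<le> (2 * N * q + B) ^ n" using B N q by simp
  ultimately show ?thesis
    by (intro bounded_cball_integrable[where r = R and B = "(2 * N * q + B) ^ n"])
      (auto simp: indicator_def)
qed

text \<open>\<open>EW\<close> on the ball of radius \<open>R\<close>, of mass \<open>ZR\<close>, is
  transported to \<open>dens\<close> on the ball of radius \<open>R'\<close>, of mass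
  \<open>m'\<close>. \<open>mR\<close> is the value of \<open>dens\<close> on the sphere of radius
  \<open>R\<close>; the hypothesis \<open>low\<close> makes the weight nonnegative exactly where it
  should be. The moment \<open>A R'\<close> arises because powers of \<open>T\<close> integrated
  against the source density become moments of the target.\<close>

proposition onofri_finite_radius:
  fixes R R' :: real
  defines "mR \<equiv> 1 / (V * (1 + R powr q) ^ n)"
    and "m' \<equiv> (R' powr q / (1 + R' powr q)) ^ (n - 1)"
    and "ZR \<equiv> (LINT x|lborel. EW x * indicator (ball 0 R) x)"
  assumes R: "R0 < R" and R': "0 < R'" and low: "\<And>x. norm x < R \<Longrightarrow> mR \<le> EW x"
  shows "N * m' + A R' \<le> (m' / ZR) powr (1 - 1 / N) * (N * R ^ (n - 1) * R' / (1 + R powr q) ^ (n - 1))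
    + (N - 1) / om * (LINT x|lborel. norm (gv x + DU x) ^ n * indicator (ball 0 R) x)"
proof -
  \<comment> \<open>This exponent, equal to \<open>1 / q\<close>, makes the product of
    \<open>EW x powr \<theta>\<close> with the N-th root of the Jacobian linear in
    \<open>EW x\<close>.\<close>
  define \<theta> where "\<theta> = 1 - 1 / N"
  have \<theta>: "0 < \<theta>" "\<theta> * q = 1" "\<theta> + 1 / N = 1" "\<theta> * N = N - 1" using N by (auto simp: \<theta>_def q_def field_simps)
  have Rp: "0 < R" using R R0 by simp
  have mR: "0 < mR" using V by (simp add: mR_def add_pos_nonneg)
  have m': "0 < m'" using R' by (simp add: m'_def add_pos_nonneg)
  obtain CE where CE: "0 < CE" "\<And>x. EW x \<le> CE" using EW_bounded by metis
  obtain CD where CD: "0 \<le> CD" "\<And>x. norm (DU x) \<le> CD" using DU_bounded by metis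
  have EWi: "integrable lborel (\<lambda>x. EW x * indicator (ball 0 R) x)"
    using CE EW_pos
    by (intro bounded_cball_integrable[where r = R and B = CE]) (auto simp: indicator_def less_imp_le abs_of_pos)
  have volR: "measure lborel (ball (0::'a) R) = V * R ^ n"
    using measure_ball_pow[of R, where 'a = 'a] Rp V by (simp add: measure_def V_def N_def n_def)
  have ZR: "0 < ZR"
  proof -
    have "mR * (V * R ^ n) = (LINT x|lborel. mR * indicator (ball (0::'a) R) x)" by (simp add: volR)
    also have "\<dots> \<le> ZR" unfolding ZR_def
      using low EW_pos
      by (intro integral_mono EWi integrable_mult_right integrable_real_indicator)
        (auto simp: indicator_def emeasure_lborel_ball_finite[simplified])
    finally show ?thesis using mR V Rp by (meson less_le_trans mult_pos_pos zero_less_power)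
  qed
  \<comment> \<open>\<kappa> corrects for the different masses; \<open>k1\<close> is the constant in
    the formula \<open>J x powr (1 / N) = k1 * EW x powr (1 / N) * (1 + norm (T x) powr q)\<close>
    below.\<close>
  define \<kappa> where "\<kappa> = m' / ZR"
  have \<kappa>: "0 < \<kappa>" using m' ZR by (simp add: \<kappa>_def)
  define k1 where "k1 = (\<kappa> * V) powr (1 / N)"
  have k1: "0 < k1" using \<kappa> V by (simp add: k1_def)
  have k1n: "k1 ^ n = \<kappa> * V"
    using \<kappa> V N dim by (simp add: k1_def powr_realpow[symmetric] N_def powr_powr)
  \<comment> \<open>With this weight Young's inequality below is an equality for
    \<open>U = 0\<close>, equal radii and the identity map.\<close>
  define P where "P = q * N * k1"
  have P: "0 < P" using q N k1 by (simp add: P_def)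
  \<comment> \<open>The source is cut to an open ball and the target to a closed one; this makes
    \<open>f\<close> lower and \<open>g\<close> upper semicontinuous.\<close>
  define f where "f x = (if norm x < R then EW x / ZR else 0)" for x
  define g where "g y = (if norm y \<le> R' then dens y / m' else 0)" for y
  have f_ind: "f x = EW x * indicator (ball 0 R) x / ZR" for x by (simp add: f_def indicator_def)
  have g_ind: "g x = dens x * indicator (cball 0 R') x / m'" for x by (simp add: g_def indicator_def)
  have fg[measurable]: "f \<in> borel_measurable borel" "g \<in> borel_measurable borel"
    unfolding f_ind g_ind by measurable
  have f_int: "(\<integral>\<^sup>+x. ennreal (f x) \<partial>lborel) = 1"
  proof -
    have "(\<integral>\<^sup>+x. ennreal (f x) \<partial>lborel) = ennreal (LINT x|lborel. EW x * indicator (ball 0 R) x / ZR)"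
      unfolding f_ind using EWi EW_pos ZR
      by (intro nn_integral_eq_integral) (auto simp: indicator_def less_imp_le)
    then show ?thesis using ZR by (simp add: ZR_def[symmetric])
  qed
  have g_int: "(\<integral>\<^sup>+x. ennreal (g x) \<partial>lborel) = 1"
  proof -
    have "(\<integral>\<^sup>+x. ennreal (g x) \<partial>lborel) = (\<integral>\<^sup>+x. ennreal (dens x) * indicator (cball 0 R') x / ennreal m' \<partial>lborel)"
      unfolding g_ind using dens_pos m'
      by (intro nn_integral_cong) (auto simp: indicator_def divide_ennreal less_imp_le)
    also have "\<dots> = ennreal m' / ennreal m'"
      using R' by (subst nn_integral_divide) (auto simp: dens_ball m'_def)
    finally show ?thesis using m' by (simp add: divide_ennreal)
  qed
  define C where "C = max (CE / ZR) (1 / V / m')"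
  define M where "M = max R R'"
  have f_nn: "0 \<le> f x" for x using EW_pos[of x] ZR by (simp add: f_def less_imp_le)
  have g_nn: "0 \<le> g x" for x using dens_pos[of x] m' by (simp add: g_def less_imp_le)
  have f_C: "f x \<le> C" for x
  proof -
    have "EW x / ZR \<le> CE / ZR" using CE(2) ZR by (intro divide_right_mono) auto
    moreover have "0 \<le> CE / ZR" using CE ZR by simp
    ultimately show ?thesis by (simp add: f_def C_def le_max_iff_disj)
  qed
  have g_C: "g x \<le> C" for x
  proof -
    have "dens x / m' \<le> 1 / V / m'" using dens_le m' by (intro divide_right_mono) auto
    moreover have "0 \<le> 1 / V / m'" using V m' by simp
    ultimately show ?thesis by (simp add: g_def C_def le_max_iff_disj)
  qed
  have fg_M: "f x = 0" "g x = 0" if "M < norm x" for x using that by (auto simp: f_def g_def M_def)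
  have lsc: "\<forall>\<^sub>F y in at x. c < f y" if c: "c < f x" for x c
  proof (cases "norm x < R")
    case True
    have "open {y. norm (y::'a) < R}" by (intro open_Collect_less continuous_intros)
    then have "\<forall>\<^sub>F y in at x. norm y < R"
      using eventually_nhds_in_open[of "{y. norm y < R}" x] True by (simp add: eventually_nhds_conv_at)
    moreover have "((\<lambda>y. EW y / ZR) \<longlongrightarrow> EW x / ZR) (at x)"
      using EW_cont[of UNIV] ZR by (intro tendsto_intros) (auto simp: continuous_on_def)
    then have "\<forall>\<^sub>F y in at x. c < EW y / ZR" using c True by (intro order_tendstoD(1)) (auto simp: f_def)
    ultimately show ?thesis by eventually_elim (simp add: f_def)
  next
    case False
    then have "c < 0" using c by (simp add: f_def)
    moreover have "0 \<le> f y" for y using EW_pos[of y] ZR by (simp add: f_def less_imp_le)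
    ultimately show ?thesis by (intro always_eventually allI) (meson less_le_trans)
  qed
  have usc: "\<forall>\<^sub>F y in at x. g y < c" if c: "g x < c" for x c
  proof (cases "norm x \<le> R'")
    case True
    then have c0: "0 < c" using c dens_pos[of x] m' by (simp add: g_def) (meson divide_pos_pos less_trans)
    have "((\<lambda>y. dens y / m') \<longlongrightarrow> dens x / m') (at x)"
      using continuous_dens[of UNIV] m' by (intro tendsto_intros) (auto simp: continuous_on_def)
    then have "\<forall>\<^sub>F y in at x. dens y / m' < c" using c True by (intro order_tendstoD(2)) (auto simp: g_def)
    then show ?thesis by eventually_elim (use c0 in \<open>simp add: g_def\<close>)
  next
    case False
    then have c0: "0 < c" using c by (simp add: g_def)
    have "open {y. R' < norm (y::'a)}" by (intro open_Collect_less continuous_intros)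
    then have "\<forall>\<^sub>F y in at x. R' < norm y"
      using eventually_nhds_in_open[of "{y. R' < norm y}" x] False by (simp add: eventually_nhds_conv_at)
    then show ?thesis by eventually_elim (use c0 in \<open>simp add: g_def\<close>)
  qed
  have M: "0 \<le> M" using Rp by (simp add: M_def)
  obtain T :: "'a \<Rightarrow> 'a" where
    T[measurable]: "T \<in> borel_measurable borel" and
    push: "\<And>k. k \<in> borel_measurable borel \<Longrightarrow>
       (\<integral>\<^sup>+x. ennreal (f x) * k (T x) \<partial>lborel) = (\<integral>\<^sup>+y. ennreal (g y) * k y \<partial>lborel)" and
    gT: "AE x in lborel. 0 < f x \<longrightarrow> 0 < g (T x)" and
    ineq: "\<And>\<psi> G. admissible_weight \<psi> G \<Longrightarrow>
       integrable lborel (\<lambda>x. G x \<bullet> T x) \<and>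
       (\<integral>\<^sup>+x. ennreal (\<psi> x * (DIM('a) * (f x / g (T x)) powr (1 / DIM('a)))) \<partial>lborel)
         \<le> ennreal (- (LINT x|lborel. G x \<bullet> T x))"
    by (rule transport_inequality[of f g C M])
      (rule fg f_nn f_C g_nn g_C f_int g_int M | erule fg_M lsc usc | (rule that; assumption))+
  \<comment> \<open>The subtracted constant is the value of the first term on the sphere of radius
    \<open>R\<close>, so the positive part \<psi> is Lipschitz, supported in the ball, and
    integration by parts leaves no boundary term.\<close>
  define \<Phi> where "\<Phi> x = EW x powr \<theta> - mR powr \<theta>" for x
  define D\<Phi> where "D\<Phi> x = (\<theta> * EW x powr \<theta>) *\<^sub>R (gv x + DU x)" for x
  have D\<Phi>: "GDERIV \<Phi> x :> D\<Phi> x" for x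
    using GDERIV_diff[OF EW_powr_GDERIV[of \<theta> x] GDERIV_const[of "mR powr \<theta>"]] by (simp add: \<Phi>_def[abs_def] D\<Phi>_def)
  define B where "B = \<theta> * CE powr \<theta> * (2 * N * q + CD)"
  have D\<Phi>_le: "norm (D\<Phi> x) \<le> B" for x
  proof -
    have "2 * N * q / (1 + norm x) \<le> 2 * N * q / 1" using N q by (intro divide_left_mono) (auto intro!: mult_nonneg_nonneg add_pos_nonneg)
    then have "norm (gv x + DU x) \<le> 2 * N * q + CD"
      using norm_triangle_ineq[of "gv x" "DU x"] gv_le[of x] CD(2)[of x] by simp
    moreover have "EW x powr \<theta> \<le> CE powr \<theta>" using CE(2)[of x] EW_pos[of x] \<theta> by (intro powr_mono2) auto
    ultimately have "(\<theta> * EW x powr \<theta>) * norm (gv x + DU x) \<le> B"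
      unfolding B_def using \<theta> by (intro mult_mono) auto
    then show ?thesis using \<theta> by (simp add: D\<Phi>_def)
  qed
  define \<psi> where "\<psi> x = max 0 (\<Phi> x)" for x
  define G where "G x = indicator (ball 0 R) x *\<^sub>R D\<Phi> x" for x
  have mono_th: "a powr \<theta> \<le> b powr \<theta>" if "0 \<le> a" "a \<le> b" for a b using that \<theta> by (intro powr_mono2) auto
  have \<Phi>_in: "0 \<le> \<Phi> x" if "norm x < R" for x
    using mono_th[of mR "EW x"] low[OF that] mR by (simp add: \<Phi>_def)
  \<comment> \<open>Outside the ball \<open>U\<close> vanishes and \<open>dens\<close> is radially
    decreasing, so the positive part cuts exactly at the sphere.\<close>
  have \<Phi>_out: "\<Phi> x \<le> 0" if "R \<le> norm x" for x
  proof -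
    have "R powr q \<le> norm x powr q" using that q Rp by (intro powr_mono2) auto
    then have "dens x \<le> mR" unfolding dens_def mR_def using V one_powr[of x]
      by (intro divide_left_mono mult_left_mono power_mono mult_pos_pos zero_less_power) (auto simp: add_pos_nonneg)
    moreover have "EW x = dens x" using that R by (simp add: EW_def U_supp)
    ultimately show ?thesis using mono_th[of "EW x" mR] dens_pos[of x] by (simp add: \<Phi>_def)
  qed
  have \<psi>_eq: "\<psi> x = \<Phi> x * indicator (ball 0 R) x" for x
    using \<Phi>_in[of x] \<Phi>_out[of x] by (auto simp: \<psi>_def indicator_def max_def)
  have [measurable]: "\<Phi> \<in> borel_measurable borel" "D\<Phi> \<in> borel_measurable borel"
    unfolding \<Phi>_def D\<Phi>_def by measurable
  have [measurable]: "\<psi> \<in> borel_measurable borel" "G \<in> borel_measurable borel"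
    unfolding \<psi>_def G_def by measurable
  have main: "integrable lborel (\<lambda>x. G x \<bullet> T x) \<and>
       (\<integral>\<^sup>+x. ennreal (\<psi> x * (DIM('a) * (f x / g (T x)) powr (1 / DIM('a)))) \<partial>lborel)
         \<le> ennreal (- (LINT x|lborel. G x \<bullet> T x))"
  proof (rule ineq, unfold admissible_weight_def, intro conjI)
    have "\<bar>\<psi> x - \<psi> y\<bar> \<le> B * norm (x - y)" for x y
      using GDERIV_bounded_imp_lipschitz[OF D\<Phi> D\<Phi>_le, of x y] unfolding \<psi>_def by linarith
    then show "\<exists>B. \<forall>x y. \<bar>\<psi> x - \<psi> y\<bar> \<le> B * norm (x - y)" by blast
    show "AE x in lborel. GDERIV \<psi> x :> G x"
      using AE_norm_neq[of R]
    proof eventually_elim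
      case (elim x)
      consider "norm x < R" | "R < norm x" using elim by linarith
      then show ?case
      proof cases
        case 1
        have op: "open {y. norm (y::'a) < R}" by (intro open_Collect_less continuous_intros)
        have "(\<psi> has_derivative (\<lambda>h. h \<bullet> D\<Phi> x)) (at x)"
        proof (rule has_derivative_transform_within_open[OF _ op])
          show "(\<Phi> has_derivative (\<lambda>h. h \<bullet> D\<Phi> x)) (at x)" using D\<Phi>[of x] by (simp only: gderiv_def)
          show "x \<in> {y. norm y < R}" using 1 by simp
          show "\<Phi> y = \<psi> y" if "y \<in> {y. norm y < R}" for y using \<Phi>_in[of y] that by (simp add: \<psi>_def)
        qed
        then show ?thesis using 1 by (simp add: gderiv_def G_def)
      next
        case 2
        have op: "open {y. R < norm (y::'a)}" by (intro open_Collect_less continuous_intros)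
        have "(\<psi> has_derivative (\<lambda>h. 0)) (at x)"
        proof (rule has_derivative_transform_within_open[OF has_derivative_const op])
          show "x \<in> {y. R < norm y}" using 2 by simp
          show "0 = \<psi> y" if "y \<in> {y. R < norm y}" for y using \<Phi>_out[of y] that by (simp add: \<psi>_def)
        qed
        then show ?thesis using 2 by (simp add: gderiv_def G_def)
      qed
    qed
    show "\<forall>x. 0 \<le> \<psi> x" by (simp add: \<psi>_def)
    show "\<exists>\<rho>. \<forall>x. \<rho> < norm x \<longrightarrow> \<psi> x = 0" by (rule exI[of _ R]) (simp add: \<psi>_eq)
  qed measurable
  have DN: "real DIM('a) = N" by (simp add: N_def n_def)
  \<comment> \<open>\<open>J\<close> plays the role of the Jacobian determinant of
    \<open>T\<close>.\<close>
  define J where "J x = f x / g (T x)" for x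
  \<comment> \<open>The dilation by \<open>s\<close> maps the source ball onto the target ball and
    has Jacobian \<open>s ^ n\<close>, which is the point where the tangent to the N-th root is
    taken.\<close>
  define s where "s = R' / R"
  have s: "0 < s" using R' Rp by (simp add: s_def)
  define DWn where "DWn x = norm (gv x + DU x) ^ n * indicator (ball 0 R) x" for x
  define ID where "ID = (LINT x|lborel. DWn x)"
  have [measurable]: "J \<in> borel_measurable borel" unfolding J_def by measurable
  have J_nn: "0 \<le> J x" for x using f_nn[of x] g_nn[of "T x"] by (simp add: J_def)
  have f_has: "integrable lborel f" "(LINT x|lborel. f x) = 1"
    using f_int f_nn by (auto intro!: integrableI_nonneg simp: integral_eq_nn_integral)
  have fT: "(\<integral>\<^sup>+x. ennreal (f x * norm (T x) powr q) \<partial>lborel) = ennreal (A R' / m')"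
  proof -
    have "(\<integral>\<^sup>+x. ennreal (f x * norm (T x) powr q) \<partial>lborel) = (\<integral>\<^sup>+x. ennreal (f x) * ennreal (norm (T x) powr q) \<partial>lborel)"
      using f_nn by (intro nn_integral_cong) (simp add: ennreal_mult)
    also have "\<dots> = (\<integral>\<^sup>+y. ennreal (g y) * ennreal (norm y powr q) \<partial>lborel)"
      by (rule push) measurable
    also have "\<dots> = (\<integral>\<^sup>+y. ennreal (dens y * norm y powr q * indicator (cball 0 R') y / m') \<partial>lborel)"
      using g_nn by (intro nn_integral_cong) (simp add: ennreal_mult[symmetric] g_ind mult_ac)
    also have "\<dots> = ennreal (LINT y|lborel. dens y * norm y powr q * indicator (cball 0 R') y / m')"
      using A_integrable[of R'] dens_pos m'
      by (intro nn_integral_eq_integral) (auto simp: less_imp_le)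
    finally show ?thesis by (simp add: A_def)
  qed
  have A_nn: "0 \<le> A R'" unfolding A_def using dens_pos by (intro integral_nonneg_AE AE_I2) (auto simp: less_imp_le)
  have fT_has: "integrable lborel (\<lambda>x. f x * norm (T x) powr q)" "(LINT x|lborel. f x * norm (T x) powr q) = A R' / m'"
    using fT f_nn A_nn m' by (auto intro!: integrableI_nonneg simp: integral_eq_nn_integral)
  \<comment> \<open>Change of variables: by the push-forward property \<open>1 / g (T x)\<close>
    integrates to the volume of the set where \<open>g\<close> is positive, the target ball.\<close>
  have J_int: "(\<integral>\<^sup>+x. ennreal (J x) \<partial>lborel) = ennreal (V * R' ^ n)"
  proof -
    have "(\<integral>\<^sup>+x. ennreal (J x) \<partial>lborel) = (\<integral>\<^sup>+x. ennreal (f x) * ennreal (1 / g (T x)) \<partial>lborel)"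
      using f_nn g_nn by (intro nn_integral_cong) (simp add: ennreal_mult[symmetric] J_def)
    also have "\<dots> = (\<integral>\<^sup>+y. ennreal (g y) * ennreal (1 / g y) \<partial>lborel)"
      by (rule push) measurable
    also have "\<dots> = (\<integral>\<^sup>+y. indicator (cball (0::'a) R') y \<partial>lborel)"
    proof (intro nn_integral_cong)
      fix y :: 'a
      show "ennreal (g y) * ennreal (1 / g y) = indicator (cball 0 R') y"
        using g_nn[of y] dens_pos[of y] m' by (subst ennreal_mult[symmetric]) (auto simp: g_def less_imp_neq[symmetric])
    qed
    also have "\<dots> = ennreal (V * R' ^ n)" using R' by (simp add: measure_cball_pow V_def N_def n_def)
    finally show ?thesis .
  qed
  have J_has: "integrable lborel J" "(LINT x|lborel. J x) = V * R' ^ n"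
    using J_int J_nn V R' by (auto intro!: integrableI_nonneg simp: integral_eq_nn_integral)
  have ind_has: "integrable lborel (indicator (ball (0::'a) R) :: 'a \<Rightarrow> real)"
    by (intro integrable_real_indicator) (auto simp: emeasure_lborel_ball_finite[simplified])
  have DWn_has: "integrable lborel DWn" unfolding DWn_def by (rule DW_integrable)
  have ID: "0 \<le> ID" unfolding ID_def DWn_def by (intro integral_nonneg_AE AE_I2) auto
  \<comment> \<open>\<open>L\<close> bounds the integrand on the left of the transport inequality
    from below and \<open>Q\<close> the one on the right from above. Their integrals are explicit in
    the masses, the moment, the volumes and the energy.\<close>
  define L where "L x = N * k1 * ZR * (f x + f x * norm (T x) powr q)
      - mR powr \<theta> * (s * (N - 1) * indicator (ball 0 R) x + J x / s ^ (n - 1))" for x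
  define Q where "Q x = \<theta> * (DWn x / (N * P ^ (n - 1)) + P / q * ZR * (f x * norm (T x) powr q))" for x
  have L_int: "integrable lborel L" unfolding L_def
    using f_has fT_has ind_has J_has by auto
  have Q_int: "integrable lborel Q" unfolding Q_def using DWn_has fT_has by auto
  have L_le: "AE x in lborel. L x \<le> \<psi> x * (N * J x powr (1 / N))"
    using gT
  proof eventually_elim
    case (elim x)
    show ?case
    proof (cases "norm x < R")
      case False
      then have "f x = 0" "J x = 0" by (auto simp: f_def J_def)
      then show ?thesis using False by (simp add: L_def \<psi>_eq)
    next
      case True
      then have "0 < f x" using EW_pos[of x] ZR by (simp add: f_def)
      then have "0 < g (T x)" using elim by simp
      then have gx: "g (T x) = dens (T x) / m'" by (simp add: g_def split: if_splits)
      \<comment> \<open>On the target \<open>1 / dens\<close> is \<open>V * \<alpha> ^ n\<close>, so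
        its N-th root is affine in the q-th power of the norm of \<open>T x\<close>. This property
        of the extremal density makes the left side computable.\<close>
      define \<alpha> where "\<alpha> = 1 + norm (T x) powr q"
      have \<alpha>: "0 < \<alpha>" unfolding \<alpha>_def by (rule one_powr)
      have "J x = (\<kappa> * V) * EW x * \<alpha> ^ n"
        unfolding J_def gx f_def \<kappa>_def dens_def \<alpha>_def[symmetric] using True ZR m' V \<alpha> by simp
      then have "J x powr (1 / N) = k1 * EW x powr (1 / N) * (\<alpha> ^ n) powr (1 / N)"
        using \<kappa> V EW_pos[of x] \<alpha> by (simp add: powr_mult k1_def)
      also have "(\<alpha> ^ n) powr (1 / N) = \<alpha>"
        using \<alpha> N dim by (simp add: powr_realpow[symmetric] N_def powr_powr)
      finally have Jr: "J x powr (1 / N) = k1 * EW x powr (1 / N) * \<alpha>" .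
      have "EW x powr \<theta> * J x powr (1 / N) = k1 * (EW x powr \<theta> * EW x powr (1 / N)) * \<alpha>"
        unfolding Jr by simp
      also have "\<dots> = k1 * EW x * \<alpha>" using \<theta> EW_pos[of x] by (simp add: powr_add[symmetric])
      finally have e0: "EW x powr \<theta> * J x powr (1 / N) = k1 * EW x * \<alpha>" .
      have fe: "ZR * f x = EW x" using True ZR by (simp add: f_def)
      have e1: "EW x powr \<theta> * J x powr (1 / N) = k1 * (ZR * f x) * \<alpha>" unfolding fe by (rule e0)
      have "N * J x powr (1 / N) \<le> N * (s * (N - 1) / N + J x / s ^ (n - 1) / N)"
        using N J_nn s by (intro mult_left_mono root_tangent) auto
      also have "\<dots> = s * (N - 1) + J x / s ^ (n - 1)" using N(4) by (simp add: distrib_left)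
      finally have e2: "mR powr \<theta> * (N * J x powr (1 / N)) \<le> mR powr \<theta> * (s * (N - 1) + J x / s ^ (n - 1))"
        by (intro mult_left_mono) auto
      have "\<psi> x * (N * J x powr (1 / N)) = N * (EW x powr \<theta> * J x powr (1 / N)) - mR powr \<theta> * (N * J x powr (1 / N))"
        using True by (simp add: \<psi>_eq \<Phi>_def algebra_simps)
      then show ?thesis using e1 e2 True by (simp add: L_def \<alpha>_def algebra_simps)
    qed
  qed
  have Q_ge: "- (G x \<bullet> T x) \<le> Q x" for x
  proof (cases "norm x < R")
    case False
    then show ?thesis by (simp add: G_def Q_def DWn_def f_def)
  next
    case True
    have "- ((gv x + DU x) \<bullet> T x) \<le> norm (gv x + DU x) * norm (T x)"
      using Cauchy_Schwarz_ineq2[of "gv x + DU x" "T x"] by linarith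
    then have "EW x powr \<theta> * - ((gv x + DU x) \<bullet> T x) \<le> EW x powr \<theta> * (norm (gv x + DU x) * norm (T x))"
      by (intro mult_left_mono) auto
    \<comment> \<open>The power of \<open>EW x\<close> is grouped with \<open>T x\<close>: as
      \<open>\<theta> * q = 1\<close>, its q-th power is \<open>EW x\<close> itself, and the
      resulting moment is known by push-forward.\<close>
    also have "\<dots> = norm (gv x + DU x) * (EW x powr \<theta> * norm (T x))" by simp
    also have "\<dots> \<le> norm (gv x + DU x) ^ n / (N * P ^ (n - 1)) + P * (EW x powr \<theta> * norm (T x)) powr q / q"
      using P by (intro young_weighted) auto
    also have "(EW x powr \<theta> * norm (T x)) powr q = EW x * norm (T x) powr q"
      using EW_pos[of x] \<theta> by (simp add: powr_mult powr_powr)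
    finally have "EW x powr \<theta> * - ((gv x + DU x) \<bullet> T x)
        \<le> norm (gv x + DU x) ^ n / (N * P ^ (n - 1)) + P * (EW x * norm (T x) powr q) / q" .
    moreover have "EW x = ZR * f x" using True ZR by (simp add: f_def)
    ultimately have "EW x powr \<theta> * - ((gv x + DU x) \<bullet> T x)
        \<le> norm (gv x + DU x) ^ n / (N * P ^ (n - 1)) + P * (ZR * f x * norm (T x) powr q) / q" by (simp only:)
    then have "\<theta> * (EW x powr \<theta> * - ((gv x + DU x) \<bullet> T x)) \<le> Q x"
      unfolding Q_def using \<theta> True by (intro mult_left_mono) (auto simp: DWn_def mult_ac)
    then show ?thesis using True by (simp add: G_def D\<Phi>_def)
  qed
  have Q_nn: "0 \<le> Q x" for x
    unfolding Q_def DWn_def using \<theta> f_nn[of x] N P q ZR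
    by (intro mult_nonneg_nonneg add_nonneg_nonneg divide_nonneg_nonneg) auto
  \<comment> \<open>The transport inequality lives in \<open>ennreal\<close>, so it controls the
    positive part of \<open>L\<close>. If the integral of \<open>L\<close> is not positive, the
    claim follows from \<open>0 \<le> Q\<close>.\<close>
  have LQ: "(LINT x|lborel. L x) \<le> (LINT x|lborel. Q x)"
  proof (cases "(LINT x|lborel. L x) \<le> 0")
    case True
    moreover have "0 \<le> (LINT x|lborel. Q x)" using Q_nn by (intro integral_nonneg_AE AE_I2)
    ultimately show ?thesis by linarith
  next
    case False
    have "(LINT x|lborel. L x) \<le> (LINT x|lborel. max 0 (L x))"
      using L_int by (intro integral_mono Bochner_Integration.integrable_max) auto
    then have "ennreal (LINT x|lborel. L x) \<le> ennreal (LINT x|lborel. max 0 (L x))" by (rule ennreal_leI)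
    also have "\<dots> = (\<integral>\<^sup>+x. ennreal (max 0 (L x)) \<partial>lborel)"
      using L_int by (intro nn_integral_eq_integral[symmetric] Bochner_Integration.integrable_max) auto
    also have "\<dots> \<le> (\<integral>\<^sup>+x. ennreal (\<psi> x * (N * J x powr (1 / N))) \<partial>lborel)"
    proof (rule nn_integral_mono_AE, use L_le in eventually_elim)
      fix x assume "L x \<le> \<psi> x * (N * J x powr (1 / N))"
      moreover have "0 \<le> \<psi> x * (N * J x powr (1 / N))" using N by (simp add: \<psi>_def)
      ultimately show "ennreal (max 0 (L x)) \<le> ennreal (\<psi> x * (N * J x powr (1 / N)))"
        by (intro ennreal_leI) simp
    qed
    also have "\<dots> \<le> ennreal (- (LINT x|lborel. G x \<bullet> T x))"
      using main unfolding J_def DN by simp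
    finally have le: "ennreal (LINT x|lborel. L x) \<le> ennreal (- (LINT x|lborel. G x \<bullet> T x))" .
    then have "(LINT x|lborel. L x) \<le> - (LINT x|lborel. G x \<bullet> T x)"
      using False by (subst (asm) ennreal_le_iff2) auto
    also have "\<dots> = (LINT x|lborel. - (G x \<bullet> T x))" by simp
    also have "\<dots> \<le> (LINT x|lborel. Q x)"
      using main Q_int Q_ge by (intro integral_mono) auto
    finally show ?thesis .
  qed
  have IL: "(LINT x|lborel. L x) = N * k1 * ZR * (1 + A R' / m') - mR powr \<theta> * (s * (N - 1) * (V * R ^ n) + V * R' ^ n / s ^ (n - 1))"
    unfolding L_def using f_has fT_has ind_has J_has by (simp add: volR)
  have IQ: "(LINT x|lborel. Q x) = \<theta> * (ID / (N * P ^ (n - 1)) + P / q * ZR * (A R' / m'))"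
    unfolding Q_def using DWn_has fT_has by (simp add: ID_def)
  have sn: "s * (N - 1) * (V * R ^ n) + V * R' ^ n / s ^ (n - 1) = N * V * R ^ (n - 1) * R'"
  proof -
    have e: "R ^ n = R ^ (n - 1) * R" "R' ^ n = R' ^ (n - 1) * R'"
      using dim power_minus_mult[of n R] power_minus_mult[of n R'] by auto
    have "s * (N - 1) * (V * R ^ n) = (N - 1) * V * R ^ (n - 1) * R'"
      unfolding e s_def using Rp by simp
    moreover have "V * R' ^ n / s ^ (n - 1) = V * R ^ (n - 1) * R'"
      unfolding e s_def power_divide using Rp R' by simp
    ultimately show ?thesis by (simp add: algebra_simps)
  qed
  have mRth: "mR powr \<theta> = V powr (- \<theta>) / (1 + R powr q) ^ (n - 1)"
  proof -
    have p: "0 < 1 + R powr q" by (simp add: add_pos_nonneg)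
    have "((1 + R powr q) ^ n) powr \<theta> = (1 + R powr q) powr (N * \<theta>)"
      using p by (simp add: powr_realpow[symmetric] powr_powr N_def)
    also have "\<dots> = (1 + R powr q) ^ (n - 1)"
      using p \<theta>(4) n1 by (simp add: mult.commute powr_realpow[symmetric])
    finally show ?thesis using V p unfolding mR_def by (simp add: powr_divide powr_mult powr_minus field_simps)
  qed
  have k1th: "k1 ^ (n - 1) = \<kappa> powr \<theta> * V powr \<theta>"
  proof -
    have "k1 ^ (n - 1) = k1 powr (N - 1)" using k1 n1 by (simp add: powr_realpow[symmetric])
    also have "\<dots> = (\<kappa> * V) powr \<theta>" using \<theta>(4) N by (simp add: k1_def powr_powr \<theta>_def diff_divide_distrib)
    finally show ?thesis using \<kappa> V by (simp add: powr_mult)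
  qed
  have "N * k1 * ZR * (1 + A R' / m') - mR powr \<theta> * (N * V * R ^ (n - 1) * R')
      \<le> \<theta> * (ID / (N * P ^ (n - 1)) + P / q * ZR * (A R' / m'))"
    using LQ unfolding IL IQ sn .
  \<comment> \<open>Of the \<open>N\<close> copies of \<open>k1 * ZR * (A R' / m')\<close> on the
    left, Young's inequality gives back \<open>N - 1\<close> on the right; the surviving one becomes
    the term \<open>A R'\<close> of the claim.\<close>
  moreover have "\<theta> * (P / q * ZR * (A R' / m')) = (N - 1) * k1 * ZR * (A R' / m')"
    using q \<theta>(4) by (simp add: P_def mult_ac)
  ultimately have "k1 * ZR * (N + A R' / m') \<le> mR powr \<theta> * (N * V * R ^ (n - 1) * R') + \<theta> * (ID / (N * P ^ (n - 1)))"
    by (simp add: algebra_simps)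
  \<comment> \<open>Multiplication by \<open>k1 ^ (n - 1)\<close> removes \<open>k1\<close> from
    \<open>P ^ (n - 1)\<close>, and \<open>k1 ^ n = \<kappa> * V\<close> turns the left side into
    masses; the remaining constants assemble to \<open>om\<close>.\<close>
  then have "k1 ^ (n - 1) * (k1 * ZR * (N + A R' / m'))
      \<le> k1 ^ (n - 1) * (mR powr \<theta> * (N * V * R ^ (n - 1) * R') + \<theta> * (ID / (N * P ^ (n - 1))))"
    using k1 by (intro mult_left_mono) auto
  moreover have "k1 ^ (n - 1) * (k1 * ZR * (N + A R' / m')) = V * (N * m' + A R')"
  proof -
    have "k1 ^ (n - 1) * k1 = \<kappa> * V" using k1n dim power_minus_mult[of n k1] by simp
    then have "k1 ^ (n - 1) * (k1 * ZR * (N + A R' / m')) = \<kappa> * V * ZR * (N + A R' / m')" by (metis mult.assoc)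
    also have "\<dots> = V * (N * m' + A R')" using ZR m' by (simp add: \<kappa>_def field_simps)
    finally show ?thesis .
  qed
  moreover have "k1 ^ (n - 1) * (mR powr \<theta> * (N * V * R ^ (n - 1) * R'))
      = V * (\<kappa> powr \<theta> * (N * R ^ (n - 1) * R' / (1 + R powr q) ^ (n - 1)))"
    unfolding k1th mRth using V by (simp add: powr_minus)
  moreover have "k1 ^ (n - 1) * (\<theta> * (ID / (N * P ^ (n - 1)))) = V * ((N - 1) / om * ID)"
  proof -
    have "P ^ (n - 1) = (q * N) ^ (n - 1) * k1 ^ (n - 1)" by (simp add: P_def power_mult_distrib)
    then have "k1 ^ (n - 1) * (\<theta> * (ID / (N * P ^ (n - 1)))) = \<theta> * ID / (N * (q * N) ^ (n - 1))"
      using k1 by simp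
    also have "\<theta> * ID / (N * (q * N) ^ (n - 1)) = (N - 1) / N * ID / (N * (q * N) ^ (n - 1))"
      using N(4) by (simp add: \<theta>_def diff_divide_distrib)
    also have "(N - 1) / N * ID / (N * (q * N) ^ (n - 1)) = V * ((N - 1) / om * ID)"
    proof -
      have "N ^ n = N ^ (n - 1) * N" using dim power_minus_mult[of n N] by auto
      then show ?thesis using V N(4) q(3) by (simp add: om_def power_mult_distrib)
    qed
    finally show ?thesis .
  qed
  ultimately have "V * (N * m' + A R') \<le> V * (\<kappa> powr \<theta> * (N * R ^ (n - 1) * R' / (1 + R powr q) ^ (n - 1)) + (N - 1) / om * ID)"
    by (simp add: distrib_left)
  then have "N * m' + A R' \<le> \<kappa> powr \<theta> * (N * R ^ (n - 1) * R' / (1 + R powr q) ^ (n - 1)) + (N - 1) / om * ID"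
    using V by simp
  then show ?thesis by (simp add: \<kappa>_def \<theta>_def ID_def DWn_def)
qed

end

section \<open>The limit of large radii\<close>

context onofri
begin

lemma inverse_one_powr_tendsto: "((\<lambda>R. 1 / (1 + R powr q)) \<longlongrightarrow> 0) at_top"
proof -
  have "filterlim (\<lambda>R. R powr q) at_top at_top"
  proof (rule filterlim_at_top_mono[OF filterlim_ident])
    show "\<forall>\<^sub>F R in at_top. R \<le> R powr q"
      using eventually_ge_at_top[of "1::real"]
    proof eventually_elim
      case (elim R)
      then show ?case using powr_mono[of 1 q R] q by simp
    qed
  qed
  then have "filterlim (\<lambda>R. 1 + R powr q) at_top at_top"
    by (intro filterlim_tendsto_add_at_top[OF tendsto_const])
  then show ?thesis by (rule real_tendsto_divide_at_top[OF tendsto_const])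
qed

lemma quotient_powr_tendsto: "((\<lambda>R. (R powr q / (1 + R powr q)) ^ k) \<longlongrightarrow> 1) at_top"
proof -
  have "((\<lambda>R. (1 - 1 / (1 + R powr q)) ^ k) \<longlongrightarrow> (1 - 0) ^ k) at_top"
    by (intro tendsto_intros inverse_one_powr_tendsto)
  moreover have "1 - 1 / (1 + R powr q) = R powr q / (1 + R powr q)" for R :: real
    using add_pos_nonneg[of 1 "R powr q"] by (simp add: field_simps)
  ultimately show ?thesis by simp
qed

lemma nn_integral_dens: "(\<integral>\<^sup>+x. ennreal (dens x) \<partial>lborel) = 1"
proof -
  have "(\<lambda>j. \<integral>\<^sup>+x. ennreal (dens x) * indicator (cball 0 (real j)) x \<partial>lborel) \<longlonglongrightarrow> (\<integral>\<^sup>+x. ennreal (dens x) \<partial>lborel)"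
  proof (rule nn_integral_LIMSEQ)
    show "incseq (\<lambda>j x. ennreal (dens x) * indicator (cball 0 (real j)) x)"
      by (auto simp: incseq_def le_fun_def indicator_def)
    show "(\<lambda>j. ennreal (dens x) * indicator (cball 0 (real j)) x) \<longlonglongrightarrow> ennreal (dens x)" for x
    proof (rule tendsto_eventually)
      obtain j0 :: nat where "norm x \<le> real j0" using real_arch_simple by blast
      show "\<forall>\<^sub>F j in sequentially. ennreal (dens x) * indicator (cball 0 (real j)) x = ennreal (dens x)"
        using eventually_ge_at_top[of j0]
      proof eventually_elim
        case (elim j)
        then have "norm x \<le> real j" using \<open>norm x \<le> real j0\<close> by linarith
        then show ?case by simp
      qed
    qed
  qed measurable
  moreover have "(\<lambda>j. \<integral>\<^sup>+x. ennreal (dens x) * indicator (cball 0 (real j)) x \<partial>lborel) \<longlonglongrightarrow> ennreal 1"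
    unfolding dens_ball[OF of_nat_0_le_iff]
  proof (rule tendsto_ennrealI)
    show "(\<lambda>j. (real j powr q / (1 + real j powr q)) ^ (n - 1)) \<longlonglongrightarrow> 1"
      by (rule filterlim_compose[OF quotient_powr_tendsto filterlim_real_sequentially])
  qed
  ultimately show ?thesis using LIMSEQ_unique by fastforce
qed

lemma dens_integrable: "integrable lborel dens" "(LINT x|lborel. dens x) = 1"
  using nn_integral_dens dens_pos
  by (auto intro!: integrableI_nonneg simp: integral_eq_nn_integral less_imp_le)

lemma dens_ball_integral:
  assumes "0 \<le> r"
  shows "(LINT x|lborel. dens x * indicator (ball 0 r) x) = (r powr q / (1 + r powr q)) ^ (n - 1)"
proof -
  have "(LINT x|lborel. dens x * indicator (ball 0 r) x) = (LINT x|lborel. dens x * indicator (cball 0 r) x)"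
    using AE_norm_neq[of r] by (intro integral_cong_AE) (auto elim!: eventually_mono simp: indicator_def)
  also have "\<dots> = enn2real (\<integral>\<^sup>+x. ennreal (dens x) * indicator (cball 0 r) x \<partial>lborel)"
    using dens_pos by (subst integral_eq_nn_integral) (auto simp: less_imp_le ennreal_mult ennreal_indicator)
  finally show ?thesis using assms by (simp add: dens_ball add_nonneg_nonneg)
qed

end

context onofri_perturbed
begin

lemma EW_diff_integrable: "integrable lborel (\<lambda>x. (exp (U x) - 1) * dens x)"
  using U_supp by (intro continuous_cball_integrable[where r = R0] continuous_intros U_cont continuous_dens) auto

definition Z :: real where "Z = 1 + (LINT x|lborel. (exp (U x) - 1) * dens x)"

lemma EW_has: "integrable lborel EW" "(LINT x|lborel. EW x) = Z"
proof -
  have e: "EW = (\<lambda>x. dens x + (exp (U x) - 1) * dens x)" by (simp add: EW_def fun_eq_iff algebra_simps)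
  show "integrable lborel EW" "(LINT x|lborel. EW x) = Z"
    unfolding e Z_def using dens_integrable EW_diff_integrable by simp_all
qed

lemma Z_pos: "0 < Z"
proof -
  have "0 \<le> Z" unfolding EW_has(2)[symmetric] using EW_pos by (intro integral_nonneg_AE) (auto simp: less_imp_le)
  moreover have "Z \<noteq> 0"
  proof
    assume "Z = 0"
    then have "AE x in lborel. EW x = 0"
      using integral_nonneg_eq_0_iff_AE[OF EW_has(1)] EW_has(2) EW_pos by (auto simp: less_imp_le)
    then have "AE x in (lborel :: 'a measure). False"
      by eventually_elim (use EW_pos in \<open>simp add: less_imp_neq[symmetric]\<close>)
    then show False by (simp add: AE_iff_null null_sets_def emeasure_lborel_UNIV)
  qed
  ultimately show ?thesis by simp
qed

lemma D_integrable: "integrable lborel (\<lambda>x. norm (gv x + DU x) ^ n - norm (gv x) ^ n)"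
  using DU_supp
  by (intro continuous_cball_integrable[where r = R0] continuous_intros continuous_gv DU_cont) auto

text \<open>Beyond \<open>R0\<close> the perturbation does not change the energy, so the difference
  of the energies is one fixed integral. The divergent part on the right of the estimate is thereby
  exactly \<open>A R\<close>.\<close>

lemma DW_ball:
  assumes "R0 < R"
  shows "(N - 1) / om * (LINT x|lborel. norm (gv x + DU x) ^ n * indicator (ball 0 R) x)
    = A R + (N - 1) / om * (LINT x|lborel. norm (gv x + DU x) ^ n - norm (gv x) ^ n)"
proof -
  have gvi: "integrable lborel (\<lambda>x. norm (gv x) ^ n * indicator (ball 0 R) x)"
  proof -
    have "integrable lborel (\<lambda>x. norm (gv x + DU x) ^ n * indicator (ball 0 R) x - (norm (gv x + DU x) ^ n - norm (gv x) ^ n))"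
      using DW_integrable D_integrable by simp
    also have "(\<lambda>x. norm (gv x + DU x) ^ n * indicator (ball 0 R) x - (norm (gv x + DU x) ^ n - norm (gv x) ^ n))
        = (\<lambda>x. norm (gv x) ^ n * indicator (ball 0 R) x)"
      using DU_supp assms by (auto simp: indicator_def fun_eq_iff)
    finally show ?thesis .
  qed
  have "(LINT x|lborel. norm (gv x + DU x) ^ n * indicator (ball 0 R) x)
      = (LINT x|lborel. norm (gv x) ^ n * indicator (ball 0 R) x + (norm (gv x + DU x) ^ n - norm (gv x) ^ n))"
    using DU_supp assms by (intro Bochner_Integration.integral_cong) (auto simp: indicator_def)
  also have "\<dots> = (LINT x|lborel. norm (gv x) ^ n * indicator (ball 0 R) x) + (LINT x|lborel. norm (gv x + DU x) ^ n - norm (gv x) ^ n)"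
    using gvi D_integrable by simp
  finally have e: "(LINT x|lborel. norm (gv x + DU x) ^ n * indicator (ball 0 R) x)
      = (LINT x|lborel. norm (gv x) ^ n * indicator (ball 0 R) x) + (LINT x|lborel. norm (gv x + DU x) ^ n - norm (gv x) ^ n)" .
  have "(N - 1) / om * (LINT x|lborel. norm (gv x) ^ n * indicator (ball 0 R) x)
      = (LINT x|lborel. ((N - 1) / om * norm (gv x) ^ n) * indicator (ball 0 R) x)"
    by (subst integral_mult_right_zero[symmetric]) (simp add: mult_ac)
  also have "\<dots> = (LINT x|lborel. dens x * norm x powr q * indicator (ball 0 R) x)"
    unfolding gv_pow_dens ..
  also have "\<dots> = A R" unfolding A_def
    using AE_norm_neq[of R] by (intro integral_cong_AE) (auto elim!: eventually_mono simp: indicator_def)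
  finally show ?thesis unfolding e by (simp add: distrib_left)
qed

lemma EW_ball:
  assumes "R0 < R"
  shows "(LINT x|lborel. EW x * indicator (ball 0 R) x) = (R powr q / (1 + R powr q)) ^ (n - 1) + (Z - 1)"
proof -
  have "(LINT x|lborel. EW x * indicator (ball 0 R) x)
      = (LINT x|lborel. dens x * indicator (ball 0 R) x + (exp (U x) - 1) * dens x)"
    using U_supp assms by (intro Bochner_Integration.integral_cong) (auto simp: indicator_def EW_def algebra_simps)
  also have "\<dots> = (LINT x|lborel. dens x * indicator (ball 0 R) x) + (Z - 1)"
    using dens_integrable(1) EW_diff_integrable
    by (subst Bochner_Integration.integral_add) (auto simp: Z_def intro!: integrable_real_mult_indicator)
  finally show ?thesis using assms R0 by (simp add: dens_ball_integral)
qed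

text \<open>On the ball of radius \<open>R0\<close> the density \<open>EW\<close> has a positive
  lower bound, and the value of \<open>dens\<close> on the sphere of radius \<open>R\<close>
  eventually falls below it. Between the two radii \<open>EW = dens\<close>, which decreases with
  the norm.\<close>

lemma EW_low: "\<forall>\<^sub>F R in at_top. \<forall>x. norm x < R \<longrightarrow> 1 / (V * (1 + R powr q) ^ n) \<le> EW x"
proof -
  obtain B where B: "0 \<le> B" "\<And>x. norm (U x) \<le> B"
    using continuous_cball_bounded[OF U_cont, of R0] U_supp less_imp_le by metis
  define c where "c = exp (- B) * (1 / (V * (1 + R0 powr q) ^ n))"
  have c: "0 < c" using V unfolding c_def by (simp add: add_pos_nonneg)
  have "((\<lambda>R. (1 / (1 + R powr q)) ^ n / V) \<longlongrightarrow> 0 ^ n / V) at_top"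
  proof (intro tendsto_divide tendsto_power tendsto_const)
    show "((\<lambda>R. 1 / (1 + R powr q)) \<longlongrightarrow> 0) at_top" by (rule inverse_one_powr_tendsto)
  qed (use V in auto)
  then have "((\<lambda>R. 1 / (V * (1 + R powr q) ^ n)) \<longlongrightarrow> 0) at_top"
    using dim by (simp add: power_divide mult.commute zero_power)
  then have "\<forall>\<^sub>F R in at_top. 1 / (V * (1 + R powr q) ^ n) < c" using c by (rule order_tendstoD(2))
  then show ?thesis using eventually_gt_at_top[of R0]
  proof eventually_elim
    case (elim R)
    show ?case
    proof (intro allI impI)
      fix x :: 'a assume x: "norm x < R"
      show "1 / (V * (1 + R powr q) ^ n) \<le> EW x"
      proof (cases "norm x \<le> R0")
        case True
        have "1 / (V * (1 + R0 powr q) ^ n) \<le> dens x"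
          unfolding dens_def using V one_powr[of x] q True R0
          by (intro divide_left_mono mult_left_mono power_mono add_left_mono powr_mono2 mult_pos_pos zero_less_power)
            (auto simp: add_pos_nonneg)
        then have "c \<le> EW x" unfolding c_def EW_def using B(2)[of x] V
          by (intro mult_mono) (auto simp: abs_le_iff add_nonneg_nonneg)
        then show ?thesis using elim by simp
      next
        case False
        have "1 / (V * (1 + R powr q) ^ n) \<le> dens x"
          unfolding dens_def using V one_powr[of x] q x R0
          by (intro divide_left_mono mult_left_mono power_mono add_left_mono powr_mono2 mult_pos_pos zero_less_power)
            (auto simp: add_pos_nonneg)
        then show ?thesis using False by (simp add: EW_def U_supp)
      qed
    qed
  qed
qed

text \<open>Both signs of \<open>ln a\<close> occur. For \<open>a \<ge> 1\<close> the lower bound on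
  the growth of \<open>A\<close> is used, with a factor tending to 1; for \<open>a < 1\<close> the
  upper bound on the growth from \<open>a * R\<close> to \<open>R\<close>.\<close>

lemma log_growth:
  assumes a: "0 < a"
  obtains c :: "real \<Rightarrow> real" where "(c \<longlongrightarrow> 1) at_top" "\<And>R. 0 < R \<Longrightarrow> c R * (N * ln a) \<le> A (a * R) - A R"
proof (cases "1 \<le> a")
  case True
  show ?thesis
  proof (rule that)
    show "((\<lambda>R. (R powr q / (1 + R powr q)) ^ n) \<longlongrightarrow> 1) at_top" by (rule quotient_powr_tendsto)
    show "(R powr q / (1 + R powr q)) ^ n * (N * ln a) \<le> A (a * R) - A R" if "0 < R" for R
      using A_diff_ge[of R "a * R"] that True by simp
  qed
next
  case False
  show ?thesis
  proof (rule that)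
    show "((\<lambda>R::real. 1 :: real) \<longlongrightarrow> 1) at_top" by simp
    show "1 * (N * ln a) \<le> A (a * R) - A R" if "0 < R" for R
      using A_diff_le[of "a * R" R] that False a by (simp add: ln_div)
  qed
qed

text \<open>With target radius \<open>a * R\<close> the divergent terms leave
  \<open>A (a * R) - A R\<close>, which contributes \<open>N * ln a = (N - 1) * ln Z\<close> in the
  limit. All mass quotients converge, and the first term on the right tends to \<open>N\<close>,
  which cancels the \<open>N\<close> on the left.\<close>

proposition onofri_compact_gradient:
  "ln Z \<le> 1 / om * (LINT x|lborel. norm (gv x + DU x) ^ n - norm (gv x) ^ n)"
proof -
  define \<theta> where "\<theta> = 1 - 1 / N"
  have \<theta>: "0 < \<theta>" using N by (simp add: \<theta>_def)
  \<comment> \<open>The best ratio of the radii: in the limit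
    \<open>N * ln a - N * a * Z powr (- \<theta>)\<close> is to be maximised.\<close>
  define a where "a = Z powr \<theta>"
  have a: "0 < a" using Z_pos by (simp add: a_def)
  define D where "D = (LINT x|lborel. norm (gv x + DU x) ^ n - norm (gv x) ^ n)"
  obtain c where c: "(c \<longlongrightarrow> 1) at_top" "\<And>R. 0 < R \<Longrightarrow> c R * (N * ln a) \<le> A (a * R) - A R"
    using log_growth[OF a] by metis
  define \<beta> where "\<beta> R = (R powr q / (1 + R powr q)) ^ (n - 1)" for R :: real
  have \<beta>_lim: "(\<beta> \<longlongrightarrow> 1) at_top"
    unfolding \<beta>_def by (rule quotient_powr_tendsto)
  have aR: "filterlim (\<lambda>R. a * R) at_top at_top"
    using a by (intro filterlim_tendsto_pos_mult_at_top[OF tendsto_const]) (auto simp: filterlim_ident)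
  have \<beta>a_lim: "((\<lambda>R. \<beta> (a * R)) \<longlongrightarrow> 1) at_top"
    using filterlim_compose[OF \<beta>_lim aR] .
  define X where "X R = N * \<beta> (a * R) + c R * (N * ln a)" for R
  define Y where "Y R = (\<beta> (a * R) / (\<beta> R + (Z - 1))) powr \<theta> * (N * a * \<beta> R) + (N - 1) / om * D" for R
  have "(X \<longlongrightarrow> N * 1 + 1 * (N * ln a)) at_top"
    unfolding X_def by (intro tendsto_intros \<beta>a_lim c)
  moreover have "(Y \<longlongrightarrow> (1 / (1 + (Z - 1))) powr \<theta> * (N * a * 1) + (N - 1) / om * D) at_top"
    unfolding Y_def using Z_pos by (intro tendsto_intros \<beta>a_lim \<beta>_lim) auto
  moreover have "\<forall>\<^sub>F R in at_top. X R \<le> Y R"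
    using EW_low eventually_gt_at_top[of R0]
  proof eventually_elim
    case (elim R)
    have R: "0 < R" using elim R0 by simp
    have "N * \<beta> (a * R) + A (a * R)
        \<le> (\<beta> (a * R) / (\<beta> R + (Z - 1))) powr \<theta> * (N * R ^ (n - 1) * (a * R) / (1 + R powr q) ^ (n - 1))
          + (A R + (N - 1) / om * D)"
      using onofri_finite_radius[of R "a * R"] elim a R
      unfolding EW_ball[OF elim(2)] DW_ball[OF elim(2)] \<beta>_def \<theta>_def D_def by simp
    moreover have e: "N * R ^ (n - 1) * (a * R) / (1 + R powr q) ^ (n - 1) = N * a * \<beta> R"
    proof -
      have "R ^ (n - 1) * R = (R powr q) ^ (n - 1)"
        using R dim power_minus_mult[of n R] powr_q_pow[of R] by simp
      then show ?thesis unfolding \<beta>_def power_divide by (simp add: mult_ac)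
    qed
    ultimately show ?case using c(2)[OF R] unfolding X_def Y_def e by linarith
  qed
  ultimately have le: "N * 1 + 1 * (N * ln a) \<le> (1 / (1 + (Z - 1))) powr \<theta> * (N * a * 1) + (N - 1) / om * D"
    by (intro tendsto_le[OF trivial_limit_at_top_linorder]) auto
  have e1: "(1 / (1 + (Z - 1))) powr \<theta> * (N * a * 1) = N"
    using Z_pos by (simp add: a_def powr_divide)
  have e2: "N * ln a = (N - 1) * ln Z"
    using Z_pos N by (simp add: a_def ln_powr \<theta>_def field_simps)
  have "(N - 1) * ln Z \<le> (N - 1) * (1 / om * D)" using le unfolding e1 e2 by simp
  then show ?thesis unfolding D_def using N(5) by (simp only: mult_le_cancel_left_pos)
qed

end

section \<open>The linear term and the divergence identity\<close>

context onofri
begin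

text \<open>The first-order Taylor remainder of the N-th power of the norm at \<open>gv x\<close>,
  with the gradient as a free argument so that approximating gradients can be inserted.\<close>

definition Hf :: "'a \<Rightarrow> 'a \<Rightarrow> real" where
  "Hf x b = norm (gv x + b) ^ n - norm (gv x) ^ n - N * norm (gv x) ^ (n - 2) * (gv x \<bullet> b)"

definition field_factor :: "'a \<Rightarrow> real" where
  "field_factor x = - ((N * q) ^ (n - 1) / (1 + norm x powr q) ^ (n - 1))"

lemma gv_field_factor: "norm (gv x) ^ (n - 2) *\<^sub>R gv x = field_factor x *\<^sub>R x"
  unfolding gv_field field_factor_def by simp

lemma field_factor_GDERIV:
  "GDERIV field_factor x :> ((N * q) ^ (n - 1) * (N - 1) / (1 + norm x powr q) ^ n * (q * norm x powr (q - 2))) *\<^sub>R x"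
proof -
  let ?s = "1 + norm x powr q"
  have p: "?s \<noteq> 0" using one_powr[of x] by simp
  have D: "((\<lambda>s. - ((N * q) ^ (n - 1) / (1 + s) ^ (n - 1))) has_real_derivative
      (N * q) ^ (n - 1) * (N - 1) / ?s ^ n) (at (norm x powr q))"
  proof -
    obtain k where k: "n = Suc (Suc k)" using le_Suc_ex[OF dim] by auto
    have Nk: "N - 1 = 1 + real k" unfolding N_def k by simp
    let ?K = "(N * q) ^ (n - 1)"
    have d: "((\<lambda>s. (1 + s) ^ Suc k) has_real_derivative real (Suc k) * ((0 + 1) * ?s ^ (Suc k - Suc 0))) (at (norm x powr q))"
      by (intro DERIV_power DERIV_add DERIV_const DERIV_ident)
    have alg: "- ((0 * (e * t) - ?K * (r * ((0 + 1) * e))) / ((e * t) * (e * t))) = ?K * r / (e * t * t)"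
      if "e \<noteq> 0" "t \<noteq> 0" for e t r :: real using that by (simp add: field_simps)
    have "((\<lambda>s. - (?K / (1 + s) ^ Suc k)) has_real_derivative
        - ((0 * ?s ^ Suc k - ?K * (real (Suc k) * ((0 + 1) * ?s ^ (Suc k - Suc 0)))) / (?s ^ Suc k * ?s ^ Suc k))) (at (norm x powr q))"
      using p by (intro DERIV_minus DERIV_divide DERIV_const d) auto
    then show ?thesis
      using alg[of "?s ^ k" ?s "real (Suc k)"] p k by (simp add: Nk mult_ac)
  qed
  show ?thesis
    using GDERIV_DERIV_compose[OF norm_powr_GDERIV[OF q(1)] D]
    by (simp add: field_factor_def[abs_def] mult_ac)
qed

lemma one_powr_neq_0: "1 + norm (x::'a) powr q \<noteq> 0"
  using one_powr[of x] by simp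

lemma continuous_field_factor: "continuous_on X field_factor"
  unfolding field_factor_def
  by (intro continuous_intros continuous_norm_powr) (simp add: one_powr_neq_0)

end

context onofri_perturbed
begin

text \<open>The difference quotient lemma for the constant function 1, all of whose difference
  quotients vanish.\<close>

lemma integral_partial_derivative_0:
  fixes \<phi> :: "'a \<Rightarrow> real"
  assumes D: "\<And>x. GDERIV \<phi> x :> G x" and cont: "continuous_on UNIV G" and b: "b \<in> Basis"
    and supp: "\<And>x. r < norm x \<Longrightarrow> \<phi> x = 0 \<and> G x = 0"
  shows "(LINT x|lborel. G x \<bullet> b) = 0" "integrable lborel (\<lambda>x. G x \<bullet> b)"
proof -
  have [measurable]: "G \<in> borel_measurable borel" using cont by (rule borel_measurable_continuous_onI)
  have "continuous_on UNIV \<phi>"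
    using D unfolding gderiv_def by (meson continuous_at_imp_continuous_on has_derivative_continuous)
  then have [measurable]: "\<phi> \<in> borel_measurable borel" by (rule borel_measurable_continuous_onI)
  obtain B where B: "\<And>x. norm (G x) \<le> B"
    using continuous_cball_bounded[OF cont, of r] supp by metis
  have lip: "\<bar>\<phi> x - \<phi> y\<bar> \<le> B * norm (x - y)" for x y
    by (rule GDERIV_bounded_imp_lipschitz[OF D B])
  have *: "(\<lambda>m. LINT x|lborel. \<phi> x * ((1 - 1) * real (Suc m))) \<longlonglongrightarrow> - (LINT x|lborel. (G x \<bullet> b) * 1)"
      "integrable lborel (\<lambda>x. (G x \<bullet> b) * 1)"
    using difference_quotient_integral_tendsto[of \<phi> G "\<lambda>_. 1" r B 1 b] supp lip D b by auto
  from *(1) have "(\<lambda>m. 0 :: real) \<longlonglongrightarrow> - (LINT x|lborel. (G x \<bullet> b) * 1)" by simp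
  then show "(LINT x|lborel. G x \<bullet> b) = 0" by (simp add: LIMSEQ_const_iff)
  show "integrable lborel (\<lambda>x. G x \<bullet> b)" using *(2) by simp
qed

lemma U_dens_integrable: "integrable lborel (\<lambda>x. U x * dens x)"
  using U_supp by (intro continuous_cball_integrable[where r = R0] continuous_intros U_cont continuous_dens) auto

text \<open>\<open>v\<close> solves a Liouville equation for the N-Laplacian: the divergence of
  \<open>field_factor x *\<^sub>R x\<close> is a constant multiple of \<open>dens\<close>. The
  derivative of \<open>(x \<bullet> b) * (U x * field_factor x)\<close> in direction
  \<open>b\<close>, summed over the basis, is the divergence of \<open>U\<close> times this field,
  and its integral vanishes because \<open>U\<close> has compact support.\<close>

lemma divergence_identity:
  "N * (LINT x|lborel. norm (gv x) ^ (n - 2) * (gv x \<bullet> DU x)) = om * (LINT x|lborel. U x * dens x)"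
  "integrable lborel (\<lambda>x. norm (gv x) ^ (n - 2) * (gv x \<bullet> DU x))"
proof -
  define c where "c = (N * q) ^ (n - 1)"
  define DF where "DF x = (c * (N - 1) / (1 + norm x powr q) ^ n * (q * norm x powr (q - 2))) *\<^sub>R x" for x :: 'a
  have DF: "GDERIV field_factor x :> DF x" for x
    using field_factor_GDERIV[of x] by (simp add: DF_def c_def)
  \<comment> \<open>Rewritten through \<open>gv\<close>, whose continuity at the origin is known, in
    place of the possibly singular power \<open>q - 2\<close>.\<close>
  have DF_alt: "DF x = - ((c * (N - 1) / N / (1 + norm x powr q) ^ (n - 1)) *\<^sub>R gv x)" for x
  proof -
    have "(1 + norm x powr q) ^ n = (1 + norm x powr q) ^ (n - 1) * (1 + norm x powr q)"
      using dim power_minus_mult[of n "1 + norm x powr q"] by auto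
    then show ?thesis using N(4) by (simp add: DF_def gv_def)
  qed
  have DF_cont: "continuous_on X DF" for X
    unfolding DF_alt
    by (intro continuous_intros continuous_norm_powr continuous_gv) (simp add: one_powr_neq_0)
  define G where "G b x = (U x * field_factor x) *\<^sub>R b + ((x \<bullet> b) * field_factor x) *\<^sub>R DU x + ((x \<bullet> b) * U x) *\<^sub>R DF x" for b x
  have GD: "GDERIV (\<lambda>x. (x \<bullet> b) * (U x * field_factor x)) x :> G b x" for b x
  proof -
    have "GDERIV (\<lambda>x. x \<bullet> b) x :> b" unfolding gderiv_def by (auto intro!: derivative_eq_intros)
    from GDERIV_mult[OF this GDERIV_mult[OF U_deriv[of x] DF[of x]]] show ?thesis
      by (simp add: G_def scaleR_add_right mult_ac add_ac)
  qed
  have Gcont: "continuous_on UNIV (G b)" for b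
    unfolding G_def by (intro continuous_intros U_cont DU_cont DF_cont continuous_field_factor)
  have G0: "(LINT x|lborel. G b x \<bullet> b) = 0" and Gint: "integrable lborel (\<lambda>x. G b x \<bullet> b)" if "b \<in> Basis" for b
    using integral_partial_derivative_0[OF GD Gcont that, of R0] U_supp DU_supp by (auto simp: G_def)
  have sumG: "(\<Sum>b\<in>Basis. G b x \<bullet> b) = norm (gv x) ^ (n - 2) * (gv x \<bullet> DU x) - c * N * V * (U x * dens x)" for x
  proof -
    have "(\<Sum>b\<in>Basis. G b x \<bullet> b)
        = (\<Sum>b\<in>(Basis::'a set). U x * field_factor x) + field_factor x * (\<Sum>b\<in>Basis. (x \<bullet> b) * (DU x \<bullet> b)) + U x * (\<Sum>b\<in>Basis. (x \<bullet> b) * (DF x \<bullet> b))"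
    proof -
      have "(\<Sum>b\<in>Basis. G b x \<bullet> b)
          = (\<Sum>b\<in>Basis. U x * field_factor x + field_factor x * ((x \<bullet> b) * (DU x \<bullet> b)) + U x * ((x \<bullet> b) * (DF x \<bullet> b)))"
        by (intro sum.cong) (auto simp: G_def inner_add_left mult_ac)
      then show ?thesis by (simp only: sum.distrib sum_distrib_left)
    qed
    also have "(\<Sum>b\<in>(Basis::'a set). U x * field_factor x) = N * (U x * field_factor x)"
      by (simp add: N_def n_def)
    also have "(\<Sum>b\<in>Basis. (x \<bullet> b) * (DU x \<bullet> b)) = x \<bullet> DU x" by (rule euclidean_inner[symmetric])
    also have "(\<Sum>b\<in>Basis. (x \<bullet> b) * (DF x \<bullet> b)) = x \<bullet> DF x" by (rule euclidean_inner[symmetric])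
    also have "x \<bullet> DF x = c * N * norm x powr q / (1 + norm x powr q) ^ n"
    proof -
      have e: "norm x powr (q - 2) * (x \<bullet> x) = norm x powr q"
      proof (cases "x = 0")
        case False
        then have "x \<bullet> x = norm x powr 2" by (simp add: power2_norm_eq_inner powr_numeral)
        then show ?thesis using powr_add[of "norm x" "q - 2" 2] by simp
      qed simp
      have "x \<bullet> DF x = c * ((N - 1) * q) / (1 + norm x powr q) ^ n * (norm x powr (q - 2) * (x \<bullet> x))"
        unfolding DF_def by simp
      then show ?thesis unfolding e q(4) by simp
    qed
    also have "field_factor x * (x \<bullet> DU x) = norm (gv x) ^ (n - 2) * (gv x \<bullet> DU x)"
      using arg_cong[OF gv_field_factor[of x], of "\<lambda>z. z \<bullet> DU x"] by simp
    also have "N * (U x * field_factor x) + norm (gv x) ^ (n - 2) * (gv x \<bullet> DU x) + U x * (c * N * norm x powr q / (1 + norm x powr q) ^ n)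
        = norm (gv x) ^ (n - 2) * (gv x \<bullet> DU x) - c * N * V * (U x * dens x)"
    proof -
      have s: "(1 + norm x powr q) ^ n = (1 + norm x powr q) ^ (n - 1) * (1 + norm x powr q)"
        using dim power_minus_mult[of n "1 + norm x powr q"] by auto
      have "field_factor x + c * norm x powr q / (1 + norm x powr q) ^ n = - (c * V * dens x)"
      proof -
        have "c / (p * r) = c / p - c * (r - 1) / (p * r)" if "p \<noteq> 0" "r \<noteq> 0" for p r :: real
          using that by (simp add: field_simps)
        from this[of "(1 + norm x powr q) ^ (n - 1)" "1 + norm x powr q"]
        show ?thesis using one_powr[of x] V by (simp add: field_factor_def dens_def s c_def)
      qed
      then have "N * U x * (field_factor x + c * norm x powr q / (1 + norm x powr q) ^ n) = N * U x * (- (c * V * dens x))"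
        by simp
      then show ?thesis by (simp add: algebra_simps)
    qed
    finally show ?thesis .
  qed
  have i1: "integrable lborel (\<lambda>x. \<Sum>b\<in>Basis. G b x \<bullet> b)" using Gint by auto
  have i2: "(LINT x|lborel. (\<Sum>b\<in>Basis. G b x \<bullet> b)) = 0"
    using G0 Gint by (subst Bochner_Integration.integral_sum) auto
  have ii: "integrable lborel (\<lambda>x. norm (gv x) ^ (n - 2) * (gv x \<bullet> DU x) - c * N * V * (U x * dens x))"
    using i1 unfolding sumG .
  have "integrable lborel (\<lambda>x. (norm (gv x) ^ (n - 2) * (gv x \<bullet> DU x) - c * N * V * (U x * dens x)) + c * N * V * (U x * dens x))"
    using ii U_dens_integrable by (intro Bochner_Integration.integrable_add integrable_mult_right) auto
  then show i3: "integrable lborel (\<lambda>x. norm (gv x) ^ (n - 2) * (gv x \<bullet> DU x))" by simp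
  have "(LINT x|lborel. norm (gv x) ^ (n - 2) * (gv x \<bullet> DU x)) = c * N * V * (LINT x|lborel. U x * dens x)"
    using i2 i3 U_dens_integrable unfolding sumG by simp
  moreover have "N * (c * N * V) = om"
  proof -
    have "N ^ n = N ^ (n - 1) * N" using dim power_minus_mult[of n N] by auto
    then show ?thesis by (simp add: om_def c_def power_mult_distrib)
  qed
  ultimately show "N * (LINT x|lborel. norm (gv x) ^ (n - 2) * (gv x \<bullet> DU x)) = om * (LINT x|lborel. U x * dens x)"
    by (metis mult.assoc)
qed

text \<open>By the divergence identity the linear term of \<open>Hf\<close> integrates to
  \<open>om\<close> times the mean of \<open>U\<close>. Passing from the difference of powers to
  \<open>Hf\<close> therefore subtracts just the mean that the right side adds.\<close>

proposition onofri_smooth: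
  "(\<integral>\<^sup>+x. ennreal (exp (U x) * dens x) \<partial>lborel)
    \<le> ennreal (exp (1 / om * (LINT x|lborel. Hf x (DU x)) + (LINT x|lborel. U x * dens x)))"
  "integrable lborel (\<lambda>x. Hf x (DU x))"
proof -
  have H: "(\<lambda>x. Hf x (DU x)) = (\<lambda>x. (norm (gv x + DU x) ^ n - norm (gv x) ^ n) - N * (norm (gv x) ^ (n - 2) * (gv x \<bullet> DU x)))"
    by (simp add: Hf_def fun_eq_iff)
  show "integrable lborel (\<lambda>x. Hf x (DU x))"
    unfolding H using D_integrable divergence_identity(2) by auto
  have "(LINT x|lborel. Hf x (DU x)) = (LINT x|lborel. norm (gv x + DU x) ^ n - norm (gv x) ^ n) - om * (LINT x|lborel. U x * dens x)"
    unfolding H divergence_identity(1)[symmetric] using D_integrable divergence_identity(2) by simp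
  then have e: "1 / om * (LINT x|lborel. Hf x (DU x)) + (LINT x|lborel. U x * dens x)
      = 1 / om * (LINT x|lborel. norm (gv x + DU x) ^ n - norm (gv x) ^ n)"
    using om_pos by (simp add: field_simps)
  have "Z \<le> exp (1 / om * (LINT x|lborel. Hf x (DU x)) + (LINT x|lborel. U x * dens x))"
    unfolding e using onofri_compact_gradient Z_pos by (metis exp_ln exp_le_cancel_iff)
  moreover have "(\<integral>\<^sup>+x. ennreal (exp (U x) * dens x) \<partial>lborel) = ennreal Z"
    using EW_has EW_pos by (subst nn_integral_eq_integral) (auto simp: EW_def[abs_def] less_imp_le dens_pos)
  ultimately show "(\<integral>\<^sup>+x. ennreal (exp (U x) * dens x) \<partial>lborel)
    \<le> ennreal (exp (1 / om * (LINT x|lborel. Hf x (DU x)) + (LINT x|lborel. U x * dens x)))"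
    by (simp add: ennreal_leI)
qed

end

section \<open>Mollifiers\<close>

text \<open>Polynomials \<open>p\<close> are needed because \<open>p (1/t) e\<^bsup>-1/t\<^esup>\<close> is a class closed under differentiation.\<close>

definition flat :: "real poly \<Rightarrow> real \<Rightarrow> real" where
  "flat p t = (if t > 0 then poly p (1 / t) * exp (- (1 / t)) else 0)"

lemma poly_exp_tendsto_0: "((\<lambda>s. poly p s * exp (- s)) \<longlongrightarrow> 0) at_top" for p :: "real poly"
proof (induction p)
  case 0
  then show ?case by simp
next
  case (pCons a p)
  have "((\<lambda>s. s * (poly p s * exp (- s))) \<longlongrightarrow> 0) at_top"
  proof -
    have *: "((\<lambda>s::real. s ^ k * exp (- s)) \<longlongrightarrow> 0) at_top" for k :: nat
      using tendsto_power_div_exp_0[of k] by (simp add: exp_minus divide_inverse)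
    have "((\<lambda>s. \<Sum>i\<le>degree p. coeff p i * (s ^ Suc i * exp (- s))) \<longlongrightarrow> (\<Sum>i\<le>degree p. coeff p i * 0)) at_top"
      by (intro tendsto_sum tendsto_mult tendsto_const *)
    moreover have "(\<Sum>i\<le>degree p. coeff p i * (s ^ Suc i * exp (- s))) = s * (poly p s * exp (- s))" for s
      unfolding poly_altdef sum_distrib_left sum_distrib_right by (intro sum.cong) auto
    ultimately show ?thesis by simp
  qed
  moreover have "((\<lambda>s. a * exp (- s)) \<longlongrightarrow> a * 0) at_top"
    by (intro tendsto_mult tendsto_const filterlim_compose[OF exp_at_bot filterlim_uminus_at_bot_at_top])
  ultimately have "((\<lambda>s. a * exp (- s) + s * (poly p s * exp (- s))) \<longlongrightarrow> a * 0 + 0) at_top"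
    by (intro tendsto_add)
  then show ?case by (simp add: algebra_simps)
qed

lemma flat_div_tendsto: "((\<lambda>t. flat p t / t) \<longlongrightarrow> 0) (at 0)"
proof -
  have "((\<lambda>s. poly ([:0, 1:] * p) s * exp (- s)) \<longlongrightarrow> 0) at_top" by (rule poly_exp_tendsto_0)
  then have "((\<lambda>t. poly ([:0, 1:] * p) (inverse t) * exp (- inverse t)) \<longlongrightarrow> 0) (at_right 0)"
    by (rule filterlim_compose[OF _ filterlim_inverse_at_top_right])
  then have R: "((\<lambda>t. flat p t / t) \<longlongrightarrow> 0) (at_right 0)"
    by (rule Lim_transform_eventually)
      (auto simp: flat_def eventually_at_filter divide_inverse intro!: always_eventually)
  have L: "((\<lambda>t. flat p t / t) \<longlongrightarrow> 0) (at_left 0)"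
    by (rule Lim_transform_eventually[OF tendsto_const])
      (auto simp: flat_def eventually_at_filter intro!: always_eventually)
  show ?thesis using L R by (simp add: filterlim_at_split)
qed

text \<open>With \<open>s = 1 / t\<close> the derivative in \<open>t\<close> is \<open>- s^2\<close>
  times the derivative in \<open>s\<close>, and the latter turns \<open>p\<close> into
  \<open>pderiv p - p\<close>; hence the polynomial. At \<open>t = 0\<close> the exponential beats
  every polynomial.\<close>

lemma flat_derivative: "(flat p has_real_derivative flat ([:0, 0, 1:] * (p - pderiv p)) t) (at t)"
proof -
  consider "t > 0" | "t < 0" | "t = 0" by linarith
  then show ?thesis
  proof cases
    case 1
    have "((\<lambda>t. poly p (1 / t) * exp (- (1 / t))) has_real_derivative
        poly (pderiv p) (1 / t) * (- 1 / t\<^sup>2) * exp (- (1 / t)) + poly p (1 / t) * (exp (- (1 / t)) * (1 / t\<^sup>2))) (at t)"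
      using 1 by (auto intro!: derivative_eq_intros DERIV_chain2[OF poly_DERIV] simp: power2_eq_square)
    moreover have "poly (pderiv p) (1 / t) * (- 1 / t\<^sup>2) * exp (- (1 / t)) + poly p (1 / t) * (exp (- (1 / t)) * (1 / t\<^sup>2))
        = flat ([:0, 0, 1:] * (p - pderiv p)) t"
      using 1 by (simp add: flat_def algebra_simps power2_eq_square)
    moreover have "\<forall>\<^sub>F s in nhds t. poly p (1 / s) * exp (- (1 / s)) = flat p s"
      using eventually_nhds_in_open[of "{0<..}" t] 1 by (auto elim!: eventually_mono simp: flat_def)
    ultimately show ?thesis by (simp add: DERIV_cong_ev)
  next
    case 2
    have "\<forall>\<^sub>F s in nhds t. 0 = flat p s"
      using eventually_nhds_in_open[of "{..<0}" t] 2 by (auto elim!: eventually_mono simp: flat_def)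
    then have "(flat p has_real_derivative 0) (at t) \<longleftrightarrow> ((\<lambda>s. 0) has_real_derivative 0) (at t)"
      using DERIV_cong_ev[OF refl, of "\<lambda>s. 0" "flat p" t 0 0] by simp
    then show ?thesis using 2 by (simp add: flat_def)
  next
    case 3
    then show ?thesis using flat_div_tendsto[of p] by (simp add: DERIV_def flat_def[of _ 0])
  qed
qed

section \<open>Iterated differentiability and bump functions\<close>

lemma continuously_diff_Suc_imp: "continuously_diff (Suc k) f \<Longrightarrow> continuously_diff k f"
proof (induction k arbitrary: f)
  case 0
  then show ?case
    by (auto intro!: continuous_at_imp_continuous_on differentiable_imp_continuous_within)
next
  case (Suc k)
  have "continuously_diff k (\<lambda>x. frechet_derivative f (at x) h)" for h
    using Suc.prems by (intro Suc.IH) simp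
  then show ?case using Suc.prems by simp
qed

lemma continuously_diff_const: "continuously_diff k (\<lambda>x. c)"
proof (induction k arbitrary: c)
  case (Suc k)
  have "frechet_derivative (\<lambda>x. c) (at x) = (\<lambda>h. 0)" for x
    by (rule frechet_derivative_at[symmetric]) (rule has_derivative_const)
  then show ?case using Suc by simp
qed simp

lemma continuously_diff_SucI:
  assumes "\<And>x. (f has_derivative f' x) (at x)" "\<And>h. continuously_diff k (\<lambda>x. f' x h)"
  shows "continuously_diff (Suc k) f"
proof -
  have "frechet_derivative f (at x) = f' x" for x
    by (rule frechet_derivative_at[symmetric]) (rule assms(1))
  then show ?thesis using assms by (auto simp: differentiable_def)
qed

lemma continuously_diff_SucD:
  assumes "continuously_diff (Suc k) f"
  shows "(f has_derivative frechet_derivative f (at x)) (at x)"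
    "continuously_diff k (\<lambda>x. frechet_derivative f (at x) h)"
  using assms by (auto simp: frechet_derivative_works[symmetric])

lemma continuously_diff_add:
  "continuously_diff k f \<Longrightarrow> continuously_diff k g \<Longrightarrow> continuously_diff k (\<lambda>x. f x + g x)"
proof (induction k arbitrary: f g)
  case 0
  then show ?case by (simp add: continuous_intros)
next
  case (Suc k)
  show ?case
    by (rule continuously_diff_SucI[where f' = "\<lambda>x h. frechet_derivative f (at x) h + frechet_derivative g (at x) h"])
      (intro has_derivative_add Suc.IH continuously_diff_SucD[OF Suc.prems(1)] continuously_diff_SucD[OF Suc.prems(2)])+
qed

lemma continuously_diff_mult:
  fixes f g :: "'a::real_normed_vector \<Rightarrow> real"
  shows "continuously_diff k f \<Longrightarrow> continuously_diff k g \<Longrightarrow> continuously_diff k (\<lambda>x. f x * g x)"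
proof (induction k arbitrary: f g)
  case 0
  then show ?case by (simp add: continuous_intros)
next
  case (Suc k)
  show ?case
    by (rule continuously_diff_SucI[where f' = "\<lambda>x h. f x * frechet_derivative g (at x) h + frechet_derivative f (at x) h * g x"])
      (intro has_derivative_mult continuously_diff_add Suc.IH continuously_diff_SucD[OF Suc.prems(1)]
        continuously_diff_SucD[OF Suc.prems(2)] continuously_diff_Suc_imp[OF Suc.prems(1)] continuously_diff_Suc_imp[OF Suc.prems(2)])+
qed

definition bump :: "real \<Rightarrow> 'a::real_inner \<Rightarrow> real" where
  "bump r x = flat 1 (r\<^sup>2 - x \<bullet> x)"

lemma continuously_diff_bounded_linear:
  fixes f :: "'a::real_normed_vector \<Rightarrow> real"
  assumes "bounded_linear f"
  shows "continuously_diff k (\<lambda>x. f x + c)"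
proof (cases k)
  case 0
  then show ?thesis using assms
    by (auto intro!: continuous_intros simp: linear_continuous_on)
next
  case (Suc j)
  have "((\<lambda>x. f x + c) has_derivative f) (at x)" for x
    using assms by (auto intro!: derivative_eq_intros bounded_linear_imp_has_derivative)
  then show ?thesis unfolding Suc by (rule continuously_diff_SucI) (rule continuously_diff_const)
qed

text \<open>The polynomial is generalised: each directional derivative is an affine function times
  an expression of the same form with another polynomial, to which the induction hypothesis
  applies.\<close>

lemma flat_norm_continuously_diff:
  fixes a :: "'a::real_inner"
  shows "continuously_diff k (\<lambda>x. flat p (c - (x - a) \<bullet> (x - a)))"
proof (induction k arbitrary: p)
  case 0
  have "continuous_on UNIV (flat p)"
    using flat_derivative by (meson DERIV_continuous continuous_at_imp_continuous_on)
  then show ?case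
    by (auto intro!: continuous_on_compose2[of UNIV "flat p"] continuous_intros)
next
  case (Suc k)
  let ?p' = "[:0, 0, 1:] * (p - pderiv p)"
  let ?f' = "\<lambda>x h. (h \<bullet> ((-2) *\<^sub>R (x - a))) * flat ?p' (c - (x - a) \<bullet> (x - a))"
  show ?case
  proof (rule continuously_diff_SucI[where f' = ?f'])
    fix x
    have d: "((\<lambda>x. c - (x - a) \<bullet> (x - a)) has_derivative (\<lambda>h. h \<bullet> ((-2) *\<^sub>R (x - a)))) (at x)"
      by (auto intro!: derivative_eq_intros simp: inner_commute algebra_simps)
    have "((\<lambda>x. flat p (c - (x - a) \<bullet> (x - a))) has_derivative
        (\<lambda>h. (h \<bullet> ((-2) *\<^sub>R (x - a))) * flat ?p' (c - (x - a) \<bullet> (x - a)))) (at x)"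
      using has_derivative_compose[OF d flat_derivative[unfolded has_field_derivative_def]]
      by (simp add: mult.commute)
    then show "((\<lambda>x. flat p (c - (x - a) \<bullet> (x - a))) has_derivative ?f' x) (at x)" .
  next
    fix h :: 'a
    have "bounded_linear (\<lambda>x. h \<bullet> ((-2) *\<^sub>R x))"
      by (intro bounded_linear_inner_right_comp bounded_linear_scaleR_right)
    from continuously_diff_bounded_linear[OF this, of k "h \<bullet> (2 *\<^sub>R a)"]
    have "continuously_diff k (\<lambda>x. h \<bullet> ((-2) *\<^sub>R (x - a)))" by (simp add: algebra_simps)
    then show "continuously_diff k (\<lambda>x. ?f' x h)" by (intro continuously_diff_mult Suc.IH)
  qed
qed

definition bump_grad :: "real \<Rightarrow> 'a::real_inner \<Rightarrow> 'a" where
  "bump_grad r x = (- 2 * flat [:0, 0, 1:] (r\<^sup>2 - x \<bullet> x)) *\<^sub>R x"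

lemma bump_GDERIV: "GDERIV (bump r) x :> bump_grad r x"
proof -
  have d: "((\<lambda>x. r\<^sup>2 - x \<bullet> x) has_derivative (\<lambda>h. h \<bullet> ((-2) *\<^sub>R x))) (at x)"
    by (auto intro!: derivative_eq_intros simp: inner_commute algebra_simps)
  show ?thesis
    using has_derivative_compose[OF d flat_derivative[of 1, unfolded has_field_derivative_def]]
    by (simp add: gderiv_def bump_def[abs_def] bump_grad_def mult_ac)
qed

lemma bump_nonneg: "0 \<le> bump r x" by (simp add: bump_def flat_def)

lemma bump_eq_0: "0 \<le> r \<Longrightarrow> r \<le> norm x \<Longrightarrow> bump r x = 0" "0 \<le> r \<Longrightarrow> r \<le> norm x \<Longrightarrow> bump_grad r x = 0"
  using power_mono[of r "norm x" 2]
  by (auto simp: bump_def bump_grad_def flat_def power2_norm_eq_inner)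

lemma bump_pos: "norm x < r \<Longrightarrow> 0 < bump r x"
  using power_strict_mono[of "norm x" r 2] by (simp add: bump_def flat_def power2_norm_eq_inner)

lemma continuous_flat: "continuous_on X (flat p)"
  using flat_derivative by (meson DERIV_continuous continuous_at_imp_continuous_on)

lemma continuous_bump: "continuous_on X (bump r)" "continuous_on X (bump_grad r)"
  unfolding bump_def bump_grad_def
  by (intro continuous_on_compose2[OF continuous_flat[of UNIV]] continuous_intros; simp)+

lemma bump_measurable[measurable]:
  "(bump r :: 'a::euclidean_space \<Rightarrow> real) \<in> borel_measurable borel"
  "(bump_grad r :: 'a::euclidean_space \<Rightarrow> 'a) \<in> borel_measurable borel"
  by (rule borel_measurable_continuous_onI, rule continuous_bump)+

lemma bump_test_function:
  fixes x :: "'a::euclidean_space"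
  assumes "0 \<le> r"
  shows "test_function (\<lambda>y. bump r (x - y))"
  unfolding test_function_def
proof (intro conjI allI)
  fix k
  have "(x - y) \<bullet> (x - y) = (y - x) \<bullet> (y - x)" for y by (simp add: inner_commute algebra_simps)
  then show "continuously_diff k (\<lambda>y. bump r (x - y))"
    using flat_norm_continuously_diff[of k 1 "r\<^sup>2" x] by (simp add: bump_def)
  have "{y. bump r (x - y) \<noteq> 0} \<subseteq> cball x r"
  proof
    fix y assume "y \<in> {y. bump r (x - y) \<noteq> 0}"
    then have "\<not> r \<le> norm (x - y)" using bump_eq_0(1)[OF assms, of "x - y"] by auto
    then show "y \<in> cball x r" by (simp add: dist_norm)
  qed
  then have "closure {y. bump r (x - y) \<noteq> 0} \<subseteq> cball x r" by (intro closure_minimal) auto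
  then show "compact (closure {y. bump r (x - y) \<noteq> 0})"
    using compact_cball bounded_subset compact_eq_bounded_closed by blast
qed

section \<open>Continuity of translations in L1\<close>

lemma integrable_translate:
  fixes f :: "'a::euclidean_space \<Rightarrow> 'b::{banach, second_countable_topology}"
  assumes "integrable lborel f"
  shows "integrable lborel (\<lambda>x. f (x + h))"
proof -
  have "integrable (distr lborel borel ((+) h)) f" using assms by (simp add: lborel_distr_plus)
  then show ?thesis by (subst (asm) integrable_distr_eq) (use assms in \<open>auto simp: add.commute\<close>)
qed

lemma integral_translate:
  fixes f :: "'a::euclidean_space \<Rightarrow> 'b::{banach, second_countable_topology}"
  assumes [measurable]: "f \<in> borel_measurable borel"
  shows "(LINT x|lborel. f (x + h)) = (LINT x|lborel. f x)"
  by (subst (2) lborel_distr_plus[symmetric, of h], subst integral_distr) (auto simp: add.commute)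

lemma lborel_reflect: "lborel = distr lborel borel (\<lambda>y. x - y)" for x :: "'a::euclidean_space"
proof -
  have "lborel = density (distr lborel borel (\<lambda>y. x + (-1) *\<^sub>R y)) (\<lambda>_. \<bar>-1::real\<bar> ^ DIM('a))"
    by (rule lborel_affine) simp
  then show ?thesis by (simp add: density_1)
qed

lemma integral_reflect:
  fixes f :: "'a::euclidean_space \<Rightarrow> 'b::{banach, second_countable_topology}"
  assumes [measurable]: "f \<in> borel_measurable borel"
  shows "(LINT y|lborel. f (x - y)) = (LINT x|lborel. f x)"
  by (subst (2) lborel_reflect[of x], subst integral_distr) auto

lemma integrable_reflect:
  fixes f :: "'a::euclidean_space \<Rightarrow> 'b::{banach, second_countable_topology}"
  assumes f: "integrable lborel f"
  shows "integrable lborel (\<lambda>y. f (x - y))"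
proof -
  have [measurable]: "f \<in> borel_measurable borel" using f by auto
  have "integrable (distr lborel borel (\<lambda>y. x - y)) f" using f lborel_reflect[of x] by simp
  then show ?thesis by (subst (asm) integrable_distr_eq) auto
qed

definition translation_continuous :: "('a::euclidean_space \<Rightarrow> 'b::{banach, second_countable_topology}) \<Rightarrow> bool" where
  "translation_continuous f \<longleftrightarrow> integrable lborel f \<and>
     (\<forall>h. h \<longlonglongrightarrow> 0 \<longrightarrow> (\<lambda>j. LINT x|lborel. norm (f (x + h j) - f x)) \<longlonglongrightarrow> 0)"

text \<open>Translations are isometries of L1, so the property passes to limits by the usual
  argument with three thirds of \<open>e\<close>.\<close>

lemma translation_continuous_approx:
  assumes f: "integrable lborel f"
    and approx: "\<And>e. 0 < e \<Longrightarrow> \<exists>g. translation_continuous g \<and> (LINT x|lborel. norm (f x - g x)) < e"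
  shows "translation_continuous f"
  unfolding translation_continuous_def
proof (intro conjI f allI impI)
  fix h :: "nat \<Rightarrow> 'a" assume h: "h \<longlonglongrightarrow> 0"
  show "(\<lambda>j. LINT x|lborel. norm (f (x + h j) - f x)) \<longlonglongrightarrow> 0"
  proof (rule LIMSEQ_I)
    fix e :: real assume e: "0 < e"
    obtain g where g: "translation_continuous g" "(LINT x|lborel. norm (f x - g x)) < e / 3"
      using approx[of "e / 3"] e by auto
    have gi: "integrable lborel g" using g by (simp add: translation_continuous_def)
    have "(\<lambda>j. LINT x|lborel. norm (g (x + h j) - g x)) \<longlonglongrightarrow> 0"
      using g h by (simp add: translation_continuous_def)
    then obtain J where J: "\<And>j. j \<ge> J \<Longrightarrow> (LINT x|lborel. norm (g (x + h j) - g x)) < e / 3"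
      using order_tendstoD(2)[of _ 0 sequentially "e / 3"] e by (auto simp: eventually_sequentially)
    show "\<exists>J. \<forall>j\<ge>J. norm ((LINT x|lborel. norm (f (x + h j) - f x)) - 0) < e"
    proof (intro exI[of _ J] allI impI)
      fix j assume j: "J \<le> j"
      have i1: "integrable lborel (\<lambda>x. norm (f (x + h j) - g (x + h j)))"
        using integrable_translate[OF Bochner_Integration.integrable_diff[OF f gi], of "h j"] by simp
      have i2: "integrable lborel (\<lambda>x. norm (g (x + h j) - g x))"
        using integrable_translate[OF gi, of "h j"] gi by simp
      have i3: "integrable lborel (\<lambda>x. norm (f x - g x))" using f gi by simp
      have i0: "integrable lborel (\<lambda>x. norm (f (x + h j) - f x))"
        using integrable_translate[OF f, of "h j"] f by simp
      have "(LINT x|lborel. norm (f (x + h j) - f x))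
          \<le> (LINT x|lborel. norm (f (x + h j) - g (x + h j)) + norm (g (x + h j) - g x) + norm (f x - g x))"
      proof (rule integral_mono)
        fix x
        have "norm (f (x + h j) - f x) = norm ((f (x + h j) - g (x + h j)) + (g (x + h j) - g x) - (f x - g x))" by simp
        also have "\<dots> \<le> norm ((f (x + h j) - g (x + h j)) + (g (x + h j) - g x)) + norm (f x - g x)"
          by (rule norm_triangle_ineq4)
        also have "\<dots> \<le> norm (f (x + h j) - g (x + h j)) + norm (g (x + h j) - g x) + norm (f x - g x)"
          by (intro add_right_mono norm_triangle_ineq)
        finally show "norm (f (x + h j) - f x)
            \<le> norm (f (x + h j) - g (x + h j)) + norm (g (x + h j) - g x) + norm (f x - g x)" .
      qed (use i0 i1 i2 i3 in auto)
      also have "\<dots> = (LINT x|lborel. norm (f (x + h j) - g (x + h j))) + (LINT x|lborel. norm (g (x + h j) - g x)) + (LINT x|lborel. norm (f x - g x))"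
        using i1 i2 i3 by simp
      also have "(LINT x|lborel. norm (f (x + h j) - g (x + h j))) = (LINT x|lborel. norm (f x - g x))"
        using f gi by (intro integral_translate[of "\<lambda>x. norm (f x - g x)"]) auto
      finally have "(LINT x|lborel. norm (f (x + h j) - f x)) < e" using g(2) J[OF j] by linarith
      moreover have "0 \<le> (LINT x|lborel. norm (f (x + h j) - f x))" by (intro integral_nonneg_AE) auto
      ultimately show "norm ((LINT x|lborel. norm (f (x + h j) - f x)) - 0) < e" by simp
    qed
  qed
qed

text \<open>Points of an open set stay in it under small shifts, so the part \<open>p j\<close> lost
  by translation tends to 0 by dominated convergence. The set and its translate have equal measure,
  so the symmetric difference has twice the measure of the lost part.\<close>

lemma translation_continuous_open:
  fixes U :: "'a::euclidean_space set" and c :: "'b::{banach, second_countable_topology}"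
  assumes U: "open U" "emeasure lborel U < \<infinity>"
  shows "translation_continuous (\<lambda>x. indicator U x *\<^sub>R c)"
  unfolding translation_continuous_def
proof (intro conjI allI impI)
  have [measurable]: "U \<in> sets borel" using U by simp
  have iU: "integrable lborel (indicator U :: 'a \<Rightarrow> real)" using U by simp
  then show "integrable lborel (\<lambda>x. indicator U x *\<^sub>R c)" by simp
  fix h :: "nat \<Rightarrow> 'a" assume h: "h \<longlonglongrightarrow> 0"
  define p where "p j x = max 0 (indicator U x - indicator U (x + h j) :: real)" for j x
  have lim: "(\<lambda>j. LINT x|lborel. p j x) \<longlonglongrightarrow> (LINT (x::'a)|lborel. 0 :: real)"
  proof (rule integral_dominated_convergence[where w = "indicator U :: 'a \<Rightarrow> real" and f = "\<lambda>_. 0 :: real" and s = p])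
    show "AE x in lborel. (\<lambda>j. p j x) \<longlonglongrightarrow> 0"
    proof (rule AE_I2)
      fix x
      show "(\<lambda>j. p j x) \<longlonglongrightarrow> 0"
      proof (cases "x \<in> U")
        case True
        have "(\<lambda>j. x + h j) \<longlonglongrightarrow> x + 0" using h by (intro tendsto_intros)
        then have "\<forall>\<^sub>F j in sequentially. x + h j \<in> U" using U True by (intro topological_tendstoD) auto
        then show ?thesis by (intro tendsto_eventually) (auto elim!: eventually_mono simp: p_def True)
      next
        case False
        then show ?thesis by (simp add: p_def)
      qed
    qed
    show "AE x in lborel. norm (p j x) \<le> indicator U x" for j
      by (rule AE_I2) (auto simp: p_def indicator_def)
  qed (use iU in \<open>auto simp: p_def[abs_def]\<close>)
  have eq: "(LINT x|lborel. norm (indicator U (x + h j) *\<^sub>R c - indicator U x *\<^sub>R c)) = 2 * norm c * (LINT x|lborel. p j x)" for j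
  proof -
    have ij: "integrable lborel (\<lambda>x. indicator U (x + h j) :: real)" by (rule integrable_translate[OF iU])
    have ip: "integrable lborel (p j)" unfolding p_def[abs_def] using iU ij by auto
    have tr: "(LINT x|lborel. indicator U (x + h j) :: real) = (LINT x|lborel. indicator U x)"
      by (rule integral_translate) simp
    have "norm (indicator U (x + h j) *\<^sub>R c - indicator U x *\<^sub>R c)
        = norm c * (2 * p j x + (indicator U (x + h j) - indicator U x))" for x
      by (auto simp: p_def indicator_def)
    then have "(LINT x|lborel. norm (indicator U (x + h j) *\<^sub>R c - indicator U x *\<^sub>R c))
        = norm c * (LINT x|lborel. 2 * p j x + (indicator U (x + h j) - indicator U x))" by simp
    also have "(LINT x|lborel. 2 * p j x + (indicator U (x + h j) - indicator U x))
        = 2 * (LINT x|lborel. p j x) + ((LINT x|lborel. indicator U (x + h j)) - (LINT x|lborel. indicator U x))"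
      using ip ij iU by simp
    finally show ?thesis by (simp add: tr)
  qed
  have "(\<lambda>j. 2 * norm c * (LINT x|lborel. p j x)) \<longlonglongrightarrow> 2 * norm c * 0"
    using lim by (intro tendsto_mult tendsto_const) simp
  then show "(\<lambda>j. LINT x|lborel. norm (indicator U (x + h j) *\<^sub>R c - indicator U x *\<^sub>R c)) \<longlonglongrightarrow> 0"
    by (simp add: eq)
qed

text \<open>Outer regularity reduces indicators of measurable sets to those of open sets; sums
  follow from the triangle inequality and limits from the approximation lemma.\<close>

lemma translation_continuous_integrable:
  fixes f :: "'a::euclidean_space \<Rightarrow> 'b::{banach, second_countable_topology}"
  assumes "integrable lborel f"
  shows "translation_continuous f"
  using assms
proof (induction rule: integrable_induct)
  case (base A c)
  have [measurable]: "A \<in> sets borel" using base by simp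
  have iA: "integrable lborel (indicator A :: 'a \<Rightarrow> real)" using base by simp
  show ?case
  proof (rule translation_continuous_approx)
    show "integrable lborel (\<lambda>x. indicator A x *\<^sub>R c)" using iA by simp
    fix e :: real assume e: "0 < e"
    have "A \<in> sets lebesgue" using base by auto
    \<comment> \<open>The denominator \<open>norm c + 1\<close> keeps the quotient meaningful for
      \<open>c = 0\<close>.\<close>
    then obtain U where U: "open U" "A \<subseteq> U" "(U - A) \<in> lmeasurable" "emeasure lebesgue (U - A) < ennreal (e / (norm c + 1))"
      using sets_lebesgue_outer_open[of A "e / (norm c + 1)"] e by (auto simp: add_nonneg_pos)
    have [measurable]: "U \<in> sets borel" using U by simp
    have d: "emeasure lborel (U - A) < ennreal (e / (norm c + 1))" using U(4) by simp
    have "emeasure lborel U = emeasure lborel A + emeasure lborel (U - A)"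
      using U by (subst plus_emeasure) (auto simp: Un_absorb1)
    also have "\<dots> < \<infinity>" using base d by (simp add: ennreal_add_less_top) (metis ennreal_less_top less_trans)
    finally have Uf: "emeasure lborel U < \<infinity>" .
    have "(LINT x|lborel. norm (indicator A x *\<^sub>R c - indicator U x *\<^sub>R c)) = (LINT x|lborel. norm c * indicator (U - A) x)"
      using U by (intro Bochner_Integration.integral_cong) (auto simp: indicator_def)
    also have "\<dots> = norm c * measure lborel (U - A)" by simp
    also have "\<dots> \<le> norm c * (e / (norm c + 1))"
      unfolding measure_def using d e by (intro mult_left_mono enn2real_leI less_imp_le[OF d]) auto
    also have "\<dots> < e"
    proof -
      have "0 < norm c + 1" by (simp add: add_nonneg_pos)
      then show ?thesis using e by (simp add: pos_divide_less_eq algebra_simps)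
    qed
    finally show "\<exists>g. translation_continuous g \<and> (LINT x|lborel. norm (indicator A x *\<^sub>R c - g x)) < e"
      using translation_continuous_open[OF U(1) Uf, of c] by blast
  qed
next
  case (add f g)
  show ?case unfolding translation_continuous_def
  proof (intro conjI allI impI)
    show "integrable lborel (\<lambda>x. f x + g x)" using add by simp
    fix h :: "nat \<Rightarrow> 'a" assume h: "h \<longlonglongrightarrow> 0"
    have lim: "(\<lambda>j. (LINT x|lborel. norm (f (x + h j) - f x)) + (LINT x|lborel. norm (g (x + h j) - g x))) \<longlonglongrightarrow> 0 + 0"
      using add h by (intro tendsto_add) (auto simp: translation_continuous_def)
    show "(\<lambda>j. LINT x|lborel. norm (f (x + h j) + g (x + h j) - (f x + g x))) \<longlonglongrightarrow> 0"
    proof (rule tendsto_sandwich[OF _ _ tendsto_const])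
      show "\<forall>\<^sub>F j in sequentially. 0 \<le> (LINT x|lborel. norm (f (x + h j) + g (x + h j) - (f x + g x)))"
        by (intro always_eventually allI integral_nonneg_AE) auto
      show "\<forall>\<^sub>F j in sequentially. (LINT x|lborel. norm (f (x + h j) + g (x + h j) - (f x + g x)))
          \<le> (LINT x|lborel. norm (f (x + h j) - f x)) + (LINT x|lborel. norm (g (x + h j) - g x))"
      proof (intro always_eventually allI)
        fix j
        have i: "integrable lborel (\<lambda>x. norm (f (x + h j) - f x))" "integrable lborel (\<lambda>x. norm (g (x + h j) - g x))"
          "integrable lborel (\<lambda>x. norm (f (x + h j) + g (x + h j) - (f x + g x)))"
          using integrable_translate[OF add.hyps(1), of "h j"] integrable_translate[OF add.hyps(2), of "h j"] add.hyps by auto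
        have "(LINT x|lborel. norm (f (x + h j) + g (x + h j) - (f x + g x)))
            \<le> (LINT x|lborel. norm (f (x + h j) - f x) + norm (g (x + h j) - g x))"
          using i by (intro integral_mono) (auto simp: norm_diff_triangle_ineq)
        then show "(LINT x|lborel. norm (f (x + h j) + g (x + h j) - (f x + g x)))
          \<le> (LINT x|lborel. norm (f (x + h j) - f x)) + (LINT x|lborel. norm (g (x + h j) - g x))"
          using i by simp
      qed
    qed (use lim in simp)
  qed
next
  case (lim f s)
  show ?case
  proof (rule translation_continuous_approx[OF lim.hyps(4)])
    fix e :: real assume e: "0 < e"
    have "(\<lambda>i. LINT x|lborel. norm (f x - s i x)) \<longlonglongrightarrow> (LINT (x::'a)|lborel. (0::real))"
    proof (rule integral_dominated_convergence[where w = "\<lambda>x. 3 * norm (f x)"])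
      show "AE x in lborel. (\<lambda>i. norm (f x - s i x)) \<longlonglongrightarrow> 0"
      proof (rule AE_I2)
        fix x
        have "(\<lambda>i. norm (f x - s i x)) \<longlonglongrightarrow> norm (f x - f x)" using lim.hyps(2)[of x] by (intro tendsto_intros) auto
        then show "(\<lambda>i. norm (f x - s i x)) \<longlonglongrightarrow> 0" by simp
      qed
      show "AE x in lborel. norm (norm (f x - s i x)) \<le> 3 * norm (f x)" for i
      proof (rule AE_I2)
        fix x
        show "norm (norm (f x - s i x)) \<le> 3 * norm (f x)"
          using lim.hyps(3)[of x i] norm_triangle_ineq4[of "f x" "s i x"] by simp
      qed
    qed (use lim in auto)
    then have "\<forall>\<^sub>F i in sequentially. (LINT x|lborel. norm (f x - s i x)) < e"
      using e by (intro order_tendstoD(2)) auto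
    then show "\<exists>g. translation_continuous g \<and> (LINT x|lborel. norm (f x - g x)) < e"
      using lim.IH unfolding eventually_sequentially by blast
  qed
qed

section \<open>Mollification\<close>

definition moll :: "real \<Rightarrow> 'a::euclidean_space \<Rightarrow> real" where
  "moll r x = bump r x / (LINT y|lborel. bump r (y :: 'a))"

definition mollify :: "real \<Rightarrow> ('a::euclidean_space \<Rightarrow> 'b::euclidean_space) \<Rightarrow> 'a \<Rightarrow> 'b" where
  "mollify r f x = (LINT y|lborel. moll r (x - y) *\<^sub>R f y)"

lemma bump_integral_pos:
  assumes r: "0 < r"
  shows "0 < (LINT y|lborel. bump r (y :: 'a::euclidean_space))" "integrable lborel (bump r :: 'a \<Rightarrow> real)"
proof -
  show i: "integrable lborel (bump r :: 'a \<Rightarrow> real)"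
    using r by (intro continuous_cball_integrable[where r = r] continuous_bump) (auto intro!: bump_eq_0(1))
  have "(LINT y|lborel. bump r (y :: 'a)) \<noteq> 0"
  proof
    assume "(LINT y|lborel. bump r (y :: 'a)) = 0"
    then have "AE y in lborel. bump r (y :: 'a) = 0"
      using integral_nonneg_eq_0_iff_AE[OF i] by (simp add: bump_nonneg)
    then have "AE y in lborel. (y :: 'a) \<notin> ball 0 r"
      by eventually_elim (use bump_pos in force)
    then have "emeasure lborel (ball (0::'a) r) = 0"
      by (subst (asm) AE_iff_measurable[of "ball 0 r"]) auto
    then show False using r content_ball_pos[of r "0::'a"] by (simp add: measure_def)
  qed
  moreover have "0 \<le> (LINT y|lborel. bump r (y :: 'a))" by (intro integral_nonneg_AE) (auto simp: bump_nonneg)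
  ultimately show "0 < (LINT y|lborel. bump r (y :: 'a))" by simp
qed

context
  fixes r :: real
  assumes r: "0 < r"
begin

lemma moll_nonneg: "0 \<le> moll r x"
  using bump_integral_pos(1)[OF r] by (simp add: moll_def bump_nonneg)

lemma moll_measurable[measurable]: "(moll r :: 'a::euclidean_space \<Rightarrow> real) \<in> borel_measurable borel"
  unfolding moll_def[abs_def] by measurable

lemma moll_integrable: "integrable lborel (moll r :: 'a::euclidean_space \<Rightarrow> real)"
  unfolding moll_def[abs_def] using bump_integral_pos(2)[OF r] by auto

lemma moll_integral: "(LINT x|lborel. moll r (x :: 'a::euclidean_space)) = 1"
  using bump_integral_pos(1)[OF r, where 'a = 'a] by (simp add: moll_def)

lemma moll_eq_0: "r \<le> norm x \<Longrightarrow> moll r x = 0"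
  using bump_eq_0(1)[of r x] r by (simp add: moll_def)

lemma continuous_moll: "continuous_on X (moll r :: 'a::euclidean_space \<Rightarrow> real)"
  unfolding moll_def[abs_def] using bump_integral_pos(1)[OF r, where 'a = 'a]
  by (intro continuous_intros continuous_bump) auto

lemma moll_bounded: obtains B where "0 \<le> B" "\<And>x :: 'a::euclidean_space. moll r x \<le> B"
proof -
  obtain B where "0 \<le> B" "\<And>x :: 'a. norm (moll r x) \<le> B"
    using continuous_cball_bounded[OF continuous_moll, of r] moll_eq_0 by (metis less_imp_le)
  then show thesis using that[of B] by (auto intro: order_trans[OF abs_ge_self])
qed

lemma mollify_integrand_integrable:
  fixes f :: "'a::euclidean_space \<Rightarrow> 'b::euclidean_space"
  assumes "integrable lborel f"
  shows "integrable lborel (\<lambda>y. moll r (x - y) *\<^sub>R f y)"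
proof -
  obtain B where B: "0 \<le> B" "\<And>x :: 'a. moll r x \<le> B" using moll_bounded by metis
  show ?thesis
  proof (rule Bochner_Integration.integrable_bound)
    show "integrable lborel (\<lambda>y. B * norm (f y))" using assms by simp
    show "AE y in lborel. norm (moll r (x - y) *\<^sub>R f y) \<le> norm (B * norm (f y))"
      by (intro AE_I2) (simp add: B moll_nonneg mult_right_mono)
  qed (use assms in measurable)
qed

lemma mollify_measurable[measurable]:
  fixes f :: "'a::euclidean_space \<Rightarrow> 'b::euclidean_space"
  assumes [measurable]: "f \<in> borel_measurable borel"
  shows "mollify r f \<in> borel_measurable borel"
  unfolding mollify_def[abs_def]
  by (rule sigma_finite_measure.borel_measurable_lebesgue_integral[OF sigma_finite_lborel]) measurable

text \<open>A mollification is an average of translates by vectors of norm less than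
  \<open>r\<close>, so by Fubini its L1 distance from \<open>f\<close> is at most the average of the
  translation errors. The form with an arbitrary \<open>e\<close> serves convergence and, with a
  crude \<open>e\<close>, integrability.\<close>

lemma mollify_diff_le:
  fixes f :: "'a::euclidean_space \<Rightarrow> 'b::euclidean_space"
  assumes f: "integrable lborel f"
    and \<omega>: "\<And>z. norm z < r \<Longrightarrow> (LINT x|lborel. norm (f (x - z) - f x)) \<le> e" and e: "0 \<le> e"
  shows "(\<integral>\<^sup>+x. ennreal (norm (mollify r f x - f x)) \<partial>lborel) \<le> ennreal e"
proof -
  have [measurable]: "f \<in> borel_measurable borel" using f by auto
  have pw: "ennreal (norm (mollify r f x - f x)) \<le> (\<integral>\<^sup>+z. ennreal (moll r z * norm (f (x - z) - f x)) \<partial>lborel)" for x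
  proof -
    have i1: "integrable lborel (\<lambda>y. moll r (x - y) *\<^sub>R f y)" by (rule mollify_integrand_integrable[OF f])
    have i2: "integrable lborel (\<lambda>z. moll r z *\<^sub>R f (x - z))"
      using integrable_reflect[OF i1, of x] by simp
    have i3: "integrable lborel (\<lambda>z::'a. moll r z *\<^sub>R f x)"
      by (rule integrable_scaleR_left) (rule moll_integrable)
    have "mollify r f x = (LINT z|lborel. moll r z *\<^sub>R f (x - z))"
      unfolding mollify_def using integral_reflect[of "\<lambda>y. moll r (x - y) *\<^sub>R f y" x] by simp
    moreover have "f x = (LINT z|lborel. moll r (z::'a) *\<^sub>R f x)"
    proof -
      have "(LINT z|lborel. moll r (z::'a) *\<^sub>R f x) = (LINT z|lborel. moll r (z::'a)) *\<^sub>R f x"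
        by (rule integral_scaleR_left) (rule moll_integrable)
      then show ?thesis unfolding moll_integral by simp
    qed
    ultimately have "mollify r f x - f x = (LINT z|lborel. moll r z *\<^sub>R f (x - z) - moll r z *\<^sub>R f x)"
      using i2 i3 by (simp only: Bochner_Integration.integral_diff)
    also have "\<dots> = (LINT z|lborel. moll r z *\<^sub>R (f (x - z) - f x))" by (simp add: scaleR_diff_right)
    finally have e: "mollify r f x - f x = (LINT z|lborel. moll r z *\<^sub>R (f (x - z) - f x))" .
    have i4: "integrable lborel (\<lambda>z. moll r z *\<^sub>R (f (x - z) - f x))"
      using i2 i3 by (simp add: scaleR_diff_right)
    have "ennreal (norm (mollify r f x - f x)) \<le> (\<integral>\<^sup>+z. ennreal (norm (moll r z *\<^sub>R (f (x - z) - f x))) \<partial>lborel)"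
      unfolding e by (rule integral_norm_bound_ennreal[OF i4])
    then show ?thesis by (simp add: moll_nonneg)
  qed
  have "(\<integral>\<^sup>+x. ennreal (norm (mollify r f x - f x)) \<partial>lborel)
      \<le> (\<integral>\<^sup>+x. \<integral>\<^sup>+z. ennreal (moll r z * norm (f (x - z) - f x)) \<partial>lborel \<partial>lborel)"
    by (intro nn_integral_mono pw)
  also have "\<dots> = (\<integral>\<^sup>+z. \<integral>\<^sup>+x. ennreal (moll r z * norm (f (x - z) - f x)) \<partial>lborel \<partial>lborel)"
    by (rule lborel_pair.Fubini') measurable
  also have "\<dots> \<le> (\<integral>\<^sup>+z. ennreal e * ennreal (moll r z) \<partial>(lborel :: 'a measure))"
  proof (rule nn_integral_mono)
    fix z :: 'a
    have i: "integrable lborel (\<lambda>x. norm (f (x - z) - f x))"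
      using integrable_translate[OF f, of "- z"] f by simp
    have "(\<integral>\<^sup>+x. ennreal (moll r z * norm (f (x - z) - f x)) \<partial>lborel) = ennreal (moll r z * (LINT x|lborel. norm (f (x - z) - f x)))"
      using i by (subst nn_integral_eq_integral) (auto simp: moll_nonneg)
    also have "\<dots> \<le> ennreal (e * moll r z)"
    proof (cases "norm z < r")
      case True
      then show ?thesis using mult_left_mono[OF \<omega>[OF True] moll_nonneg[of z]]
        by (intro ennreal_leI) (simp add: mult.commute)
    next
      case False
      then show ?thesis by (simp add: moll_eq_0)
    qed
    finally show "(\<integral>\<^sup>+x. ennreal (moll r z * norm (f (x - z) - f x)) \<partial>lborel) \<le> ennreal e * ennreal (moll r z)"
      using e moll_nonneg[of z] by (simp add: ennreal_mult)
  qed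
  also have "\<dots> = ennreal e * ennreal (LINT z|lborel. moll r (z::'a))"
    by (simp add: nn_integral_cmult nn_integral_eq_integral moll_integrable moll_nonneg)
  finally show ?thesis by (simp add: moll_integral)
qed

end

lemma mollify_integrable:
  fixes f :: "'a::euclidean_space \<Rightarrow> 'b::euclidean_space"
  assumes r: "0 < r" and f: "integrable lborel f"
  shows "integrable lborel (mollify r f)"
proof -
  have [measurable]: "f \<in> borel_measurable borel" using f by auto
  \<comment> \<open>The crude bound on the translation error by the triangle inequality; it makes
    the difference between the mollification and \<open>f\<close> integrable.\<close>
  define e where "e = 2 * (LINT x|lborel. norm (f x))"
  have "(LINT x|lborel. norm (f (x - z) - f x)) \<le> e" for z
  proof -
    have i: "integrable lborel (\<lambda>x. norm (f (x - z)))" using integrable_translate[OF f, of "- z"] by simp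
    have "(LINT x|lborel. norm (f (x - z) - f x)) \<le> (LINT x|lborel. norm (f (x - z)) + norm (f x))"
      using i f integrable_translate[OF f, of "- z"] by (intro integral_mono) (auto simp: norm_triangle_ineq4)
    also have "\<dots> = (LINT x|lborel. norm (f (x - z))) + (LINT x|lborel. norm (f x))" using i f by simp
    also have "(LINT x|lborel. norm (f (x - z))) = (LINT x|lborel. norm (f x))"
      using integral_translate[of "\<lambda>x. norm (f x)" "- z"] by simp
    finally show ?thesis by (simp add: e_def)
  qed
  then have "(\<integral>\<^sup>+x. ennreal (norm (mollify r f x - f x)) \<partial>lborel) \<le> ennreal e"
    by (intro mollify_diff_le r f) (auto simp: e_def)
  then have "integrable lborel (\<lambda>x. mollify r f x - f x)"
    using mollify_measurable[OF r, of f] by (intro integrableI_bounded) (auto simp: order_le_less_trans)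
  from Bochner_Integration.integrable_add[OF this f] show ?thesis by simp
qed

lemma mollify_tendsto_L1:
  fixes f :: "'a::euclidean_space \<Rightarrow> 'b::euclidean_space"
  assumes f: "integrable lborel f"
  shows "(\<lambda>j. LINT x|lborel. norm (mollify (1 / real (Suc j)) f x - f x)) \<longlonglongrightarrow> 0"
proof (rule LIMSEQ_I)
  fix e :: real assume e: "0 < e"
  define \<omega> where "\<omega> z = (LINT x|lborel. norm (f (x - z) - f x))" for z
  have "(\<omega> \<longlongrightarrow> 0) (at 0)"
    unfolding tendsto_at_iff_sequentially
  proof (intro allI impI)
    fix Z :: "nat \<Rightarrow> 'a" assume "\<forall>i. Z i \<in> UNIV - {0}" and Z: "Z \<longlonglongrightarrow> 0"
    have "(\<lambda>j. - Z j) \<longlonglongrightarrow> 0" using tendsto_minus[OF Z] by simp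
    then have "(\<lambda>j. LINT x|lborel. norm (f (x + - Z j) - f x)) \<longlonglongrightarrow> 0"
      using translation_continuous_integrable[OF f] unfolding translation_continuous_def by blast
    then show "(\<omega> \<circ> Z) \<longlonglongrightarrow> 0" by (simp add: \<omega>_def o_def)
  qed
  then have "\<forall>\<^sub>F z in at 0. \<omega> z < e / 2" using e by (intro order_tendstoD(2)) auto
  then obtain d where d: "d > 0" "\<And>z. z \<noteq> 0 \<Longrightarrow> norm z < d \<Longrightarrow> \<omega> z < e / 2"
    by (auto simp: eventually_at dist_norm)
  have \<omega>_le: "\<omega> z \<le> e / 2" if "norm z < d" for z
    using d(2)[of z] that e by (cases "z = 0") (auto simp: \<omega>_def)
  obtain J where J: "1 / real (Suc J) < d" using d(1) nat_approx_posE by blast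
  show "\<exists>J. \<forall>j\<ge>J. norm ((LINT x|lborel. norm (mollify (1 / real (Suc j)) f x - f x)) - 0) < e"
  proof (intro exI[of _ J] allI impI)
    fix j assume j: "J \<le> j"
    let ?r = "1 / real (Suc j)"
    have "?r \<le> 1 / real (Suc J)" using j by (intro divide_left_mono) auto
    then have rd: "?r < d" using J by simp
    have i: "integrable lborel (\<lambda>x. norm (mollify ?r f x - f x))"
      using mollify_integrable[of ?r f] f by simp
    have "(\<integral>\<^sup>+x. ennreal (norm (mollify ?r f x - f x)) \<partial>lborel) \<le> ennreal (e / 2)"
      using \<omega>_le rd e by (intro mollify_diff_le f) (auto simp: \<omega>_def)
    then have "(LINT x|lborel. norm (mollify ?r f x - f x)) \<le> e / 2"
      using i e by (subst (asm) nn_integral_eq_integral) (auto simp: ennreal_le_iff)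
    moreover have "0 \<le> (LINT x|lborel. norm (mollify ?r f x - f x))" by (intro integral_nonneg_AE) auto
    ultimately show "norm ((LINT x|lborel. norm (mollify ?r f x - f x)) - 0) < e" using e by simp
  qed
qed

definition locally_integrable :: "('a::euclidean_space \<Rightarrow> 'b::euclidean_space) \<Rightarrow> bool" where
  "locally_integrable f \<longleftrightarrow> f \<in> borel_measurable borel \<and>
     (\<forall>\<rho>. integrable lborel (\<lambda>x. indicator (cball 0 \<rho>) x *\<^sub>R f x))"

lemma locally_integrable_kernel:
  fixes k :: "'a::euclidean_space \<Rightarrow> 'b::euclidean_space" and f :: "'a \<Rightarrow> real"
  assumes f: "locally_integrable f" and [measurable]: "k \<in> borel_measurable borel"
    and supp: "\<And>z. norm z > r \<Longrightarrow> k z = 0" and bd: "\<And>z. norm (k z) \<le> B"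
  shows "integrable lborel (\<lambda>y. f y *\<^sub>R k (x - y))"
proof (rule Bochner_Integration.integrable_bound)
  have [measurable]: "f \<in> borel_measurable borel" using f by (simp add: locally_integrable_def)
  show "integrable lborel (\<lambda>y. B * norm (indicator (cball 0 (norm x + r)) y *\<^sub>R f y))"
    using f unfolding locally_integrable_def by (intro integrable_mult_right integrable_norm) auto
  show "(\<lambda>y. f y *\<^sub>R k (x - y)) \<in> borel_measurable lborel" by measurable
  show "AE y in lborel. norm (f y *\<^sub>R k (x - y)) \<le> norm (B * norm (indicator (cball 0 (norm x + r)) y *\<^sub>R f y))"
  proof (rule AE_I2)
    fix y
    have B: "0 \<le> B" using bd[of 0] norm_ge_zero order_trans by blast
    show "norm (f y *\<^sub>R k (x - y)) \<le> norm (B * norm (indicator (cball 0 (norm x + r)) y *\<^sub>R f y))"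
    proof (cases "norm (x - y) > r")
      case True
      then show ?thesis using supp by simp
    next
      case False
      then have "norm y \<le> norm x + r" using norm_triangle_ineq2[of y x] by (simp add: norm_minus_commute)
      then show ?thesis using B mult_left_mono[OF bd[of "x - y"], of "\<bar>f y\<bar>"] by (simp add: abs_mult mult.commute)
    qed
  qed
qed

lemma locally_integrable_convolution_continuous:
  fixes k :: "'a::euclidean_space \<Rightarrow> real" and f :: "'a \<Rightarrow> 'b::euclidean_space"
  assumes f: "locally_integrable f" and k: "continuous_on UNIV k" and supp: "\<And>z. norm z > r \<Longrightarrow> k z = 0"
  shows "continuous_on UNIV (\<lambda>x. LINT y|lborel. k (x - y) *\<^sub>R f y)"
proof -
  have [measurable]: "f \<in> borel_measurable borel" using f by (simp add: locally_integrable_def)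
  have [measurable]: "k \<in> borel_measurable borel" using k by (rule borel_measurable_continuous_onI)
  obtain B where B: "0 \<le> B" "\<And>z. norm (k z) \<le> B" using continuous_cball_bounded[OF k, of r] supp by metis
  have "isCont (\<lambda>x. LINT y|lborel. k (x - y) *\<^sub>R f y) x" for x
    unfolding isCont_def tendsto_at_iff_sequentially o_def
  proof (intro allI impI)
    fix X :: "nat \<Rightarrow> 'a" assume X: "X \<longlonglongrightarrow> x"
    then obtain K where K: "\<And>j. norm (X j) \<le> K"
      using convergent_imp_Bseq[of X] by (auto simp: convergent_def Bseq_def)
    show "(\<lambda>j. LINT y|lborel. k (X j - y) *\<^sub>R f y) \<longlonglongrightarrow> (LINT y|lborel. k (x - y) *\<^sub>R f y)"
    proof (rule integral_dominated_convergence[where w = "\<lambda>y. B * norm (indicator (cball 0 (K + r)) y *\<^sub>R f y)"])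
      show "integrable lborel (\<lambda>y. B * norm (indicator (cball 0 (K + r)) y *\<^sub>R f y))"
        using f unfolding locally_integrable_def by (intro integrable_mult_right integrable_norm) auto
      show "AE y in lborel. (\<lambda>j. k (X j - y) *\<^sub>R f y) \<longlonglongrightarrow> k (x - y) *\<^sub>R f y"
      proof (rule AE_I2)
        fix y
        have "isCont k (x - y)" using k by (simp add: continuous_on_eq_continuous_at)
        then have "(\<lambda>j. k (X j - y)) \<longlonglongrightarrow> k (x - y)"
          by (rule isCont_tendsto_compose) (intro tendsto_intros X)
        then show "(\<lambda>j. k (X j - y) *\<^sub>R f y) \<longlonglongrightarrow> k (x - y) *\<^sub>R f y" by (intro tendsto_intros)
      qed
      show "AE y in lborel. norm (k (X j - y) *\<^sub>R f y) \<le> B * norm (indicator (cball 0 (K + r)) y *\<^sub>R f y)" for j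
      proof (rule AE_I2)
        fix y
        show "norm (k (X j - y) *\<^sub>R f y) \<le> B * norm (indicator (cball 0 (K + r)) y *\<^sub>R f y)"
        proof (cases "norm (X j - y) > r")
          case True
          then show ?thesis using supp B by simp
        next
          case False
          then have "norm y \<le> K + r" using norm_triangle_ineq2[of y "X j"] K[of j] by (simp add: norm_minus_commute)
          then show ?thesis using mult_right_mono[OF B(2)[of "X j - y"], of "norm (f y)"] by simp
        qed
      qed
    qed measurable
  qed
  then show ?thesis by (simp add: continuous_at_imp_continuous_on)
qed

definition moll_grad :: "real \<Rightarrow> 'a::euclidean_space \<Rightarrow> 'a" where
  "moll_grad r x = bump_grad r x /\<^sub>R (LINT y|lborel. bump r (y :: 'a))"

lemma moll_GDERIV: "GDERIV (moll r) x :> moll_grad r x"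
proof -
  have "GDERIV (\<lambda>x. bump r x * inverse (LINT y|lborel. bump r (y :: 'a))) x :> moll_grad r x"
    using GDERIV_mult[OF bump_GDERIV[of r x] GDERIV_const[of "inverse (LINT y|lborel. bump r (y :: 'a))" x]]
    by (simp add: moll_grad_def)
  then show ?thesis by (simp add: moll_def[abs_def] divide_inverse)
qed

lemma moll_grad_eq_0: "0 < r \<Longrightarrow> r \<le> norm x \<Longrightarrow> moll_grad r x = 0"
  using bump_eq_0(2)[of r x] by (simp add: moll_grad_def)

lemma continuous_moll_grad: "continuous_on X (moll_grad r)"
  unfolding moll_grad_def[abs_def] by (intro continuous_intros continuous_bump)

lemma moll_grad_measurable[measurable]: "(moll_grad r :: 'a::euclidean_space \<Rightarrow> 'a) \<in> borel_measurable borel"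
  using continuous_moll_grad by (rule borel_measurable_continuous_onI)

text \<open>Differentiation under the integral. The first-order remainder of the kernel divided by
  the norm of the increment tends to 0 and is at most \<open>2 * B\<close> by the Lipschitz bound.
  The increments of a null sequence are bounded by some \<open>K\<close>, so all supports lie in one
  ball, on which \<open>u\<close> is integrable.\<close>

lemma mollify_has_gradient:
  fixes u :: "'a::euclidean_space \<Rightarrow> real"
  assumes r: "0 < r" and u: "locally_integrable u"
  shows "GDERIV (mollify r u) x :> (LINT y|lborel. u y *\<^sub>R moll_grad r (x - y))"
proof -
  note [measurable] = moll_measurable[OF r]
  have [measurable]: "u \<in> borel_measurable borel" using u by (simp add: locally_integrable_def)
  obtain B where B: "0 \<le> B" "\<And>z :: 'a. norm (moll_grad r z) \<le> B"
    using continuous_cball_bounded[OF continuous_moll_grad, of r r] moll_grad_eq_0[OF r] by (metis less_imp_le)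
  obtain B0 where B0: "0 \<le> B0" "\<And>z :: 'a. moll r z \<le> B0" using moll_bounded[OF r] by metis
  have lip: "\<bar>moll r z - moll r w\<bar> \<le> B * norm (z - w)" for z w :: 'a
    by (rule GDERIV_bounded_imp_lipschitz[OF moll_GDERIV B(2)])
  define G where "G = (LINT y|lborel. u y *\<^sub>R moll_grad r (x - y))"
  have iG: "integrable lborel (\<lambda>y. u y *\<^sub>R moll_grad r (x - y))"
    using B by (intro locally_integrable_kernel[OF u, where r = r and B = B]) (auto intro!: moll_grad_eq_0[OF r])
  have im: "integrable lborel (\<lambda>y. moll r (z - y) *\<^sub>R u y)" for z
  proof -
    have "integrable lborel (\<lambda>y. u y *\<^sub>R moll r (z - y))"
      using B0 by (intro locally_integrable_kernel[OF u, where r = r and B = B0])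
        (auto simp: moll_nonneg[OF r] intro: moll_eq_0[OF r])
    then show ?thesis by (simp add: mult.commute)
  qed
  have "((\<lambda>h. norm (mollify r u (x + h) - mollify r u x - h \<bullet> G) / norm h) \<longlongrightarrow> 0) (at 0)"
    unfolding tendsto_at_iff_sequentially o_def
  proof (intro allI impI)
    fix X :: "nat \<Rightarrow> 'a" assume X0: "\<forall>i. X i \<in> UNIV - {0}" and X: "X \<longlonglongrightarrow> 0"
    obtain K where K: "\<And>j. norm (X j) \<le> K"
      using convergent_imp_Bseq[of X] X by (auto simp: convergent_def Bseq_def)
    define E where "E j y = (moll r (x + X j - y) - moll r (x - y) - X j \<bullet> moll_grad r (x - y)) / norm (X j) * u y" for j y
    have lim: "(\<lambda>j. LINT y|lborel. E j y) \<longlonglongrightarrow> (LINT (y::'a)|lborel. (0::real))"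
    proof (rule integral_dominated_convergence[where w = "\<lambda>y. (2 * B) * norm (indicator (cball 0 (norm x + K + r)) y *\<^sub>R u y)"])
      show "integrable lborel (\<lambda>y. (2 * B) * norm (indicator (cball 0 (norm x + K + r)) y *\<^sub>R u y))"
        using u unfolding locally_integrable_def by (intro integrable_mult_right integrable_norm) auto
      show "AE y in lborel. (\<lambda>j. E j y) \<longlonglongrightarrow> 0"
      proof (rule AE_I2)
        fix y
        have "((\<lambda>h. norm (moll r (x - y + h) - moll r (x - y) - h \<bullet> moll_grad r (x - y)) / norm h) \<longlongrightarrow> 0) (at 0)"
          using moll_GDERIV[of r "x - y"] unfolding gderiv_def has_derivative_at by simp
        then have "(\<lambda>j. norm (moll r (x - y + X j) - moll r (x - y) - X j \<bullet> moll_grad r (x - y)) / norm (X j)) \<longlonglongrightarrow> 0"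
          using X0 X unfolding tendsto_at_iff_sequentially o_def by blast
        then have "(\<lambda>j. norm (moll r (x - y + X j) - moll r (x - y) - X j \<bullet> moll_grad r (x - y)) / norm (X j) * norm (u y)) \<longlonglongrightarrow> 0 * norm (u y)"
          by (intro tendsto_intros)
        moreover have "x - y + X j = x + X j - y" for j by simp
        ultimately have "(\<lambda>j. norm (E j y)) \<longlonglongrightarrow> 0" by (simp add: E_def abs_mult)
        then show "(\<lambda>j. E j y) \<longlonglongrightarrow> 0" by (rule tendsto_norm_zero_cancel)
      qed
      show "AE y in lborel. norm (E j y) \<le> (2 * B) * norm (indicator (cball 0 (norm x + K + r)) y *\<^sub>R u y)" for j
      proof (rule AE_I2)
        fix y
        have Xj: "0 < norm (X j)" using X0 by auto
        show "norm (E j y) \<le> (2 * B) * norm (indicator (cball 0 (norm x + K + r)) y *\<^sub>R u y)"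
        proof (cases "norm y \<le> norm x + K + r")
          case False
          have "norm y \<le> norm (x - y) + norm x" using norm_triangle_ineq2[of y x] by (simp add: norm_minus_commute)
          moreover have "norm (x - y) \<le> norm (x + X j - y) + norm (X j)"
            using norm_triangle_ineq4[of "x + X j - y" "X j"] by simp
          ultimately have "r \<le> norm (x - y)" "r \<le> norm (x + X j - y)" using False K[of j] norm_ge_zero[of "X j"] by linarith+
          then have "E j y = 0" by (simp add: E_def moll_eq_0[OF r] moll_grad_eq_0[OF r])
          then show ?thesis using B by simp
        next
          case True
          have "\<bar>moll r (x + X j - y) - moll r (x - y)\<bar> \<le> B * norm (X j)"
            using lip[of "x + X j - y" "x - y"] by simp
          moreover have "\<bar>X j \<bullet> moll_grad r (x - y)\<bar> \<le> B * norm (X j)"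
            using Cauchy_Schwarz_ineq2[of "X j" "moll_grad r (x - y)"] mult_left_mono[OF B(2)[of "x - y"], of "norm (X j)"]
            by (simp add: mult.commute)
          ultimately have "\<bar>moll r (x + X j - y) - moll r (x - y) - X j \<bullet> moll_grad r (x - y)\<bar> \<le> 2 * B * norm (X j)" by linarith
          then have "\<bar>moll r (x + X j - y) - moll r (x - y) - X j \<bullet> moll_grad r (x - y)\<bar> / norm (X j) \<le> 2 * B"
            using Xj by (simp add: pos_divide_le_eq)
          then have "\<bar>moll r (x + X j - y) - moll r (x - y) - X j \<bullet> moll_grad r (x - y)\<bar> / norm (X j) * \<bar>u y\<bar> \<le> 2 * B * \<bar>u y\<bar>"
            by (rule mult_right_mono) simp
          then show ?thesis using True by (simp add: E_def abs_mult)
        qed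
      qed
    qed (auto simp: E_def[abs_def])
    have eq: "(LINT y|lborel. E j y) = (mollify r u (x + X j) - mollify r u x - X j \<bullet> G) / norm (X j)" for j
    proof -
      have "X j \<bullet> G = (LINT y|lborel. X j \<bullet> (u y *\<^sub>R moll_grad r (x - y)))"
        unfolding G_def by (rule integral_inner_right[OF iG, symmetric])
      moreover have "integrable lborel (\<lambda>y. X j \<bullet> (u y *\<^sub>R moll_grad r (x - y)))"
        by (rule integrable_inner_right) (rule iG)
      ultimately have "mollify r u (x + X j) - mollify r u x - X j \<bullet> G
          = (LINT y|lborel. moll r (x + X j - y) *\<^sub>R u y - moll r (x - y) *\<^sub>R u y - X j \<bullet> (u y *\<^sub>R moll_grad r (x - y)))"
        unfolding mollify_def using im by simp
      then have "(mollify r u (x + X j) - mollify r u x - X j \<bullet> G) / norm (X j)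
          = (LINT y|lborel. moll r (x + X j - y) *\<^sub>R u y - moll r (x - y) *\<^sub>R u y - X j \<bullet> (u y *\<^sub>R moll_grad r (x - y))) / norm (X j)"
        by (rule arg_cong)
      also have "\<dots> = (LINT y|lborel. (moll r (x + X j - y) *\<^sub>R u y - moll r (x - y) *\<^sub>R u y - X j \<bullet> (u y *\<^sub>R moll_grad r (x - y))) / norm (X j))"
        by (rule integral_divide_zero[symmetric])
      also have "\<dots> = (LINT y|lborel. E j y)"
      proof (rule Bochner_Integration.integral_cong)
        have alg: "(a * v - b * v - v * c) / m = (a - b - c) / m * v" for a b c v m :: real
          by (simp add: left_diff_distrib right_diff_distrib diff_divide_distrib mult.commute)
        show "(moll r (x + X j - y) *\<^sub>R u y - moll r (x - y) *\<^sub>R u y - X j \<bullet> (u y *\<^sub>R moll_grad r (x - y))) / norm (X j) = E j y" for y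
          unfolding E_def inner_scaleR_right real_scaleR_def by (rule alg)
      qed simp
      finally show ?thesis by simp
    qed
    have "(\<lambda>j. norm (LINT y|lborel. E j y)) \<longlonglongrightarrow> norm (LINT (y::'a)|lborel. (0::real))"
      using lim by (rule tendsto_norm)
    then show "(\<lambda>j. norm (mollify r u (x + X j) - mollify r u x - X j \<bullet> G) / norm (X j)) \<longlonglongrightarrow> 0"
      unfolding eq by (simp add: norm_divide)
  qed
  then show ?thesis
    unfolding gderiv_def has_derivative_at G_def by (simp add: bounded_linear_inner_left)
qed

lemma moll_test_function:
  fixes x :: "'a::euclidean_space"
  assumes r: "0 < r"
  shows "test_function (\<lambda>y. moll r (x - y))"
proof -
  let ?c = "inverse (LINT y|lborel. bump r (y :: 'a))"
  have b: "test_function (\<lambda>y. bump r (x - y))" using r by (intro bump_test_function) simp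
  have "continuously_diff k (\<lambda>y. bump r (x - y) * ?c)" for k
    using b by (intro continuously_diff_mult continuously_diff_const) (auto simp: test_function_def)
  moreover have "{y. bump r (x - y) * ?c \<noteq> 0} = {y. bump r (x - y) \<noteq> 0}"
    using bump_integral_pos(1)[OF r, where 'a = 'a] by auto
  ultimately show ?thesis using b by (simp add: test_function_def moll_def divide_inverse)
qed

lemma moll_translate_GDERIV: "GDERIV (\<lambda>y. moll r (x - y)) y :> - moll_grad r (x - y)"
proof -
  have "((\<lambda>y. x - y) has_derivative (\<lambda>h. - h)) (at y)" by (auto intro!: derivative_eq_intros)
  from has_derivative_compose[OF this moll_GDERIV[of r "x - y", unfolded gderiv_def]]
  show ?thesis by (simp add: gderiv_def)
qed

section \<open>Passage to the limit\<close>

text \<open>A recursion in the exponent for the distance between a power and its tangent; it proves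
  both the bound from below and the quadratic bound from above.\<close>

lemma power_tangent_rec:
  fixes a t :: real
  shows "t ^ Suc (Suc j) - a ^ Suc (Suc j) - real (Suc (Suc j)) * a ^ Suc j * (t - a)
    = t * (t ^ Suc j - a ^ Suc j - real (Suc j) * a ^ j * (t - a)) + real (Suc j) * a ^ j * (t - a)\<^sup>2"
  by (simp add: algebra_simps power2_eq_square)

lemma power_tangent_le:
  fixes a t :: real
  assumes "0 \<le> a" "0 \<le> t"
  shows "a ^ n + real n * a ^ (n - 1) * (t - a) \<le> t ^ n"
proof (induction n)
  case (Suc m)
  show ?case
  proof (cases m)
    case (Suc j)
    have "0 \<le> t * (t ^ Suc j - a ^ Suc j - real (Suc j) * a ^ j * (t - a)) + real (Suc j) * a ^ j * (t - a)\<^sup>2"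
      using Suc.IH assms unfolding Suc by (intro add_nonneg_nonneg mult_nonneg_nonneg) auto
    then show ?thesis unfolding Suc power_tangent_rec[symmetric] by simp
  qed simp
qed simp

text \<open>Jensen's inequality for the probability density \<open>moll r (x - y)\<close>, by
  integrating the tangent inequality at the mean \<open>a\<close>.\<close>

lemma mollify_power_le:
  fixes f :: "'a::euclidean_space \<Rightarrow> 'b::euclidean_space"
  assumes r: "0 < r" and f: "integrable lborel f" and fp: "integrable lborel (\<lambda>x. norm (f x) ^ n)"
  shows "norm (mollify r f x) ^ n \<le> mollify r (\<lambda>x. norm (f x) ^ n) x"
proof -
  define a where "a = (LINT y|lborel. moll r (x - y) * norm (f y))"
  have i0: "integrable lborel (\<lambda>y. moll r (x - y) *\<^sub>R f y)" by (rule mollify_integrand_integrable[OF r f])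
  have i1: "integrable lborel (\<lambda>y. moll r (x - y) * norm (f y))"
    using mollify_integrand_integrable[OF r, of "\<lambda>y. norm (f y)"] f by simp
  have i2: "integrable lborel (\<lambda>y. moll r (x - y) * norm (f y) ^ n)"
    using mollify_integrand_integrable[OF r fp] by simp
  have i3: "integrable lborel (\<lambda>y. moll r (x - y))" "(LINT y|lborel. moll r (x - y)) = 1"
    using integrable_reflect[OF moll_integrable[OF r], of x] integral_reflect[OF moll_measurable[OF r], of x] moll_integral[OF r, where 'a = 'a]
    by auto
  have a0: "0 \<le> a" unfolding a_def by (intro integral_nonneg_AE AE_I2) (simp add: moll_nonneg[OF r])
  have "norm (mollify r f x) \<le> (LINT y|lborel. norm (moll r (x - y) *\<^sub>R f y))"
    unfolding mollify_def by (rule integral_norm_bound)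
  also have "\<dots> = a" by (simp add: a_def moll_nonneg[OF r])
  finally have le: "norm (mollify r f x) ^ n \<le> a ^ n" by (intro power_mono) auto
  have "a ^ n = (LINT y|lborel. a ^ n * moll r (x - y) + real n * a ^ (n - 1) * (moll r (x - y) * norm (f y) - a * moll r (x - y)))"
    using i1 i3 by (simp add: a_def[symmetric])
  also have "\<dots> \<le> (LINT y|lborel. moll r (x - y) * norm (f y) ^ n)"
  proof (rule integral_mono)
    fix y
    have "moll r (x - y) * (a ^ n + real n * a ^ (n - 1) * (norm (f y) - a)) \<le> moll r (x - y) * norm (f y) ^ n"
      using a0 by (intro mult_left_mono power_tangent_le moll_nonneg[OF r]) auto
    then show "a ^ n * moll r (x - y) + real n * a ^ (n - 1) * (moll r (x - y) * norm (f y) - a * moll r (x - y))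
        \<le> moll r (x - y) * norm (f y) ^ n" by (simp add: algebra_simps)
  qed (use i1 i2 i3 in auto)
  finally show ?thesis using le by (simp add: mollify_def)
qed

text \<open>The square in the constant is chosen for the induction: one step adds the exponent
  \<open>k\<close> itself, and \<open>k^2 + k \<le> (k + 1)^2\<close>.\<close>

lemma power_tangent_ge:
  fixes a t :: real
  assumes "0 \<le> a" "0 \<le> t"
  shows "t ^ (m + 2) - a ^ (m + 2) - real (m + 2) * a ^ (m + 1) * (t - a) \<le> (real (m + 2))\<^sup>2 * (t + a) ^ m * (t - a)\<^sup>2"
proof (induction m)
  case 0
  have "t * t - a * a - 2 * a * (t - a) = (t - a)\<^sup>2" by (simp add: power2_eq_square algebra_simps)
  then show ?case using zero_le_power2[of "t - a"] by simp
next
  case (Suc m)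
  have "t ^ (Suc m + 2) - a ^ (Suc m + 2) - real (Suc m + 2) * a ^ (Suc m + 1) * (t - a)
      = t * (t ^ (m + 2) - a ^ (m + 2) - real (m + 2) * a ^ (m + 1) * (t - a)) + real (m + 2) * a ^ (m + 1) * (t - a)\<^sup>2"
    using power_tangent_rec[of t "Suc m" a] by simp
  also have "\<dots> \<le> t * ((real (m + 2))\<^sup>2 * (t + a) ^ m * (t - a)\<^sup>2) + real (m + 2) * (t + a) ^ (m + 1) * (t - a)\<^sup>2"
    using assms by (intro add_mono mult_left_mono mult_right_mono Suc.IH power_mono) auto
  also have "\<dots> \<le> (t + a) * ((real (m + 2))\<^sup>2 * (t + a) ^ m * (t - a)\<^sup>2) + real (m + 2) * (t + a) ^ (m + 1) * (t - a)\<^sup>2"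
    using assms by (intro add_mono mult_right_mono) auto
  also have "\<dots> = ((real (m + 2))\<^sup>2 + real (m + 2)) * (t + a) ^ Suc m * (t - a)\<^sup>2"
    by (simp add: algebra_simps)
  also have "\<dots> \<le> (real (Suc m + 2))\<^sup>2 * (t + a) ^ Suc m * (t - a)\<^sup>2"
  proof -
    have "(real (m + 2))\<^sup>2 + real (m + 2) \<le> (real (Suc m + 2))\<^sup>2"
      by (simp add: power2_eq_square algebra_simps)
    then show ?thesis using assms by (intro mult_right_mono) simp_all
  qed
  finally show ?case .
qed

lemma power_sum_le:
  fixes a b :: real
  assumes "0 \<le> a" "0 \<le> b"
  shows "(a + b) ^ m \<le> 2 ^ m * (a ^ m + b ^ m)"
proof -
  have "(a + b) ^ m \<le> (2 * max a b) ^ m" using assms by (intro power_mono) auto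
  also have "\<dots> = 2 ^ m * max a b ^ m" by (rule power_mult_distrib)
  also have "max a b ^ m \<le> a ^ m + b ^ m" using assms by (auto simp: max_def)
  finally show ?thesis by simp
qed

text \<open>Pratt's lemma: dominated convergence with convergent dominating functions. The upper bound alone is
  needed, as the integrals of \<open>f j\<close> stand on the larger side of the inequality.\<close>

lemma pratt:
  fixes f D :: "nat \<Rightarrow> 'a \<Rightarrow> real"
  assumes [measurable]: "\<And>j. f j \<in> borel_measurable M" "g \<in> borel_measurable M"
    and f: "\<And>j. AE x in M. 0 \<le> f j x \<and> f j x \<le> D j x" and flim: "AE x in M. (\<lambda>j. f j x) \<longlonglongrightarrow> g x"
    and Dlim: "AE x in M. (\<lambda>j. D j x) \<longlonglongrightarrow> D' x"
    and D: "\<And>j. integrable M (D j)" "integrable M D'"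
    and Dint: "(\<lambda>j. LINT x|M. D j x) \<longlonglongrightarrow> (LINT x|M. D' x)"
    and e: "0 < e"
  shows "integrable M g" "\<forall>\<^sub>F j in sequentially. (LINT x|M. f j x) < (LINT x|M. g x) + e"
proof -
  have [measurable]: "\<And>j. D j \<in> borel_measurable M" "D' \<in> borel_measurable M" using D by auto
  have fall: "AE x in M. \<forall>j. 0 \<le> f j x \<and> f j x \<le> D j x" using f by (simp add: AE_all_countable)
  have gb: "AE x in M. 0 \<le> g x \<and> g x \<le> D' x"
    using fall flim Dlim
  proof eventually_elim
    case (elim x)
    then show ?case by (auto intro: LIMSEQ_le LIMSEQ_le_const)
  qed
  show gi: "integrable M g"
  proof (rule Bochner_Integration.integrable_bound[OF D(2)])
    show "AE x in M. norm (g x) \<le> norm (D' x)" using gb by eventually_elim simp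
  qed simp
  have fi: "integrable M (f j)" for j
  proof (rule Bochner_Integration.integrable_bound[OF D(1)[of j]])
    show "AE x in M. norm (f j x) \<le> norm (D j x)" using f[of j] by eventually_elim simp
  qed simp
  \<comment> \<open>\<open>d\<close> is the integral of the limit of the nonnegative functions
    \<open>D j - f j\<close>, to which Fatou's lemma is applied.\<close>
  define d where "d = (LINT x|M. D' x) - (LINT x|M. g x)"
  have nn: "AE x in M. 0 \<le> D' x - g x" "AE x in M. 0 \<le> D j x - f j x" for j
    using gb f[of j] by (eventually_elim, simp)+
  have "ennreal d = (\<integral>\<^sup>+x. ennreal (D' x - g x) \<partial>M)"
    using nn(1) gi D unfolding d_def by (subst nn_integral_eq_integral) auto
  also have "\<dots> \<le> (\<integral>\<^sup>+x. liminf (\<lambda>j. ennreal (D j x - f j x)) \<partial>M)"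
  proof (rule nn_integral_mono_AE)
    show "AE x in M. ennreal (D' x - g x) \<le> liminf (\<lambda>j. ennreal (D j x - f j x))"
      using flim Dlim
    proof eventually_elim
      case (elim x)
      have "(\<lambda>j. ennreal (D j x - f j x)) \<longlonglongrightarrow> ennreal (D' x - g x)"
        using elim by (intro tendsto_ennrealI tendsto_diff)
      then show ?case by (simp add: lim_imp_Liminf)
    qed
  qed
  also have "\<dots> \<le> liminf (\<lambda>j. \<integral>\<^sup>+x. ennreal (D j x - f j x) \<partial>M)"
    by (intro nn_integral_liminf) measurable
  also have "\<dots> = liminf (\<lambda>j. ennreal ((LINT x|M. D j x) - (LINT x|M. f j x)))"
  proof -
    have "(\<integral>\<^sup>+x. ennreal (D j x - f j x) \<partial>M) = ennreal ((LINT x|M. D j x) - (LINT x|M. f j x))" for j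
      using nn(2)[of j] fi[of j] D(1)[of j] by (subst nn_integral_eq_integral) auto
    then show ?thesis by simp
  qed
  finally have lim: "ennreal d \<le> liminf (\<lambda>j. ennreal ((LINT x|M. D j x) - (LINT x|M. f j x)))" .
  have ev1: "\<forall>\<^sub>F j in sequentially. d - e / 2 < (LINT x|M. D j x) - (LINT x|M. f j x)"
  proof (cases "d - e / 2 < 0")
    case True
    have "0 \<le> (LINT x|M. D j x) - (LINT x|M. f j x)" for j
      using integral_nonneg_AE[OF nn(2)[of j]] fi[of j] D(1)[of j] by simp
    then show ?thesis using True by (intro always_eventually allI) (meson less_le_trans)
  next
    case False
    then have "ennreal (d - e / 2) < ennreal d" using e by (simp add: ennreal_less_iff)
    then have "\<forall>\<^sub>F j in sequentially. ennreal (d - e / 2) < ennreal ((LINT x|M. D j x) - (LINT x|M. f j x))"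
      using lim by (intro less_LiminfD) (rule less_le_trans)
    then show ?thesis by eventually_elim (use False in \<open>simp add: ennreal_less_iff\<close>)
  qed
  have "\<forall>\<^sub>F j in sequentially. (LINT x|M. D j x) < (LINT x|M. D' x) + e / 2"
    using Dint e by (intro order_tendstoD(2)) auto
  with ev1 show "\<forall>\<^sub>F j in sequentially. (LINT x|M. f j x) < (LINT x|M. g x) + e"
    by eventually_elim (simp add: d_def)
qed

section \<open>Bounds for the integrand, and stability of the inequality under limits\<close>

context onofri
begin

text \<open>The Cauchy-Schwarz inequality bounds \<open>gv x \<bullet> b\<close> in terms of the
  norms \<open>A\<close> and \<open>s\<close>; what remains is the tangent inequality for the N-th
  power of a real variable.\<close>

lemma Hf_nonneg: "0 \<le> Hf x b"
proof -
  define A where "A = norm (gv x)"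
  define s where "s = norm (gv x + b)"
  obtain m where m: "n = m + 2" using le_Suc_ex[OF dim] by (auto simp: add.commute)
  have nN: "N = real (m + 2)" by (simp add: N_def m)
  have "gv x \<bullet> (gv x + b) \<le> A * s" unfolding A_def s_def by (rule norm_cauchy_schwarz)
  then have cs: "gv x \<bullet> b \<le> A * s - A * A" by (simp add: inner_add_right A_def dot_square_norm power2_eq_square)
  have "A ^ n + real n * A ^ (n - 1) * (s - A) \<le> s ^ n"
    by (rule power_tangent_le) (auto simp: A_def s_def)
  moreover have "N * A ^ (n - 2) * (gv x \<bullet> b) \<le> N * A ^ (n - 2) * (A * s - A * A)"
    using cs N by (intro mult_left_mono) (auto simp: A_def)
  moreover have "N * A ^ (n - 2) * (A * s - A * A) = real n * A ^ (n - 1) * (s - A)"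
    by (simp add: N_def m algebra_simps)
  ultimately show ?thesis unfolding Hf_def A_def[symmetric] s_def[symmetric] by simp
qed

definition CH :: real where "CH = N\<^sup>2 * 3 ^ n + N"

lemma CH_pos: "0 < CH" using N by (simp add: CH_def add_pos_pos)

definition Hdom :: "'a \<Rightarrow> real \<Rightarrow> real" where "Hdom x t = t ^ n + norm (gv x) ^ (n - 2) * t\<^sup>2"

lemma Hdom_nonneg: "0 \<le> t \<Longrightarrow> 0 \<le> Hdom x t" by (simp add: Hdom_def)

lemma Hdom_mono: "0 \<le> s \<Longrightarrow> s \<le> t \<Longrightarrow> Hdom x s \<le> Hdom x t"
  unfolding Hdom_def by (intro add_mono mult_left_mono power_mono) auto

lemma Hdom_add: "0 \<le> s \<Longrightarrow> 0 \<le> t \<Longrightarrow> Hdom x (s + t) \<le> 2 ^ n * (Hdom x s + Hdom x t)"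
proof -
  assume st: "0 \<le> s" "0 \<le> t"
  have "(s + t)\<^sup>2 \<le> 2 ^ 2 * (s\<^sup>2 + t\<^sup>2)" by (rule power_sum_le[OF st])
  also have "\<dots> \<le> 2 ^ n * (s\<^sup>2 + t\<^sup>2)" using dim by (intro mult_right_mono power_increasing) auto
  finally have "norm (gv x) ^ (n - 2) * (s + t)\<^sup>2 \<le> norm (gv x) ^ (n - 2) * (2 ^ n * (s\<^sup>2 + t\<^sup>2))"
    by (intro mult_left_mono) auto
  then show ?thesis unfolding Hdom_def using power_sum_le[OF st, of n] by (simp add: algebra_simps)
qed

text \<open>Two errors add up. The scalar tangent remainder at \<open>A\<close> is at most
  \<open>N^2 * (s + A)^(N - 2) * (s - A)^2\<close>, where \<open>s - A\<close> is at most the norm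
  of \<open>b\<close>; this gives the first summand of \<open>CH\<close>. Replacing
  \<open>A * (s - A)\<close> by \<open>gv x \<bullet> b\<close> costs
  \<open>(B^2 - (s - A)^2) / 2\<close>; this gives the second.\<close>

lemma Hf_le: "Hf x b \<le> CH * Hdom x (norm b)"
proof -
  define A where "A = norm (gv x)"
  define B where "B = norm b"
  define s where "s = norm (gv x + b)"
  obtain m where m: "n = m + 2" using le_Suc_ex[OF dim] by (auto simp: add.commute)
  have nn: "0 \<le> A" "0 \<le> B" "0 \<le> s" by (auto simp: A_def B_def s_def)
  have s2: "s\<^sup>2 = A\<^sup>2 + 2 * (gv x \<bullet> b) + B\<^sup>2"
    by (simp add: s_def A_def B_def power2_norm_eq_inner inner_add_left inner_add_right inner_commute)
  have sA: "\<bar>s - A\<bar> \<le> B" using norm_triangle_ineq3[of "gv x + b" "gv x"] by (simp add: s_def A_def B_def)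
  then have sA2: "(s - A)\<^sup>2 \<le> B\<^sup>2" using nn by (metis abs_le_square_iff abs_of_nonneg)
  have sle: "s + A \<le> 2 * A + B" using sA by linarith
  have p3: "(2 * A + B) ^ m \<le> 3 ^ m * (A ^ m + B ^ m)"
  proof -
    have "(2 * A + B) ^ m \<le> (3 * max A B) ^ m" using nn by (intro power_mono) auto
    also have "\<dots> = 3 ^ m * max A B ^ m" by (rule power_mult_distrib)
    also have "max A B ^ m \<le> A ^ m + B ^ m" using nn by (auto simp: max_def)
    finally show ?thesis by simp
  qed
  have "s ^ n - A ^ n - N * A ^ (n - 1) * (s - A) \<le> N\<^sup>2 * (s + A) ^ m * (s - A)\<^sup>2"
    using power_tangent_ge[of A s m] nn by (simp add: m N_def)
  also have "\<dots> \<le> N\<^sup>2 * (3 ^ m * (A ^ m + B ^ m)) * B\<^sup>2"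
    using nn sA2 order_trans[OF power_mono[OF sle, of m] p3] by (intro mult_mono mult_nonneg_nonneg) auto
  finally have 1: "s ^ n - A ^ n - N * A ^ (n - 1) * (s - A) \<le> N\<^sup>2 * (3 ^ m * (A ^ m + B ^ m)) * B\<^sup>2" .
  have "A * (s - A) - gv x \<bullet> b = (B\<^sup>2 - (s - A)\<^sup>2) / 2"
    using s2 by (simp add: power2_eq_square algebra_simps)
  also have "\<dots> \<le> B\<^sup>2" using nn by simp
  finally have "N * A ^ m * (A * (s - A) - gv x \<bullet> b) \<le> N * A ^ m * B\<^sup>2"
    using N nn by (intro mult_left_mono) auto
  then have 2: "N * A ^ (n - 1) * (s - A) - N * A ^ m * (gv x \<bullet> b) \<le> N * A ^ m * B\<^sup>2"
    by (simp add: m algebra_simps)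
  have "Hf x b \<le> N\<^sup>2 * (3 ^ m * (A ^ m + B ^ m)) * B\<^sup>2 + N * A ^ m * B\<^sup>2"
    using 1 2 unfolding Hf_def A_def[symmetric] s_def[symmetric] by (simp add: m)
  also have "\<dots> \<le> (N\<^sup>2 * 3 ^ n) * ((A ^ m + B ^ m) * B\<^sup>2) + N * ((A ^ m + B ^ m) * B\<^sup>2)"
  proof (rule add_mono)
    have "N\<^sup>2 * 3 ^ m * ((A ^ m + B ^ m) * B\<^sup>2) \<le> N\<^sup>2 * 3 ^ n * ((A ^ m + B ^ m) * B\<^sup>2)"
      using nn m by (intro mult_right_mono mult_left_mono power_increasing mult_nonneg_nonneg add_nonneg_nonneg) auto
    then show "N\<^sup>2 * (3 ^ m * (A ^ m + B ^ m)) * B\<^sup>2 \<le> (N\<^sup>2 * 3 ^ n) * ((A ^ m + B ^ m) * B\<^sup>2)" by (simp add: mult_ac)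
    have "N * (A ^ m * B\<^sup>2) \<le> N * ((A ^ m + B ^ m) * B\<^sup>2)"
      using nn N by (intro mult_left_mono mult_right_mono) auto
    then show "N * A ^ m * B\<^sup>2 \<le> N * ((A ^ m + B ^ m) * B\<^sup>2)" by (simp add: mult_ac)
  qed
  also have "\<dots> = CH * Hdom x B"
  proof -
    have e: "B ^ n = B ^ m * B\<^sup>2" "n - 2 = m" by (simp_all only: m power_add)
    show ?thesis by (simp only: CH_def Hdom_def A_def[symmetric] e) (simp add: algebra_simps)
  qed
  finally show ?thesis by (simp add: B_def)
qed

lemma Hf_measurable[measurable]:
  assumes [measurable]: "G \<in> borel_measurable borel"
  shows "(\<lambda>x. Hf x (G x)) \<in> borel_measurable borel"
  unfolding Hf_def by measurable

lemma Hf_tendsto: "(G \<longlongrightarrow> b) F \<Longrightarrow> ((\<lambda>j. Hf x (G j)) \<longlongrightarrow> Hf x b) F"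
  unfolding Hf_def by (intro tendsto_intros)

definition onofri_ineq :: "('a \<Rightarrow> real) \<Rightarrow> ('a \<Rightarrow> 'a) \<Rightarrow> bool" where
  "onofri_ineq U G \<longleftrightarrow> (\<integral>\<^sup>+x. ennreal (exp (U x) * dens x) \<partial>lborel)
     \<le> ennreal (exp (1 / om * (LINT x|lborel. Hf x (G x)) + (LINT x|lborel. U x * dens x)))"

text \<open>The two sides are semicontinuous in matching directions. Fatou's lemma bounds the
  exponential integral of the limit, the means converge by dominated convergence, and Pratt's lemma
  keeps the limit superior of the integrals of \<open>Hf\<close> below the integral of the
  limit.\<close>

lemma onofri_ineq_limit:
  assumes [measurable]: "\<And>j. U' j \<in> borel_measurable borel" "\<And>j. G' j \<in> borel_measurable borel"
      "U \<in> borel_measurable borel" "G \<in> borel_measurable borel"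
    and ineq: "\<And>j. onofri_ineq (U' j) (G' j)"
    and Ulim: "AE x in lborel. (\<lambda>j. U' j x) \<longlonglongrightarrow> U x" and Glim: "AE x in lborel. (\<lambda>j. G' j x) \<longlonglongrightarrow> G x"
    and UE: "\<And>j x. \<bar>U' j x\<bar> \<le> E x" and E: "integrable lborel (\<lambda>x. E x * dens x)"
    and HD: "\<And>j. AE x in lborel. Hf x (G' j x) \<le> D j x"
    and Dlim: "AE x in lborel. (\<lambda>j. D j x) \<longlonglongrightarrow> D' x"
    and D: "\<And>j. integrable lborel (D j)" "integrable lborel D'"
    and Dint: "(\<lambda>j. LINT x|lborel. D j x) \<longlonglongrightarrow> (LINT x|lborel. D' x)"
  shows "onofri_ineq U G" "integrable lborel (\<lambda>x. Hf x (G x))"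
proof -
  have Hlim: "AE x in lborel. (\<lambda>j. Hf x (G' j x)) \<longlonglongrightarrow> Hf x (G x)"
    using Glim by eventually_elim (rule Hf_tendsto)
  have HD': "AE x in lborel. 0 \<le> Hf x (G' j x) \<and> Hf x (G' j x) \<le> D j x" for j
    using HD[of j] by eventually_elim (simp add: Hf_nonneg)
  note pr = pratt[of "\<lambda>j x. Hf x (G' j x)" lborel "\<lambda>x. Hf x (G x)" D D', OF _ _ HD' Hlim Dlim D Dint]
  show "integrable lborel (\<lambda>x. Hf x (G x))" by (rule pr(1)[of 1]) auto
  have Eb: "AE x in lborel. norm (U' j x * dens x) \<le> E x * dens x" for j
    using UE[of j] dens_pos by (auto simp: abs_mult less_imp_le intro!: AE_I2 mult_right_mono)
  have Uint: "(\<lambda>j. LINT x|lborel. U' j x * dens x) \<longlonglongrightarrow> (LINT x|lborel. U x * dens x)"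
  proof (rule integral_dominated_convergence[OF _ _ E _ Eb])
    show "AE x in lborel. (\<lambda>j. U' j x * dens x) \<longlonglongrightarrow> U x * dens x"
      using Ulim by eventually_elim (intro tendsto_intros)
  qed measurable
  define c where "c = 1 / om * (LINT x|lborel. Hf x (G x)) + (LINT x|lborel. U x * dens x)"
  \<comment> \<open>The margin \<open>e\<close> is shared equally between the energy and the mean;
    it is sent to 0 at the end.\<close>
  have le: "(\<integral>\<^sup>+x. ennreal (exp (U x) * dens x) \<partial>lborel) \<le> ennreal (exp (c + e))" if e: "0 < e" for e
  proof -
    have "\<forall>\<^sub>F j in sequentially. (LINT x|lborel. Hf x (G' j x)) < (LINT x|lborel. Hf x (G x)) + om * e / 2"
      using e om_pos by (intro pr(2)) auto
    moreover have "\<forall>\<^sub>F j in sequentially. (LINT x|lborel. U' j x * dens x) < (LINT x|lborel. U x * dens x) + e / 2"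
      using Uint e by (intro order_tendstoD(2)) auto
    ultimately have ev: "\<forall>\<^sub>F j in sequentially. (\<integral>\<^sup>+x. ennreal (exp (U' j x) * dens x) \<partial>lborel) \<le> ennreal (exp (c + e))"
    proof eventually_elim
      case (elim j)
      have "1 / om * (LINT x|lborel. Hf x (G' j x)) \<le> 1 / om * ((LINT x|lborel. Hf x (G x)) + om * e / 2)"
        using elim(1) om_pos by (intro mult_left_mono) auto
      also have "\<dots> = 1 / om * (LINT x|lborel. Hf x (G x)) + e / 2" using om_pos by (simp add: field_simps)
      finally have "1 / om * (LINT x|lborel. Hf x (G' j x)) + (LINT x|lborel. U' j x * dens x) \<le> c + e"
        using elim(2) by (simp add: c_def)
      then show ?case using ineq[of j] unfolding onofri_ineq_def by (meson ennreal_leI exp_le_cancel_iff order_trans)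
    qed
    have "(\<integral>\<^sup>+x. ennreal (exp (U x) * dens x) \<partial>lborel) \<le> (\<integral>\<^sup>+x. liminf (\<lambda>j. ennreal (exp (U' j x) * dens x)) \<partial>lborel)"
    proof (rule nn_integral_mono_AE)
      show "AE x in lborel. ennreal (exp (U x) * dens x) \<le> liminf (\<lambda>j. ennreal (exp (U' j x) * dens x))"
        using Ulim
      proof eventually_elim
        case (elim x)
        then have "(\<lambda>j. ennreal (exp (U' j x) * dens x)) \<longlonglongrightarrow> ennreal (exp (U x) * dens x)"
          by (intro tendsto_ennrealI tendsto_intros)
        then show ?case by (simp add: lim_imp_Liminf)
      qed
    qed
    also have "\<dots> \<le> liminf (\<lambda>j. \<integral>\<^sup>+x. ennreal (exp (U' j x) * dens x) \<partial>lborel)"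
      by (intro nn_integral_liminf) measurable
    also have "\<dots> \<le> liminf (\<lambda>j. ennreal (exp (c + e)))" by (intro Liminf_mono ev)
    also have "\<dots> = ennreal (exp (c + e))" by (simp add: Liminf_const)
    finally show ?thesis .
  qed
  have "(\<lambda>j. ennreal (exp (c + 1 / real (Suc j)))) \<longlonglongrightarrow> ennreal (exp (c + 0))"
    by (intro tendsto_ennrealI tendsto_intros LIMSEQ_Suc[OF lim_1_over_n])
  then have "(\<integral>\<^sup>+x. ennreal (exp (U x) * dens x) \<partial>lborel) \<le> ennreal (exp (c + 0))"
    by (rule LIMSEQ_le_const) (auto intro!: le simp del: of_nat_Suc)
  then show "onofri_ineq U G" by (simp add: onofri_ineq_def c_def)
qed

end

section \<open>Logarithmic cut-off and truncation\<close>

text \<open>A step from 1 on \<open>t \<le> 1\<close> to 0 on \<open>2 \<le> t\<close>. It is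
  continuously differentiable because it is built from squares of positive parts.\<close>

definition cutoff :: "real \<Rightarrow> real" where
  "cutoff t = (max 0 (1 - (max 0 (t - 1))\<^sup>2))\<^sup>2"

definition cutoff_deriv :: "real \<Rightarrow> real" where
  "cutoff_deriv t = - 4 * max 0 (1 - (max 0 (t - 1))\<^sup>2) * max 0 (t - 1)"

lemma positive_part_square_deriv: "((\<lambda>t::real. (max 0 t)\<^sup>2) has_real_derivative 2 * max 0 t) (at t)"
proof -
  consider "t > 0" | "t < 0" | "t = 0" by linarith
  then show ?thesis
  proof cases
    case 1
    have "((\<lambda>t. t\<^sup>2) has_real_derivative 2 * max 0 t) (at t)"
      using 1 by (auto intro!: derivative_eq_intros)
    moreover have "\<forall>\<^sub>F s in nhds t. s\<^sup>2 = (max 0 s)\<^sup>2"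
      using eventually_nhds_in_open[of "{0<..}" t] 1 by (auto elim!: eventually_mono)
    ultimately show ?thesis by (simp add: DERIV_cong_ev)
  next
    case 2
    have "((\<lambda>t. 0) has_real_derivative 2 * max 0 t) (at t)" using 2 by simp
    moreover have "\<forall>\<^sub>F s in nhds t. 0 = (max 0 s)\<^sup>2"
      using eventually_nhds_in_open[of "{..<0}" t] 2 by (auto elim!: eventually_mono)
    ultimately show ?thesis using DERIV_cong_ev[OF refl, of "\<lambda>t. 0" "\<lambda>t. (max 0 t)\<^sup>2"] by blast
  next
    case 3
    have "((\<lambda>h::real. max 0 h) \<longlongrightarrow> max 0 0) (at 0)" by (intro tendsto_intros)
    then have m: "((\<lambda>h::real. max 0 h) \<longlongrightarrow> 0) (at 0)" by simp
    have "((\<lambda>h::real. (max 0 h)\<^sup>2 / h) \<longlongrightarrow> 0) (at 0)"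
    proof (rule Lim_transform_eventually[OF m])
      show "\<forall>\<^sub>F h in at (0::real). max 0 h = (max 0 h)\<^sup>2 / h"
        unfolding eventually_at_filter
        by (intro always_eventually allI impI) (simp add: max_def power2_eq_square)
    qed
    then show ?thesis using 3 by (simp add: DERIV_def)
  qed
qed

lemma cutoff_has_deriv: "(cutoff has_real_derivative cutoff_deriv t) (at t)"
proof -
  have d1: "((\<lambda>t. (max 0 (t - 1))\<^sup>2) has_real_derivative 2 * max 0 (t - 1) * 1) (at t)"
    by (rule DERIV_chain2[OF positive_part_square_deriv]) (auto intro!: derivative_eq_intros)
  have "((\<lambda>t. 1 - (max 0 (t - 1))\<^sup>2) has_real_derivative (0 - 2 * max 0 (t - 1) * 1)) (at t)"
    by (intro DERIV_diff DERIV_const d1)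
  from DERIV_chain2[OF positive_part_square_deriv this] show ?thesis
    by (simp add: cutoff_def[abs_def] cutoff_deriv_def mult_ac)
qed

lemma cutoff_eq_1: "t \<le> 1 \<Longrightarrow> cutoff t = 1" by (simp add: cutoff_def)

lemma cutoff_eq_0:
  assumes "2 \<le> t"
  shows "cutoff t = 0" "cutoff_deriv t = 0"
proof -
  have "1 \<le> (max 0 (t - 1))\<^sup>2" using power_mono[of 1 "t - 1" 2] assms by simp
  then have "max 0 (1 - (max 0 (t - 1))\<^sup>2) = 0" by simp
  then show "cutoff t = 0" "cutoff_deriv t = 0" by (simp_all add: cutoff_def cutoff_deriv_def)
qed

lemma cutoff_bounds: "0 \<le> cutoff t" "cutoff t \<le> 1"
  by (auto simp: cutoff_def intro!: power_le_one)

lemma cutoff_deriv_le: "\<bar>cutoff_deriv t\<bar> \<le> 4"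
proof (cases "t \<le> 2")
  case True
  have "max 0 (1 - (max 0 (t - 1))\<^sup>2) * max 0 (t - 1) \<le> 1 * 1"
    using True by (intro mult_mono) auto
  then show ?thesis by (simp add: cutoff_deriv_def abs_mult)
qed (use cutoff_eq_0 in auto)

lemma cutoff_deriv_eq_0: "t \<le> 1 \<Longrightarrow> cutoff_deriv t = 0" by (simp add: cutoff_deriv_def)

lemma continuous_cutoff: "continuous_on X cutoff" "continuous_on X cutoff_deriv"
  unfolding cutoff_def cutoff_deriv_def by (intro continuous_intros)+

text \<open>The argument \<open>1 + x \<bullet> x\<close> avoids the singularity of the logarithm
  and of the norm at the origin. The transition takes place between radii of order
  \<open>exp (L / 2)\<close> and \<open>exp L\<close>, so the gradient is of order
  \<open>1 / (L * norm x)\<close> there.\<close>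

definition log_cutoff :: "real \<Rightarrow> 'a::euclidean_space \<Rightarrow> real" where
  "log_cutoff L x = cutoff (ln (1 + x \<bullet> x) / L)"

definition log_cutoff_grad :: "real \<Rightarrow> 'a::euclidean_space \<Rightarrow> 'a" where
  "log_cutoff_grad L x = (cutoff_deriv (ln (1 + x \<bullet> x) / L) / (L * (1 + x \<bullet> x)) * 2) *\<^sub>R x"

lemma one_inner_pos: "0 < 1 + x \<bullet> x" by (simp add: add_pos_nonneg)

lemma one_inner_neq_0: "1 + x \<bullet> x \<noteq> 0" using one_inner_pos[of x] by simp

lemma log_cutoff_GDERIV:
  assumes L: "0 < L"
  shows "GDERIV (log_cutoff L) x :> log_cutoff_grad L x"
proof -
  have d: "GDERIV (\<lambda>x. x \<bullet> x) x :> 2 *\<^sub>R x"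
    unfolding gderiv_def by (auto intro!: derivative_eq_intros simp: inner_commute)
  have "((\<lambda>s. ln (1 + s) / L) has_real_derivative 1 / (1 + x \<bullet> x) / L) (at (x \<bullet> x))"
    using L one_inner_pos[of x] by (auto intro!: derivative_eq_intros)
  from DERIV_chain2[OF cutoff_has_deriv this]
  have "((\<lambda>s. cutoff (ln (1 + s) / L)) has_real_derivative cutoff_deriv (ln (1 + x \<bullet> x) / L) * (1 / (1 + x \<bullet> x) / L)) (at (x \<bullet> x))" .
  from GDERIV_DERIV_compose[OF d this] show ?thesis
    by (simp add: log_cutoff_def[abs_def] log_cutoff_grad_def mult_ac)
qed

lemma continuous_log_cutoff:
  assumes L: "0 < L"
  shows "continuous_on X (log_cutoff L)" "continuous_on X (log_cutoff_grad L)"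
proof -
  have c: "continuous_on X (\<lambda>x. ln (1 + x \<bullet> x) / L)"
    using L by (intro continuous_intros) (auto simp: one_inner_neq_0)
  show "continuous_on X (log_cutoff L)"
    unfolding log_cutoff_def[abs_def] by (rule continuous_on_compose2[OF continuous_cutoff(1)[of UNIV] c]) simp
  have "continuous_on X (\<lambda>x. cutoff_deriv (ln (1 + x \<bullet> x) / L))"
    by (rule continuous_on_compose2[OF continuous_cutoff(2)[of UNIV] c]) simp
  then show "continuous_on X (log_cutoff_grad L)"
    unfolding log_cutoff_grad_def[abs_def] using L
    by (intro continuous_intros) (auto simp: one_inner_neq_0)
qed

lemma log_cutoff_eq_0:
  assumes L: "0 < L" and x: "exp L \<le> norm x"
  shows "log_cutoff L x = 0" "log_cutoff_grad L x = 0"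
proof -
  have "exp (2 * L) = exp L * exp L" by (simp add: exp_add[symmetric])
  also have "\<dots> \<le> norm x * norm x" using x by (intro mult_mono) auto
  also have "\<dots> \<le> 1 + x \<bullet> x" by (simp add: dot_square_norm power2_eq_square)
  finally have "2 * L \<le> ln (1 + x \<bullet> x)" using one_inner_pos[of x] by (simp add: ln_ge_iff)
  then have "2 \<le> ln (1 + x \<bullet> x) / L" using L by (simp add: field_simps)
  then show "log_cutoff L x = 0" "log_cutoff_grad L x = 0"
    by (simp_all add: log_cutoff_def log_cutoff_grad_def cutoff_eq_0)
qed

text \<open>The constant is \<open>4 * 2 * 2\<close>: the bound on \<open>cutoff_deriv\<close>, the
  gradient of \<open>x \<bullet> x\<close>, and the comparison of
  \<open>norm x / (1 + (norm x)^2)\<close> with \<open>1 / (1 + norm x)\<close>.\<close>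

lemma log_cutoff_grad_le:
  assumes L: "0 < L"
  shows "norm (log_cutoff_grad L x) \<le> 16 / (L * (1 + norm x))"
proof -
  have p: "0 < 1 + (norm x)\<^sup>2" "0 < 1 + norm x" by (auto simp: add_pos_nonneg)
  have "norm x * (1 + norm x) \<le> 2 * (1 + (norm x)\<^sup>2)"
  proof -
    have "2 * (1 + t\<^sup>2) - t * (1 + t) = (t - 1)\<^sup>2 + (1 + t)" for t :: real
      by (simp add: power2_eq_square algebra_simps)
    from this[of "norm x"] have "0 \<le> 2 * (1 + (norm x)\<^sup>2) - norm x * (1 + norm x)" by (simp only: add_nonneg_nonneg zero_le_power2 norm_ge_zero zero_le_one)
    then show ?thesis by simp
  qed
  then have "norm x / (1 + (norm x)\<^sup>2) \<le> 2 / (1 + norm x)"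
    using p by (simp add: divide_simps mult.commute)
  then have "8 / L * (norm x / (1 + (norm x)\<^sup>2)) \<le> 8 / L * (2 / (1 + norm x))"
    using L by (intro mult_left_mono) auto
  moreover have "norm (log_cutoff_grad L x) \<le> 8 / L * (norm x / (1 + (norm x)\<^sup>2))"
  proof -
    have "norm (log_cutoff_grad L x) = \<bar>cutoff_deriv (ln (1 + x \<bullet> x) / L)\<bar> * (2 / L * (norm x / (1 + (norm x)\<^sup>2)))"
      using L p by (simp add: log_cutoff_grad_def abs_mult dot_square_norm)
    also have "\<dots> \<le> 4 * (2 / L * (norm x / (1 + (norm x)\<^sup>2)))"
      using L by (intro mult_right_mono cutoff_deriv_le mult_nonneg_nonneg) auto
    finally show ?thesis by simp
  qed
  ultimately show ?thesis by simp
qed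

lemma log_cutoff_tendsto:
  assumes L: "filterlim L at_top sequentially"
  shows "\<forall>\<^sub>F j in sequentially. log_cutoff (L j) x = 1 \<and> log_cutoff_grad (L j) x = 0"
proof -
  have "\<forall>\<^sub>F j in sequentially. max 1 (ln (1 + x \<bullet> x)) \<le> L j"
    using L unfolding filterlim_at_top by blast
  then show ?thesis
  proof eventually_elim
    case (elim j)
    then have "ln (1 + x \<bullet> x) / L j \<le> 1" by (simp add: divide_le_eq_1)
    then show ?case by (simp add: log_cutoff_def log_cutoff_grad_def cutoff_eq_1 cutoff_deriv_eq_0)
  qed
qed

text \<open>The arctangent bounds the values by \<open>2 * k\<close> and has a derivative between 0
  and 1 after scaling. Gradients therefore never grow, and the identity dominates all truncations at
  once.\<close>

definition soft :: "real \<Rightarrow> real \<Rightarrow> real" where "soft k s = k * arctan (s / k)"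

definition soft_deriv :: "real \<Rightarrow> real \<Rightarrow> real" where "soft_deriv k s = 1 / (1 + (s / k)\<^sup>2)"

lemma soft_has_deriv:
  assumes "0 < k"
  shows "(soft k has_real_derivative soft_deriv k s) (at s)"
proof -
  have "((\<lambda>s. s / k) has_real_derivative 1 / k) (at s)"
    using assms by (auto intro!: derivative_eq_intros)
  then have "((\<lambda>s. k * arctan (s / k)) has_real_derivative k * (inverse (1 + (s / k)\<^sup>2) * (1 / k))) (at s)"
    by (intro DERIV_cmult DERIV_chain2[OF DERIV_arctan])
  then show ?thesis using assms by (simp add: soft_def[abs_def] soft_deriv_def inverse_eq_divide)
qed

lemma soft_le: "0 < k \<Longrightarrow> \<bar>soft k s\<bar> \<le> 2 * k"
proof -
  assume k: "0 < k"
  have "\<bar>arctan (s / k)\<bar> \<le> 2" using arctan_bounded[of "s / k"] pi_less_4 by linarith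
  then show ?thesis using k by (simp add: soft_def abs_mult)
qed

lemma soft_abs_le: "0 < k \<Longrightarrow> \<bar>soft k s\<bar> \<le> \<bar>s\<bar>"
  using abs_arctan_le[of "s / k"] by (simp add: soft_def abs_mult field_simps)

lemma soft_deriv_bounds: "0 \<le> soft_deriv k s" "soft_deriv k s \<le> 1"
proof -
  have "1 / (1 + (s / k)\<^sup>2) \<le> 1 / 1" by (rule frac_le) auto
  then show "0 \<le> soft_deriv k s" "soft_deriv k s \<le> 1" by (auto simp: soft_deriv_def add_nonneg_nonneg)
qed

lemma continuous_soft: "0 < k \<Longrightarrow> continuous_on X (soft k)" "0 < k \<Longrightarrow> continuous_on X (soft_deriv k)"
proof -
  have "1 + (s / k)\<^sup>2 \<noteq> 0" for s by (metis add_pos_nonneg less_irrefl zero_le_power2 zero_less_one)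
  then show "0 < k \<Longrightarrow> continuous_on X (soft k)" "0 < k \<Longrightarrow> continuous_on X (soft_deriv k)"
    unfolding soft_def[abs_def] soft_deriv_def[abs_def] by (auto intro!: continuous_intros)
qed

lemma soft_tendsto:
  "(\<lambda>j. soft (real (Suc j)) s) \<longlonglongrightarrow> s" "(\<lambda>j. soft_deriv (real (Suc j)) s) \<longlonglongrightarrow> 1"
proof -
  have z: "(\<lambda>j. s * (1 / real (Suc j))) \<longlonglongrightarrow> s * 0"
    by (intro tendsto_mult tendsto_const LIMSEQ_Suc[OF lim_1_over_n])
  then have z: "(\<lambda>j. s / real (Suc j)) \<longlonglongrightarrow> 0" by simp
  have "(\<lambda>j. 1 / (1 + (s / real (Suc j))\<^sup>2)) \<longlonglongrightarrow> 1 / (1 + 0\<^sup>2)"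
    by (intro tendsto_intros z) simp
  then show "(\<lambda>j. soft_deriv (real (Suc j)) s) \<longlonglongrightarrow> 1" by (simp add: soft_deriv_def)
  show "(\<lambda>j. soft (real (Suc j)) s) \<longlonglongrightarrow> s"
  proof (cases "s = 0")
    case False
    have "(arctan has_real_derivative 1) (at 0)" using DERIV_arctan[of 0] by simp
    then have "((\<lambda>h. arctan h / h) \<longlongrightarrow> 1) (at 0)" by (simp add: DERIV_def)
    moreover have "filterlim (\<lambda>j. s / real (Suc j)) (at 0) sequentially"
      unfolding filterlim_at using z False by auto
    ultimately have "(\<lambda>j. arctan (s / real (Suc j)) / (s / real (Suc j))) \<longlonglongrightarrow> 1"
      by (rule filterlim_compose)
    then have "(\<lambda>j. s * (arctan (s / real (Suc j)) / (s / real (Suc j)))) \<longlonglongrightarrow> s * 1" by (intro tendsto_intros)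
    moreover have "s * (arctan (s / real (Suc j)) / (s / real (Suc j))) = soft (real (Suc j)) s" for j
      using False by (simp add: soft_def)
    ultimately show ?thesis by simp
  qed (simp add: soft_def)
qed

lemma soft_measurable[measurable]:
  "soft k \<in> borel_measurable borel" "soft_deriv k \<in> borel_measurable borel"
  unfolding soft_def[abs_def] soft_deriv_def[abs_def] by measurable

lemma log_cutoff_measurable:
  assumes L: "0 < L"
  shows "(log_cutoff L :: 'a::euclidean_space \<Rightarrow> real) \<in> borel_measurable borel"
    "(log_cutoff_grad L :: 'a::euclidean_space \<Rightarrow> 'a) \<in> borel_measurable borel"
  by (rule borel_measurable_continuous_onI, rule continuous_log_cutoff[OF L])+

lemma tendsto_L1_subseq_limit:
  fixes f :: "nat \<Rightarrow> 'a \<Rightarrow> 'b::{banach, second_countable_topology}"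
  assumes "\<And>j. integrable M (f j)" "integrable M g" "(\<lambda>j. LINT x|M. norm (f j x - g x)) \<longlonglongrightarrow> 0"
  obtains r :: "nat \<Rightarrow> nat" where "strict_mono r" "AE x in M. (\<lambda>j. f (r j) x) \<longlonglongrightarrow> g x"
proof -
  obtain r :: "nat \<Rightarrow> nat" where r: "strict_mono r" "AE x in M. (\<lambda>j. f (r j) x - g x) \<longlonglongrightarrow> 0"
    using tendsto_L1_AE_subseq[of M "\<lambda>j x. f j x - g x"] assms by auto
  from r(2) have "AE x in M. (\<lambda>j. f (r j) x) \<longlonglongrightarrow> g x"
    by eventually_elim (simp add: LIM_zero_iff)
  then show thesis using that r by blast
qed

text \<open>For radii at most 1 the mollification on a ball sees \<open>f\<close> only on the ball
  enlarged by 1. Local integrability can thus be exchanged for integrability of a restricted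
  function.\<close>

lemma mollify_local:
  fixes f :: "'a::euclidean_space \<Rightarrow> 'b::euclidean_space"
  assumes r: "0 < r" "r \<le> 1" and x: "norm x \<le> \<rho>"
  shows "mollify r (\<lambda>y. indicator (cball 0 (\<rho> + 1)) y *\<^sub>R f y) x = mollify r f x"
  unfolding mollify_def
proof (intro Bochner_Integration.integral_cong refl)
  fix y
  show "moll r (x - y) *\<^sub>R indicator (cball 0 (\<rho> + 1)) y *\<^sub>R f y = moll r (x - y) *\<^sub>R f y"
  proof (cases "r \<le> norm (x - y)")
    case True
    then show ?thesis by (simp add: moll_eq_0[OF r(1)])
  next
    case False
    then have "norm y \<le> \<rho> + 1" using x r norm_triangle_ineq2[of y x] by (simp add: norm_minus_commute)
    then show ?thesis by simp
  qed
qed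

section \<open>Removal of mollification, cut-off and truncation\<close>

context onofri
begin

lemma Hf_0: "Hf x 0 = 0" by (simp add: Hf_def)

text \<open>\<open>gv\<close> is bounded and a square is at most 1 plus the n-th power. The additive
  constant is harmless on the bounded support of a fixed cut-off, where this bound is used.\<close>

lemma Hdom_le: "0 \<le> t \<Longrightarrow> Hdom x t \<le> (1 + (2 * N * q) ^ (n - 2)) * t ^ n + (2 * N * q) ^ (n - 2)"
proof -
  assume t: "0 \<le> t"
  have "2 * N * q / (1 + norm x) \<le> 2 * N * q / 1"
    using N q by (intro divide_left_mono) (auto intro!: mult_nonneg_nonneg add_pos_nonneg)
  then have g: "norm (gv x) ^ (n - 2) \<le> (2 * N * q) ^ (n - 2)" using gv_le[of x] by (intro power_mono) auto
  have "t\<^sup>2 \<le> 1 + t ^ n"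
  proof (cases "t \<le> 1")
    case True
    then have "t\<^sup>2 \<le> 1" using t by (simp add: power_le_one)
    then show ?thesis using t zero_le_power[of t n] by linarith
  next
    case False
    then have "t\<^sup>2 \<le> t ^ n" using dim by (intro power_increasing) auto
    then show ?thesis by simp
  qed
  then have "norm (gv x) ^ (n - 2) * t\<^sup>2 \<le> (2 * N * q) ^ (n - 2) * (1 + t ^ n)"
    using g t N q by (intro mult_mono) auto
  then show ?thesis by (simp add: Hdom_def algebra_simps)
qed

text \<open>The defining identity of a weak gradient, tested against translates of the mollifier only.\<close>

definition smooth_gradient :: "('a \<Rightarrow> real) \<Rightarrow> ('a \<Rightarrow> 'a) \<Rightarrow> bool" where
  "smooth_gradient u g \<longleftrightarrow> locally_integrable u \<and> locally_integrable g \<and>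
     (\<forall>r>0. \<forall>x. (LINT y|lborel. u y *\<^sub>R moll_grad r (x - y)) = mollify r g x)"

text \<open>The mollification radius tends to 0 while cut-off and truncation stay fixed. By Jensen's
  inequality the n-th power of the mollified gradient is at most the mollification of
  \<open>pB\<close>, which converges in L1. This supplies convergent dominating functions, as no
  fixed one is at hand.\<close>

lemma onofri_ineq_cut:
  fixes u :: "'a \<Rightarrow> real" and g :: "'a \<Rightarrow> 'a"
  assumes k: "0 < k" and L: "0 < L" and ug: "smooth_gradient u g"
    and gn: "integrable lborel (\<lambda>x. norm (g x) ^ n)"
  shows "onofri_ineq (\<lambda>x. log_cutoff L x * soft k (u x))
    (\<lambda>x. (log_cutoff L x * soft_deriv k (u x)) *\<^sub>R g x + soft k (u x) *\<^sub>R log_cutoff_grad L x)"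
proof -
  have u: "locally_integrable u" and g: "locally_integrable g"
    and grad: "\<And>r x. 0 < r \<Longrightarrow> (LINT y|lborel. u y *\<^sub>R moll_grad r (x - y)) = mollify r g x"
    using ug by (auto simp: smooth_gradient_def)
  have [measurable]: "u \<in> borel_measurable borel" "g \<in> borel_measurable borel"
    using u g by (auto simp: locally_integrable_def)
  note [measurable] = log_cutoff_measurable[OF L, where 'a = 'a]
  define \<rho> where "\<rho> = exp L"
  have \<rho>: "0 < \<rho>" by (simp add: \<rho>_def)
  define uB where "uB x = indicator (cball 0 (\<rho> + 1)) x *\<^sub>R u x" for x
  define gB where "gB x = indicator (cball 0 (\<rho> + 1)) x *\<^sub>R g x" for x
  define pB where "pB x = norm (gB x) ^ n" for x
  have uBi: "integrable lborel uB" and gBi: "integrable lborel gB"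
    using u g unfolding uB_def gB_def locally_integrable_def by auto
  have pBi: "integrable lborel pB"
  proof (rule Bochner_Integration.integrable_bound[OF gn])
    show "AE x in lborel. norm (pB x) \<le> norm (norm (g x) ^ n)"
      using dim by (intro AE_I2) (auto simp: pB_def gB_def indicator_def)
  next
    show "pB \<in> borel_measurable lborel" unfolding pB_def[abs_def] gB_def[abs_def] by measurable
  qed
  define r where "r j = 1 / real (Suc j)" for j
  have rp: "0 < r j" "r j \<le> 1" for j by (auto simp: r_def)
  have sub: "\<exists>s. strict_mono s \<and> (AE x in lborel. (\<lambda>j. mollify (r (s0 (s j))) f x) \<longlonglongrightarrow> f x)"
    if f: "integrable lborel f" and s0: "strict_mono s0" for f :: "'a \<Rightarrow> 'c::euclidean_space" and s0 :: "nat \<Rightarrow> nat"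
  proof -
    have "(\<lambda>j. LINT x|lborel. norm (mollify (r (s0 j)) f x - f x)) \<longlonglongrightarrow> 0"
      using LIMSEQ_subseq_LIMSEQ[OF mollify_tendsto_L1[OF f] s0] by (simp add: o_def r_def)
    then obtain s :: "nat \<Rightarrow> nat" where "strict_mono s" "AE x in lborel. (\<lambda>j. mollify (r (s0 (s j))) f x) \<longlonglongrightarrow> f x"
      using tendsto_L1_subseq_limit[of lborel "\<lambda>j. mollify (r (s0 j)) f" f] mollify_integrable[OF rp(1) f] f by blast
    then show ?thesis by blast
  qed
  \<comment> \<open>L1 convergence gives convergence almost everywhere along a subsequence; three
    successive extractions serve \<open>uB\<close>, \<open>gB\<close> and \<open>pB\<close>
    simultaneously.\<close>
  obtain s1 where s1: "strict_mono s1" "AE x in lborel. (\<lambda>j. mollify (r (s1 j)) uB x) \<longlonglongrightarrow> uB x"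
    using sub[OF uBi, of "\<lambda>j. j"] by (auto simp: strict_mono_def)
  obtain s2 where s2: "strict_mono s2" "AE x in lborel. (\<lambda>j. mollify (r (s1 (s2 j))) gB x) \<longlonglongrightarrow> gB x"
    using sub[OF gBi s1(1)] by auto
  have s12: "strict_mono (\<lambda>j. s1 (s2 j))" using strict_mono_o[OF s1(1) s2(1)] by (simp add: o_def)
  obtain s3 where s3: "strict_mono s3" "AE x in lborel. (\<lambda>j. mollify (r (s1 (s2 (s3 j)))) pB x) \<longlonglongrightarrow> pB x"
    using sub[OF pBi s12] by auto
  define s where "s j = s1 (s2 (s3 j))" for j
  have s23: "strict_mono (\<lambda>j. s2 (s3 j))" using strict_mono_o[OF s2(1) s3(1)] by (simp add: o_def)
  have s: "strict_mono s" using strict_mono_o[OF s12 s3(1)] by (simp add: o_def s_def[abs_def])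
  define rr where "rr j = r (s j)" for j
  have rr: "0 < rr j" "rr j \<le> 1" for j using rp by (auto simp: rr_def)
  have ulim: "AE x in lborel. (\<lambda>j. mollify (rr j) uB x) \<longlonglongrightarrow> uB x"
    using s1(2)
  proof eventually_elim
    case (elim x)
    from LIMSEQ_subseq_LIMSEQ[OF this s23] show ?case by (simp add: o_def rr_def s_def)
  qed
  have glim: "AE x in lborel. (\<lambda>j. mollify (rr j) gB x) \<longlonglongrightarrow> gB x"
    using s2(2)
  proof eventually_elim
    case (elim x)
    from LIMSEQ_subseq_LIMSEQ[OF this s3(1)] show ?case by (simp add: o_def rr_def s_def)
  qed
  have plim: "AE x in lborel. (\<lambda>j. mollify (rr j) pB x) \<longlonglongrightarrow> pB x"
    using s3(2) by (simp add: rr_def s_def)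
  have pL1: "(\<lambda>j. LINT x|lborel. norm (mollify (rr j) pB x - pB x)) \<longlonglongrightarrow> 0"
    using LIMSEQ_subseq_LIMSEQ[OF mollify_tendsto_L1[OF pBi] s] by (simp add: o_def rr_def r_def)
  define uj where "uj j = mollify (rr j) u" for j
  define gj where "gj j = mollify (rr j) g" for j
  have uj_eq: "uj j x = mollify (rr j) uB x" and gj_eq: "gj j x = mollify (rr j) gB x" if "norm x \<le> \<rho>" for j x
    using mollify_local[OF rr that, of j u] mollify_local[OF rr that, of j g]
    by (simp_all add: uj_def gj_def uB_def[abs_def] gB_def[abs_def])
  have cut0: "log_cutoff L x = 0" "log_cutoff_grad L x = 0" if "\<rho> \<le> norm x" for x :: 'a
    using log_cutoff_eq_0[OF L, of x] that by (auto simp: \<rho>_def)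
  have uj_D: "GDERIV (uj j) x :> gj j x" for j x
    using mollify_has_gradient[OF rr(1) u, of j x] grad[OF rr(1)] by (simp add: uj_def gj_def)
  have uj_cont: "continuous_on X (uj j)" for X j
    using uj_D unfolding gderiv_def by (meson continuous_at_imp_continuous_on has_derivative_continuous)
  have gj_cont: "continuous_on UNIV (gj j)" for j
    unfolding gj_def mollify_def[abs_def]
    by (rule locally_integrable_convolution_continuous[OF g continuous_moll[OF rr(1)], where r = "rr j"])
      (simp add: moll_eq_0[OF rr(1)])
  have [measurable]: "uj j \<in> borel_measurable borel" "gj j \<in> borel_measurable borel" for j
    by (rule borel_measurable_continuous_onI, fact uj_cont gj_cont)+
  define U' where "U' j x = log_cutoff L x * soft k (uj j x)" for j x
  define G' where "G' j x = (log_cutoff L x * soft_deriv k (uj j x)) *\<^sub>R gj j x + soft k (uj j x) *\<^sub>R log_cutoff_grad L x" for j x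
  have ineq: "onofri_ineq (U' j) (G' j)" for j
  proof -
    have sc: "continuous_on X (\<lambda>x. soft k (uj j x))" "continuous_on X (\<lambda>x. soft_deriv k (uj j x))" for X
      by (rule continuous_on_compose2[OF continuous_soft(1)[OF k, of UNIV] uj_cont], simp)
        (rule continuous_on_compose2[OF continuous_soft(2)[OF k, of UNIV] uj_cont], simp)
    \<comment> \<open>The mollified, truncated and cut-off function is continuously differentiable
      with compact support, so the smooth case applies to it.\<close>
    interpret P: onofri_perturbed n N q V dens gv "U' j" "G' j" \<rho>
    proof
      fix x
      have "GDERIV (\<lambda>x. soft k (uj j x)) x :> soft_deriv k (uj j x) *\<^sub>R gj j x"
        by (rule GDERIV_DERIV_compose[OF uj_D soft_has_deriv[OF k]])
      from GDERIV_mult[OF log_cutoff_GDERIV[OF L] this]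
      show "GDERIV (U' j) x :> G' j x"
        by (simp add: U'_def[abs_def] G'_def add.commute)
      show "continuous_on UNIV (G' j)"
        unfolding G'_def[abs_def] by (intro continuous_intros sc continuous_log_cutoff L gj_cont)
      show "U' j x = 0" if "\<rho> \<le> norm x" using cut0[OF that] by (simp add: U'_def)
    qed (rule \<rho>)
    show ?thesis using P.onofri_smooth(1) by (simp add: onofri_ineq_def)
  qed
  define K where "K = (2 * N * q) ^ (n - 2)"
  have K: "0 \<le> K" using N q by (simp add: K_def)
  \<comment> \<open>A bound for the part of the gradient that falls on the cut-off: the truncated
    value is at most \<open>2 * k\<close>, and the gradient of the cut-off at most
    \<open>16 / L\<close>.\<close>
  define b where "b = 2 * k * (16 / L)"
  have b: "0 \<le> b" using k L by (simp add: b_def)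
  define c1 where "c1 = CH * 2 ^ n * (1 + K)"
  define c2 where "c2 = CH * 2 ^ n * (K + ((1 + K) * b ^ n + K))"
  define D where "D j x = indicator (cball 0 \<rho>) x * (c1 * mollify (rr j) pB x + c2)" for j x
  define D' where "D' x = indicator (cball 0 \<rho>) x * (c1 * pB x + c2)" for x :: 'a
  have mpi: "integrable lborel (mollify (rr j) pB)" for j by (rule mollify_integrable[OF rr(1) pBi])
  have indm: "integrable lborel (\<lambda>x. indicator (cball 0 \<rho>) x * (c * f x))" if "integrable lborel f" for f :: "'a \<Rightarrow> real" and c
  proof (rule Bochner_Integration.integrable_bound)
    show "integrable lborel (\<lambda>x. c * f x)" using that by simp
    show "AE x in lborel. norm (indicator (cball 0 \<rho>) x * (c * f x)) \<le> norm (c * f x)"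
      by (intro AE_I2) (auto simp: indicator_def)
  qed (use that in measurable)
  have dist: "indicator (cball 0 \<rho>) x * (c * y + d) = indicator (cball 0 \<rho>) x * (c * y) + indicator (cball 0 \<rho>) x * d"
    for x :: 'a and c y d :: real by (simp add: distrib_left)
  have indi': "integrable lborel (\<lambda>x::'a. indicator (cball 0 \<rho>) x * c2 :: real)"
    by (intro integrable_mult_left integrable_real_indicator) (auto simp: emeasure_bounded_finite[OF bounded_cball, simplified])
  have Di: "integrable lborel (D j)" for j
    unfolding D_def[abs_def] dist by (intro Bochner_Integration.integrable_add indm mpi indi')
  have D'i: "integrable lborel D'"
    unfolding D'_def[abs_def] dist by (intro Bochner_Integration.integrable_add indm pBi indi')
  show ?thesis
  proof (rule onofri_ineq_limit(1)[where U' = U' and G' = G' and D = D and D' = D' and E = "\<lambda>_. 2 * k"])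
    show "U' j \<in> borel_measurable borel" "G' j \<in> borel_measurable borel" for j
      unfolding U'_def[abs_def] G'_def[abs_def] by measurable
    show "onofri_ineq (U' j) (G' j)" for j by (rule ineq)
    have sq: "(\<lambda>j. soft k (uj j x)) \<longlonglongrightarrow> soft k (u x)" "(\<lambda>j. soft_deriv k (uj j x)) \<longlonglongrightarrow> soft_deriv k (u x)"
      if "(\<lambda>j. uj j x) \<longlonglongrightarrow> u x" for x
    proof -
      have "isCont (soft k) (u x)" "isCont (soft_deriv k) (u x)"
        using continuous_soft[OF k, of UNIV] by (auto simp: continuous_on_eq_continuous_at)
      then show "(\<lambda>j. soft k (uj j x)) \<longlonglongrightarrow> soft k (u x)" "(\<lambda>j. soft_deriv k (uj j x)) \<longlonglongrightarrow> soft_deriv k (u x)"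
        using that by (auto intro: isCont_tendsto_compose)
    qed
    show "AE x in lborel. (\<lambda>j. U' j x) \<longlonglongrightarrow> log_cutoff L x * soft k (u x)"
      using ulim
    proof eventually_elim
      case (elim x)
      show ?case
      proof (cases "norm x \<le> \<rho>")
        case True
        then have "(\<lambda>j. uj j x) \<longlonglongrightarrow> u x" using elim by (simp add: uj_eq uB_def)
        then show ?thesis unfolding U'_def by (intro tendsto_intros sq)
      next
        case False
        then show ?thesis using cut0[of x] by (simp add: U'_def)
      qed
    qed
    show "AE x in lborel. (\<lambda>j. G' j x) \<longlonglongrightarrow> (log_cutoff L x * soft_deriv k (u x)) *\<^sub>R g x + soft k (u x) *\<^sub>R log_cutoff_grad L x"
      using ulim glim
    proof eventually_elim
      case (elim x)
      show ?case
      proof (cases "norm x \<le> \<rho>")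
        case True
        then have "(\<lambda>j. uj j x) \<longlonglongrightarrow> u x" "(\<lambda>j. gj j x) \<longlonglongrightarrow> g x" using elim by (simp_all add: uj_eq gj_eq uB_def gB_def)
        then show ?thesis unfolding G'_def by (intro tendsto_intros sq)
      next
        case False
        then show ?thesis using cut0[of x] by (simp add: G'_def)
      qed
    qed
    show "\<bar>U' j x\<bar> \<le> 2 * k" for j x
    proof -
      have "\<bar>U' j x\<bar> \<le> 1 * (2 * k)"
        unfolding U'_def abs_mult using soft_le[OF k, of "uj j x"] cutoff_bounds k
        by (intro mult_mono) (auto simp: log_cutoff_def abs_of_nonneg)
      then show ?thesis by simp
    qed
    show "integrable lborel (\<lambda>x. 2 * k * dens x)" using dens_integrable by simp
    show "AE x in lborel. Hf x (G' j x) \<le> D j x" for j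
    proof (rule AE_I2)
      fix x
      show "Hf x (G' j x) \<le> D j x"
      proof (cases "norm x \<le> \<rho>")
        case False
        then show ?thesis using cut0[of x] by (simp add: G'_def D_def Hf_0)
      next
        case True
        have c: "0 \<le> log_cutoff L x" "log_cutoff L x \<le> 1" using cutoff_bounds by (auto simp: log_cutoff_def)
        have d: "norm (log_cutoff_grad L x) \<le> 16 / L"
        proof -
          have "16 / (L * (1 + norm x)) \<le> 16 / (L * 1)"
            using L by (intro divide_left_mono mult_left_mono mult_pos_pos) (auto simp: add_pos_nonneg)
          then show ?thesis using log_cutoff_grad_le[OF L, of x] by simp
        qed
        have "norm (G' j x) \<le> norm ((log_cutoff L x * soft_deriv k (uj j x)) *\<^sub>R gj j x) + norm (soft k (uj j x) *\<^sub>R log_cutoff_grad L x)"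
          unfolding G'_def by (rule norm_triangle_ineq)
        also have "\<dots> \<le> norm (gj j x) + b"
        proof (rule add_mono)
          have "\<bar>log_cutoff L x * soft_deriv k (uj j x)\<bar> * norm (gj j x) \<le> 1 * norm (gj j x)"
            using c soft_deriv_bounds[of k "uj j x"] by (intro mult_right_mono) (auto simp: abs_mult intro!: mult_le_one)
          then show "norm ((log_cutoff L x * soft_deriv k (uj j x)) *\<^sub>R gj j x) \<le> norm (gj j x)" by simp
          have "\<bar>soft k (uj j x)\<bar> * norm (log_cutoff_grad L x) \<le> b"
            unfolding b_def using d soft_le[OF k, of "uj j x"] k by (intro mult_mono) auto
          then show "norm (soft k (uj j x) *\<^sub>R log_cutoff_grad L x) \<le> b" by simp
        qed
        finally have nG: "norm (G' j x) \<le> norm (gj j x) + b" .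
        have "norm (gj j x) ^ n \<le> mollify (rr j) pB x"
          unfolding gj_eq[OF True] pB_def[abs_def] using pBi
          by (intro mollify_power_le rr gBi) (simp add: pB_def[abs_def])
        then have gp: "(1 + K) * norm (gj j x) ^ n \<le> (1 + K) * mollify (rr j) pB x" using K by (intro mult_left_mono) auto
        have "Hf x (G' j x) \<le> CH * Hdom x (norm (G' j x))" by (rule Hf_le)
        also have "\<dots> \<le> CH * Hdom x (norm (gj j x) + b)"
          using nG CH_pos by (intro mult_left_mono Hdom_mono) auto
        also have "\<dots> \<le> CH * (2 ^ n * (Hdom x (norm (gj j x)) + Hdom x b))"
          using b CH_pos by (intro mult_left_mono Hdom_add) auto
        also have "\<dots> \<le> CH * (2 ^ n * (((1 + K) * mollify (rr j) pB x + K) + ((1 + K) * b ^ n + K)))"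
          using Hdom_le[of "norm (gj j x)" x] Hdom_le[OF b, of x] gp CH_pos
          by (intro mult_left_mono add_mono) (auto simp: K_def)
        also have "\<dots> = D j x" using True by (simp add: D_def c1_def c2_def algebra_simps)
        finally show ?thesis .
      qed
    qed
    show "AE x in lborel. (\<lambda>j. D j x) \<longlonglongrightarrow> D' x"
      using plim
    proof eventually_elim
      case (elim x)
      then show ?case unfolding D_def D'_def by (intro tendsto_intros)
    qed
    show "integrable lborel (D j)" for j by (rule Di)
    show "integrable lborel D'" by (rule D'i)
    show "(\<lambda>j. LINT x|lborel. D j x) \<longlonglongrightarrow> (LINT x|lborel. D' x)"
    proof (rule LIM_zero_cancel, rule tendsto_norm_zero_cancel, rule tendsto_sandwich[OF _ _ tendsto_const])
      show "\<forall>\<^sub>F j in sequentially. norm ((LINT x|lborel. D j x) - (LINT x|lborel. D' x)) \<le> \<bar>c1\<bar> * (LINT x|lborel. norm (mollify (rr j) pB x - pB x))"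
      proof (intro always_eventually allI)
        fix j
        have "(LINT x|lborel. D j x) - (LINT x|lborel. D' x) = (LINT x|lborel. D j x - D' x)" using Di D'i by simp
        also have "norm \<dots> \<le> (LINT x|lborel. norm (D j x - D' x))" by (rule integral_norm_bound)
        also have "\<dots> \<le> (LINT x|lborel. \<bar>c1\<bar> * norm (mollify (rr j) pB x - pB x))"
        proof (rule integral_mono)
          fix x
          have "D j x - D' x = indicator (cball 0 \<rho>) x * (c1 * (mollify (rr j) pB x - pB x))"
            by (simp add: D_def D'_def algebra_simps)
          then show "norm (D j x - D' x) \<le> \<bar>c1\<bar> * norm (mollify (rr j) pB x - pB x)"
            by (auto simp: indicator_def abs_mult)
        qed (use Di D'i mpi pBi in auto)
        finally show "norm ((LINT x|lborel. D j x) - (LINT x|lborel. D' x)) \<le> \<bar>c1\<bar> * (LINT x|lborel. norm (mollify (rr j) pB x - pB x))"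
          by simp
      qed
      show "(\<lambda>j. \<bar>c1\<bar> * (LINT x|lborel. norm (mollify (rr j) pB x - pB x))) \<longlonglongrightarrow> 0"
        using tendsto_mult[OF tendsto_const[of "\<bar>c1\<bar>"] pL1] by simp
    qed (simp add: always_eventually)
  qed measurable
qed

end

context onofri
begin

text \<open>Both terms of \<open>Hdom\<close> are bounded by a multiple of
  \<open>1 / (L^2 * (1 + norm x)^n)\<close>, as \<open>n \<ge> 2\<close> and
  \<open>L \<ge> 1\<close>. In polar coordinates the integral up to radius \<open>exp L\<close>
  grows only like \<open>L\<close>, which leaves \<open>C / L\<close>.\<close>

lemma log_cutoff_energy:
  assumes k: "0 < k"
  obtains C where "0 \<le> C" "\<And>L. 1 \<le> L \<Longrightarrow> integrable lborel (\<lambda>x. Hdom x (2 * k * norm (log_cutoff_grad L x)))"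
    "\<And>L. 1 \<le> L \<Longrightarrow> (LINT x|lborel. Hdom x (2 * k * norm (log_cutoff_grad L x))) \<le> C / L"
proof
  \<comment> \<open>The number 32 is the truncation bound 2 times the constant 16 of the cut-off
    gradient; the second summand pairs its square with the decay of \<open>gv\<close>.\<close>
  define C3 where "C3 = (32 * k) ^ n + (2 * N * q) ^ (n - 2) * (32 * k)\<^sup>2"
  have C3: "0 \<le> C3" using k N q by (simp add: C3_def)
  show "0 \<le> 2 * (C3 * (V * N))" using C3 V N by simp
  fix L :: real assume L: "1 \<le> L"
  have L0: "0 < L" using L by simp
  note [measurable] = log_cutoff_measurable[OF L0, where 'a = 'a]
  define P where "P x = Hdom x (2 * k * norm (log_cutoff_grad L x))" for x
  have Pm[measurable]: "P \<in> borel_measurable borel" unfolding P_def[abs_def] Hdom_def by measurable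
  have P0: "0 \<le> P x" for x using k by (simp add: P_def Hdom_nonneg)
  have Ple: "P x \<le> C3 / L\<^sup>2 / (1 + norm x) ^ n" for x
  proof -
    define s where "s = 1 + norm x"
    have s: "0 < s" by (simp add: s_def add_pos_nonneg)
    define t where "t = 32 * k / (L * s)"
    have t: "0 \<le> t" using k L0 s by (simp add: t_def)
    have "2 * k * norm (log_cutoff_grad L x) \<le> 2 * k * (16 / (L * s))"
      using k log_cutoff_grad_le[OF L0, of x] by (intro mult_left_mono) (auto simp: s_def)
    then have "P x \<le> Hdom x t" unfolding P_def t_def using k by (intro Hdom_mono) auto
    also have "\<dots> \<le> t ^ n + (2 * N * q / s) ^ (n - 2) * t\<^sup>2"
      unfolding Hdom_def using gv_le[of x] by (intro add_left_mono mult_right_mono power_mono) (auto simp: s_def)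
    also have "\<dots> = (32 * k) ^ n / s ^ n * (1 / L ^ n) + (2 * N * q) ^ (n - 2) * (32 * k)\<^sup>2 / s ^ n * (1 / L\<^sup>2)"
    proof -
      have "s ^ n = s ^ (n - 2) * s\<^sup>2" using dim by (metis le_add_diff_inverse2 power_add)
      then show ?thesis by (simp add: t_def power_divide power_mult_distrib mult_ac)
    qed
    also have "\<dots> \<le> (32 * k) ^ n / s ^ n * (1 / L\<^sup>2) + (2 * N * q) ^ (n - 2) * (32 * k)\<^sup>2 / s ^ n * (1 / L\<^sup>2)"
      using L dim k s by (intro add_right_mono mult_left_mono divide_left_mono power_increasing) auto
    also have "\<dots> = C3 / L\<^sup>2 / s ^ n" by (simp add: C3_def add_divide_distrib mult_ac)
    finally show ?thesis by (simp add: s_def)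
  qed
  have Pz: "P x = 0" if "exp L \<le> norm x" for x
    using log_cutoff_eq_0(2)[OF L0 that] dim by (simp add: P_def Hdom_def)
  define h where "h r = ennreal (C3 / L\<^sup>2 / (1 + r) ^ n)" for r
  have [measurable]: "h \<in> borel_measurable borel" unfolding h_def[abs_def] by measurable
  have "(\<integral>\<^sup>+x. ennreal (P x) \<partial>lborel) \<le> (\<integral>\<^sup>+x. h (norm x) * indicator {x. 0 \<le> norm x \<and> norm x \<le> exp L} (x :: 'a) \<partial>lborel)"
  proof (rule nn_integral_mono)
    fix x :: 'a
    show "ennreal (P x) \<le> h (norm x) * indicator {x. 0 \<le> norm x \<and> norm x \<le> exp L} x"
      using Ple[of x] Pz[of x] by (auto simp: h_def indicator_def intro!: ennreal_leI)
  qed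
  also have "\<dots> = (\<integral>\<^sup>+r. h r * ennreal (V * (N * r ^ (n - 1))) * indicator {0..exp L} r \<partial>lborel)"
    by (subst nn_integral_radial) (auto simp: V_def n_def N_def)
  also have "\<dots> \<le> (\<integral>\<^sup>+r. ennreal (C3 / L\<^sup>2 * (V * N) / (1 + r)) * indicator {0..exp L} r \<partial>lborel)"
  proof (rule nn_integral_mono)
    fix r :: real
    show "h r * ennreal (V * (N * r ^ (n - 1))) * indicator {0..exp L} r
        \<le> ennreal (C3 / L\<^sup>2 * (V * N) / (1 + r)) * indicator {0..exp L} r"
    proof (cases "0 \<le> r")
      case True
      have "r ^ (n - 1) * (1 + r) \<le> (1 + r) ^ (n - 1) * (1 + r)" using True by (intro mult_right_mono power_mono) auto
      also have "\<dots> = (1 + r) ^ n" using dim by (cases n) auto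
      finally have "r ^ (n - 1) / (1 + r) ^ n \<le> 1 / (1 + r)" using True by (simp add: field_simps)
      then have "(C3 / L\<^sup>2 * (V * N)) * (r ^ (n - 1) / (1 + r) ^ n) \<le> (C3 / L\<^sup>2 * (V * N)) * (1 / (1 + r))"
        using C3 V N by (intro mult_left_mono) auto
      then have "C3 / L\<^sup>2 / (1 + r) ^ n * (V * (N * r ^ (n - 1))) \<le> C3 / L\<^sup>2 * (V * N) / (1 + r)"
        by (simp add: mult_ac)
      then show ?thesis using True C3 V N
        by (auto simp: h_def indicator_def ennreal_mult[symmetric] intro!: ennreal_leI)
    qed simp
  qed
  also have "\<dots> = ennreal (C3 / L\<^sup>2 * (V * N) * ln (1 + exp L) - C3 / L\<^sup>2 * (V * N) * ln (1 + 0))"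
  proof (rule nn_integral_FTC_Icc)
    fix r assume "r \<in> {0..exp L}"
    then have r: "0 \<le> r" by simp
    have "((\<lambda>r. ln (1 + r)) has_real_derivative 1 / (1 + r)) (at r)"
      using r by (auto intro!: derivative_eq_intros)
    from DERIV_cmult[OF this, of "C3 / L\<^sup>2 * (V * N)"]
    show "((\<lambda>r. C3 / L\<^sup>2 * (V * N) * ln (1 + r)) has_real_derivative C3 / L\<^sup>2 * (V * N) / (1 + r)) (at r)"
      by simp
    show "0 \<le> C3 / L\<^sup>2 * (V * N) / (1 + r)" using r C3 V N by simp
  qed auto
  also have "\<dots> \<le> ennreal (2 * (C3 * (V * N)) / L)"
  proof (rule ennreal_leI)
    have "1 + exp L \<le> exp 1 * exp L"
    proof -
      have "2 \<le> exp (1::real)" using exp_ge_add_one_self[of "1::real"] by simp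
      then have "2 * exp L \<le> exp 1 * exp L" by (intro mult_right_mono) auto
      moreover have "1 \<le> exp L" using L by simp
      ultimately show ?thesis by linarith
    qed
    then have "ln (1 + exp L) \<le> ln (exp 1 * exp L)" by (intro ln_mono) (auto simp: add_pos_pos)
    also have "\<dots> = 1 + L" by (simp flip: exp_add)
    also have "\<dots> \<le> 2 * L" using L by simp
    finally have "C3 / L\<^sup>2 * (V * N) * ln (1 + exp L) \<le> C3 / L\<^sup>2 * (V * N) * (2 * L)"
      using C3 V N by (intro mult_left_mono) auto
    then show "C3 / L\<^sup>2 * (V * N) * ln (1 + exp L) - C3 / L\<^sup>2 * (V * N) * ln (1 + 0) \<le> 2 * (C3 * (V * N)) / L"
      using L by (simp add: power2_eq_square mult_ac)
  qed
  finally have le: "(\<integral>\<^sup>+x. ennreal (P x) \<partial>lborel) \<le> ennreal (2 * (C3 * (V * N)) / L)" .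
  have Pi: "integrable lborel P"
    by (rule integrableI_nonneg) (use P0 le_less_trans[OF le ennreal_less_top] in auto)
  then show "integrable lborel (\<lambda>x. Hdom x (2 * k * norm (log_cutoff_grad L x)))" by (simp add: P_def[abs_def])
  have "ennreal (LINT x|lborel. P x) \<le> ennreal (2 * (C3 * (V * N)) / L)"
    using le nn_integral_eq_integral[OF Pi] P0 by simp
  then show "(LINT x|lborel. Hdom x (2 * k * norm (log_cutoff_grad L x))) \<le> 2 * (C3 * (V * N)) / L"
    using C3 V N L by (simp add: P_def[abs_def])
qed

lemma Hdom_integrable:
  assumes [measurable]: "g \<in> borel_measurable borel" and "integrable lborel (\<lambda>x. norm (g x) ^ n)"
    and "integrable lborel (\<lambda>x. (norm (g x))\<^sup>2 * norm (gv x) ^ (n - 2))"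
  shows "integrable lborel (\<lambda>x. Hdom x (norm (g x)))"
  unfolding Hdom_def using assms by (intro Bochner_Integration.integrable_add) (auto simp: mult.commute)

text \<open>The cut-off is removed at a fixed truncation level. The cross term is dominated by
  \<open>Hdom\<close> of \<open>2 * k\<close> times the gradient of the cut-off, whose integral
  tends to 0; so the integrals of the dominating functions converge to that of
  \<open>D'\<close>.\<close>

lemma onofri_ineq_bounded:
  fixes u :: "'a \<Rightarrow> real" and g :: "'a \<Rightarrow> 'a"
  assumes k: "0 < k" and ug: "smooth_gradient u g"
    and gn: "integrable lborel (\<lambda>x. norm (g x) ^ n)"
    and g2: "integrable lborel (\<lambda>x. (norm (g x))\<^sup>2 * norm (gv x) ^ (n - 2))"
  shows "onofri_ineq (\<lambda>x. soft k (u x)) (\<lambda>x. soft_deriv k (u x) *\<^sub>R g x)"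
proof -
  have [measurable]: "u \<in> borel_measurable borel" "g \<in> borel_measurable borel"
    using ug by (auto simp: smooth_gradient_def locally_integrable_def)
  obtain C where C: "0 \<le> C" "\<And>L. 1 \<le> L \<Longrightarrow> integrable lborel (\<lambda>x. Hdom x (2 * k * norm (log_cutoff_grad L x)))"
    "\<And>L. 1 \<le> L \<Longrightarrow> (LINT x|lborel. Hdom x (2 * k * norm (log_cutoff_grad L x))) \<le> C / L"
    by (rule log_cutoff_energy[OF k]) blast
  define L where "L j = real (Suc j)" for j
  have L: "0 < L j" "1 \<le> L j" for j by (auto simp: L_def)
  have Llim: "filterlim L at_top sequentially"
    unfolding L_def[abs_def] by (rule filterlim_compose[OF filterlim_real_sequentially filterlim_Suc])
  note [measurable] = log_cutoff_measurable[OF L(1), where 'a = 'a]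
  define e where "e j x = Hdom x (2 * k * norm (log_cutoff_grad (L j) x))" for j x
  define c where "c = CH * 2 ^ n"
  have c: "0 < c" using CH_pos by (simp add: c_def)
  define D' where "D' x = c * Hdom x (norm (g x))" for x
  define D where "D j x = D' x + c * e j x" for j x
  have ei: "integrable lborel (e j)" for j using C(2)[OF L(2)] by (simp add: e_def[abs_def])
  have D'i: "integrable lborel D'" unfolding D'_def[abs_def] using Hdom_integrable[OF _ gn g2] by simp
  have elim0: "(\<lambda>j. LINT x|lborel. e j x) \<longlonglongrightarrow> 0"
  proof (rule tendsto_sandwich[OF _ _ tendsto_const])
    have "e j x \<ge> 0" for j x using k by (simp add: e_def Hdom_nonneg)
    then show "\<forall>\<^sub>F j in sequentially. 0 \<le> (LINT x|lborel. e j x)" by (simp add: always_eventually)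
    show "\<forall>\<^sub>F j in sequentially. (LINT x|lborel. e j x) \<le> C * (1 / real (Suc j))"
      using C(3)[OF L(2)] by (simp add: e_def[abs_def] L_def always_eventually)
    show "(\<lambda>j. C * (1 / real (Suc j))) \<longlonglongrightarrow> 0"
      using tendsto_mult[OF tendsto_const[of C] LIMSEQ_Suc[OF lim_1_over_n]] by simp
  qed
  show ?thesis
  proof (rule onofri_ineq_limit(1)[where D = D and D' = D' and E = "\<lambda>_. 2 * k" and U' = "\<lambda>j x. log_cutoff (L j) x * soft k (u x)"
      and G' = "\<lambda>j x. (log_cutoff (L j) x * soft_deriv k (u x)) *\<^sub>R g x + soft k (u x) *\<^sub>R log_cutoff_grad (L j) x"])
    show "onofri_ineq (\<lambda>x. log_cutoff (L j) x * soft k (u x))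
        (\<lambda>x. (log_cutoff (L j) x * soft_deriv k (u x)) *\<^sub>R g x + soft k (u x) *\<^sub>R log_cutoff_grad (L j) x)" for j
      by (rule onofri_ineq_cut[OF k L(1) ug gn])
    show "AE x in lborel. (\<lambda>j. log_cutoff (L j) x * soft k (u x)) \<longlonglongrightarrow> soft k (u x)"
    proof (intro AE_I2 tendsto_eventually)
      fix x :: 'a
      show "\<forall>\<^sub>F j in sequentially. log_cutoff (L j) x * soft k (u x) = soft k (u x)"
        using log_cutoff_tendsto[OF Llim, of x] by eventually_elim simp
    qed
    show "AE x in lborel. (\<lambda>j. (log_cutoff (L j) x * soft_deriv k (u x)) *\<^sub>R g x + soft k (u x) *\<^sub>R log_cutoff_grad (L j) x)
        \<longlonglongrightarrow> soft_deriv k (u x) *\<^sub>R g x"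
    proof (intro AE_I2 tendsto_eventually)
      fix x :: 'a
      show "\<forall>\<^sub>F j in sequentially. (log_cutoff (L j) x * soft_deriv k (u x)) *\<^sub>R g x + soft k (u x) *\<^sub>R log_cutoff_grad (L j) x
          = soft_deriv k (u x) *\<^sub>R g x"
        using log_cutoff_tendsto[OF Llim, of x] by eventually_elim simp
    qed
    have cut: "0 \<le> log_cutoff l x" "log_cutoff l x \<le> 1" for l and x :: 'a using cutoff_bounds by (auto simp: log_cutoff_def)
    show "\<bar>log_cutoff (L j) x * soft k (u x)\<bar> \<le> 2 * k" for j x
    proof -
      have "\<bar>log_cutoff (L j) x * soft k (u x)\<bar> \<le> 1 * (2 * k)"
        unfolding abs_mult using soft_le[OF k, of "u x"] cut k by (intro mult_mono) auto
      then show ?thesis by simp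
    qed
    show "integrable lborel (\<lambda>x. 2 * k * dens x)" using dens_integrable by simp
    show "AE x in lborel. Hf x ((log_cutoff (L j) x * soft_deriv k (u x)) *\<^sub>R g x + soft k (u x) *\<^sub>R log_cutoff_grad (L j) x) \<le> D j x" for j
    proof (rule AE_I2)
      fix x
      define w where "w = (log_cutoff (L j) x * soft_deriv k (u x)) *\<^sub>R g x + soft k (u x) *\<^sub>R log_cutoff_grad (L j) x"
      define b where "b = 2 * k * norm (log_cutoff_grad (L j) x)"
      have b: "0 \<le> b" using k by (simp add: b_def)
      have "norm w \<le> norm ((log_cutoff (L j) x * soft_deriv k (u x)) *\<^sub>R g x) + norm (soft k (u x) *\<^sub>R log_cutoff_grad (L j) x)"
        unfolding w_def by (rule norm_triangle_ineq)
      also have "\<dots> \<le> norm (g x) + b"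
      proof (rule add_mono)
        have "\<bar>log_cutoff (L j) x * soft_deriv k (u x)\<bar> * norm (g x) \<le> 1 * norm (g x)"
          using cut[of "L j" x] soft_deriv_bounds[of k "u x"] by (intro mult_right_mono) (auto simp: abs_mult intro!: mult_le_one)
        then show "norm ((log_cutoff (L j) x * soft_deriv k (u x)) *\<^sub>R g x) \<le> norm (g x)" by simp
        show "norm (soft k (u x) *\<^sub>R log_cutoff_grad (L j) x) \<le> b"
          unfolding b_def using soft_le[OF k, of "u x"] k by (auto intro!: mult_right_mono)
      qed
      finally have nw: "norm w \<le> norm (g x) + b" .
      have "Hf x w \<le> CH * Hdom x (norm w)" by (rule Hf_le)
      also have "\<dots> \<le> CH * Hdom x (norm (g x) + b)"
        using nw CH_pos by (intro mult_left_mono Hdom_mono) auto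
      also have "\<dots> \<le> CH * (2 ^ n * (Hdom x (norm (g x)) + Hdom x b))"
        using b CH_pos by (intro mult_left_mono Hdom_add) auto
      also have "\<dots> = D j x" by (simp add: D_def D'_def e_def b_def c_def algebra_simps)
      finally show "Hf x w \<le> D j x" .
    qed
    show "AE x in lborel. (\<lambda>j. D j x) \<longlonglongrightarrow> D' x"
    proof (intro AE_I2 tendsto_eventually)
      fix x :: 'a
      show "\<forall>\<^sub>F j in sequentially. D j x = D' x"
        using log_cutoff_tendsto[OF Llim, of x] by eventually_elim (use dim in \<open>simp add: D_def e_def Hdom_def\<close>)
    qed
    show "integrable lborel (D j)" for j unfolding D_def[abs_def] using D'i ei by simp
    show "integrable lborel D'" by (rule D'i)
    have "(LINT x|lborel. D j x) = (LINT x|lborel. D' x) + c * (LINT x|lborel. e j x)" for j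
      unfolding D_def[abs_def] using D'i ei by simp
    then show "(\<lambda>j. LINT x|lborel. D j x) \<longlonglongrightarrow> (LINT x|lborel. D' x)"
      using tendsto_add[OF tendsto_const[of "LINT x|lborel. D' x"] tendsto_mult[OF tendsto_const[of c] elim0]] by simp
  qed measurable
qed

text \<open>The truncation level tends to infinity. Here fixed dominating functions exist: the
  absolute value of \<open>u\<close> for the means and \<open>Hdom\<close> of the gradient for the
  energies, because truncation shrinks values and gradients.\<close>

lemma onofri_weak:
  fixes u :: "'a \<Rightarrow> real" and g :: "'a \<Rightarrow> 'a"
  assumes ug: "smooth_gradient u g" and ud: "integrable lborel (\<lambda>x. u x * dens x)"
    and gn: "integrable lborel (\<lambda>x. norm (g x) ^ n)"
    and g2: "integrable lborel (\<lambda>x. (norm (g x))\<^sup>2 * norm (gv x) ^ (n - 2))"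
  shows "onofri_ineq u g" "integrable lborel (\<lambda>x. Hf x (g x))"
proof -
  have [measurable]: "u \<in> borel_measurable borel" "g \<in> borel_measurable borel"
    using ug by (auto simp: smooth_gradient_def locally_integrable_def)
  define D where "D x = CH * Hdom x (norm (g x))" for x
  have Di: "integrable lborel D" unfolding D_def[abs_def] using Hdom_integrable[OF _ gn g2] by simp
  have k: "0 < real (Suc j)" for j by simp
  have 1: "onofri_ineq (\<lambda>x. soft (real (Suc j)) (u x)) (\<lambda>x. soft_deriv (real (Suc j)) (u x) *\<^sub>R g x)" for j
    by (rule onofri_ineq_bounded[OF k ug gn g2])
  have 2: "AE x in lborel. (\<lambda>j. soft (real (Suc j)) (u x)) \<longlonglongrightarrow> u x"
    by (intro AE_I2 soft_tendsto)
  have 3: "AE x in lborel. (\<lambda>j. soft_deriv (real (Suc j)) (u x) *\<^sub>R g x) \<longlonglongrightarrow> g x"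
  proof (rule AE_I2)
    fix x
    show "(\<lambda>j. soft_deriv (real (Suc j)) (u x) *\<^sub>R g x) \<longlonglongrightarrow> g x"
      using tendsto_scaleR[OF soft_tendsto(2)[of "u x"] tendsto_const[of "g x"]] by simp
  qed
  have 4: "\<bar>soft (real (Suc j)) (u x)\<bar> \<le> \<bar>u x\<bar>" for j x by (rule soft_abs_le[OF k])
  have 5: "integrable lborel (\<lambda>x. \<bar>u x\<bar> * dens x)"
    using integrable_abs[OF ud] dens_pos by (simp add: abs_mult less_imp_le)
  have 6: "AE x in lborel. Hf x (soft_deriv (real (Suc j)) (u x) *\<^sub>R g x) \<le> D x" for j
  proof (rule AE_I2)
    fix x
    have "Hf x (soft_deriv (real (Suc j)) (u x) *\<^sub>R g x) \<le> CH * Hdom x (norm (soft_deriv (real (Suc j)) (u x) *\<^sub>R g x))"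
      by (rule Hf_le)
    also have "\<dots> \<le> D x" unfolding D_def using CH_pos soft_deriv_bounds[of "real (Suc j)" "u x"]
      by (intro mult_left_mono Hdom_mono) (auto simp: mult_left_le_one_le)
    finally show "Hf x (soft_deriv (real (Suc j)) (u x) *\<^sub>R g x) \<le> D x" .
  qed
  note lim = onofri_ineq_limit[OF _ _ _ _ 1 2 3 4 5 6 _ Di Di]
  show "onofri_ineq u g" by (rule lim(1)) auto
  show "integrable lborel (\<lambda>x. Hf x (g x))" by (rule lim(2)) auto
qed

end

section \<open>The Hausdorff measure of the sphere\<close>

text \<open>Covering sets are projected along a coordinate axis to cylinders over boxes, which cover a ball.\<close>

lemma hausdorff_measure_sphere_pos:
  assumes dim: "2 \<le> DIM('a::euclidean_space)"
  shows "0 < hausdorff_measure (DIM('a) - 1) (sphere (0::'a) 1)"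
proof -
  define s where "s = DIM('a) - 1"
  have s: "s \<noteq> 0" using dim by (simp add: s_def)
  define \<alpha> where "\<alpha> = unit_ball_vol (real s)"
  have \<alpha>: "0 < \<alpha>" by (simp add: \<alpha>_def unit_ball_vol_pos)
  obtain e :: 'a where e: "e \<in> Basis" using nonempty_Basis by blast
  have ne: "norm e = 1" using e by simp
  \<comment> \<open>The ball with diameter from \<open>0\<close> to \<open>e\<close>. Its points
    satisfy \<open>(norm z)^2 \<le> z \<bullet> e\<close>; hence they lie in the unit ball and at
    heights between 0 and 1.\<close>
  define Q where "Q = ball (e /\<^sub>R 2) (1 / 2)"
  define W where "W U = (\<Sum>i. if U i = {} then 0 else ennreal (\<alpha> * (diameter (U i) / 2) ^ s))" for U :: "nat \<Rightarrow> 'a set"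
  have le: "emeasure lborel Q \<le> ennreal (4 ^ s / \<alpha>) * W U"
    if cov: "sphere 0 1 \<subseteq> (\<Union>i. U i)" and bd: "\<forall>i. bounded (U i) \<and> diameter (U i) \<le> 1" for U :: "nat \<Rightarrow> 'a set"
  proof -
    define d where "d i = diameter (U i)" for i
    have d: "0 \<le> d i" for i using bd by (simp add: d_def diameter_ge_0)
    define p where "p i = (SOME x. x \<in> U i)" for i
    have p: "p i \<in> U i" if "U i \<noteq> {}" for i using that by (auto simp: p_def intro: someI_ex)
    \<comment> \<open>The box has the edge \<open>{0..1}\<close> along \<open>e\<close> and
      half-width \<open>d i\<close> around the chosen point \<open>p i\<close> in all other
      directions. Its volume is \<open>(2 * d i) ^ s\<close>, that is,
      \<open>4 ^ s / \<alpha>\<close> times the weight of the covering set.\<close>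
    define lo where "lo i = (\<Sum>b\<in>Basis. (if b = e then 0 else p i \<bullet> b - d i) *\<^sub>R b)" for i
    define hi where "hi i = (\<Sum>b\<in>Basis. (if b = e then 1 else p i \<bullet> b + d i) *\<^sub>R b)" for i
    define B where "B i = (if U i = {} then {} else cbox (lo i) (hi i))" for i
    have lob: "lo i \<bullet> b = (if b = e then 0 else p i \<bullet> b - d i)" and hib: "hi i \<bullet> b = (if b = e then 1 else p i \<bullet> b + d i)"
      if "b \<in> Basis" for i b using that by (auto simp: lo_def hi_def)
    have "Q \<subseteq> (\<Union>i. B i)"
    proof
      fix z assume z: "z \<in> Q"
      define h where "h = z \<bullet> e"
      have nz: "(norm z)\<^sup>2 \<le> h"
      proof -
        have "(norm (e /\<^sub>R 2 - z))\<^sup>2 \<le> (1 / 2)\<^sup>2" using z by (intro power_mono) (auto simp: Q_def dist_norm)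
        moreover have "(norm (e /\<^sub>R 2 - z))\<^sup>2 = 1 / 4 - h + (norm z)\<^sup>2"
          using e by (simp add: power2_norm_eq_inner inner_diff inner_commute h_def)
        ultimately show ?thesis by (simp add: power2_eq_square)
      qed
      have h0: "0 \<le> h" using nz zero_le_power2[of "norm z"] by linarith
      have hn: "h \<le> norm z" using Cauchy_Schwarz_ineq2[of z e] ne by (simp add: h_def)
      have n1: "norm z \<le> 1"
      proof (rule ccontr)
        assume "\<not> norm z \<le> 1"
        then have "norm z < norm z * norm z" using mult_strict_left_mono[of 1 "norm z" "norm z"] by linarith
        then show False using nz hn by (simp add: power2_eq_square)
      qed
      define y where "y = z - h *\<^sub>R e"
      have ye: "y \<bullet> e = 0" using e by (simp add: y_def inner_diff_left h_def)
      have "(norm y)\<^sup>2 = (norm z)\<^sup>2 - h\<^sup>2"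
        using e unfolding power2_norm_eq_inner y_def power2_eq_square[of h]
        by (simp add: inner_diff inner_commute h_def del: inner_same_Basis) (simp add: algebra_simps)
      then have y1: "(norm y)\<^sup>2 \<le> 1" using n1 power_le_one[of "norm z" 2] zero_le_power2[of h] norm_ge_zero[of z] by linarith
      \<comment> \<open>The point of the upper hemisphere with the same projection along
        \<open>e\<close> as \<open>z\<close>; a covering set that contains it has a box containing
        \<open>z\<close>.\<close>
      define x where "x = y + sqrt (1 - (norm y)\<^sup>2) *\<^sub>R e"
      have "(norm x)\<^sup>2 = (norm y)\<^sup>2 + (1 - (norm y)\<^sup>2)"
        using e ye y1 by (simp add: x_def power2_norm_eq_inner inner_add inner_commute flip: power2_eq_square)
      then have "(norm x)\<^sup>2 = 1" by simp
      then have "norm x = 1" using norm_ge_zero[of x] unfolding power2_eq_1_iff by linarith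
      then obtain i where i: "x \<in> U i" using cov by auto
      have "z \<in> B i"
      proof -
        have "lo i \<bullet> b \<le> z \<bullet> b \<and> z \<bullet> b \<le> hi i \<bullet> b" if b: "b \<in> Basis" for b
        proof (cases "b = e")
          case True
          then show ?thesis using h0 hn n1 b by (simp add: lob hib h_def)
        next
          case False
          have "z \<bullet> b = x \<bullet> b" using False b e by (simp add: x_def y_def inner_add_left inner_diff_left inner_Basis)
          moreover have "\<bar>(x - p i) \<bullet> b\<bar> \<le> norm (x - p i)" by (rule Basis_le_norm[OF b])
          moreover have "norm (x - p i) \<le> d i"
            using diameter_bounded_bound[of "U i" x "p i"] i p[of i] bd by (auto simp: d_def dist_norm)
          ultimately show ?thesis using False b by (auto simp: lob hib inner_diff_left)
        qed
        then show ?thesis using i by (auto simp: B_def mem_box)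
      qed
      then show "z \<in> (\<Union>i. B i)" by blast
    qed
    then have "emeasure lborel Q \<le> emeasure lborel (\<Union>i. B i)" by (intro emeasure_mono) (auto simp: B_def)
    also have "\<dots> \<le> (\<Sum>i. emeasure lborel (B i))" by (intro emeasure_subadditive_countably) (auto simp: B_def)
    also have "\<dots> = (\<Sum>i. ennreal (4 ^ s / \<alpha>) * (if U i = {} then 0 else ennreal (\<alpha> * (diameter (U i) / 2) ^ s)))"
    proof (rule arg_cong[where f = suminf], rule ext)
      fix i
      show "emeasure lborel (B i) = ennreal (4 ^ s / \<alpha>) * (if U i = {} then 0 else ennreal (\<alpha> * (diameter (U i) / 2) ^ s))"
      proof (cases "U i = {}")
        case False
        have le': "lo i \<bullet> b \<le> hi i \<bullet> b" if "b \<in> Basis" for b using that d[of i] by (simp add: lob hib)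
        have "emeasure lborel (B i) = ennreal (\<Prod>b\<in>Basis. (hi i - lo i) \<bullet> b)"
          using False le' by (simp add: B_def emeasure_lborel_cbox)
        also have "(\<Prod>b\<in>Basis. (hi i - lo i) \<bullet> b) = (\<Prod>b\<in>Basis. if b = e then 1 else 2 * d i)"
          by (intro prod.cong) (auto simp: inner_diff_left lob hib)
        also have "\<dots> = (\<Prod>b\<in>Basis - {e}. 2 * d i)" using e by (subst prod.remove[of _ e]) (auto intro!: prod.cong)
        also have "\<dots> = (2 * d i) ^ s" using e by (simp add: s_def)
        also have "\<dots> = 4 ^ s / \<alpha> * (\<alpha> * (d i / 2) ^ s)"
          using \<alpha> power_mult_distrib[of 4 "d i / 2" s] by simp
        finally show ?thesis using False \<alpha> d[of i] by (simp add: ennreal_mult[symmetric] d_def)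
      qed (simp add: B_def)
    qed
    also have "\<dots> = ennreal (4 ^ s / \<alpha>) * W U" unfolding W_def by (rule ennreal_suminf_cmult)
    finally show ?thesis .
  qed
  have Q0: "0 < emeasure lborel Q"
    using emeasure_ball[of "1/2" "e /\<^sub>R 2"] by (simp add: Q_def unit_ball_vol_pos)
  have "ennreal (\<alpha> / 4 ^ s) * emeasure lborel Q \<le> (INF U\<in>{U :: nat \<Rightarrow> 'a set. sphere 0 1 \<subseteq> (\<Union>i. U i) \<and> (\<forall>i. bounded (U i) \<and> diameter (U i) \<le> 1)}. W U)"
  proof (rule INF_greatest)
    fix U :: "nat \<Rightarrow> 'a set" assume "U \<in> {U. sphere 0 1 \<subseteq> (\<Union>i. U i) \<and> (\<forall>i. bounded (U i) \<and> diameter (U i) \<le> 1)}"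
    then have "ennreal (\<alpha> / 4 ^ s) * emeasure lborel Q \<le> ennreal (\<alpha> / 4 ^ s) * (ennreal (4 ^ s / \<alpha>) * W U)"
      using le[of U] by (intro mult_left_mono) auto
    also have "\<dots> = W U" using \<alpha> by (simp add: mult.assoc[symmetric] ennreal_mult[symmetric])
    finally show "ennreal (\<alpha> / 4 ^ s) * emeasure lborel Q \<le> W U" .
  qed
  also have "\<dots> \<le> hausdorff_measure s (sphere (0::'a) 1)"
    unfolding hausdorff_measure_def W_def \<alpha>_def by (rule SUP_upper) simp
  finally have "ennreal (\<alpha> / 4 ^ s) * emeasure lborel Q \<le> hausdorff_measure s (sphere (0::'a) 1)" .
  moreover have "0 < ennreal (\<alpha> / 4 ^ s) * emeasure lborel Q" using Q0 \<alpha> by (simp add: ennreal_zero_less_mult_iff)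
  ultimately show ?thesis by (simp add: s_def)
qed

section \<open>The upper bound by cones over spherical caps\<close>

lemma measure_cone_basis:
  fixes e :: "'a::euclidean_space"
  assumes dim: "2 \<le> DIM('a)" and e: "e \<in> Basis" and r: "0 < r" and c: "0 < c"
  shows "emeasure lborel {z. 0 < z \<bullet> e \<and> z \<bullet> e \<le> c \<and> norm (z - (z \<bullet> e) *\<^sub>R e) \<le> r * (z \<bullet> e)}
    = ennreal (unit_ball_vol (real (DIM('a) - 1)) * r ^ (DIM('a) - 1) * c ^ DIM('a) / real DIM('a))"
proof -
  interpret product_sigma_finite "\<lambda>_::'a. lborel :: real measure" by standard
  define s where "s = DIM('a) - 1"
  define J where "J = Basis - {e}"
  have J: "finite J" "e \<notin> J" "insert e J = Basis" "card J = s" using e by (auto simp: J_def s_def)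
  define K where "K = {z::'a. 0 < z \<bullet> e \<and> z \<bullet> e \<le> c \<and> norm (z - (z \<bullet> e) *\<^sub>R e) \<le> r * (z \<bullet> e)}"
  have Km[measurable]: "K \<in> sets borel" unfolding K_def by measurable
  define F where "F f = (\<Sum>b\<in>Basis. f b *\<^sub>R b)" for f :: "'a \<Rightarrow> real"
  have Fm[measurable]: "F \<in> (\<Pi>\<^sub>M b\<in>Basis. lborel) \<rightarrow>\<^sub>M borel" unfolding F_def by measurable
  have FK: "F f \<in> K \<longleftrightarrow> 0 < f e \<and> f e \<le> c \<and> sqrt (\<Sum>b\<in>J. (f b)\<^sup>2) \<le> r * f e" for f
  proof -
    have Fe: "F f \<bullet> e = f e" using e by (simp add: F_def)
    have "F f - f e *\<^sub>R e = (\<Sum>b\<in>J. f b *\<^sub>R b)" using e unfolding F_def J_def by (subst sum.remove[of _ e]) auto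
    moreover have "norm (\<Sum>b\<in>J. f b *\<^sub>R b) = sqrt (\<Sum>b\<in>J. (f b)\<^sup>2)"
    proof -
      define w where "w = (\<Sum>b\<in>J. f b *\<^sub>R b)"
      have "w \<bullet> b = (if b = e then 0 else f b)" if "b \<in> Basis" for b
        using that e by (auto simp: w_def J_def inner_sum_left inner_Basis if_distrib sum.delta' cong: if_cong)
      then have "norm w = sqrt (\<Sum>b\<in>Basis. (if b = e then 0 else (f b)\<^sup>2))"
        by (subst norm_eq_sqrt_inner, subst euclidean_inner) (auto simp: power2_eq_square intro!: sum.cong)
      also have "(\<Sum>b\<in>Basis. (if b = e then 0 else (f b)\<^sup>2)) = (\<Sum>b\<in>J. (f b)\<^sup>2)"
        using e unfolding J_def by (subst sum.remove[of _ e]) (auto intro!: sum.cong)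
      finally show ?thesis by (simp add: w_def)
    qed
    ultimately show ?thesis by (simp add: K_def Fe)
  qed
  have "emeasure lborel K = (\<integral>\<^sup>+z. indicator K z \<partial>lborel)" by simp
  also have "\<dots> = (\<integral>\<^sup>+z. indicator K z \<partial>distr (\<Pi>\<^sub>M b\<in>Basis. lborel) borel F)"
    by (subst lborel_eq) (simp add: F_def[abs_def])
  also have "\<dots> = (\<integral>\<^sup>+f. indicator K (F f) \<partial>(\<Pi>\<^sub>M b\<in>insert e J. lborel))"
    by (subst nn_integral_distr) (auto simp: J)
  \<comment> \<open>Fubini along the axis: the section of the cone at height \<open>t\<close> is a
    ball of dimension \<open>s\<close> and radius \<open>r * t\<close>.\<close>
  also have "\<dots> = (\<integral>\<^sup>+t. \<integral>\<^sup>+f. indicator K (F (f(e := t))) \<partial>(\<Pi>\<^sub>M b\<in>J. lborel) \<partial>lborel)"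
    using Fm by (subst product_nn_integral_insert_rev) (auto simp: J)
  also have "\<dots> = (\<integral>\<^sup>+t. ennreal (unit_ball_vol (real s) * (r * t) ^ s) * indicator {0..c} t \<partial>lborel)"
  proof (rule nn_integral_cong)
    fix t :: real
    show "(\<integral>\<^sup>+f. indicator K (F (f(e := t))) \<partial>(\<Pi>\<^sub>M b\<in>J. lborel)) = ennreal (unit_ball_vol (real s) * (r * t) ^ s) * indicator {0..c} t"
    proof (cases "0 < t \<and> t \<le> c")
      case True
      have "(\<integral>\<^sup>+f. indicator K (F (f(e := t))) \<partial>(\<Pi>\<^sub>M b\<in>J. lborel))
          = (\<integral>\<^sup>+f. indicator ({f. sqrt (\<Sum>b\<in>J. (f b)\<^sup>2) \<le> r * t} \<inter> space (\<Pi>\<^sub>M b\<in>J. lborel)) f \<partial>(\<Pi>\<^sub>M b\<in>J. lborel))"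
      proof (rule nn_integral_cong)
        fix f assume f: "f \<in> space (\<Pi>\<^sub>M b\<in>J. lborel :: real measure)"
        have "(\<Sum>b\<in>J. ((f(e := t)) b)\<^sup>2) = (\<Sum>b\<in>J. (f b)\<^sup>2)" using J by (intro sum.cong) auto
        then have "F (f(e := t)) \<in> K \<longleftrightarrow> sqrt (\<Sum>b\<in>J. (f b)\<^sup>2) \<le> r * t"
          using FK[of "f(e := t)"] True by simp
        then show "indicator K (F (f(e := t))) = (indicator ({f. sqrt (\<Sum>b\<in>J. (f b)\<^sup>2) \<le> r * t} \<inter> space (\<Pi>\<^sub>M b\<in>J. lborel)) f :: ennreal)"
          using f by (simp add: indicator_def)
      qed
      also have "\<dots> = emeasure (\<Pi>\<^sub>M b\<in>J. lborel) ({f. sqrt (\<Sum>b\<in>J. (f b)\<^sup>2) \<le> r * t} \<inter> space (\<Pi>\<^sub>M b\<in>J. lborel))"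
        by (rule nn_integral_indicator) measurable
      also have "\<dots> = ennreal (unit_ball_vol (real s) * (r * t) ^ s)"
        using True r J(4) by (subst emeasure_cball_aux) (auto simp: J)
      finally show ?thesis using True by simp
    next
      case False
      have "F (f(e := t)) \<notin> K" for f using FK[of "f(e := t)"] False by auto
      then have "(\<integral>\<^sup>+f. indicator K (F (f(e := t))) \<partial>(\<Pi>\<^sub>M b\<in>J. lborel :: real measure)) = 0" by simp
      \<comment> \<open>At \<open>t = 0\<close> the cone is empty while the indicator of
        \<open>{0..c}\<close> is 1; the two agree because the volume \<open>(r * t) ^ s\<close>
        vanishes there, \<open>s\<close> being positive.\<close>
      moreover have "ennreal (unit_ball_vol (real s) * (r * t) ^ s) * indicator {0..c} t = 0"
      proof -
        have "s \<noteq> 0" using dim by (simp add: s_def)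
        then show ?thesis using False by (cases "t = 0") (auto simp: indicator_def)
      qed
      ultimately show ?thesis by simp
    qed
  qed
  also have "\<dots> = ennreal (unit_ball_vol (real s) * r ^ s * c ^ Suc s / real (Suc s) - unit_ball_vol (real s) * r ^ s * 0 ^ Suc s / real (Suc s))"
  proof (rule nn_integral_FTC_Icc[where f = "\<lambda>t. unit_ball_vol (real s) * (r * t) ^ s" and F = "\<lambda>t. unit_ball_vol (real s) * r ^ s * t ^ Suc s / real (Suc s)"])
    fix t :: real assume "t \<in> {0..c}"
    then have "0 \<le> t" by simp
    then show "0 \<le> unit_ball_vol (real s) * (r * t) ^ s" using r by simp
    have "((\<lambda>t. t ^ Suc s) has_real_derivative real (Suc s) * t ^ s) (at t)"
      using DERIV_pow[of "Suc s" t] by (simp del: power_Suc of_nat_Suc)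
    then have "((\<lambda>t. unit_ball_vol (real s) * r ^ s * t ^ Suc s / real (Suc s)) has_real_derivative
        unit_ball_vol (real s) * r ^ s * (real (Suc s) * t ^ s) / real (Suc s)) (at t)"
      by (intro DERIV_cdivide DERIV_cmult)
    then show "((\<lambda>t. unit_ball_vol (real s) * r ^ s * t ^ Suc s / real (Suc s)) has_real_derivative unit_ball_vol (real s) * (r * t) ^ s) (at t)"
      by (simp add: power_mult_distrib mult_ac del: of_nat_Suc)
  qed (use c in auto)
  also have "\<dots> = ennreal (unit_ball_vol (real s) * r ^ s * c ^ Suc s / real (Suc s))" by simp
  finally show ?thesis using dim by (simp add: K_def s_def)
qed

text \<open>The slope \<open>r\<close> is measured in the hyperplane orthogonal to the axis
  \<open>x\<close>. This makes the Lebesgue measure explicit, while the radial projection still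
  lands in the cap \<open>cball x r\<close>.\<close>

definition sphere_cone :: "'a::euclidean_space \<Rightarrow> real \<Rightarrow> real \<Rightarrow> 'a set" where
  "sphere_cone x r c = {z. 0 < z \<bullet> x \<and> z \<bullet> x \<le> c \<and> norm (z - (z \<bullet> x) *\<^sub>R x) \<le> r * (z \<bullet> x)}"

lemma sphere_cone_borel[measurable]: "sphere_cone x r c \<in> sets borel"
  unfolding sphere_cone_def by measurable

text \<open>Lebesgue measure and its image under \<open>f\<close> are translation invariant and agree on balls, so they agree by
  the Fubini argument for uniqueness of Haar measure.\<close>

lemma emeasure_orthogonal_vimage:
  fixes f :: "'a::euclidean_space \<Rightarrow> 'a"
  assumes f: "orthogonal_transformation f" and A[measurable]: "A \<in> sets borel"
  shows "emeasure lborel (f -` A) = emeasure lborel A"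
proof -
  have lin: "linear f" and surj: "surj f" and nf: "norm (f x) = norm x" for x
    using f orthogonal_transformation_linear orthogonal_transformation_surj orthogonal_transformation_norm by auto
  have [measurable]: "f \<in> borel_measurable borel"
    by (intro borel_measurable_continuous_onI linear_continuous_on linear_conv_bounded_linear[THEN iffD1] lin)
  have shift: "(\<integral>\<^sup>+x. h x \<partial>lborel) = (\<integral>\<^sup>+x. h (t + x) \<partial>lborel)" if [measurable]: "h \<in> borel_measurable borel"
    for h :: "'a \<Rightarrow> ennreal" and t
    by (subst lborel_distr_plus[of t, symmetric]) (simp add: nn_integral_distr)
  define B where "B = cball (0 :: 'a) 1"
  have Bm[measurable]: "B \<in> sets borel" by (simp add: B_def)
  have fA: "f -` A \<in> sets borel" using measurable_sets_borel[of f borel A] by simp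
  have "emeasure lborel (f -` A) * emeasure lborel B = (\<integral>\<^sup>+x. indicator A (f x) \<partial>lborel) * emeasure lborel B"
    using fA by (simp flip: nn_integral_indicator) (simp add: indicator_vimage)
  also have "\<dots> = (\<integral>\<^sup>+y. (\<integral>\<^sup>+x. indicator A (f x) \<partial>lborel) * indicator B y \<partial>lborel)"
    by (subst nn_integral_cmult) auto
  also have "\<dots> = (\<integral>\<^sup>+y. \<integral>\<^sup>+x. indicator A (f x + y) * indicator B y \<partial>lborel \<partial>lborel)"
  proof (rule nn_integral_cong)
    fix y
    \<comment> \<open>The shift by \<open>y\<close> in the image is a translation by
      \<open>w\<close> in the domain, under which Lebesgue measure is invariant.\<close>
    obtain w where w: "f w = y" using surj by (metis surjD)
    have "(\<integral>\<^sup>+x. indicator A (f x) \<partial>lborel) = (\<integral>\<^sup>+x. (indicator A (f (w + x)) :: ennreal) \<partial>lborel)"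
      by (rule shift) measurable
    then show "(\<integral>\<^sup>+x. indicator A (f x) \<partial>lborel) * indicator B y = (\<integral>\<^sup>+x. indicator A (f x + y) * (indicator B y :: ennreal) \<partial>lborel)"
      by (simp add: nn_integral_multc linear_add[OF lin] w add.commute)
  qed
  also have "\<dots> = (\<integral>\<^sup>+x. \<integral>\<^sup>+y. indicator A (f x + y) * indicator B y \<partial>lborel \<partial>lborel)"
    by (rule lborel_pair.Fubini') measurable
  also have "\<dots> = (\<integral>\<^sup>+x. \<integral>\<^sup>+y. indicator A y * indicator B (y - f x) \<partial>lborel \<partial>lborel)"
  proof (rule nn_integral_cong)
    fix x
    show "(\<integral>\<^sup>+y. indicator A (f x + y) * indicator B y \<partial>lborel) = (\<integral>\<^sup>+y. indicator A y * (indicator B (y - f x) :: ennreal) \<partial>lborel)"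
      by (subst shift[of "\<lambda>y. indicator A y * indicator B (y - f x)" "f x"]) simp_all
  qed
  also have "\<dots> = (\<integral>\<^sup>+y. \<integral>\<^sup>+x. indicator A y * indicator B (y - f x) \<partial>lborel \<partial>lborel)"
    by (rule lborel_pair.Fubini') measurable
  also have "\<dots> = (\<integral>\<^sup>+y. indicator A y * emeasure lborel B \<partial>lborel)"
  proof (rule nn_integral_cong)
    fix y
    obtain w where w: "f w = y" using surj by (metis surjD)
    \<comment> \<open>As \<open>f\<close> preserves norms, the points whose images lie within
      distance 1 of \<open>f w\<close> form the unit ball around \<open>w\<close>.\<close>
    have "indicator B (y - f x) = (indicator (cball w 1) x :: ennreal)" for x
      using nf[of "x - w"] by (simp add: B_def w[symmetric] linear_diff[OF lin] indicator_def dist_norm norm_minus_commute)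
    then have "(\<integral>\<^sup>+x. indicator B (y - f x) \<partial>lborel) = emeasure lborel (cball w 1)" by simp
    also have "\<dots> = emeasure lborel B" by (simp add: B_def emeasure_cball)
    finally show "(\<integral>\<^sup>+x. indicator A y * indicator B (y - f x) \<partial>lborel) = indicator A y * emeasure lborel B"
      by (simp add: nn_integral_cmult)
  qed
  also have "\<dots> = emeasure lborel A * emeasure lborel B" by (simp add: nn_integral_multc)
  finally have "emeasure lborel (f -` A) * emeasure lborel B = emeasure lborel A * emeasure lborel B" .
  moreover have "emeasure lborel B \<noteq> 0" "emeasure lborel B \<noteq> top"
    using less_imp_neq[OF unit_ball_vol_pos[of "real DIM('a)"]] by (auto simp: B_def emeasure_cball)
  ultimately show ?thesis by (simp add: ennreal_mult_cancel_left mult.commute[of _ "emeasure lborel B"])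
qed

lemma sphere_cone_measure:
  fixes x :: "real^'n"
  assumes dim: "2 \<le> CARD('n)" and x: "norm x = 1" and r: "0 < r" and c: "0 < c"
  shows "emeasure lborel (sphere_cone x r c) = ennreal (unit_ball_vol (real (CARD('n) - 1)) * r ^ (CARD('n) - 1) * c ^ CARD('n) / real CARD('n))"
proof -
  obtain e :: "real^'n" where e: "e \<in> Basis" using nonempty_Basis by blast
  obtain f where f: "orthogonal_transformation f" "f e = x"
    using orthogonal_transformation_exists_1[of e x] e x by auto
  have ip: "f a \<bullet> f b = a \<bullet> b" for a b using f(1) by (simp add: orthogonal_transformation_def)
  have lin: "linear f" using f(1) by (simp add: orthogonal_transformation_def)
  have "f y \<in> sphere_cone x r c \<longleftrightarrow> y \<in> sphere_cone e r c" for y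
  proof -
    have 1: "f y \<bullet> x = y \<bullet> e" using ip[of y e] f(2) by simp
    have "f y - (y \<bullet> e) *\<^sub>R x = f (y - (y \<bullet> e) *\<^sub>R e)" using lin f(2) by (simp add: linear_diff linear_scale)
    then have "norm (f y - (y \<bullet> e) *\<^sub>R x) = norm (y - (y \<bullet> e) *\<^sub>R e)" using orthogonal_transformation_norm[OF f(1)] by simp
    then show ?thesis by (simp add: sphere_cone_def 1)
  qed
  then have "f -` sphere_cone x r c = sphere_cone e r c" by auto
  then have "emeasure lborel (sphere_cone x r c) = emeasure lborel (sphere_cone e r c)"
    using emeasure_orthogonal_vimage[OF f(1) sphere_cone_borel[of x r c]] by simp
  then show ?thesis using measure_cone_basis[OF _ e r c] dim by (simp add: sphere_cone_def)
qed

text \<open>If \<phi> is the angle between \<open>z\<close> and \<open>x\<close>, the chord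
  satisfies \<open>2 * (1 - cos \<phi>) \<le> (tan \<phi>)^2\<close>, and the tangent is at most the
  slope \<open>r\<close>. The second claim is Pythagoras at height at most \<open>c\<close>.\<close>

lemma sphere_cone_projection:
  fixes x :: "'a::euclidean_space"
  assumes x: "norm x = 1" and z: "z \<in> sphere_cone x r c" and r: "0 < r"
  shows "z /\<^sub>R norm z \<in> cball x r" "(norm z)\<^sup>2 \<le> c\<^sup>2 * (1 + r\<^sup>2)"
proof -
  define h where "h = z \<bullet> x"
  have h: "0 < h" "h \<le> c" and w: "norm (z - h *\<^sub>R x) \<le> r * h" using z by (auto simp: sphere_cone_def h_def)
  have xx: "x \<bullet> x = 1" using x by (simp add: norm_eq_1)
  have nw: "(norm (z - h *\<^sub>R x))\<^sup>2 = (norm z)\<^sup>2 - h\<^sup>2"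
    unfolding power2_norm_eq_inner power2_eq_square[of h]
    by (simp add: inner_diff xx) (simp add: h_def inner_commute)
  have w2: "(norm z)\<^sup>2 - h\<^sup>2 \<le> r\<^sup>2 * h\<^sup>2"
    using power_mono[OF w, of 2] by (simp add: nw power_mult_distrib)
  have hz: "h \<le> norm z" using Cauchy_Schwarz_ineq2[of z x] x by (simp add: h_def)
  have z0: "0 < norm z" using h hz by linarith
  have "(norm z)\<^sup>2 \<le> (1 + r\<^sup>2) * h\<^sup>2" using w2 by (simp add: algebra_simps)
  also have "\<dots> \<le> (1 + r\<^sup>2) * c\<^sup>2" using h by (intro mult_left_mono power_mono) (auto simp: add_nonneg_nonneg)
  finally show "(norm z)\<^sup>2 \<le> c\<^sup>2 * (1 + r\<^sup>2)" by (simp add: mult.commute)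
  have "(norm z - h) * (2 * h) \<le> (norm z - h) * (norm z + h)" using hz by (intro mult_left_mono) auto
  also have "\<dots> \<le> r\<^sup>2 * h\<^sup>2" using w2 by (simp add: power2_eq_square algebra_simps)
  finally have "h * (2 * (norm z - h)) \<le> h * (r\<^sup>2 * h)" by (simp add: power2_eq_square algebra_simps)
  then have "2 * (norm z - h) \<le> r\<^sup>2 * h" using h by simp
  also have "\<dots> \<le> r\<^sup>2 * norm z" using hz by (intro mult_left_mono) auto
  finally have A: "2 * (norm z - h) / norm z \<le> r\<^sup>2" using z0 by (simp add: divide_simps)
  have sq: "(norm (z /\<^sub>R norm z - x))\<^sup>2 = 2 * (norm z - h) / norm z"
  proof -
    define y where "y = z /\<^sub>R norm z"
    have "norm y = 1" using z0 by (simp add: y_def)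
    then have "y \<bullet> y = 1" by (simp add: norm_eq_1)
    moreover have "y \<bullet> x = h / norm z" by (simp add: y_def h_def divide_inverse_commute)
    ultimately have "(norm (y - x))\<^sup>2 = 2 - 2 * (h / norm z)"
      unfolding power2_norm_eq_inner by (simp add: inner_diff xx inner_commute)
    also have "\<dots> = 2 * (norm z - h) / norm z" using z0 by (simp add: field_simps)
    finally show ?thesis by (simp add: y_def)
  qed
  have "norm (z /\<^sub>R norm z - x) \<le> r" by (rule power2_le_imp_le) (use sq A r in linarith)+
  then show "z /\<^sub>R norm z \<in> cball x r" by (simp add: dist_norm norm_minus_commute)
qed

text \<open>The cones over disjoint caps are disjoint subsets of the unit ball.\<close>

lemma disjoint_caps_sum_le:
  fixes F :: "((real^'n) \<times> real) set"
  assumes dim: "2 \<le> CARD('n)" and F: "finite F" and FK: "\<And>x r. (x, r) \<in> F \<Longrightarrow> norm x = 1 \<and> 0 < r \<and> r \<le> \<rho>"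
    and disj: "pairwise (\<lambda>i j. disjnt (cball (fst i) (snd i)) (cball (fst j) (snd j))) F"
  shows "(\<Sum>i\<in>F. unit_ball_vol (real (CARD('n) - 1)) * snd i ^ (CARD('n) - 1))
    \<le> real CARD('n) * unit_ball_vol (real CARD('n)) * sqrt (1 + \<rho>\<^sup>2) ^ CARD('n)"
proof -
  \<comment> \<open>The height at which a cone of slope \<rho> just fits into the unit ball.\<close>
  define c where "c = 1 / sqrt (1 + \<rho>\<^sup>2)"
  have p: "0 < 1 + \<rho>\<^sup>2" by (simp add: add_pos_nonneg)
  have c: "0 < c" "c\<^sup>2 * (1 + \<rho>\<^sup>2) = 1" using p by (auto simp: c_def power_divide real_sqrt_pow2_iff less_imp_le)
  define T where "T i = sphere_cone (fst i) (snd i) c" for i :: "(real^'n) \<times> real"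
  have Fi: "norm (fst i) = 1" "0 < snd i" "snd i \<le> \<rho>" if "i \<in> F" for i using FK[of "fst i" "snd i"] that by auto
  have Tm[measurable]: "T i \<in> sets borel" for i by (simp add: T_def)
  have TE: "emeasure lborel (T i) = ennreal (unit_ball_vol (real (CARD('n) - 1)) * snd i ^ (CARD('n) - 1) * c ^ CARD('n) / real CARD('n))" if "i \<in> F" for i
    unfolding T_def by (rule sphere_cone_measure[OF dim Fi(1,2)[OF that] c(1)])
  have TM: "measure lborel (T i) = unit_ball_vol (real (CARD('n) - 1)) * snd i ^ (CARD('n) - 1) * c ^ CARD('n) / real CARD('n)" if "i \<in> F" for i
    unfolding measure_def TE[OF that] using Fi[OF that] c by simp
  \<comment> \<open>A common point would project radially into both caps, which are
    disjoint.\<close>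
  have "T i \<inter> T j = {}" if "i \<in> F" "j \<in> F" "i \<noteq> j" for i j
    using sphere_cone_projection(1)[OF Fi(1)[OF that(1)] _ Fi(2)[OF that(1)]] sphere_cone_projection(1)[OF Fi(1)[OF that(2)] _ Fi(2)[OF that(2)]]
      pairwiseD[OF disj that] unfolding T_def disjnt_def by blast
  then have df: "disjoint_family_on T F" by (auto simp: disjoint_family_on_def)
  have sub: "(\<Union>i\<in>F. T i) \<subseteq> cball 0 1"
  proof clarify
    fix i z assume i: "i \<in> F" and "z \<in> T i"
    then have "(norm z)\<^sup>2 \<le> c\<^sup>2 * (1 + (snd i)\<^sup>2)"
      unfolding T_def using sphere_cone_projection(2)[OF Fi(1)[OF i] _ Fi(2)[OF i]] by blast
    also have "\<dots> \<le> c\<^sup>2 * (1 + \<rho>\<^sup>2)" using Fi[OF i] by (intro mult_left_mono add_left_mono power_mono) auto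
    finally show "z \<in> cball 0 1" using c by (simp add: power_le_one_iff abs_square_le_1)
  qed
  have "(\<Sum>i\<in>F. unit_ball_vol (real (CARD('n) - 1)) * snd i ^ (CARD('n) - 1)) * (c ^ CARD('n) / real CARD('n))
      = (\<Sum>i\<in>F. measure lborel (T i))"
    unfolding sum_distrib_right by (intro sum.cong) (auto simp: TM)
  also have "\<dots> = measure lborel (\<Union>i\<in>F. T i)"
    using df F by (intro measure_finite_Union[symmetric]) (auto simp: TE)
  also have "\<dots> \<le> measure lborel (cball (0 :: real^'n) 1)"
    using sub F by (intro measure_mono_fmeasurable) (auto simp: fmeasurable_def emeasure_cball)
  also have "\<dots> = unit_ball_vol (real CARD('n))" by (simp add: measure_def emeasure_cball)
  finally have le: "(\<Sum>i\<in>F. unit_ball_vol (real (CARD('n) - 1)) * snd i ^ (CARD('n) - 1)) * (c ^ CARD('n) / real CARD('n))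
      \<le> unit_ball_vol (real CARD('n))" .
  have R: "c ^ CARD('n) * sqrt (1 + \<rho>\<^sup>2) ^ CARD('n) = 1" using c(1) by (simp add: c_def power_divide)
  define S where "S = (\<Sum>i\<in>F. unit_ball_vol (real (CARD('n) - 1)) * snd i ^ (CARD('n) - 1))"
  have "S = S * (c ^ CARD('n) / real CARD('n)) * (real CARD('n) * sqrt (1 + \<rho>\<^sup>2) ^ CARD('n))"
    using R by (simp add: mult.assoc)
  also have "\<dots> \<le> unit_ball_vol (real CARD('n)) * (real CARD('n) * sqrt (1 + \<rho>\<^sup>2) ^ CARD('n))"
    using le unfolding S_def by (intro mult_right_mono) auto
  finally show ?thesis by (simp add: S_def mult_ac)
qed

text \<open>A Vitali family of small disjoint caps: finitely many carry almost all of the sum, and the remaining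
  ones, enlarged five times, cover the rest of the sphere.\<close>

lemma hausdorff_measure_sphere_le:
  assumes dim: "2 \<le> CARD('n)"
  shows "hausdorff_measure (CARD('n) - 1) (sphere (0::real^'n) 1) \<le> ennreal (real CARD('n) * unit_ball_vol (real CARD('n)))"
proof -
  define n where "n = CARD('n)"
  define s where "s = n - 1"
  define \<alpha> where "\<alpha> = unit_ball_vol (real s)"
  have \<alpha>: "0 < \<alpha>" by (simp add: \<alpha>_def unit_ball_vol_pos)
  define V where "V = real n * unit_ball_vol (real n)"
  have V: "0 \<le> V" by (simp add: V_def)
  define W where "W U = (\<Sum>i. if U i = {} then 0 else ennreal (\<alpha> * (diameter (U i) / 2) ^ s))" for U :: "nat \<Rightarrow> (real^'n) set"
  define adm where "adm \<delta> = {U :: nat \<Rightarrow> (real^'n) set. sphere 0 1 \<subseteq> (\<Union>i. U i) \<and> (\<forall>i. bounded (U i) \<and> diameter (U i) \<le> \<delta>)}" for \<delta> :: real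
  have "(INF U\<in>adm \<delta>. W U) \<le> ennreal V" if \<delta>: "0 < \<delta>" for \<delta>
  proof (rule ennreal_le_epsilon)
    fix \<epsilon> :: real assume \<epsilon>: "0 < \<epsilon>"
    \<comment> \<open>\<rho> is chosen so small that the distortion factor of
      \<open>disjoint_caps_sum_le\<close> costs less than half of \<epsilon>, and that caps enlarged
      five times, of diameter at most \<open>10 * \<rho>\<close>, are admissible for
      \<delta>.\<close>
    have "((\<lambda>\<rho>. V * sqrt (1 + \<rho>\<^sup>2) ^ n) \<longlongrightarrow> V * sqrt (1 + 0\<^sup>2) ^ n) (at_right 0)"
      by (intro tendsto_intros)
    then have "\<forall>\<^sub>F \<rho> in at_right 0. V * sqrt (1 + \<rho>\<^sup>2) ^ n < V + \<epsilon> / 2"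
      using \<epsilon> by (intro order_tendstoD(2)[of _ "V"]) auto
    moreover have "\<forall>\<^sub>F \<rho> in at_right 0. \<rho> < \<delta> / 10 \<and> 0 < \<rho>"
      using \<delta> unfolding eventually_at_right_field by (intro exI[of _ "\<delta> / 10"]) auto
    ultimately have "\<forall>\<^sub>F \<rho> in at_right 0. V * sqrt (1 + \<rho>\<^sup>2) ^ n < V + \<epsilon> / 2 \<and> \<rho> < \<delta> / 10 \<and> 0 < \<rho>"
      by eventually_elim simp
    then obtain \<rho> :: real where \<rho>: "V * sqrt (1 + \<rho>\<^sup>2) ^ n < V + \<epsilon> / 2" "\<rho> < \<delta> / 10" "0 < \<rho>"
      using eventually_happens'[OF trivial_limit_at_right_real] by blast
    define K where "K = sphere (0::real^'n) 1 \<times> {0<..\<rho>}"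
    have K\<rho>: "0 < snd i \<and> snd i \<le> \<rho>" if "i \<in> K" for i using that by (auto simp: K_def)
    obtain C where C: "countable C" "C \<subseteq> K"
        "pairwise (\<lambda>i j. disjnt (cball (fst i) (snd i)) (cball (fst j) (snd j))) C"
      and cov: "\<And>i. i \<in> K \<Longrightarrow> \<exists>j. j \<in> C \<and> \<not> disjnt (cball (fst i) (snd i)) (cball (fst j) (snd j)) \<and>
          cball (fst i) (snd i) \<subseteq> ball (fst j) (5 * snd j)"
      by (rule Vitali_covering_lemma_cballs_balls[of K snd \<rho> fst, OF K\<rho>]) blast+
    define w where "w i = \<alpha> * snd i ^ s" for i :: "(real^'n) \<times> real"
    have w0: "0 \<le> w i" if "i \<in> C" for i using K\<rho>[of i] C(2) that \<alpha> by (auto simp: w_def)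
    have bound: "sum w F \<le> V + \<epsilon> / 2" if F: "finite F" "F \<subseteq> C" for F
    proof -
      have "sum w F \<le> V * sqrt (1 + \<rho>\<^sup>2) ^ n"
        unfolding w_def[abs_def] \<alpha>_def s_def V_def n_def
        by (rule disjoint_caps_sum_le[OF dim F(1)]) (use F C in \<open>auto simp: K_def intro: pairwise_subset\<close>)
      then show ?thesis using \<rho>(1) by simp
    qed
    \<comment> \<open>The total weight of the countable family, as a supremum of finite sums.
      \<open>F\<close> misses less than \<open>\<epsilon> / 2 / 5 ^ s\<close> of it, which allows
      for the factor \<open>5 ^ s\<close> that the enlargement puts on the remaining caps.\<close>
    define T where "T = (SUP F\<in>{F. finite F \<and> F \<subseteq> C}. sum w F)"
    have bdd: "bdd_above (sum w ` {F. finite F \<and> F \<subseteq> C})" using bound by (intro bdd_aboveI2[of _ _ "V + \<epsilon> / 2"]) auto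
    have sT: "sum w F \<le> T" if "finite F" "F \<subseteq> C" for F
      unfolding T_def by (rule cSUP_upper[OF _ bdd]) (use that in auto)
    obtain F where F: "finite F" "F \<subseteq> C" "T - \<epsilon> / 2 / 5 ^ s < sum w F"
    proof -
      have "\<exists>F. finite F \<and> F \<subseteq> C \<and> T - \<epsilon> / 2 / 5 ^ s < sum w F"
      proof (rule ccontr)
        assume "\<not> ?thesis"
        then have "T \<le> T - \<epsilon> / 2 / 5 ^ s" by (subst (1) T_def, intro cSUP_least) (auto simp: not_less)
        moreover have "0 < \<epsilon> / 2 / 5 ^ s" using \<epsilon> by simp
        ultimately show False by linarith
      qed
      then show ?thesis using that by blast
    qed
    have tail: "sum w G \<le> \<epsilon> / 2 / 5 ^ s" if G: "finite G" "G \<subseteq> C - F" for G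
    proof -
      have "sum w (F \<union> G) = sum w F + sum w G" using F G by (intro sum.union_disjoint) auto
      moreover have "sum w (F \<union> G) \<le> T" using F G by (intro sT) auto
      ultimately show ?thesis using F(3) by linarith
    qed
    define P where "P j = (if j \<in> F then cball (fst j) (snd j) else cball (fst j) (5 * snd j))" for j :: "(real^'n) \<times> real"
    \<comment> \<open>The family is enumerated through \<open>to_nat_on C\<close>. Indices outside
      its range give the empty set, to which the definition of the measure assigns weight 0.\<close>
    define U where "U i = (\<Union>j\<in>{j \<in> C. to_nat_on C j = i}. P j)" for i
    have inj: "inj_on (to_nat_on C) C" by (rule inj_on_to_nat_on[OF C(1)])
    have Uj: "U (to_nat_on C j) = P j" if "j \<in> C" for j
    proof -
      have "{i \<in> C. to_nat_on C i = to_nat_on C j} = {j}" using inj that by (auto dest: inj_onD)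
      then show ?thesis by (simp add: U_def)
    qed
    have Ue: "U i = {}" if "i \<notin> to_nat_on C ` C" for i using that by (auto simp: U_def)
    have "sphere 0 1 \<subseteq> (\<Union>i. U i)"
    proof
      fix x :: "real^'n" assume x: "x \<in> sphere 0 1"
      have "\<exists>j\<in>C. x \<in> P j"
      proof (cases "x \<in> (\<Union>j\<in>F. cball (fst j) (snd j))")
        case True
        then show ?thesis using F by (auto simp: P_def)
      next
        case False
        have "closed (\<Union>j\<in>F. cball (fst j) (snd j))" using F by auto
        then have opn: "open (- (\<Union>j\<in>F. cball (fst j) (snd j)))" by (simp add: open_closed)
        have "x \<in> - (\<Union>j\<in>F. cball (fst j) (snd j))" using False by blast
        from open_contains_cball[THEN iffD1, rule_format, OF opn this]
        obtain r0 where r0: "0 < r0" "cball x r0 \<subseteq> - (\<Union>j\<in>F. cball (fst j) (snd j))" by blast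
        \<comment> \<open>A cap around \<open>x\<close> that avoids the closed caps of
          \<open>F\<close>. The member of \<open>C\<close> assigned to it by the covering lemma
          meets it, so it lies outside \<open>F\<close> and contains \<open>x\<close> after
          enlargement.\<close>
        define i where "i = (x, min r0 \<rho>)"
        have "i \<in> K" using x r0 \<rho> by (auto simp: i_def K_def)
        from cov[OF this] obtain j where j: "j \<in> C" "\<not> disjnt (cball (fst i) (snd i)) (cball (fst j) (snd j))"
          "cball (fst i) (snd i) \<subseteq> ball (fst j) (5 * snd j)" by blast
        have "cball (fst i) (snd i) \<subseteq> cball x r0" by (auto simp: i_def)
        then have "j \<notin> F" using j(2) r0(2) by (auto simp: disjnt_def)
        moreover have "x \<in> cball (fst i) (snd i)" using r0 \<rho> by (simp add: i_def)
        ultimately have "x \<in> P j" using j(3) by (auto simp: P_def)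
        then show ?thesis using j(1) by blast
      qed
      then show "x \<in> (\<Union>i. U i)" using Uj by blast
    qed
    moreover have "bounded (U i) \<and> diameter (U i) \<le> \<delta>" for i
    proof (cases "i \<in> to_nat_on C ` C")
      case True
      then obtain j where j: "j \<in> C" "i = to_nat_on C j" by auto
      have "0 < snd j" "snd j \<le> \<rho>" using K\<rho>[of j] C(2) j by auto
      then show ?thesis using \<rho> by (auto simp: j(2) Uj[OF j(1)] P_def)
    qed (use \<delta> in \<open>simp add: Ue diameter_empty\<close>)
    ultimately have "U \<in> adm \<delta>" by (auto simp: adm_def)
    then have "(INF U\<in>adm \<delta>. W U) \<le> W U" by (rule INF_lower)
    also have "W U \<le> ennreal (V + \<epsilon>)"
      unfolding W_def
    proof (rule suminf_le_const[OF summableI])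
      fix m
      define G where "G = {j \<in> C. to_nat_on C j < m}"
      have G: "finite G" "G \<subseteq> C"
      proof -
        have "finite (to_nat_on C ` G)" by (rule finite_subset[of _ "{..<m}"]) (auto simp: G_def)
        then show "finite G" by (rule finite_imageD) (auto simp: G_def intro: inj_on_subset[OF inj])
      qed (auto simp: G_def)
      define t where "t i = (if U i = {} then 0 else ennreal (\<alpha> * (diameter (U i) / 2) ^ s))" for i
      have "(\<Sum>i<m. t i) = (\<Sum>i\<in>to_nat_on C ` G. t i)"
      proof (rule sum.mono_neutral_right)
        show "\<forall>i\<in>{..<m} - to_nat_on C ` G. t i = 0"
        proof
          fix i assume "i \<in> {..<m} - to_nat_on C ` G"
          then have "i \<notin> to_nat_on C ` C" by (auto simp: G_def)
          then show "t i = 0" by (simp add: t_def Ue)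
        qed
      qed (auto simp: G_def)
      also have "\<dots> = (\<Sum>j\<in>G. t (to_nat_on C j))"
        using inj_on_subset[OF inj G(2)] by (simp add: sum.reindex)
      also have "\<dots> \<le> (\<Sum>j\<in>G. ennreal (w j + (if j \<in> F then 0 else 5 ^ s * w j)))"
      proof (rule sum_mono)
        fix j assume "j \<in> G"
        then have j: "j \<in> C" using G by auto
        have sj: "0 < snd j" using K\<rho>[of j] C(2) j by auto
        have "t (to_nat_on C j) \<le> ennreal (\<alpha> * (diameter (P j) / 2) ^ s)" by (simp add: t_def Uj[OF j])
        also have "\<alpha> * (diameter (P j) / 2) ^ s = (if j \<in> F then w j else 5 ^ s * w j)"
          using sj by (simp add: P_def w_def power_mult_distrib)
        also have "\<dots> \<le> w j + (if j \<in> F then 0 else 5 ^ s * w j)" using w0[OF j] by simp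
        finally show "t (to_nat_on C j) \<le> ennreal (w j + (if j \<in> F then 0 else 5 ^ s * w j))"
          by (simp add: ennreal_leI)
      qed
      also have "\<dots> = ennreal (\<Sum>j\<in>G. w j + (if j \<in> F then 0 else 5 ^ s * w j))"
        using w0 G by (intro sum_ennreal) auto
      also have "(\<Sum>j\<in>G. w j + (if j \<in> F then 0 else 5 ^ s * w j)) = sum w G + 5 ^ s * sum w (G - F)"
      proof -
        have "(\<Sum>j\<in>G. if j \<in> F then 0 else 5 ^ s * w j) = (\<Sum>j\<in>G - F. 5 ^ s * w j)"
          using G by (intro sum.mono_neutral_cong_right) auto
        then show ?thesis by (simp add: sum.distrib sum_distrib_left)
      qed
      also have "\<dots> \<le> V + \<epsilon>"
      proof -
        have "5 ^ s * sum w (G - F) \<le> 5 ^ s * (\<epsilon> / 2 / 5 ^ s)" using G by (intro mult_left_mono tail) auto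
        then show ?thesis using bound[OF G] by simp
      qed
      finally show "(\<Sum>i<m. if U i = {} then 0 else ennreal (\<alpha> * (diameter (U i) / 2) ^ s)) \<le> ennreal (V + \<epsilon>)"
        by (simp add: t_def ennreal_leI)
    qed
    finally show "(INF U\<in>adm \<delta>. W U) \<le> ennreal V + ennreal \<epsilon>" using V \<epsilon> by simp
  qed
  then have "(SUP \<delta>\<in>{0<..}. INF U\<in>adm \<delta>. W U) \<le> ennreal V" by (intro SUP_least) auto
  then show ?thesis unfolding hausdorff_measure_def adm_def W_def V_def \<alpha>_def s_def n_def by simp
qed

text \<open>Finiteness enters into the positivity claim as well, because \<open>enn2real\<close>
  sends \<open>top\<close> to 0.\<close>

lemma sphere_area_bounds:
  assumes dim: "2 \<le> CARD('n::finite)"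
  shows "0 < sphere_area TYPE('n)" "sphere_area TYPE('n) \<le> real CARD('n) * unit_ball_vol (real CARD('n))"
proof -
  note le = hausdorff_measure_sphere_le[OF dim]
  have "hausdorff_measure (CARD('n) - 1) (sphere (0::real^'n) 1) < top"
    using le_less_trans[OF le ennreal_less_top] .
  then show "0 < sphere_area TYPE('n)"
    using hausdorff_measure_sphere_pos[where 'a = "real^'n"] dim by (simp add: sphere_area_def enn2real_positive_iff)
  show "sphere_area TYPE('n) \<le> real CARD('n) * unit_ball_vol (real CARD('n))"
    unfolding sphere_area_def using enn2real_mono[OF le ennreal_less_top] by simp
qed

section \<open>Weak gradients and the main theorem\<close>

lemma grad_eq: "GDERIV f x :> D \<Longrightarrow> grad f x = D"
  unfolding grad_def
proof (rule the_equality)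
  fix D' assume "GDERIV f x :> D" "GDERIV f x :> D'"
  then have "(\<lambda>h. h \<bullet> D) = (\<lambda>h. h \<bullet> D')" unfolding gderiv_def by (rule has_derivative_unique)
  then show "D' = D" by (metis vector_eq_ldot)
qed

text \<open>The theorem is stated over the completed measure, whereas Fubini, push-forward and
  mollification are carried out for Borel functions over \<open>lborel\<close>; this is the
  bridge.\<close>

lemma lebesgue_integral_representative:
  fixes f f' :: "'a::euclidean_space \<Rightarrow> 'b::euclidean_space"
  assumes f: "f \<in> borel_measurable lebesgue" and f': "f' \<in> borel_measurable borel" and eq: "AE x in lborel. f x = f' x"
  shows "integrable lebesgue f \<longleftrightarrow> integrable lborel f'" "(LINT x|lebesgue. f x) = (LINT x|lborel. f' x)"
proof -
  have m: "f' \<in> borel_measurable lebesgue" using f' by (simp add: measurable_completion)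
  have ae: "AE x in lebesgue. f x = f' x" using eq by (simp add: AE_completion)
  show "integrable lebesgue f \<longleftrightarrow> integrable lborel f'"
    using integrable_cong_AE[OF f m ae] f' by (simp add: integrable_completion)
  show "(LINT x|lebesgue. f x) = (LINT x|lborel. f' x)"
    using integral_cong_AE[OF f m ae] f' by (simp add: integral_completion)
qed

lemma lebesgue_borel_representative:
  fixes g :: "'a::euclidean_space \<Rightarrow> 'b::euclidean_space"
  assumes [measurable]: "g \<in> borel_measurable lebesgue"
  obtains g' where "g' \<in> borel_measurable borel" "AE x in lborel. g x = g' x"
proof -
  have "\<exists>h. h \<in> borel_measurable lborel \<and> (AE x in lborel. g x \<bullet> b = h x)" for b :: 'b
    using completion_ex_borel_measurable_real[of "\<lambda>x. g x \<bullet> b" lborel] by auto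
  then obtain h where h: "\<And>b. h b \<in> borel_measurable borel" "\<And>b. AE x in lborel. g x \<bullet> b = h b x"
    by (metis measurable_lborel2)
  have "AE x in lborel. \<forall>b\<in>Basis. g x \<bullet> b = h b x" using h(2) by (intro AE_finite_allI) auto
  then have "AE x in lborel. g x = (\<Sum>b\<in>Basis. h b x *\<^sub>R b)"
  proof eventually_elim
    case (elim x)
    then have "(\<Sum>b\<in>Basis. h b x *\<^sub>R b) = (\<Sum>b\<in>Basis. (g x \<bullet> b) *\<^sub>R b)" by (intro sum.cong) auto
    then show ?case by (simp add: euclidean_representation)
  qed
  moreover have "(\<lambda>x. \<Sum>b\<in>Basis. h b x *\<^sub>R b) \<in> borel_measurable borel" using h(1) by measurable
  ultimately show ?thesis using that by blast
qed

lemma locally_absolutely_integrable_measurable: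
  fixes g :: "'a::euclidean_space \<Rightarrow> 'b::euclidean_space"
  assumes "\<And>K. compact K \<Longrightarrow> g absolutely_integrable_on K"
  shows "g \<in> borel_measurable lebesgue"
proof (rule borel_measurable_LIMSEQ_metric)
  fix j :: nat
  show "(\<lambda>x. indicat_real (cball 0 (real j)) x *\<^sub>R g x) \<in> borel_measurable lebesgue"
    using assms[of "cball 0 (real j)"] by (auto simp: set_integrable_def dest: borel_measurable_integrable)
next
  fix x :: 'a
  obtain m :: nat where m: "norm x \<le> real m" using real_arch_simple by blast
  show "(\<lambda>j. indicat_real (cball 0 (real j)) x *\<^sub>R g x) \<longlonglongrightarrow> g x"
  proof (rule tendsto_eventually, rule eventually_sequentiallyI)
    fix j assume "m \<le> j"
    then have "norm x \<le> real j" using m by linarith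
    then show "indicat_real (cball 0 (real j)) x *\<^sub>R g x = g x" by simp
  qed
qed

lemma onofri_mu:
  assumes dim: "2 \<le> CARD('n)"
  shows "onofri CARD('n) (real CARD('n)) (real CARD('n) / (real CARD('n) - 1)) (unit_ball_vol (real CARD('n)))
    (mu :: real^'n \<Rightarrow> real) (grad v)"
proof -
  define q where "q = real CARD('n) / (real CARD('n) - 1)"
  define gv where "gv x = - ((real CARD('n) * q * norm x powr (q - 2) / (1 + norm x powr q)) *\<^sub>R x)" for x :: "real^'n"
  have vol: "measure lebesgue (ball (0::real^'n) 1) = unit_ball_vol (real CARD('n))"
    by (simp add: content_ball)
  interpret onofri "CARD('n)" "real CARD('n)" q "unit_ball_vol (real CARD('n))" "mu :: real^'n \<Rightarrow> real" gv
    by unfold_locales (use dim in \<open>simp_all add: mu_def vol gv_def q_def\<close>)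
  \<comment> \<open>The locale is first interpreted with the explicit field, whose formula yields
    the derivative of \<open>v\<close>; only then can \<open>grad v\<close> be identified and
    substituted.\<close>
  have "grad v x = gv x" for x :: "real^'n"
    using grad_eq[OF ln_dens_GDERIV[of x]] by (simp add: v_def[abs_def])
  then have "grad v = gv" by blast
  then show ?thesis using onofri_axioms by (simp add: q_def)
qed

text \<open>The test function is \<open>moll r (x - y)\<close> in the variable \<open>y\<close>. Its
  gradient is minus the gradient of the mollifier, so the two minus signs in the definition of a
  weak gradient cancel.\<close>

lemma weak_gradient_representative:
  fixes u :: "real^'n \<Rightarrow> real"
  assumes w: "has_weak_gradient u g"
    and u': "u' \<in> borel_measurable borel" "AE x in lborel. u x = u' x"
    and g': "g' \<in> borel_measurable borel" "AE x in lborel. g x = g' x"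
  shows "locally_integrable u'" "locally_integrable g'"
    "0 < r \<Longrightarrow> (LINT y|lborel. u' y *\<^sub>R moll_grad r (x - y)) = mollify r g' x"
proof -
  have ai: "u absolutely_integrable_on K" "g absolutely_integrable_on K" if "compact K" for K
    using w that by (auto simp: has_weak_gradient_def)
  have um[measurable]: "u \<in> borel_measurable lebesgue" and gm[measurable]: "g \<in> borel_measurable lebesgue"
    using ai by (auto intro: locally_absolutely_integrable_measurable)
  note [measurable] = u'(1) g'(1)
  have ind: "indicator (cball 0 \<rho>) \<in> borel_measurable lebesgue" for \<rho> :: real
    by (intro borel_measurable_indicator) auto
  have li: "locally_integrable f'"
    if f: "\<And>K. compact K \<Longrightarrow> f absolutely_integrable_on K" and f': "f' \<in> borel_measurable borel" "AE x in lborel. f x = f' x"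
    for f f' :: "real^'n \<Rightarrow> 'c::euclidean_space"
    unfolding locally_integrable_def
  proof (intro conjI allI f')
    fix \<rho>
    note [measurable] = f'(1)
    have fi: "integrable lebesgue (\<lambda>x. indicator (cball 0 \<rho>) x *\<^sub>R f x)"
      using f[of "cball 0 \<rho>"] by (simp add: set_integrable_def)
    have "AE x in lborel. indicat_real (cball 0 \<rho>) x *\<^sub>R f x = indicat_real (cball 0 \<rho>) x *\<^sub>R f' x"
      using f'(2) by eventually_elim simp
    from lebesgue_integral_representative(1)[OF borel_measurable_integrable[OF fi] _ this] fi
    show "integrable lborel (\<lambda>x. indicator (cball 0 \<rho>) x *\<^sub>R f' x)" by simp
  qed
  show "locally_integrable u'" "locally_integrable g'" using li[OF ai(1) u'] li[OF ai(2) g'] by blast+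
  assume r: "0 < r"
  have gr: "grad (\<lambda>y. moll r (x - y)) y = - moll_grad r (x - y)" for y
    by (rule grad_eq[OF moll_translate_GDERIV])
  have mg[measurable]: "(\<lambda>y. moll_grad r (x - y)) \<in> borel_measurable borel" "(\<lambda>y. moll r (x - y)) \<in> borel_measurable borel"
    by (rule borel_measurable_continuous_onI, rule continuous_on_compose2[of UNIV],
        rule continuous_moll_grad continuous_moll[OF r], auto intro!: continuous_intros)+
  have mgl: "(\<lambda>y. moll_grad r (x - y)) \<in> borel_measurable lebesgue" "(\<lambda>y. moll r (x - y)) \<in> borel_measurable lebesgue"
    using mg by (simp_all add: measurable_completion)
  have "(LINT y|lebesgue. u y *\<^sub>R - moll_grad r (x - y)) = - (LINT y|lebesgue. moll r (x - y) *\<^sub>R g y)"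
    using w moll_test_function[OF r, of x] by (simp add: has_weak_gradient_def gr flip: gr)
  moreover have "(LINT y|lebesgue. u y *\<^sub>R - moll_grad r (x - y)) = (LINT y|lborel. u' y *\<^sub>R - moll_grad r (x - y))"
    using u'(2) mgl by (intro lebesgue_integral_representative) (auto elim: eventually_mono)
  moreover have "(LINT y|lebesgue. moll r (x - y) *\<^sub>R g y) = (LINT y|lborel. moll r (x - y) *\<^sub>R g' y)"
    using g'(2) mgl by (intro lebesgue_integral_representative) (auto elim: eventually_mono)
  ultimately show "(LINT y|lborel. u' y *\<^sub>R moll_grad r (x - y)) = mollify r g' x" by (simp add: mollify_def)
qed

theorem theorem1p2:
  fixes u :: "real^'n \<Rightarrow> real"
  assumes "CARD('n) \<ge> 2" and "u \<in> W_mu"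
  shows "integrable mu_measure (\<lambda>x. exp (u x)) \<and> integrable lebesgue (H u) \<and>
    ln (\<integral>x. exp (u x) \<partial>mu_measure)
      \<le> 1 / omega_tilde TYPE('n) * (\<integral>x. H u x \<partial>lebesgue) + (\<integral>x. u x \<partial>mu_measure)"
proof -
  interpret onofri "CARD('n)" "real CARD('n)" "real CARD('n) / (real CARD('n) - 1)" "unit_ball_vol (real CARD('n))"
      "mu :: real^'n \<Rightarrow> real" "grad v"
    by (rule onofri_mu[OF assms(1)])
  define g where "g = weak_grad u"
  have um: "integrable mu_measure u"
    and gn: "integrable lebesgue (\<lambda>x. norm (g x) ^ CARD('n))"
    and g2: "integrable lebesgue (\<lambda>x. (norm (g x))\<^sup>2 * norm (grad v x) ^ (CARD('n) - 2))"
    using assms(2) by (auto simp: W_mu_def g_def)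
  have "\<exists>g. has_weak_gradient u g" using assms(2) by (simp add: W_mu_def)
  then have w: "has_weak_gradient u g" unfolding g_def weak_grad_def by (rule someI_ex)
  have ul[measurable]: "u \<in> borel_measurable lebesgue" and gl[measurable]: "g \<in> borel_measurable lebesgue"
    using w by (auto simp: has_weak_gradient_def intro!: locally_absolutely_integrable_measurable)
  obtain u' where u': "u' \<in> borel_measurable borel" "AE x in lborel. u x = u' x"
    using lebesgue_borel_representative[OF ul] .
  obtain g' where g': "g' \<in> borel_measurable borel" "AE x in lborel. g x = g' x"
    using lebesgue_borel_representative[OF gl] .
  note [measurable] = u'(1) g'(1)
  have mb[measurable]: "(mu :: real^'n \<Rightarrow> real) \<in> borel_measurable borel"
    using continuous_dens by (intro borel_measurable_continuous_onI)
  have vb[measurable]: "(grad v :: real^'n \<Rightarrow> real^'n) \<in> borel_measurable borel"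
    using continuous_gv by (intro borel_measurable_continuous_onI)
  have ml[measurable]: "(mu :: real^'n \<Rightarrow> real) \<in> borel_measurable lebesgue" "(grad v :: real^'n \<Rightarrow> real^'n) \<in> borel_measurable lebesgue"
    using mb vb by (simp_all add: measurable_completion)
  have mu0: "0 < mu x" for x :: "real^'n" by (rule dens_pos)
  \<comment> \<open>\<open>mu_measure\<close> is a density over the completed measure; its integrals
    are expressed by Borel representatives over \<open>lborel\<close>.\<close>
  have density: "integrable mu_measure f \<longleftrightarrow> integrable lborel (\<lambda>x. f' x * mu x)"
      "(LINT x|mu_measure. f x) = (LINT x|lborel. f' x * mu x)"
    if f: "f \<in> borel_measurable lebesgue" and f': "f' \<in> borel_measurable borel" and eq: "AE x in lborel. f x = f' x"
    for f f' :: "real^'n \<Rightarrow> real"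
  proof -
    note [measurable] = f f'
    have "AE x in lborel. mu x *\<^sub>R f x = f' x * mu x" using eq by eventually_elim simp
    note rep = lebesgue_integral_representative[OF _ _ this]
    have 1: "AE x in lebesgue. 0 \<le> mu (x :: real^'n)" using mu0 by (simp add: less_imp_le)
    show "integrable mu_measure f \<longleftrightarrow> integrable lborel (\<lambda>x. f' x * mu x)"
      unfolding mu_measure_def using integrable_density[OF f ml(1) 1] rep(1) by simp
    show "(LINT x|mu_measure. f x) = (LINT x|lborel. f' x * mu x)"
      unfolding mu_measure_def using integral_density[OF f ml(1) 1] rep(2) by simp
  qed
  have ud: "integrable lborel (\<lambda>x. u' x * mu x)" using um density(1)[OF ul u'] by simp
  have gn': "integrable lborel (\<lambda>x. norm (g' x) ^ CARD('n))"
  proof -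
    have "AE x in lborel. norm (g x) ^ CARD('n) = norm (g' x) ^ CARD('n)" using g'(2) by eventually_elim simp
    from lebesgue_integral_representative(1)[OF _ _ this] gn show ?thesis by simp
  qed
  have g2': "integrable lborel (\<lambda>x. (norm (g' x))\<^sup>2 * norm (grad v x) ^ (CARD('n) - 2))"
  proof -
    have "AE x in lborel. (norm (g x))\<^sup>2 * norm (grad v x) ^ (CARD('n) - 2) = (norm (g' x))\<^sup>2 * norm (grad v x) ^ (CARD('n) - 2)"
      using g'(2) by eventually_elim simp
    from lebesgue_integral_representative(1)[OF _ _ this] g2 show ?thesis by simp
  qed
  have "smooth_gradient u' g'"
    unfolding smooth_gradient_def using weak_gradient_representative[OF w u' g'] by blast
  note main = onofri_weak[OF this ud gn' g2']
  have Hu: "H u x = Hf x (g x)" for x by (simp add: H_def Hf_def g_def)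
  have Hm: "H u \<in> borel_measurable lebesgue" unfolding H_def[abs_def] g_def[symmetric] by measurable
  have "AE x in lborel. H u x = Hf x (g' x)" using g'(2) by eventually_elim (simp add: Hu)
  note Hrep = lebesgue_integral_representative[OF Hm Hf_measurable[OF g'(1)] this]
  have em: "(\<lambda>x. exp (u x)) \<in> borel_measurable lebesgue" "(\<lambda>x. exp (u' x)) \<in> borel_measurable borel" by measurable
  have ee: "AE x in lborel. exp (u x) = exp (u' x)" using u'(2) by eventually_elim simp
  define X where "X = 1 / om * (LINT x|lborel. Hf x (g' x)) + (LINT x|lborel. u' x * mu x)"
  have le: "(\<integral>\<^sup>+x. ennreal (exp (u' x) * mu x) \<partial>lborel) \<le> ennreal (exp X)"
    using main(1) by (simp add: onofri_ineq_def X_def)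
  \<comment> \<open>Integrability of the exponential is part of the conclusion and comes from the
    bound on its nonnegative integral.\<close>
  have ei: "integrable lborel (\<lambda>x. exp (u' x) * mu x)"
    by (rule integrableI_nonneg) (use mu0 le_less_trans[OF le ennreal_less_top] in \<open>auto simp: less_imp_le\<close>)
  define I where "I = (LINT x|lborel. exp (u' x) * mu x)"
  have I0: "0 \<le> I" unfolding I_def using mu0 by (intro integral_nonneg_AE) (simp add: less_imp_le)
  have "ennreal I = (\<integral>\<^sup>+x. ennreal (exp (u' x) * mu x) \<partial>lborel)"
    unfolding I_def using mu0 by (intro nn_integral_eq_integral[symmetric] ei) (simp add: less_imp_le)
  then have "ennreal I \<le> ennreal (exp X)" using le by (simp only:)
  then have Ile: "I \<le> exp X" by simp
  \<comment> \<open>Positivity is what allows taking logarithms, since \<open>ln 0\<close> has the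
    default value 0.\<close>
  have "I \<noteq> 0"
  proof
    assume "I = 0"
    then have "AE x in lborel. exp (u' x) * mu x = 0"
      using integral_nonneg_eq_0_iff_AE[OF ei] mu0 by (simp add: I_def less_imp_le)
    then have "AE x::real^'n in lborel. False"
    proof eventually_elim
      case (elim x)
      then show ?case using mu0[of x] by simp
    qed
    then have "(UNIV :: (real^'n) set) \<in> null_sets lborel" by (simp add: AE_iff_null_sets)
    then show False by (simp add: null_sets_def emeasure_lborel_UNIV)
  qed
  then have "ln I \<le> ln (exp X)" using I0 Ile by (subst ln_le_cancel_iff) auto
  then have lnI: "ln I \<le> X" by simp
  have om0: "0 < omega_tilde TYPE('n)" "omega_tilde TYPE('n) \<le> om"
    using sphere_area_bounds[where 'n = 'n, OF assms(1)] assms(1)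
    unfolding omega_tilde_def om_def by (auto intro!: mult_pos_pos mult_left_mono)
  have "1 / om * (LINT x|lborel. Hf x (g' x)) \<le> 1 / omega_tilde TYPE('n) * (LINT x|lborel. Hf x (g' x))"
    using om0 om_pos by (intro mult_right_mono divide_left_mono integral_nonneg_AE AE_I2 Hf_nonneg) auto
  then have "ln I \<le> 1 / omega_tilde TYPE('n) * (LINT x|lebesgue. H u x) + (LINT x|mu_measure. u x)"
    using lnI unfolding X_def Hrep(2) density(2)[OF ul u'] by linarith
  then show ?thesis
    using density[OF em ee] ei Hrep(1) main(2) by (simp add: I_def)
qed

end
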